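(* Let $K$ be an algebraically closed field, complete with respect to a nontrivial non-archimedean absolute value $|\cdot|$, and let $d\ge1$. Consider an ultrametric norm $\|\cdot\|_0$ on $K^d$ and a bounded subset $S$ of $M_d(K)$. Then $$\max_{1\le k\le \ell(d)}\Lambda(S^k)^{\frac1k}=\rho(S)=\inf_{g\in \mathrm{GL}_d(K)}\|gSg^{-1}\|_0.$$ Moreover, $\rho(S)>0$ if and only if the subalgebra of $M_d(K)$ generated by $S$ is not nilpotent, in which case there is an ultrametric norm $\|\cdot\|$ on $K^d$ with $\|S\|=\rho(S)$.
   Context: An ultrametric norm on $K^d$ is a map $\|\cdot\|:K^d\to\mathbb{R}_{\ge0}$ with $\|\lambda x\|=|\lambda|\|x\|$, $\|x+y\|\le\max\{\|x\|,\|y\|\}$, and $\|x\|=0$ iff $x=0$, for all $x,y\in K^d$, $\lambda\in K$; the same symbol denotes its associated operator norm on $M_d(K)$, and $\|S\|:=\sup_{s\in S}\|s\|$ for $S\subset M_d(K)$. For $n\ge1$, $S^n:=\{s_1\cdots s_n: s_i\in S\}$. The joint spectral radius of a bounded set $S\subset M_d(K)$ is $\rho(S):=\lim_{n\to+\infty}\|S^n\|^{1/n}$ (independent of the choice of ultrametric norm). For $s\in M_d(K)$, $\Lambda(s)$ is the largest absolute value of an eigenvalue of $s$, and $\Lambda(S):=\sup_{s\in S}\Lambda(s)$. For a field $F$ and $S\subset M_d(F)$, $F[S]$ denotes the (not necessarily unital) subalgebra generated by $S$, i.e. the linear span of $\bigcup_{n\ge1}S^n$. The integer $\ell(d)$ is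 the smallest integer $k$ such that for every field $F$ and every $S\subset M_d(F)$, the sets $S,S^2,\ldots,S^k$ linearly span $F[S]$ (one has $\ell(d)\le d^2$). An algebra $N$ is nilpotent if $N^n=0$ for some integer $n\ge 1$. *)

theory Defs
  imports
    "HOL-Analysis.Abstract_Metric_Spaces"
    "HOL-Algebra.Generated_Fields"
    "HOL-Algebra.Weak_Morphisms"
    "Jordan_Normal_Form.VS_Connect"
    "Jordan_Normal_Form.Char_Poly"
begin

hide_type (open) Finite_Cartesian_Product.vec
hide_const (open) Finite_Cartesian_Product.vec Finite_Cartesian_Product.row
  Finite_Cartesian_Product.column Finite_Cartesian_Product.mat
hide_const (open) Multiset.mult Polynomial.smult Modules.module
unbundle no vec_syntax

definition nonarch_absolute_value :: "('a::field \<Rightarrow> real) \<Rightarrow> bool" where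
  "nonarch_absolute_value v \<longleftrightarrow>
     (\<forall>x. 0 \<le> v x) \<and> (\<forall>x. v x = 0 \<longleftrightarrow> x = 0) \<and>
     (\<forall>x y. v (x * y) = v x * v y) \<and> (\<forall>x y. v (x + y) \<le> max (v x) (v y))"

definition nontrivial_absolute_value :: "('a::field \<Rightarrow> real) \<Rightarrow> bool" where
  "nontrivial_absolute_value v \<longleftrightarrow> (\<exists>x. x \<noteq> 0 \<and> v x \<noteq> 1)"

definition complete_absolute_value :: "('a::field \<Rightarrow> real) \<Rightarrow> bool" where
  "complete_absolute_value v \<longleftrightarrow> Metric_space.mcomplete UNIV (\<lambda>x y. v (x - y))"

definition ultrametric_norm ::
    "('a::field \<Rightarrow> real) \<Rightarrow> nat \<Rightarrow> ('a vec \<Rightarrow> real) \<Rightarrow> bool" where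
  "ultrametric_norm v d N \<longleftrightarrow>
     (\<forall>x \<in> carrier_vec d. 0 \<le> N x) \<and>
     (\<forall>c. \<forall>x \<in> carrier_vec d. N (c \<cdot>\<^sub>v x) = v c * N x) \<and>
     (\<forall>x \<in> carrier_vec d. \<forall>y \<in> carrier_vec d. N (x + y) \<le> max (N x) (N y)) \<and>
     (\<forall>x \<in> carrier_vec d. N x = 0 \<longleftrightarrow> x = 0\<^sub>v d)"

definition op_norm :: "nat \<Rightarrow> ('a::field vec \<Rightarrow> real) \<Rightarrow> 'a mat \<Rightarrow> real" where
  "op_norm d N A = (SUP x \<in> carrier_vec d - {0\<^sub>v d}. N (A *\<^sub>v x) / N x)"

text \<open>Suprema of sets of norms are taken in \<open>[0, \<infinity>)\<close>: inserting \<open>0\<close> only matters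
  for the empty set, whose supremum in the type of real numbers is unspecified.\<close>

definition set_norm :: "nat \<Rightarrow> ('a::field vec \<Rightarrow> real) \<Rightarrow> 'a mat set \<Rightarrow> real" where
  "set_norm d N S = Sup (insert 0 (op_norm d N ` S))"

text \<open>On subsets of the carrier of a monoid, \<open>set_pow G S n\<close> is the set of all products
  \<open>s\<^sub>1 \<cdots> s\<^sub>n\<close> with factors in \<open>S\<close>.\<close>

primrec set_pow :: "('m, 'e) monoid_scheme \<Rightarrow> 'm set \<Rightarrow> nat \<Rightarrow> 'm set" where
  "set_pow G S 0 = {\<one>\<^bsub>G\<^esub>}"
| "set_pow G S (Suc n) = S <#>\<^bsub>G\<^esub> set_pow G S n"

definition joint_spectral_radius ::
    "nat \<Rightarrow> ('a::field vec \<Rightarrow> real) \<Rightarrow> 'a mat set \<Rightarrow> real" where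
  "joint_spectral_radius d N S =
     lim (\<lambda>n. root n (set_norm d N (set_pow (module_mat TYPE('a) d d) S n)))"

definition max_eigenvalue :: "('a::field \<Rightarrow> real) \<Rightarrow> 'a mat \<Rightarrow> real" where
  "max_eigenvalue v s = Max (v ` {c. eigenvalue s c})"

definition max_eigenvalue_set :: "('a::field \<Rightarrow> real) \<Rightarrow> 'a mat set \<Rightarrow> real" where
  "max_eigenvalue_set v S = Sup (insert 0 (max_eigenvalue v ` S))"

definition generated_algebra ::
    "('f, 'c) ring_scheme \<Rightarrow> ('f, 'm, 'e) module_scheme \<Rightarrow> 'm set \<Rightarrow> 'm set" where
  "generated_algebra F A S = LinearCombinations.module.span F A (\<Union>n\<in>{1..}. set_pow A S n)"

definition nilpotent_algebra :: "('f, 'm, 'e) module_scheme \<Rightarrow> 'm set \<Rightarrow> bool" where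
  "nilpotent_algebra A N \<longleftrightarrow> (\<exists>n\<ge>1. set_pow A N n = {\<zero>\<^bsub>A\<^esub>})"

text \<open>The algebra of \<open>d \<times> d\<close> matrices over a field given as a record, so that one can
  quantify over fields inside a definition.  For a type-class field it is the
  library's \<open>module_mat\<close>, see below.\<close>

definition mat_algebra :: "('f, 'c) ring_scheme \<Rightarrow> nat \<Rightarrow> ('f, 'f mat) module" where
  "mat_algebra F d = \<lparr>
     carrier = {A \<in> carrier_mat d d. elements_mat A \<subseteq> carrier F},
     mult = (\<lambda>A B. mat (dim_row A) (dim_col B)
       (\<lambda>(i, j). \<Oplus>\<^bsub>F\<^esub>k\<in>{0..<dim_row B}. row A i $ k \<otimes>\<^bsub>F\<^esub> col B j $ k)),
     one = mat d d (\<lambda>(i, j). if i = j then \<one>\<^bsub>F\<^esub> else \<zero>\<^bsub>F\<^esub>),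
     zero = mat d d (\<lambda>_. \<zero>\<^bsub>F\<^esub>),
     add = (\<lambda>A B. mat (dim_row B) (dim_col B) (\<lambda>ij. A $$ ij \<oplus>\<^bsub>F\<^esub> B $$ ij)),
     smult = (\<lambda>c. map_mat (\<lambda>a. c \<otimes>\<^bsub>F\<^esub> a)) \<rparr>"

definition powers_span :: "'f itself \<Rightarrow> nat \<Rightarrow> nat \<Rightarrow> bool" where
  "powers_span TYPE('f) d k \<longleftrightarrow>
     (\<forall>F :: 'f ring. field F \<longrightarrow> (\<forall>S \<subseteq> carrier (mat_algebra F d).
        LinearCombinations.module.span F (mat_algebra F d)
          (\<Union>i\<in>{1..k}. set_pow (mat_algebra F d) S i)
        = generated_algebra F (mat_algebra F d) S))"

text \<open>A definition cannot quantify over all types, so the fields range over records carried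
  by subsets of \<open>nat\<close>.  This is no restriction: \<open>powers_span_transfer\<close> below extends the
  spanning property to all fields over all types, and \<open>ell_eq\<close> shows that every infinite
  type in place of \<open>nat\<close> gives the same number.\<close>

definition ell :: "nat \<Rightarrow> nat" where
  "ell d = (LEAST k. powers_span TYPE(nat) d k)"

lemma mat_algebra_class_ring: "mat_algebra class_ring d = module_mat TYPE('a::field) d d"
proof -
  have s: "finsum (class_ring :: 'a ring) f A = sum f A" for f and A :: "nat set"
    by (simp add: class_ring_simps)
  show ?thesis
    unfolding mat_algebra_def module_mat_def
    by (auto simp: s times_mat_def scalar_prod_def one_mat_def zero_mat_def plus_mat_def
        smult_mat_def fun_eq_iff intro!: eq_matI)
qed

lemma mat_algebra_carrier:
  "A \<in> carrier (mat_algebra F d) \<longleftrightarrow>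
     A \<in> carrier_mat d d \<and> (\<forall>i<d. \<forall>j<d. A $$ (i, j) \<in> carrier F)"
  unfolding mat_algebra_def elements_mat_def by fastforce

lemma mat_algebra_mult_index:
  assumes "A \<in> carrier_mat d d" "B \<in> carrier_mat d d" "i < d" "j < d"
    "ring F" "\<And>i j. i < d \<Longrightarrow> j < d \<Longrightarrow> A $$ (i, j) \<in> carrier F"
    "\<And>i j. i < d \<Longrightarrow> j < d \<Longrightarrow> B $$ (i, j) \<in> carrier F"
  shows "(A \<otimes>\<^bsub>mat_algebra F d\<^esub> B) $$ (i, j) =
    (\<Oplus>\<^bsub>F\<^esub>k\<in>{0..<d}. A $$ (i, k) \<otimes>\<^bsub>F\<^esub> B $$ (k, j))"
proof -
  interpret ring F by fact
  show ?thesis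
    using assms unfolding mat_algebra_def
    by (auto intro!: finsum_cong' simp: Pi_def)
qed

lemma mat_algebra_index:
  assumes "A \<in> carrier_mat d d" "B \<in> carrier_mat d d" "i < d" "j < d"
  shows "(A \<oplus>\<^bsub>mat_algebra F d\<^esub> B) $$ (i, j) = A $$ (i, j) \<oplus>\<^bsub>F\<^esub> B $$ (i, j)"
    "(c \<odot>\<^bsub>mat_algebra F d\<^esub> B) $$ (i, j) = c \<otimes>\<^bsub>F\<^esub> B $$ (i, j)"
    "\<zero>\<^bsub>mat_algebra F d\<^esub> $$ (i, j) = \<zero>\<^bsub>F\<^esub>"
    "\<one>\<^bsub>mat_algebra F d\<^esub> $$ (i, j) = (if i = j then \<one>\<^bsub>F\<^esub> else \<zero>\<^bsub>F\<^esub>)"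
  using assms by (auto simp: mat_algebra_def)

lemma mat_algebra_dim:
  assumes "A \<in> carrier_mat d d" "B \<in> carrier_mat d d"
  shows "A \<otimes>\<^bsub>mat_algebra F d\<^esub> B \<in> carrier_mat d d"
    "A \<oplus>\<^bsub>mat_algebra F d\<^esub> B \<in> carrier_mat d d"
    "c \<odot>\<^bsub>mat_algebra F d\<^esub> B \<in> carrier_mat d d"
    "\<zero>\<^bsub>mat_algebra F d\<^esub> \<in> carrier_mat d d"
    "\<one>\<^bsub>mat_algebra F d\<^esub> \<in> carrier_mat d d"
  using assms by (auto simp: mat_algebra_def)

lemma mat_algebra_closed:
  assumes "ring F" "A \<in> carrier (mat_algebra F d)" "B \<in> carrier (mat_algebra F d)"
  shows "A \<otimes>\<^bsub>mat_algebra F d\<^esub> B \<in> carrier (mat_algebra F d)"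
    "A \<oplus>\<^bsub>mat_algebra F d\<^esub> B \<in> carrier (mat_algebra F d)"
    "c \<in> carrier F \<Longrightarrow> c \<odot>\<^bsub>mat_algebra F d\<^esub> B \<in> carrier (mat_algebra F d)"
proof -
  interpret ring F by fact
  show "A \<otimes>\<^bsub>mat_algebra F d\<^esub> B \<in> carrier (mat_algebra F d)"
    "A \<oplus>\<^bsub>mat_algebra F d\<^esub> B \<in> carrier (mat_algebra F d)"
    "c \<in> carrier F \<Longrightarrow> c \<odot>\<^bsub>mat_algebra F d\<^esub> B \<in> carrier (mat_algebra F d)"
    using assms
    by (auto simp: mat_algebra_carrier mat_algebra_dim mat_algebra_index mat_algebra_mult_index
        intro!: finsum_closed)
qed

lemma mat_algebra_zero_one_closed:
  assumes "ring F"
  shows "\<zero>\<^bsub>mat_algebra F d\<^esub> \<in> carrier (mat_algebra F d)"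
    "\<one>\<^bsub>mat_algebra F d\<^esub> \<in> carrier (mat_algebra F d)"
proof -
  interpret ring F by fact
  show "\<zero>\<^bsub>mat_algebra F d\<^esub> \<in> carrier (mat_algebra F d)"
    "\<one>\<^bsub>mat_algebra F d\<^esub> \<in> carrier (mat_algebra F d)"
    by (auto simp: mat_algebra_carrier, auto simp: mat_algebra_def)
qed

lemma mat_algebra_eqI:
  assumes "A \<in> carrier_mat d d" "B \<in> carrier_mat d d"
    "\<And>i j. i < d \<Longrightarrow> j < d \<Longrightarrow> A $$ (i, j) = B $$ (i, j)"
  shows "A = B"
  using assms by (intro eq_matI) auto

lemma mat_algebra_module:
  assumes "field F"
  shows "Module.module F (mat_algebra F d)"
proof -
  interpret field F by fact
  let ?M = "mat_algebra F d"
  note simps = mat_algebra_carrier mat_algebra_dim mat_algebra_index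
  note closed = mat_algebra_closed[OF ring_axioms] mat_algebra_zero_one_closed[OF ring_axioms]
  have "abelian_group ?M"
  proof (rule abelian_groupI)
    fix A assume A: "A \<in> carrier ?M"
    let ?B = "map_mat (\<lambda>a. \<ominus>\<^bsub>F\<^esub> a) A"
    have "?B \<in> carrier ?M" "?B \<oplus>\<^bsub>?M\<^esub> A = \<zero>\<^bsub>?M\<^esub>"
      using A by (auto simp: simps l_neg intro!: mat_algebra_eqI[of _ d])
    then show "\<exists>B\<in>carrier ?M. B \<oplus>\<^bsub>?M\<^esub> A = \<zero>\<^bsub>?M\<^esub>" by blast
  qed (auto simp: closed intro!: mat_algebra_eqI[of _ d], auto simp: simps a_ac)
  then show ?thesis
    by (intro moduleI)
      (auto simp: closed is_cring intro!: mat_algebra_eqI[of _ d],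
       auto simp: simps l_distr r_distr m_assoc)
qed

lemma set_pow_subset:
  assumes "ring F" "S \<subseteq> carrier (mat_algebra F d)"
  shows "set_pow (mat_algebra F d) S n \<subseteq> carrier (mat_algebra F d)"
  using assms
  by (induction n) (auto simp: mat_algebra_zero_one_closed set_mult_def intro!: mat_algebra_closed)

lemma set_pow_mono: "S \<subseteq> T \<Longrightarrow> set_pow G S n \<subseteq> set_pow G T n"
  by (induction n) (auto simp: set_mult_def)

lemma set_pow_finite:
  assumes "x \<in> set_pow G S n"
  shows "\<exists>T. finite T \<and> T \<subseteq> S \<and> x \<in> set_pow G T n"
  using assms
proof (induction n arbitrary: x)
  case 0
  then show ?case by auto
next
  case (Suc n)
  then obtain s y where sy: "s \<in> S" "y \<in> set_pow G S n" "x = s \<otimes>\<^bsub>G\<^esub> y"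
    by (auto simp: set_mult_def)
  from Suc.IH[OF sy(2)] obtain T where T: "finite T" "T \<subseteq> S" "y \<in> set_pow G T n" by blast
  have "y \<in> set_pow G (insert s T) n"
    using T(3) set_pow_mono[of T "insert s T" G n] by blast
  then have "x \<in> set_pow G (insert s T) (Suc n)"
    using sy by (auto simp: set_mult_def)
  then show ?case using T sy by blast
qed

lemma map_mat_hom:
  assumes "field H" "field F" "g \<in> Ring.ring_hom H F"
  shows "A \<in> carrier (mat_algebra H d) \<Longrightarrow> map_mat g A \<in> carrier (mat_algebra F d)"
    "\<lbrakk>A \<in> carrier (mat_algebra H d); B \<in> carrier (mat_algebra H d)\<rbrakk> \<Longrightarrow>
      map_mat g (A \<otimes>\<^bsub>mat_algebra H d\<^esub> B) = map_mat g A \<otimes>\<^bsub>mat_algebra F d\<^esub> map_mat g B"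
    "\<lbrakk>A \<in> carrier (mat_algebra H d); B \<in> carrier (mat_algebra H d)\<rbrakk> \<Longrightarrow>
      map_mat g (A \<oplus>\<^bsub>mat_algebra H d\<^esub> B) = map_mat g A \<oplus>\<^bsub>mat_algebra F d\<^esub> map_mat g B"
    "\<lbrakk>c \<in> carrier H; B \<in> carrier (mat_algebra H d)\<rbrakk> \<Longrightarrow>
      map_mat g (c \<odot>\<^bsub>mat_algebra H d\<^esub> B) = g c \<odot>\<^bsub>mat_algebra F d\<^esub> map_mat g B"
    "map_mat g \<zero>\<^bsub>mat_algebra H d\<^esub> = \<zero>\<^bsub>mat_algebra F d\<^esub>"
    "map_mat g \<one>\<^bsub>mat_algebra H d\<^esub> = \<one>\<^bsub>mat_algebra F d\<^esub>"
proof -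
  interpret H: field H by fact
  interpret F: field F by fact
  interpret g: ring_hom_ring H F g
    by (rule ring_hom_ringI2) (fact H.ring_axioms F.ring_axioms assms(3))+
  have carr: "map_mat g A \<in> carrier (mat_algebra F d)"
    if "A \<in> carrier (mat_algebra H d)" for A
    using that by (auto simp: mat_algebra_carrier)
  show "A \<in> carrier (mat_algebra H d) \<Longrightarrow> map_mat g A \<in> carrier (mat_algebra F d)" by (rule carr)
  show "map_mat g (A \<otimes>\<^bsub>mat_algebra H d\<^esub> B) = map_mat g A \<otimes>\<^bsub>mat_algebra F d\<^esub> map_mat g B"
    if A: "A \<in> carrier (mat_algebra H d)" and B: "B \<in> carrier (mat_algebra H d)"
  proof (rule mat_algebra_eqI[of _ d])
    show "map_mat g (A \<otimes>\<^bsub>mat_algebra H d\<^esub> B) \<in> carrier_mat d d"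
      "map_mat g A \<otimes>\<^bsub>mat_algebra F d\<^esub> map_mat g B \<in> carrier_mat d d"
      using A B by (auto simp: mat_algebra_dim mat_algebra_carrier)
    fix i j assume ij: "i < d" "j < d"
    have A': "A \<in> carrier_mat d d" "\<And>i j. i < d \<Longrightarrow> j < d \<Longrightarrow> A $$ (i, j) \<in> carrier H"
      and B': "B \<in> carrier_mat d d" "\<And>i j. i < d \<Longrightarrow> j < d \<Longrightarrow> B $$ (i, j) \<in> carrier H"
      using A B by (auto simp: mat_algebra_carrier)
    have "map_mat g (A \<otimes>\<^bsub>mat_algebra H d\<^esub> B) $$ (i, j) = g ((A \<otimes>\<^bsub>mat_algebra H d\<^esub> B) $$ (i, j))"
      using mat_algebra_dim(1)[OF A'(1) B'(1), of H] ij by simp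
    also have "\<dots> = g (\<Oplus>\<^bsub>H\<^esub>k\<in>{0..<d}. A $$ (i, k) \<otimes>\<^bsub>H\<^esub> B $$ (k, j))"
      using A' B' ij H.ring_axioms by (simp add: mat_algebra_mult_index)
    also have "\<dots> = (\<Oplus>\<^bsub>F\<^esub>k\<in>{0..<d}. g (A $$ (i, k) \<otimes>\<^bsub>H\<^esub> B $$ (k, j)))"
      using A' B' ij by (subst g.hom_finsum) (auto simp: comp_def)
    also have "\<dots> = (\<Oplus>\<^bsub>F\<^esub>k\<in>{0..<d}. map_mat g A $$ (i, k) \<otimes>\<^bsub>F\<^esub> map_mat g B $$ (k, j))"
      using A' B' ij by (intro F.finsum_cong') auto
    also have "\<dots> = (map_mat g A \<otimes>\<^bsub>mat_algebra F d\<^esub> map_mat g B) $$ (i, j)"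
      using A' B' ij F.ring_axioms by (subst mat_algebra_mult_index) auto
    finally show "map_mat g (A \<otimes>\<^bsub>mat_algebra H d\<^esub> B) $$ (i, j) =
      (map_mat g A \<otimes>\<^bsub>mat_algebra F d\<^esub> map_mat g B) $$ (i, j)" .
  qed
  show "map_mat g (A \<oplus>\<^bsub>mat_algebra H d\<^esub> B) = map_mat g A \<oplus>\<^bsub>mat_algebra F d\<^esub> map_mat g B"
    if "A \<in> carrier (mat_algebra H d)" "B \<in> carrier (mat_algebra H d)"
    using that by (auto simp: mat_algebra_carrier) (auto simp: mat_algebra_def)
  show "map_mat g (c \<odot>\<^bsub>mat_algebra H d\<^esub> B) = g c \<odot>\<^bsub>mat_algebra F d\<^esub> map_mat g B"
    if "c \<in> carrier H" "B \<in> carrier (mat_algebra H d)"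
    using that by (auto simp: mat_algebra_carrier) (auto simp: mat_algebra_def)
  show "map_mat g \<zero>\<^bsub>mat_algebra H d\<^esub> = \<zero>\<^bsub>mat_algebra F d\<^esub>"
    "map_mat g \<one>\<^bsub>mat_algebra H d\<^esub> = \<one>\<^bsub>mat_algebra F d\<^esub>"
    by (auto simp: mat_algebra_def)
qed

lemma set_pow_hom:
  assumes "field H" "field F" "g \<in> Ring.ring_hom H F" "S \<subseteq> carrier (mat_algebra H d)"
  shows "set_pow (mat_algebra F d) (map_mat g ` S) n = map_mat g ` set_pow (mat_algebra H d) S n"
proof (induction n)
  case 0
  then show ?case using map_mat_hom(6)[OF assms(1-3)] by simp
next
  case (Suc n)
  have "ring H" using assms(1) by (simp add: field_def domain_def cring_def)
  note sub = set_pow_subset[OF this assms(4), of n]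
  have "map_mat g (a \<otimes>\<^bsub>mat_algebra H d\<^esub> b) = map_mat g a \<otimes>\<^bsub>mat_algebra F d\<^esub> map_mat g b"
    if "a \<in> S" "b \<in> set_pow (mat_algebra H d) S n" for a b
    using that sub assms(4) by (intro map_mat_hom(2)[OF assms(1-3)]) auto
  then show ?case unfolding set_pow.simps Suc.IH set_mult_def
    by (auto simp: image_iff) blast
qed

lemma span_hom:
  assumes "field H" "field F" "g \<in> Ring.ring_hom H F" "X \<subseteq> carrier (mat_algebra H d)"
  shows "map_mat g ` LinearCombinations.module.span H (mat_algebra H d) X
    \<subseteq> LinearCombinations.module.span F (mat_algebra F d) (map_mat g ` X)"
proof -
  interpret H: Module.module H "mat_algebra H d" by (rule mat_algebra_module) fact
  interpret F: Module.module F "mat_algebra F d" by (rule mat_algebra_module) fact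
  note hom = map_mat_hom[OF assms(1-3), where d = d]
  have X: "map_mat g ` X \<subseteq> carrier (mat_algebra F d)" using hom(1) assms(4) by blast
  interpret W: LinearCombinations.submodule F "F.span (map_mat g ` X)" "mat_algebra F d"
    by (rule F.span_is_submodule) fact
  let ?N = "{B \<in> carrier (mat_algebra H d). map_mat g B \<in> F.span (map_mat g ` X)}"
  have g: "g c \<in> carrier F" if "c \<in> carrier H" for c
    using assms(3) that by (rule ring_hom_closed)
  have "LinearCombinations.submodule H ?N (mat_algebra H d)"
  proof (rule LinearCombinations.submodule.intro)
    show "Module.module H (mat_algebra H d)" by (rule H.module_axioms)
  qed (auto simp: hom g)
  moreover have "X \<subseteq> ?N" using F.in_own_span[OF X] assms(4) by blast
  ultimately have "H.span X \<subseteq> ?N" by (intro H.span_is_subset)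
  then show ?thesis by blast
qed

lemma countable_generate_field:
  assumes "countable E"
  shows "countable (generate_field R E)"
proof -
  define step where "step T = T \<union> (\<lambda>x. \<ominus>\<^bsub>R\<^esub> x) ` T \<union> (\<lambda>x. inv\<^bsub>R\<^esub> x) ` T
    \<union> (\<lambda>(x, y). x \<oplus>\<^bsub>R\<^esub> y) ` (T \<times> T) \<union> (\<lambda>(x, y). x \<otimes>\<^bsub>R\<^esub> y) ` (T \<times> T)" for T
  define U where "U n = (step ^^ n) (insert \<one>\<^bsub>R\<^esub> E)" for n
  have U_Suc: "U (Suc n) = step (U n)" for n by (simp add: U_def)
  have "countable (U n)" for n
  proof (induction n)
    case 0
    then show ?case using assms by (simp add: U_def)
  next
    case (Suc n)
    then show ?case by (simp add: U_Suc step_def)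
  qed
  then have "countable (\<Union>n. U n)" by simp
  moreover have "x \<in> (\<Union>n. U n)" if "x \<in> generate_field R E" for x
  proof -
    have mono: "U m \<subseteq> U n" if "m \<le> n" for m n
      using that by (induction rule: dec_induct) (auto simp: U_Suc step_def)
    have two: "\<exists>n. x \<in> U n \<and> y \<in> U n" if "x \<in> U k" "y \<in> U m" for x y k m
      using that mono[of k "max k m"] mono[of m "max k m"] by auto
    show ?thesis using that
    proof (induction rule: generate_field.induct)
      case one
      have "\<one>\<^bsub>R\<^esub> \<in> U 0" by (simp add: U_def)
      then show ?case by blast
    next
      case (incl h)
      then have "h \<in> U 0" by (simp add: U_def)
      then show ?case by blast
    next
      case (a_inv h)
      then obtain n where "h \<in> U n" by blast
      then have "\<ominus>\<^bsub>R\<^esub> h \<in> U (Suc n)" by (auto simp: U_Suc step_def)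
      then show ?case by blast
    next
      case (m_inv h)
      then obtain n where "h \<in> U n" by blast
      then have "inv\<^bsub>R\<^esub> h \<in> U (Suc n)" by (auto simp: U_Suc step_def)
      then show ?case by blast
    next
      case (eng_add x y)
      then obtain n where "x \<in> U n" "y \<in> U n" using two by blast
      then have "x \<oplus>\<^bsub>R\<^esub> y \<in> U (Suc n)" by (auto simp: U_Suc step_def)
      then show ?case by blast
    next
      case (eng_mult x y)
      then obtain n where "x \<in> U n" "y \<in> U n" using two by blast
      then have "x \<otimes>\<^bsub>R\<^esub> y \<in> U (Suc n)" by (auto simp: U_Suc step_def)
      then show ?case by blast
    qed
  qed
  ultimately show ?thesis by (meson countable_subset subsetI)
qed

lemma small_subfield:
  fixes F :: "'f ring"
  assumes "field F" "finite E" "E \<subseteq> carrier F" "infinite (UNIV :: 'u set)"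
  shows "\<exists>(H :: 'u ring) g. field H \<and> g \<in> Ring.ring_hom H F \<and> E \<subseteq> g ` carrier H"
proof -
  interpret F: field F by fact
  define F0 where "F0 = generate_field F E"
  have sub: "subfield F0 F" unfolding F0_def using assms by (intro F.generate_field_is_subfield)
  have field: "field (F \<lparr> carrier := F0 \<rparr>)"
    unfolding F0_def using assms by (intro F.generate_field_is_field)
  have "countable F0" unfolding F0_def
    by (rule countable_generate_field) (use assms(2) in \<open>simp add: countable_finite\<close>)
  then obtain f :: "'f \<Rightarrow> nat" where f: "inj_on f F0" by (auto simp: countable_def)
  obtain e :: "nat \<Rightarrow> 'u" where e: "inj e"
    using assms(4) infinite_countable_subset by blast
  define h where "h = e \<circ> f"
  have h: "inj_on h (carrier (F \<lparr> carrier := F0 \<rparr>))"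
    using f e by (auto simp: h_def inj_on_def)
  define H where "H = image_ring h (F \<lparr> carrier := F0 \<rparr>)"
  interpret F0: field "F \<lparr> carrier := F0 \<rparr>" by fact
  have H: "field H" unfolding H_def by (rule F0.inj_imp_image_ring_is_field[OF h])
  define g where "g = inv_into F0 h"
  have iso: "g \<in> ring_iso H (F \<lparr> carrier := F0 \<rparr>)"
    using ring_iso_set_sym[OF F0.ring_axioms inj_imp_image_ring_iso[OF h]] by (simp add: g_def H_def)
  then have "g \<in> Ring.ring_hom H F"
    using subfieldE(3)[OF sub] unfolding ring_iso_def Ring.ring_hom_def by auto
  moreover have "g ` carrier H = F0"
    using iso by (auto simp: ring_iso_def bij_betw_def)
  moreover have "E \<subseteq> F0" by (auto simp: F0_def intro: generate_field.incl)
  ultimately show ?thesis using H by blast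
qed

lemma powers_span_transfer:
  assumes "infinite (UNIV :: 'u set)" and span: "powers_span TYPE('u) d k"
  shows "powers_span TYPE('f) d k"
  unfolding powers_span_def
proof (intro allI impI)
  fix F :: "'f ring" and S
  assume F: "field F" and S: "S \<subseteq> carrier (mat_algebra F d)"
  let ?MF = "mat_algebra F d"
  interpret F: Module.module F ?MF by (rule mat_algebra_module) fact
  have pow: "set_pow ?MF S n \<subseteq> carrier ?MF" for n
    by (rule set_pow_subset[OF F.R.ring_axioms S])
  let ?W = "F.span (\<Union>i\<in>{1..k}. set_pow ?MF S i)"
  have "set_pow ?MF S n \<subseteq> ?W" if n: "n \<ge> 1" for n
  proof
    fix A assume "A \<in> set_pow ?MF S n"
    from set_pow_finite[OF this] obtain T
      where T: "finite T" "T \<subseteq> S" "A \<in> set_pow ?MF T n" by blast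
    define E where "E = (\<Union>B\<in>T. elements_mat B)"
    have "finite E" using T(1) unfolding E_def elements_mat_def by auto
    moreover have "E \<subseteq> carrier F"
      using T(2) S by (auto simp: E_def mat_algebra_def)
    ultimately obtain H :: "'u ring" and g
      where H: "field H" "g \<in> Ring.ring_hom H F" "E \<subseteq> g ` carrier H"
      using small_subfield[OF F _ _ assms(1)] by blast
    let ?MH = "mat_algebra H d"
    interpret H: Module.module H ?MH by (rule mat_algebra_module) fact
    define T' where "T' = {B \<in> carrier ?MH. map_mat g B \<in> T}"
    have T'sub: "T' \<subseteq> carrier ?MH" by (auto simp: T'_def)
    have "B \<in> map_mat g ` T'" if B: "B \<in> T" for B
    proof -
      define B' where "B' = map_mat (inv_into (carrier H) g) B"
      have dim: "B \<in> carrier_mat d d" using B T(2) S by (auto simp: mat_algebra_carrier)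
      have img: "B $$ (i, j) \<in> g ` carrier H" if "i < d" "j < d" for i j
      proof -
        have "B $$ (i, j) \<in> elements_mat B" using dim that by (intro elements_matI) auto
        then show ?thesis using H(3) B by (auto simp: E_def)
      qed
      have "B' \<in> carrier ?MH"
        using dim img by (auto simp: B'_def mat_algebra_carrier intro: inv_into_into)
      moreover have "map_mat g B' = B"
        using dim img by (intro eq_matI) (auto simp: B'_def f_inv_into_f)
      ultimately show ?thesis using B by (force simp: T'_def)
    qed
    then have T': "map_mat g ` T' = T" by (auto simp: T'_def)
    have powT: "set_pow ?MF T i = map_mat g ` set_pow ?MH T' i" for i
      using set_pow_hom[OF H(1) F H(2) T'sub, of i] by (simp add: T')
    have powH: "set_pow ?MH T' i \<subseteq> carrier ?MH" for i
      by (rule set_pow_subset[OF H.R.ring_axioms T'sub])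
    obtain A' where A': "A' \<in> set_pow ?MH T' n" "A = map_mat g A'"
      using T(3) powT by auto
    have "A' \<in> generated_algebra H ?MH T'"
      unfolding generated_algebra_def
      using A'(1) n powH H.in_own_span[of "\<Union>n\<in>{1..}. set_pow ?MH T' n"] by auto
    then have "A' \<in> H.span (\<Union>i\<in>{1..k}. set_pow ?MH T' i)"
      using span H(1) T'sub unfolding powers_span_def by blast
    then have "A \<in> F.span (map_mat g ` (\<Union>i\<in>{1..k}. set_pow ?MH T' i))"
      using span_hom[OF H(1) F H(2), of "\<Union>i\<in>{1..k}. set_pow ?MH T' i" d] powH A'(2) by blast
    also have "map_mat g ` (\<Union>i\<in>{1..k}. set_pow ?MH T' i) = (\<Union>i\<in>{1..k}. set_pow ?MF T i)"
      by (simp add: powT image_UN)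
    also have "F.span \<dots> \<subseteq> ?W"
      by (intro F.span_is_monotone UN_mono set_pow_mono T(2) subset_refl)
    finally show "A \<in> ?W" .
  qed
  then have "generated_algebra F ?MF S \<subseteq> ?W"
    unfolding generated_algebra_def
    using pow by (intro F.span_is_subset F.span_is_submodule) blast+
  moreover have "?W \<subseteq> generated_algebra F ?MF S"
    unfolding generated_algebra_def by (intro F.span_is_monotone) auto
  ultimately show "?W = generated_algebra F ?MF S" by blast
qed

lemma ell_eq:
  assumes "infinite (UNIV :: 'u set)"
  shows "ell d = (LEAST k. powers_span TYPE('u) d k)"
proof -
  have "powers_span TYPE(nat) d k \<longleftrightarrow> powers_span TYPE('u) d k" for k
    using powers_span_transfer[where 'u = nat and 'f = 'u, of d k]
      powers_span_transfer[where 'u = 'u and 'f = nat, of d k] assms by auto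
  then show ?thesis by (simp add: ell_def)
qed

end

theory Submission
  imports Defs "HOL-Library.Function_Algebras"
begin

text \<open>
  Let \<open>R\<close> be the infimum of \<open>\<parallel>S\<parallel>\<close> over all ultrametric norms. The Rota--Strang construction gives
  \<open>R^n \<le> \<parallel>S^n\<parallel>\<close>, so \<open>R\<close> is the joint spectral radius, and almost orthogonal bases replace arbitrary
  norms by conjugates of a given one. If the eigenvalues of words of length at most \<open>ell d\<close> satisfied
  \<open>\<Lambda>(S^k)^(1/k) \<le> r < R\<close>, conjugates of \<open>S\<close> rescaled to have norm tending to 1 would reduce, in the
  residue field of an ultraproduct, to a set whose short words are nilpotent and span the algebra it
  generates. By Burnside's argument and a trace such an algebra is nilpotent, so words of a fixed
  length shrink by a factor below 1 infinitely often, against the minimality of \<open>R\<close>. The same theorem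
  on nilpotency, applied over the field itself, treats \<open>R = 0\<close>. If \<open>R > 0\<close>, a seminorm expanded by
  at most \<open>R\<close> with smallest kernel must be a norm: on a non-zero kernel an upper limit of
  normalised almost optimal norms would shrink the kernel.
\<close>

section \<open>Modules over a local ring modulo its maximal ideal\<close>

text \<open>The residue field depends on an ultrafilter chosen inside a proof and so cannot be a
  type. Linear algebra over it is done with representatives in \<open>R\<close>, congruence modulo
  \<open>P\<close> and submodules between \<open>Z\<close> and \<open>V\<close>; a record for the
  quotient appears only where \<open>ell\<close> requires one. An ultraproduct is used because the
  radius R need be no absolute value of a scalar and no conjugate of S need attain it. S is
  therefore conjugated ever better and divided by scalars c_n with |c_n| slightly above R. If small
  meant |x_n| < 1 for each n, all rescaled words would be small, their norms being below 1 but
  tending to 1, and nothing would follow. So small means bounded by some D < 1 along the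
  ultrafilter. As to nilpotency: on a simple subquotient, a multiple of an operator of minimal rank
  is a projection onto a line. It has trace 1, whereas nilpotent operators have trace 0. This holds
  in every characteristic, while the trace of the identity might vanish.\<close>

locale residue_field =
  fixes R P :: "'r::comm_ring_1 set"
  assumes one_R: "1 \<in> R" and minus_one_R: "- 1 \<in> R"
    and add_R: "a \<in> R \<Longrightarrow> b \<in> R \<Longrightarrow> a + b \<in> R"
    and mult_R: "a \<in> R \<Longrightarrow> b \<in> R \<Longrightarrow> a * b \<in> R"
    and P_sub: "P \<subseteq> R" and zero_P: "0 \<in> P" and one_P: "1 \<notin> P"
    and add_P: "a \<in> P \<Longrightarrow> b \<in> P \<Longrightarrow> a + b \<in> P"
    and mult_P: "a \<in> R \<Longrightarrow> b \<in> P \<Longrightarrow> a * b \<in> P"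
    and inverse_mod: "a \<in> R \<Longrightarrow> a \<notin> P \<Longrightarrow> \<exists>b\<in>R. a * b - 1 \<in> P"
begin

definition cong :: "'r \<Rightarrow> 'r \<Rightarrow> bool" (infix \<open>\<simeq>\<^sub>P\<close> 50) where
  "a \<simeq>\<^sub>P b \<longleftrightarrow> a - b \<in> P"

lemma P_R: "a \<in> P \<Longrightarrow> a \<in> R" using P_sub by blast
lemma zero_R: "0 \<in> R" using zero_P P_R by blast
lemma uminus_R: "a \<in> R \<Longrightarrow> - a \<in> R" using mult_R[OF minus_one_R, of a] by simp
lemma uminus_P: "a \<in> P \<Longrightarrow> - a \<in> P" using mult_P[OF minus_one_R, of a] by simp
lemma diff_R: "a \<in> R \<Longrightarrow> b \<in> R \<Longrightarrow> a - b \<in> R"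
  using add_R[OF _ uminus_R, of a b] by simp
lemma diff_P: "a \<in> P \<Longrightarrow> b \<in> P \<Longrightarrow> a - b \<in> P"
  using add_P[OF _ uminus_P, of a b] by simp
lemma mult_P': "a \<in> P \<Longrightarrow> b \<in> R \<Longrightarrow> a * b \<in> P"
  using mult_P[of b a] by (simp add: mult.commute)
lemma sum_R: "(\<And>i. i \<in> I \<Longrightarrow> f i \<in> R) \<Longrightarrow> sum f I \<in> R"
  by (induction I rule: infinite_finite_induct) (auto simp: zero_R add_R)
lemma sum_P: "(\<And>i. i \<in> I \<Longrightarrow> f i \<in> P) \<Longrightarrow> sum f I \<in> P"
  by (induction I rule: infinite_finite_induct) (auto simp: zero_P add_P)

lemma cong_refl [simp]: "a \<simeq>\<^sub>P a" by (simp add: cong_def zero_P)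
lemma cong_sym: "a \<simeq>\<^sub>P b \<Longrightarrow> b \<simeq>\<^sub>P a"
  using uminus_P[of "a - b"] by (simp add: cong_def)
lemma cong_trans [trans]: "a \<simeq>\<^sub>P b \<Longrightarrow> b \<simeq>\<^sub>P c \<Longrightarrow> a \<simeq>\<^sub>P c"
  using add_P[of "a - b" "b - c"] by (simp add: cong_def)
lemma cong_add: "a \<simeq>\<^sub>P b \<Longrightarrow> c \<simeq>\<^sub>P d \<Longrightarrow> a + c \<simeq>\<^sub>P b + d"
  using add_P[of "a - b" "c - d"] by (simp add: cong_def algebra_simps)
lemma cong_diff: "a \<simeq>\<^sub>P b \<Longrightarrow> c \<simeq>\<^sub>P d \<Longrightarrow> a - c \<simeq>\<^sub>P b - d"
  using diff_P[of "a - b" "c - d"] by (simp add: cong_def algebra_simps)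
lemma cong_R: "a \<simeq>\<^sub>P b \<Longrightarrow> b \<in> R \<Longrightarrow> a \<in> R"
  using add_R[of "a - b" b] P_R by (auto simp: cong_def)
lemma cong_mult: assumes "a \<simeq>\<^sub>P b" "c \<simeq>\<^sub>P d" "b \<in> R" "c \<in> R" shows "a * c \<simeq>\<^sub>P b * d"
proof -
  have "(a - b) * c + b * (c - d) \<in> P"
    using assms by (intro add_P mult_P mult_P') (auto simp: cong_def)
  then show ?thesis by (simp add: cong_def algebra_simps)
qed
lemma cong_sum: "(\<And>i. i \<in> I \<Longrightarrow> f i \<simeq>\<^sub>P g i) \<Longrightarrow> sum f I \<simeq>\<^sub>P sum g I"
  using sum_P[of I "\<lambda>i. f i - g i"] by (simp add: cong_def sum_subtractf)
lemma cong_zero: "a \<simeq>\<^sub>P 0 \<longleftrightarrow> a \<in> P" by (simp add: cong_def)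
lemma cong_P: "a \<simeq>\<^sub>P b \<Longrightarrow> b \<in> P \<Longrightarrow> a \<in> P"
  using add_P[of "a - b" b] by (simp add: cong_def)

end

text \<open>Submodules between \<open>Z\<close> and \<open>V\<close> stand for the subspaces of V/Z,
  so that comparing subspaces is plain inclusion of sets.\<close>

definition submod :: "'r set \<Rightarrow> ('r \<Rightarrow> 'v \<Rightarrow> 'v) \<Rightarrow> 'v set \<Rightarrow> 'v set \<Rightarrow> 'v::ab_group_add set \<Rightarrow> bool"
  where "submod R sc Z V U \<longleftrightarrow> Z \<subseteq> U \<and> U \<subseteq> V \<and> (\<forall>x\<in>U. \<forall>y\<in>U. x + y \<in> U) \<and>
    (\<forall>a\<in>R. \<forall>x\<in>U. sc a x \<in> U)"

text \<open>Vectors and matrices are total functions. Entries at indices from \<open>d\<close> on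
  carry no meaning, so statements about entries are restricted to indices below \<open>d\<close>
  wherever this matters.\<close>

definition mat_app :: "nat \<Rightarrow> (nat \<Rightarrow> nat \<Rightarrow> 'r::comm_ring_1) \<Rightarrow> (nat \<Rightarrow> 'r) \<Rightarrow> nat \<Rightarrow> 'r" where
  "mat_app d M x = (\<lambda>i. \<Sum>j<d. M i j * x j)"

text \<open>V/Z is a vector space over the residue field because \<open>P\<close> carries
  \<open>V\<close> into \<open>Z\<close>. The strictly monotone \<open>rk\<close> takes the place of
  a dimension: it supplies maximal submodules and lets inductions terminate.\<close>

locale finite_length_module = residue_field R P for R P :: "'r::comm_ring_1 set" +
  fixes sc :: "'r \<Rightarrow> 'v::ab_group_add \<Rightarrow> 'v" and Z V :: "'v set" and rk :: "'v set \<Rightarrow> nat"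
  assumes zero_Z: "0 \<in> Z"
    and sc_add_left: "sc (a + b) x = sc a x + sc b x"
    and sc_add_right: "sc a (x + y) = sc a x + sc a y"
    and sc_mult: "sc (a * b) x = sc a (sc b x)"
    and sc_one: "sc 1 x = x"
    and submod_V: "submod R sc Z V V" and submod_Z: "submod R sc Z V Z"
    and sc_P: "a \<in> P \<Longrightarrow> x \<in> V \<Longrightarrow> sc a x \<in> Z"
    and rk_strict: "submod R sc Z V U \<Longrightarrow> submod R sc Z V W \<Longrightarrow> U \<subset> W \<Longrightarrow> rk U < rk W"
begin

abbreviation sub where "sub \<equiv> submod R sc Z V"

lemma subD: assumes "sub U"
  shows "Z \<subseteq> U" "U \<subseteq> V" "x \<in> U \<Longrightarrow> y \<in> U \<Longrightarrow> x + y \<in> U" "a \<in> R \<Longrightarrow> x \<in> U \<Longrightarrow> sc a x \<in> U"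
  using assms by (auto simp: submod_def)

lemma sub_V: "sub U \<Longrightarrow> x \<in> U \<Longrightarrow> x \<in> V" by (auto simp: submod_def)

lemma sc_zero_left: "sc 0 x = 0" using sc_add_left[of 0 0 x] by simp
lemma sc_zero_right: "sc a 0 = 0" using sc_add_right[of a 0 0] by simp
lemma sc_uminus: "sc (- a) x = - sc a x"
  using sc_add_left[of a "- a" x] by (simp add: sc_zero_left eq_neg_iff_add_eq_0 add.commute)
lemma sc_diff_left: "sc (a - b) x = sc a x - sc b x"
  using sc_add_left[of a "- b" x] by (simp add: sc_uminus)
lemma sc_uminus_right: "sc a (- x) = - sc a x"
  using sc_add_right[of a x "- x"] by (simp add: sc_zero_right eq_neg_iff_add_eq_0 add.commute)
lemma sc_diff_right: "sc a (x - y) = sc a x - sc a y"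
  using sc_add_right[of a x "- y"] by (simp add: sc_uminus_right)
lemma sub_uminus: "sub U \<Longrightarrow> x \<in> U \<Longrightarrow> - x \<in> U"
  using subD(4)[of U "- 1" x] minus_one_R sc_uminus[of 1 x] by (simp add: sc_one)
lemma sub_diff: "sub U \<Longrightarrow> x \<in> U \<Longrightarrow> y \<in> U \<Longrightarrow> x - y \<in> U"
  using subD(3)[of U x "- y"] sub_uminus by simp
lemma sub_zero: "sub U \<Longrightarrow> 0 \<in> U"
  using zero_Z subD(1) by blast
lemma sub_sum: "sub U \<Longrightarrow> (\<And>i. i \<in> I \<Longrightarrow> f i \<in> U) \<Longrightarrow> sum f I \<in> U"
  by (induction I rule: infinite_finite_induct) (auto simp: sub_zero intro: subD(3))
lemma sc_P_sub: "sub U \<Longrightarrow> a \<in> P \<Longrightarrow> x \<in> V \<Longrightarrow> sc a x \<in> U"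
  using sc_P subD(1) by blast

text \<open>A scalar outside \<open>P\<close> has an inverse up to an error in \<open>P\<close>, and
  such an error takes \<open>x\<close> into \<open>Z\<close>, hence into \<open>U\<close>.\<close>

lemma sub_sc_cancel:
  assumes U: "sub U" and a: "a \<in> R" "a \<notin> P" and x: "x \<in> V" "sc a x \<in> U"
  shows "x \<in> U"
proof -
  obtain b where b: "b \<in> R" "a * b - 1 \<in> P" using inverse_mod a by blast
  have "sc b (sc a x) \<in> U" by (rule subD(4)[OF U b(1) x(2)])
  then have "sc (a * b) x \<in> U" by (simp add: sc_mult mult.commute[of a b])
  moreover have "sc (a * b - 1) x \<in> U" by (rule sc_P_sub[OF U b(2) x(1)])
  ultimately have "sc (a * b) x - sc (a * b - 1) x \<in> U" by (rule sub_diff[OF U])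
  then show ?thesis by (simp add: sc_diff_left sc_one)
qed

definition add_line :: "'v set \<Rightarrow> 'v \<Rightarrow> 'v set" where
  "add_line W u = {w + sc a u | w a. w \<in> W \<and> a \<in> R}"

lemma sub_add_line: assumes W: "sub W" and u: "u \<in> V" shows "sub (add_line W u)"
  unfolding submod_def
proof (intro conjI ballI)
  have "w \<in> add_line W u" if "w \<in> W" for w
    unfolding add_line_def using that zero_R by (intro CollectI exI[of _ w] exI[of _ 0]) (simp add: sc_zero_left)
  then show "Z \<subseteq> add_line W u" using subD(1)[OF W] by blast
  show "add_line W u \<subseteq> V"
    unfolding add_line_def using u sub_V[OF W] subD(3,4)[OF submod_V] by auto
  fix x assume "x \<in> add_line W u"
  then obtain w a where x: "x = w + sc a u" "w \<in> W" "a \<in> R" unfolding add_line_def by blast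
  { fix y assume "y \<in> add_line W u"
    then obtain w' a' where y: "y = w' + sc a' u" "w' \<in> W" "a' \<in> R" unfolding add_line_def by blast
    have "x + y = (w + w') + sc (a + a') u" using x y by (simp add: sc_add_left)
    then show "x + y \<in> add_line W u"
      unfolding add_line_def using x y subD(3)[OF W] add_R by blast }
  { fix c assume c: "c \<in> R"
    have "sc c x = sc c w + sc (c * a) u" using x by (simp add: sc_add_right sc_mult)
    then show "sc c x \<in> add_line W u"
      unfolding add_line_def using x c subD(4)[OF W] mult_R by blast }
qed

lemma add_line_mem: "w \<in> W \<Longrightarrow> w \<in> add_line W u"
  unfolding add_line_def using zero_R by (intro CollectI exI[of _ w] exI[of _ 0]) (simp add: sc_zero_left)
lemma add_line_self: "sub W \<Longrightarrow> u \<in> add_line W u"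
  unfolding add_line_def using one_R sub_zero[of W]
  by (intro CollectI exI[of _ 0] exI[of _ 1]) (simp add: sc_one)
lemma add_line_psubset: "sub W \<Longrightarrow> u \<notin> W \<Longrightarrow> W \<subset> add_line W u"
  using add_line_mem add_line_self by blast

lemma rk_mono: "sub U \<Longrightarrow> sub W \<Longrightarrow> U \<subseteq> W \<Longrightarrow> rk U \<le> rk W"
  by (cases "U = W") (simp, metis less_imp_le psubsetI rk_strict)

text \<open>Ranks are bounded by \<open>rk V\<close>, so a member of greatest rank exists, and it is
  maximal. The predicate \<open>Q\<close> is left open to cover non-membership, invariance and
  kernels of operators alike.\<close>

lemma maximal_sub:
  assumes "sub W0" "Q W0"
  obtains W where "sub W" "Q W" "W0 \<subseteq> W" "\<And>W'. sub W' \<Longrightarrow> Q W' \<Longrightarrow> W \<subseteq> W' \<Longrightarrow> W' = W"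
proof -
  let ?Q = "\<lambda>W. sub W \<and> Q W \<and> W0 \<subseteq> W"
  have bound: "\<forall>W. ?Q W \<longrightarrow> rk W < Suc (rk V)"
    using rk_mono[OF _ submod_V] subD(2) by (meson less_Suc_eq_le)
  from ex_has_greatest_nat[of ?Q W0 rk "Suc (rk V)"] bound assms obtain W
    where W: "?Q W" "\<And>W'. ?Q W' \<Longrightarrow> rk W' \<le> rk W" by blast
  show thesis
  proof (rule that)
    fix W' assume W': "sub W'" "Q W'" "W \<subseteq> W'"
    then have "rk W' \<le> rk W" using W by blast
    then show "W' = W" using W' W(1) rk_strict[of W W'] by (metis leD psubsetI)
  qed (use W in auto)
qed

section \<open>Linear forms with values in the residue field, and dual bases\<close>

definition linear_form :: "('v \<Rightarrow> 'r) \<Rightarrow> bool" where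
  "linear_form c \<longleftrightarrow> (\<forall>x\<in>V. c x \<in> R) \<and> (\<forall>x\<in>V. \<forall>y\<in>V. c (x + y) \<simeq>\<^sub>P c x + c y) \<and>
     (\<forall>a\<in>R. \<forall>x\<in>V. c (sc a x) \<simeq>\<^sub>P a * c x)"

lemma linear_formD:
  assumes "linear_form c"
  shows "x \<in> V \<Longrightarrow> c x \<in> R" "x \<in> V \<Longrightarrow> y \<in> V \<Longrightarrow> c (x + y) \<simeq>\<^sub>P c x + c y"
    "a \<in> R \<Longrightarrow> x \<in> V \<Longrightarrow> c (sc a x) \<simeq>\<^sub>P a * c x"
  using assms by (auto simp: linear_form_def)

lemma linear_form_zero: assumes c: "linear_form c" shows "c 0 \<in> P"
  using linear_formD(3)[OF c zero_R sub_zero[OF submod_V]]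
  by (simp add: sc_zero_left cong_zero)

lemma linear_form_sum:
  assumes c: "linear_form c" and f: "\<And>i. i \<in> I \<Longrightarrow> f i \<in> V"
  shows "c (sum f I) \<simeq>\<^sub>P (\<Sum>i\<in>I. c (f i))"
  using f
proof (induction I rule: infinite_finite_induct)
  case (insert i I)
  have "c (f i + sum f I) \<simeq>\<^sub>P c (f i) + c (sum f I)"
    using insert.prems by (intro linear_formD(2)[OF c] sub_sum[OF submod_V]) auto
  also have "\<dots> \<simeq>\<^sub>P c (f i) + (\<Sum>i\<in>I. c (f i))"
    using insert by (intro cong_add) auto
  finally show ?case using insert by simp
qed (auto simp: linear_form_zero[OF c] cong_zero)

lemma linear_form_combination:
  assumes c: "linear_form c" and u: "\<And>i. i \<in> I \<Longrightarrow> u i \<in> V" and x: "\<And>i. i \<in> I \<Longrightarrow> x i \<in> R"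
  shows "c (\<Sum>i\<in>I. sc (x i) (u i)) \<simeq>\<^sub>P (\<Sum>i\<in>I. x i * c (u i))"
proof -
  have "c (\<Sum>i\<in>I. sc (x i) (u i)) \<simeq>\<^sub>P (\<Sum>i\<in>I. c (sc (x i) (u i)))"
    using u x by (intro linear_form_sum[OF c] subD(4)[OF submod_V])
  also have "\<dots> \<simeq>\<^sub>P (\<Sum>i\<in>I. x i * c (u i))"
    using u x by (intro cong_sum linear_formD(3)[OF c])
  finally show ?thesis .
qed

lemma linear_form_cong:
  assumes c: "linear_form c" and W: "sub W" "\<And>w. w \<in> W \<Longrightarrow> c w \<in> P"
    and x: "x \<in> V" "y \<in> V" "x - y \<in> W"
  shows "c x \<simeq>\<^sub>P c y"
proof -
  have "c (y + (x - y)) \<simeq>\<^sub>P c y + c (x - y)"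
    using x sub_V[OF W(1)] by (intro linear_formD(2)[OF c]) auto
  also have "\<dots> \<simeq>\<^sub>P c y + 0"
    using W(2) x(3) by (intro cong_add) (auto simp: cong_zero)
  finally show ?thesis by simp
qed

text \<open>Let \<open>M\<close> be maximal among the submodules that contain \<open>W\<close> but
  not \<open>u\<close>. Maximality forces V = M + R u, and the coefficient of \<open>u\<close>,
  which is unique modulo \<open>P\<close>, is the form.\<close>

lemma separating_form:
  assumes W: "sub W" and u: "u \<in> V" "u \<notin> W"
  obtains c where "linear_form c" "\<And>w. w \<in> W \<Longrightarrow> c w \<in> P" "c u \<simeq>\<^sub>P 1"
proof -
  obtain M where M: "sub M" "u \<notin> M" "W \<subseteq> M"
    and max: "\<And>M'. sub M' \<Longrightarrow> u \<notin> M' \<Longrightarrow> M \<subseteq> M' \<Longrightarrow> M' = M"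
    using maximal_sub[of W "\<lambda>M. u \<notin> M"] W u by blast
  have ex: "\<exists>a\<in>R. y - sc a u \<in> M" if y: "y \<in> V" for y
  proof (cases "y \<in> M")
    case True
    then show ?thesis using zero_R by (intro bexI[of _ 0]) (auto simp: sc_zero_left)
  next
    case False
    \<comment> \<open>The coefficient of \<open>y\<close> in the resulting expression for
      \<open>u\<close> lies outside \<open>P\<close>, for otherwise \<open>u\<close> would be in
      \<open>M\<close>; so the expression can be solved for \<open>y\<close>.\<close>
    have "u \<in> add_line M y"
      using max[OF sub_add_line[OF M(1) y]] add_line_psubset[OF M(1) False] by blast
    then obtain w t where wt: "u = w + sc t y" "w \<in> M" "t \<in> R" unfolding add_line_def by blast
    have "t \<notin> P" using wt M(2) subD(3)[OF M(1)] sc_P_sub[OF M(1) _ y] by blast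
    then obtain b where b: "b \<in> R" "t * b - 1 \<in> P" using inverse_mod wt(3) by blast
    have "sc b u = sc b w + sc (t * b) y" using wt by (simp add: sc_add_right sc_mult mult.commute[of t b])
    then have "y - sc b u = - (sc b w + sc (t * b - 1) y)" by (simp add: sc_diff_left sc_one)
    then have "y - sc b u \<in> M"
      using sub_uminus[OF M(1)] subD(3)[OF M(1)] subD(4)[OF M(1) b(1) wt(2)] sc_P_sub[OF M(1) b(2) y]
      by metis
    then show ?thesis using b by blast
  qed
  define c where "c y = (SOME a. a \<in> R \<and> y - sc a u \<in> M)" for y
  have c: "c y \<in> R \<and> y - sc (c y) u \<in> M" if "y \<in> V" for y
    unfolding c_def by (rule someI_ex) (use ex[OF that] in blast)
  have uniq: "c y \<simeq>\<^sub>P a" if "y \<in> V" "a \<in> R" "y - sc a u \<in> M" for y a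
  proof (rule ccontr)
    assume "\<not> ?thesis"
    then have 1: "c y - a \<notin> P" by (simp add: cong_def)
    have 2: "c y - a \<in> R" using c[OF that(1)] that(2) diff_R by blast
    have "sc (c y - a) u \<in> M"
      using sub_diff[OF M(1) that(3) conjunct2[OF c[OF that(1)]]] by (simp add: sc_diff_left)
    then have "u \<in> M" by (rule sub_sc_cancel[OF M(1) 2 1 u(1)])
    then show False using M(2) by blast
  qed
  show thesis
  proof (rule that)
    show "linear_form c" unfolding linear_form_def
    proof (intro conjI ballI)
      fix x assume x: "x \<in> V"
      show "c x \<in> R" using c x by blast
      { fix y assume y: "y \<in> V"
        have eq: "x + y - sc (c x + c y) u = (x - sc (c x) u) + (y - sc (c y) u)"
          by (simp add: sc_add_left)
        show "c (x + y) \<simeq>\<^sub>P c x + c y"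
          by (rule uniq, unfold eq)
            (use c x y in \<open>auto intro: subD(3)[OF submod_V] add_R subD(3)[OF M(1)]\<close>) }
      { fix a assume a: "a \<in> R"
        have eq: "sc a x - sc (a * c x) u = sc a (x - sc (c x) u)"
          by (simp add: sc_mult sc_diff_right)
        show "c (sc a x) \<simeq>\<^sub>P a * c x"
          by (rule uniq, unfold eq)
            (use c x a in \<open>auto intro: subD(4)[OF submod_V] mult_R subD(4)[OF M(1)]\<close>) }
    qed
    show "c w \<in> P" if "w \<in> W" for w
      using uniq[of w 0] that M(3) sub_V[OF W] zero_R by (auto simp: sc_zero_left cong_zero)
    show "c u \<simeq>\<^sub>P 1"
      using uniq[OF u(1) one_R] sub_zero[OF M(1)] by (simp add: sc_one)
  qed
qed

lemma linear_form_minus_combination: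
  assumes c: "linear_form c" and cs: "\<And>i. i \<in> I \<Longrightarrow> linear_form (cs i)" and a: "\<And>i. i \<in> I \<Longrightarrow> a i \<in> R"
  shows "linear_form (\<lambda>x. c x - (\<Sum>i\<in>I. a i * cs i x))"
  unfolding linear_form_def
proof (intro conjI ballI)
  fix x assume x: "x \<in> V"
  show "c x - (\<Sum>i\<in>I. a i * cs i x) \<in> R"
    using x by (intro diff_R sum_R mult_R a linear_formD(1)[OF c] linear_formD(1)[OF cs])
  { fix y assume y: "y \<in> V"
    have "c (x + y) - (\<Sum>i\<in>I. a i * cs i (x + y)) \<simeq>\<^sub>P c x + c y - (\<Sum>i\<in>I. a i * (cs i x + cs i y))"
      using x y by (intro cong_diff cong_sum cong_mult cong_refl linear_formD(2)[OF c] linear_formD(2)[OF cs] a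
        cong_R[OF linear_formD(2)[OF cs]] add_R linear_formD(1)[OF cs])
    then show "c (x + y) - (\<Sum>i\<in>I. a i * cs i (x + y)) \<simeq>\<^sub>P
        c x - (\<Sum>i\<in>I. a i * cs i x) + (c y - (\<Sum>i\<in>I. a i * cs i y))"
      by (simp add: algebra_simps sum.distrib) }
  { fix b assume b: "b \<in> R"
    have "c (sc b x) - (\<Sum>i\<in>I. a i * cs i (sc b x)) \<simeq>\<^sub>P b * c x - (\<Sum>i\<in>I. a i * (b * cs i x))"
      using x b by (intro cong_diff cong_sum cong_mult cong_refl linear_formD(3)[OF c] linear_formD(3)[OF cs] a
        cong_R[OF linear_formD(3)[OF cs]] mult_R linear_formD(1)[OF cs])
    then show "c (sc b x) - (\<Sum>i\<in>I. a i * cs i (sc b x)) \<simeq>\<^sub>P b * (c x - (\<Sum>i\<in>I. a i * cs i x))"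
      by (simp add: algebra_simps sum_distrib_left) }
qed

end

context finite_length_module begin

text \<open>The forms live on all of \<open>V\<close> and not just on \<open>U\<close>, so they
  yield coordinates as well as traces of operators on U/W. The induction splits off one line above
  \<open>W\<close> and adds a form that detects it.\<close>

lemma dual_basis:
  assumes "sub W" "sub U" "W \<subseteq> U"
  shows "\<exists>r us cs. (\<forall>i<r. us i \<in> U \<and> linear_form (cs i) \<and> (\<forall>w\<in>W. cs i w \<in> P)) \<and>
    (\<forall>i<r. \<forall>j<r. cs i (us j) \<simeq>\<^sub>P (if i = j then 1 else 0)) \<and>
    (\<forall>x\<in>U. x - (\<Sum>i<(r::nat). sc (cs i x) (us i)) \<in> W)"
  using assms
proof (induction "rk U - rk W" arbitrary: W rule: less_induct)
  case less
  note W = less.prems(1) and U = less.prems(2)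
  show ?case
  proof (cases "U \<subseteq> W")
    case True
    then show ?thesis by (intro exI[of _ 0]) auto
  next
    case False
    then obtain u where u: "u \<in> U" "u \<notin> W" by blast
    have uV: "u \<in> V" using u U sub_V by blast
    let ?M = "add_line W u"
    have M: "sub ?M" by (rule sub_add_line[OF W uV])
    have MU: "?M \<subseteq> U" unfolding add_line_def using less.prems u subD(3,4)[OF U] by auto
    have "rk W < rk ?M" "rk ?M \<le> rk U"
      using rk_strict[OF W M add_line_psubset[OF W u(2)]] rk_mono[OF M U MU] by auto
    then have "rk U - rk ?M < rk U - rk W" by linarith
    from less.hyps[OF \<open>rk U - rk ?M < rk U - rk W\<close> M U MU] obtain r :: nat and us cs where
      IH: "\<forall>i<r. us i \<in> U \<and> linear_form (cs i) \<and> (\<forall>w\<in>?M. cs i w \<in> P)"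
        "\<forall>i<r. \<forall>j<r. cs i (us j) \<simeq>\<^sub>P (if i = j then 1 else 0)"
        "\<forall>x\<in>U. x - (\<Sum>i<r. sc (cs i x) (us i)) \<in> ?M"
      by blast
    have IH1: "us i \<in> U" and IH2: "linear_form (cs i)" and IH3: "w \<in> ?M \<Longrightarrow> cs i w \<in> P"
      if "i < r" for i w using IH(1) that by auto
    have IH4: "cs i (us j) \<simeq>\<^sub>P (if i = j then 1 else 0)" if "i < r" "j < r" for i j
      using IH(2) that by blast
    have IH5: "x - (\<Sum>i<r. sc (cs i x) (us i)) \<in> ?M" if "x \<in> U" for x
      using IH(3) that by blast
    obtain c where c: "linear_form c" "\<And>w. w \<in> W \<Longrightarrow> c w \<in> P" "c u \<simeq>\<^sub>P 1"
      using separating_form[OF W uV u(2)] by blast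
    \<comment> \<open>Multiples of the earlier forms are subtracted so that the new form vanishes on
      the earlier vectors \<open>us i\<close>. On \<open>?M\<close> this changes nothing modulo
      \<open>P\<close>, since the earlier forms vanish there.\<close>
    define c0 where "c0 x = c x - (\<Sum>i<r. c (us i) * cs i x)" for x
    have usV: "us i \<in> V" if "i < r" for i using IH1 that U sub_V by blast
    have cus: "c (us i) \<in> R" if "i < r" for i using linear_formD(1)[OF c(1) usV[OF that]] .
    have c0: "linear_form c0" unfolding c0_def
      by (intro linear_form_minus_combination c(1)) (auto intro: IH2 cus)
    have c0_M: "c0 y \<simeq>\<^sub>P c y" if "y \<in> ?M" for y
    proof -
      have "(\<Sum>i<r. c (us i) * cs i y) \<in> P" using that by (intro sum_P mult_P cus IH3) auto
      then have "c y - (\<Sum>i<r. c (us i) * cs i y) \<simeq>\<^sub>P c y - 0"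
        by (intro cong_diff cong_refl) (simp add: cong_zero)
      then show ?thesis by (simp add: c0_def)
    qed
    have c0_us: "c0 (us j) \<in> P" if j: "j < r" for j
    proof -
      have "c (us j) - (\<Sum>i<r. c (us i) * cs i (us j)) \<simeq>\<^sub>P
          c (us j) - (\<Sum>i<r. c (us i) * (if i = j then 1 else 0))"
        using j by (intro cong_diff cong_sum cong_mult cong_refl IH4 cus
          linear_formD(1)[OF IH2 usV]) auto
      also have "\<dots> = 0" using j by (simp add: if_distrib[of "(*) _"] cong: if_cong)
      finally show ?thesis by (simp add: c0_def cong_zero)
    qed
    have c0_u: "c0 u \<simeq>\<^sub>P 1" using c0_M[OF add_line_self[OF W]] c(3) cong_trans by blast
    have c0_W: "c0 w \<in> P" if "w \<in> W" for w using c0_M[OF add_line_mem[OF that]] c(2)[OF that] cong_P by blast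
    define us' where "us' i = (if i = r then u else us i)" for i
    define cs' where "cs' i = (if i = r then c0 else cs i)" for i
    have "x - (\<Sum>i<Suc r. sc (cs' i x) (us' i)) \<in> W" if x: "x \<in> U" for x
    proof -
      have xV: "x \<in> V" using x U sub_V by blast
      let ?s = "\<Sum>i<r. sc (cs i x) (us i)"
      have cR: "cs i x \<in> R" if "i < r" for i using linear_formD(1)[OF IH2[OF that] xV] .
      have sV: "?s \<in> V" using cR usV by (intro sub_sum[OF submod_V] subD(4)[OF submod_V]) auto
      obtain w t where y: "x - ?s = w + sc t u" "w \<in> W" "t \<in> R"
        using IH5[OF x] unfolding add_line_def by blast
      have "c0 ?s \<simeq>\<^sub>P (\<Sum>i<r. cs i x * c0 (us i))"
        using usV cR by (intro linear_form_combination[OF c0]) auto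
      then have c0s: "c0 ?s \<in> P"
        by (rule cong_P) (auto intro!: sum_P mult_P cR c0_us)
      have wV: "w \<in> V" using y W sub_V by blast
      \<comment> \<open>Evaluating \<open>c0\<close> on both sides identifies the coefficient
        \<open>t\<close> from the induction hypothesis with \<open>c0 x\<close> modulo
        \<open>P\<close>.\<close>
      have "c0 x = c0 ((w + sc t u) + ?s)" using y(1) by (metis diff_add_cancel)
      also have "\<dots> \<simeq>\<^sub>P c0 (w + sc t u) + c0 ?s"
        using wV uV y sV by (intro linear_formD(2)[OF c0] subD(3)[OF submod_V] subD(4)[OF submod_V])
      also have "\<dots> \<simeq>\<^sub>P (c0 w + c0 (sc t u)) + 0"
        using c0s wV uV y by (intro cong_add linear_formD(2)[OF c0] subD(4)[OF submod_V]) (auto simp: cong_zero)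
      also have "\<dots> \<simeq>\<^sub>P (0 + t * 1) + 0"
        using c0_W y uV
        by (intro cong_add cong_refl cong_trans[OF linear_formD(3)[OF c0]] cong_mult c0_u linear_formD(1)[OF c0] one_R)
           (auto simp: cong_zero)
      finally have "t - c0 x \<in> P" using cong_sym[of "c0 x" t] by (simp add: cong_def)
      then have "w + sc (t - c0 x) u \<in> W" by (intro subD(3)[OF W y(2)] sc_P_sub[OF W _ uV])
      moreover have "x - (\<Sum>i<Suc r. sc (cs' i x) (us' i)) = (x - ?s) - sc (c0 x) u"
        by (simp add: us'_def cs'_def)
      ultimately show ?thesis unfolding y(1) by (simp add: sc_diff_left add_diff_eq)
    qed
    moreover have "cs' i (us' j) \<simeq>\<^sub>P (if i = j then 1 else 0)" if "i < Suc r" "j < Suc r" for i j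
      using that IH4[of i j] c0_us[of j] c0_u IH3[OF _ add_line_self[OF W], of i]
      by (auto simp: cs'_def us'_def cong_zero less_Suc_eq)
    moreover have "us' i \<in> U \<and> linear_form (cs' i) \<and> (\<forall>w\<in>W. cs' i w \<in> P)" if "i < Suc r" for i
      using that u(1) IH1 IH2 IH3 add_line_mem c0 c0_W by (auto simp: cs'_def us'_def less_Suc_eq)
    ultimately show ?thesis by (intro exI[of _ "Suc r"] exI[of _ us'] exI[of _ cs']) blast
  qed
qed

section \<open>Operators and their matrices on subquotients\<close>

definition lin_op :: "('v \<Rightarrow> 'v) \<Rightarrow> bool" where
  "lin_op a \<longleftrightarrow> (\<forall>x\<in>V. a x \<in> V) \<and> (\<forall>x\<in>Z. a x \<in> Z) \<and> (\<forall>x y. a (x + y) = a x + a y) \<and>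
     (\<forall>c x. a (sc c x) = sc c (a x))"

lemma lin_opD:
  assumes "lin_op a"
  shows "x \<in> V \<Longrightarrow> a x \<in> V" "x \<in> Z \<Longrightarrow> a x \<in> Z" "a (x + y) = a x + a y" "a (sc c x) = sc c (a x)"
    "a (x - y) = a x - a y" "a 0 = 0"
proof -
  show *: "a (x + y) = a x + a y" "a (sc c x) = sc c (a x)"
    "x \<in> V \<Longrightarrow> a x \<in> V" "x \<in> Z \<Longrightarrow> a x \<in> Z" for x y c
    using assms by (auto simp: lin_op_def)
  show "a (x - y) = a x - a y" using *(1)[of "x - y" y] by (simp add: algebra_simps)
  show "a 0 = 0" using *(1)[of 0 0] by simp
qed

lemma lin_op_sum: "lin_op a \<Longrightarrow> a (sum f I) = (\<Sum>i\<in>I. a (f i))"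
  by (induction I rule: infinite_finite_induct) (auto simp: lin_opD)

definition invariant :: "('v \<Rightarrow> 'v) set \<Rightarrow> 'v set \<Rightarrow> bool" where
  "invariant A U \<longleftrightarrow> sub U \<and> (\<forall>a\<in>A. \<forall>x\<in>U. a x \<in> U)"

text \<open>Translates nilpotency of an operator on U/W into nilpotency of its matrix, the form in
  which \<open>nil_trace\<close> speaks. Each power leaves an error in \<open>W\<close>, which the
  forms \<open>cs i\<close> do not see.\<close>

lemma subquotient_matrix_power:
  assumes A: "\<And>a. a \<in> A \<Longrightarrow> lin_op a" and U: "invariant A U" and W: "invariant A W"
    and us: "\<And>i. i < r \<Longrightarrow> us i \<in> U" and cs: "\<And>i. i < r \<Longrightarrow> linear_form (cs i)"
    and csW: "\<And>i w. i < r \<Longrightarrow> w \<in> W \<Longrightarrow> cs i w \<in> P"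
    and dual: "\<And>i j. i < r \<Longrightarrow> j < r \<Longrightarrow> cs i (us j) \<simeq>\<^sub>P (if i = j then 1 else 0)"
    and dec: "\<And>x. x \<in> U \<Longrightarrow> x - (\<Sum>i<(r::nat). sc (cs i x) (us i)) \<in> W"
    and a: "a \<in> A" and x: "\<And>j. j < r \<Longrightarrow> x j \<in> R" and i: "i < r"
  shows "(mat_app r (\<lambda>i j. cs i (a (us j))) ^^ k) x i \<simeq>\<^sub>P cs i ((a ^^ k) (\<Sum>j<r. sc (x j) (us j)))"
  using i
proof (induction k arbitrary: i)
  case 0
  have usV: "us i \<in> V" if "i < r" for i using us that U sub_V unfolding invariant_def by blast
  have "cs i (\<Sum>j<r. sc (x j) (us j)) \<simeq>\<^sub>P (\<Sum>j<r. x j * cs i (us j))"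
    using x usV by (intro linear_form_combination[OF cs[OF 0]]) auto
  also have "\<dots> \<simeq>\<^sub>P (\<Sum>j<r. x j * (if i = j then 1 else 0))"
    using 0 x by (intro cong_sum cong_mult cong_refl dual linear_formD(1)[OF cs usV]) auto
  also have "\<dots> = x i" using 0 by (simp add: if_distrib[of "(*) _"] cong: if_cong)
  finally show ?case by (auto intro: cong_sym)
next
  case (Suc k)
  have Us: "sub U" and Ws: "sub W" using U W by (auto simp: invariant_def)
  have usV: "us i \<in> V" if "i < r" for i using us that Us sub_V by blast
  let ?B = "mat_app r (\<lambda>i j. cs i (a (us j)))"
  define X where "X = (\<Sum>j<r. sc (x j) (us j))"
  define y where "y = (a ^^ k) X"
  have X: "X \<in> U" unfolding X_def using us x by (intro sub_sum[OF Us] subD(4)[OF Us]) auto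
  have y: "y \<in> U" unfolding y_def
    by (induction k) (use X U a in \<open>auto simp: invariant_def\<close>)
  then have yV: "y \<in> V" using Us sub_V by blast
  have cy: "cs j y \<in> R" if "j < r" for j using linear_formD(1)[OF cs[OF that] yV] .
  have aus: "a (us j) \<in> V" if "j < r" for j using lin_opD(1)[OF A[OF a] usV[OF that]] .
  have "(?B ^^ Suc k) x i = (\<Sum>j<r. cs i (a (us j)) * (?B ^^ k) x j)"
    by (simp add: mat_app_def)
  also have "\<dots> \<simeq>\<^sub>P (\<Sum>j<r. cs i (a (us j)) * cs j y)"
    using Suc.IH Suc.prems cy unfolding y_def X_def
    by (intro cong_sum cong_mult cong_refl) (auto intro: cong_R linear_formD(1)[OF cs] aus)
  also have "\<dots> \<simeq>\<^sub>P cs i (\<Sum>j<r. sc (cs j y) (a (us j)))"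
    using linear_form_combination[OF cs[OF Suc.prems], of "{..<r}" "\<lambda>j. a (us j)" "\<lambda>j. cs j y"] aus cy
    by (auto simp: mult.commute intro: cong_sym)
  also have "(\<Sum>j<r. sc (cs j y) (a (us j))) = a (\<Sum>j<r. sc (cs j y) (us j))"
    by (simp add: lin_op_sum[OF A[OF a]] lin_opD(4)[OF A[OF a]])
  also have "cs i \<dots> \<simeq>\<^sub>P cs i (a y)"
  proof (rule cong_sym, rule linear_form_cong[OF cs[OF Suc.prems] Ws csW[OF Suc.prems]])
    show "a y - a (\<Sum>j<r. sc (cs j y) (us j)) \<in> W"
      using dec[OF y] W a lin_opD(5)[OF A[OF a]] unfolding invariant_def by metis
    show "a y \<in> V" "a (\<Sum>j<r. sc (cs j y) (us j)) \<in> V"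
      using yV cy usV by (intro lin_opD(1)[OF A[OF a]] sub_sum[OF submod_V] subD(4)[OF submod_V]; simp)+
  qed
  finally show ?case by (simp add: y_def X_def)
qed

lemma sub_kernel:
  assumes "lin_op T" "sub U" "sub W" shows "sub {x \<in> U. T x \<in> W}"
  using assms subD[OF assms(2)] subD[OF assms(3)] lin_opD[OF assms(1)]
  unfolding submod_def[of R sc Z V "{x \<in> U. T x \<in> W}"] by auto

text \<open>Used for a product of factors a - l that takes a vector into \<open>W\<close>: at the
  factor where the vector first enters \<open>W\<close> it is an eigenvector modulo
  \<open>W\<close>.\<close>

lemma fold_escape:
  assumes "fold g ls z \<in> W" "z \<notin> W" "Q z" "set ls \<subseteq> R" "\<And>l z. l \<in> R \<Longrightarrow> Q z \<Longrightarrow> Q (g l z)"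
  shows "\<exists>l\<in>R. \<exists>z. Q z \<and> z \<notin> W \<and> g l z \<in> W"
  using assms(1-4)
proof (induction ls arbitrary: z)
  case (Cons l ls)
  then show ?case using assms(5)[of l z] by (cases "g l z \<in> W") auto
qed auto

end

section \<open>Algebras spanned by nilpotent operators\<close>

text \<open>\<open>span\<close> says in dual form that the nilpotent elements span \<open>A\<close>
  over the residue field: a functional that kills them kills \<open>A\<close>. It will be applied to
  traces. \<open>split\<close> supplies eigenvalues, and \<open>nil_trace\<close> says that
  nilpotent matrices have trace 0.\<close>

locale nil_spanned_algebra = finite_length_module R P sc Z V rk
  for R P :: "'r::comm_ring_1 set" and sc :: "'r \<Rightarrow> 'v::ab_group_add \<Rightarrow> 'v" and Z V rk +
  fixes A :: "('v \<Rightarrow> 'v) set"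
  assumes lin: "\<And>a. a \<in> A \<Longrightarrow> lin_op a" and zero: "(\<lambda>x. 0) \<in> A"
    and comp: "\<And>a b. a \<in> A \<Longrightarrow> b \<in> A \<Longrightarrow> (\<lambda>x. a (b x)) \<in> A"
    and plus: "\<And>a b. a \<in> A \<Longrightarrow> b \<in> A \<Longrightarrow> (\<lambda>x. a x + b x) \<in> A"
    and scale: "\<And>c a. c \<in> R \<Longrightarrow> a \<in> A \<Longrightarrow> (\<lambda>x. sc c (a x)) \<in> A"
    and split: "\<And>a. a \<in> A \<Longrightarrow> \<exists>ls. set ls \<subseteq> R \<and> (\<forall>x\<in>V. fold (\<lambda>l z. a z - sc l z) ls x \<in> Z)"
    and span: "\<forall>\<tau>. (\<forall>a\<in>A. \<tau> a \<in> R) \<longrightarrow>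
      (\<forall>a\<in>A. \<forall>b\<in>A. \<tau> (\<lambda>x. a x + b x) \<simeq>\<^sub>P \<tau> a + \<tau> b) \<longrightarrow>
      (\<forall>c\<in>R. \<forall>a\<in>A. \<tau> (\<lambda>x. sc c (a x)) \<simeq>\<^sub>P c * \<tau> a) \<longrightarrow>
      (\<forall>a\<in>A. \<forall>m. (\<forall>x\<in>V. (a ^^ m) x \<in> Z) \<longrightarrow> \<tau> a \<in> P) \<longrightarrow> (\<forall>a\<in>A. \<tau> a \<in> P)"
    and nil_trace: "\<forall>r B m. (\<forall>i<r. \<forall>j<r. B i j \<in> R) \<longrightarrow>
      (\<forall>x i. (\<forall>i<r. x i \<in> R) \<longrightarrow> i < r \<longrightarrow> (mat_app r B ^^ m) x i \<in> P) \<longrightarrow>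
      (\<Sum>i<r. B i i) \<in> P"
begin

text \<open>Take \<open>W\<close> maximal among the invariant proper submodules of \<open>U\<close>.
  If \<open>A\<close> did not kill U/W, this subquotient would be simple, and \<open>A\<close> would
  contain an operator acting there as a projection onto a line. Its trace is 1, but traces vanish on
  \<open>A\<close>.\<close>

lemma shrinks_invariant:
  assumes U: "invariant A U" "U \<noteq> Z"
  shows "\<exists>W. invariant A W \<and> W \<subset> U \<and> (\<forall>a\<in>A. \<forall>x\<in>U. a x \<in> W)"
proof -
  have Us: "sub U" and UA: "a \<in> A \<Longrightarrow> x \<in> U \<Longrightarrow> a x \<in> U" for a x using U by (auto simp: invariant_def)
  have "invariant A Z" unfolding invariant_def using submod_Z lin_opD(2)[OF lin] by blast
  moreover have "Z \<subset> U" using subD(1)[OF Us] U(2) by blast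
  ultimately obtain W where W: "sub W" "invariant A W" "W \<subset> U"
    and max: "\<And>W'. invariant A W' \<Longrightarrow> W \<subseteq> W' \<Longrightarrow> W' \<subset> U \<Longrightarrow> W' = W"
    using maximal_sub[OF submod_Z, of "\<lambda>W. invariant A W \<and> W \<subset> U"] unfolding invariant_def by metis
  have WA: "a \<in> A \<Longrightarrow> x \<in> W \<Longrightarrow> a x \<in> W" for a x using W by (auto simp: invariant_def)
  have WU: "x \<in> W \<Longrightarrow> x \<in> U" for x using W by blast
  note UV = sub_V[OF Us] and WV = sub_V[OF W(1)]
  note Wa = subD(3)[OF W(1)] and Ws = subD(4)[OF W(1)]
  have "a x \<in> W" if "a \<in> A" "x \<in> U" for a x
  proof (rule ccontr)
    assume a0: "a x \<notin> W"
    \<comment> \<open>W + A u is invariant. It is larger than \<open>W\<close>, for otherwise W + R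
      u would be invariant, hence all of \<open>U\<close>, and \<open>A\<close> would map
      \<open>U\<close> into \<open>W\<close>. So it is \<open>U\<close>.\<close>
    have irr: "\<exists>b\<in>A. y - b u \<in> W" if u: "u \<in> U" "u \<notin> W" and y: "y \<in> U" for u y
    proof -
      let ?O = "{w + b u | w b. w \<in> W \<and> b \<in> A}"
      have nz: "\<exists>b\<in>A. b u \<notin> W"
      proof (rule ccontr)
        assume neg: "\<not> ?thesis"
        have "b z \<in> W" if b: "b \<in> A" and zl: "z \<in> add_line W u" for b z
        proof -
          obtain w t where z: "z = w + sc t u" "w \<in> W" "t \<in> R" using zl unfolding add_line_def by blast
          have "b z = b w + sc t (b u)" using z lin_opD(3,4)[OF lin[OF b]] by simp
          then show ?thesis using neg WA[OF b z(2)] b Wa Ws z(3) by auto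
        qed
        note 1 = this
        have inv: "invariant A (add_line W u)"
          unfolding invariant_def using sub_add_line[OF W(1) UV[OF u(1)]] 1 add_line_mem by blast
        have "add_line W u \<subseteq> U"
          unfolding add_line_def using WU u subD(3,4)[OF Us] by auto
        then have "add_line W u = U"
          using max[OF inv] add_line_psubset[OF W(1) u(2)] by blast
        then show False using 1 a0 that \<open>a \<in> A\<close> \<open>x \<in> U\<close> by blast
      qed
      then obtain b0 where b0: "b0 \<in> A" "b0 u \<notin> W" by blast
      have OI: "p \<in> ?O" if "w \<in> W" "b \<in> A" "p = w + b u" for w b p using that by blast
      have WO: "w \<in> ?O" if "w \<in> W" for w
        using that zero by (intro CollectI exI[of _ w] exI[of _ "\<lambda>x. 0"]) auto
      have OU: "?O \<subseteq> U" using WU UA u(1) subD(3)[OF Us] by auto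
      have "sub ?O" unfolding submod_def
      proof (intro conjI ballI)
        show "Z \<subseteq> ?O" using subD(1)[OF W(1)] WO by blast
        show "?O \<subseteq> V" using OU UV by blast
        fix p assume "p \<in> ?O"
        then obtain w b where p: "p = w + b u" "w \<in> W" "b \<in> A" by blast
        { fix q assume "q \<in> ?O"
          then obtain w' b' where q: "q = w' + b' u" "w' \<in> W" "b' \<in> A" by blast
          have "p + q = (w + w') + (b u + b' u)" using p q by simp
          then show "p + q \<in> ?O" by (rule OI[OF Wa[OF p(2) q(2)] plus[OF p(3) q(3)]]) }
        { fix c assume c: "c \<in> R"
          have "sc c p = sc c w + sc c (b u)" using p by (simp add: sc_add_right)
          then show "sc c p \<in> ?O" by (rule OI[OF Ws[OF c p(2)] scale[OF c p(3)]]) }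
      qed
      moreover have "b p \<in> ?O" if b: "b \<in> A" and pO: "p \<in> ?O" for b p
      proof -
        obtain w b' where p: "p = w + b' u" "w \<in> W" "b' \<in> A" using pO by blast
        have "b p = b w + b (b' u)" using p lin_opD(3)[OF lin[OF b]] by simp
        then show ?thesis by (rule OI[OF WA[OF b p(2)] comp[OF b p(3)]])
      qed
      ultimately have inv: "invariant A ?O" unfolding invariant_def by blast
      have "b0 u \<in> ?O" using b0(1) sub_zero[OF W(1)] by (intro CollectI exI[of _ 0] exI[of _ b0]) auto
      then have "?O \<noteq> W" using b0(2) by blast
      then have "?O = U" using max[OF inv] WO OU by blast
      then obtain w b where "y = w + b u" "w \<in> W" "b \<in> A" using y by blast
      then show ?thesis by (intro bexI[of _ b]) auto
    qed
    let ?ker = "\<lambda>T. {x \<in> U. T x \<in> W}"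
    define Q where "Q K \<longleftrightarrow> (\<exists>T\<in>A. K = ?ker T \<and> (\<exists>x\<in>U. T x \<notin> W))" for K
    have "sub (?ker a)" by (rule sub_kernel[OF lin[OF \<open>a \<in> A\<close>] Us W(1)])
    moreover have "Q (?ker a)" unfolding Q_def using a0 \<open>a \<in> A\<close> \<open>x \<in> U\<close> by (intro bexI[of _ a] conjI refl bexI[of _ x])
    ultimately have "\<exists>K. Q K \<and> (\<forall>K'. sub K' \<longrightarrow> Q K' \<longrightarrow> K \<subseteq> K' \<longrightarrow> K' = K)"
      by (rule maximal_sub) (intro exI conjI allI impI)
    then obtain K where K': "Q K \<and> (\<forall>K'. sub K' \<longrightarrow> Q K' \<longrightarrow> K \<subseteq> K' \<longrightarrow> K' = K)"
      by (rule exE)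
    have K: "Q K" using K' by (rule conjunct1)
    have Kmax: "K' = K" if "sub K'" "Q K'" "K \<subseteq> K'" for K' using K' that by metis
    from K obtain T x1 where T: "T \<in> A" "K = ?ker T" and x1: "x1 \<in> U" "T x1 \<notin> W"
      unfolding Q_def by blast
    define u where "u = T x1"
    have u: "u \<in> U" "u \<notin> W" using x1 UA[OF T(1)] by (auto simp: u_def)
    note Tl = lin_opD[OF lin[OF T(1)]]
    \<comment> \<open>An operator with maximal kernel has rank one modulo \<open>W\<close>: otherwise subtracting an
      eigenvalue from \<open>T B\<close> would enlarge the kernel of \<open>T\<close>.\<close>
    have rank_one: "\<exists>f\<in>R. T x2 - sc f u \<in> W" if x2: "x2 \<in> U" for x2
    proof -
      obtain B where B: "B \<in> A" "x2 - B u \<in> W" using irr[OF u x2] by blast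
      note Bl = lin_opD[OF lin[OF B(1)]]
      define Y where "Y = (\<lambda>x. T (B x))"
      have Y: "Y \<in> A" unfolding Y_def by (rule comp[OF T(1) B(1)])
      obtain ls where ls: "set ls \<subseteq> R" "\<And>x. x \<in> V \<Longrightarrow> fold (\<lambda>l z. Y z - sc l z) ls x \<in> Z"
        using split[OF Y] by blast
      \<comment> \<open>The eigenvector must lie in the image of \<open>T\<close>, so that
        membership there is carried through all the factors.\<close>
      let ?Q = "\<lambda>z. \<exists>x\<in>U. z = T x"
      have "fold (\<lambda>l z. Y z - sc l z) ls u \<in> W" using ls(2)[OF UV[OF u(1)]] subD(1)[OF W(1)] by blast
      then have "\<exists>l\<in>R. \<exists>z. ?Q z \<and> z \<notin> W \<and> Y z - sc l z \<in> W"
      proof (rule fold_escape[OF _ u(2) _ ls(1)])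
        show "?Q u" using x1 by (auto simp: u_def)
        show "?Q (Y z - sc l z)" if l: "l \<in> R" and Qz: "?Q z" for l z
        proof -
          obtain p where p: "p \<in> U" "z = T p" using Qz by blast
          have "Y z - sc l z = T (B z - sc l p)" using p by (simp add: Y_def Tl)
          moreover have "B z - sc l p \<in> U"
            using p l UA[OF T(1) p(1)] UA[OF B(1)] by (intro sub_diff[OF Us] subD(4)[OF Us]) auto
          ultimately show ?thesis by blast
        qed
      qed
      then obtain l x3 where l: "l \<in> R" and x3: "x3 \<in> U" "T x3 \<notin> W" "Y (T x3) - sc l (T x3) \<in> W" by blast
      define T3 where "T3 = (\<lambda>x. Y (T x) + sc (- l) (T x))"
      have T3: "T3 \<in> A" unfolding T3_def
        by (rule plus[OF comp[OF Y T(1)] scale[OF uminus_R[OF l] T(1)]])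
      have T3e: "T3 x = Y (T x) - sc l (T x)" for x by (simp add: T3_def sc_uminus)
      have "K \<subseteq> ?ker T3"
        unfolding T(2) T3e using WA[OF Y] sub_diff[OF W(1)] Ws[OF l] by blast
      moreover have "x3 \<in> ?ker T3" "x3 \<notin> K" unfolding T(2) T3e using x3 by auto
      ultimately have "\<not> Q (?ker T3)"
        using Kmax[OF sub_kernel[OF lin[OF T3] Us W(1)]] by blast
      then have "\<not> (\<exists>x\<in>U. T3 x \<notin> W)" unfolding Q_def using T3 by blast
      then have "Y u - sc l u \<in> W" using x1 T3e[of x1] by (auto simp: u_def)
      moreover have "T x2 - Y u \<in> W" using WA[OF T(1) B(2)] by (simp add: Y_def Tl)
      ultimately have "(T x2 - Y u) + (Y u - sc l u) \<in> W" using Wa by blast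
      then show ?thesis using l by auto
    qed
    obtain f where f: "\<And>x. x \<in> U \<Longrightarrow> f x \<in> R" "\<And>x. x \<in> U \<Longrightarrow> T x - sc (f x) u \<in> W"
      using rank_one by metis
    obtain C where C: "C \<in> A" "x1 - C u \<in> W" using irr[OF u x1(1)] by blast
    note Cl = lin_opD[OF lin[OF C(1)]]
    \<comment> \<open>\<open>C\<close> takes the image line of \<open>T\<close> back to
      \<open>x1\<close>, so modulo \<open>W\<close> the product sends x to f x times x1, with f x1
      congruent to 1: a projection onto a line.\<close>
    define E where "E = (\<lambda>x. C (T x))"
    have E: "E \<in> A" unfolding E_def by (rule comp[OF C(1) T(1)])
    note El = lin_opD[OF lin[OF E]]
    have Ef: "sc (f x) x1 - E x \<in> W" if x: "x \<in> U" for x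
    proof -
      have "sc (f x) (x1 - C u) - C (T x - sc (f x) u) \<in> W"
        using WA[OF C(1) f(2)[OF x]] Ws[OF f(1)[OF x] C(2)] sub_diff[OF W(1)] by blast
      then show ?thesis by (simp add: E_def Cl sc_diff_right)
    qed
    obtain r :: nat and us cs where
      db: "\<forall>i<r. us i \<in> U \<and> linear_form (cs i) \<and> (\<forall>w\<in>W. cs i w \<in> P)"
        "\<forall>i<r. \<forall>j<r. cs i (us j) \<simeq>\<^sub>P (if i = j then 1 else 0)"
        "\<forall>x\<in>U. x - (\<Sum>i<r. sc (cs i x) (us i)) \<in> W"
      using dual_basis[OF W(1) Us] W(3) by blast
    have us: "us i \<in> U" and cs: "linear_form (cs i)" and csW: "w \<in> W \<Longrightarrow> cs i w \<in> P"
      if "i < r" for i w using db(1) that by auto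
    have dual: "cs i (us j) \<simeq>\<^sub>P (if i = j then 1 else 0)" if "i < r" "j < r" for i j
      using db(2) that by blast
    have dec: "x - (\<Sum>i<r. sc (cs i x) (us i)) \<in> W" if "x \<in> U" for x
      using db(3) that by blast
    have aus: "b (us j) \<in> V" if "b \<in> A" "j < r" for b j using lin_opD(1)[OF lin UV[OF us]] that .
    \<comment> \<open>The trace on U/W, read off the dual basis. By \<open>span\<close> it vanishes
      on \<open>A\<close>, because it vanishes on nilpotent elements.\<close>
    define \<tau> where "\<tau> b = (\<Sum>i<r. cs i (b (us i)))" for b
    have "\<forall>a\<in>A. \<tau> a \<in> P"
    proof (intro span[THEN spec, THEN mp, THEN mp, THEN mp, THEN mp] ballI allI impI)
      show "\<tau> b \<in> R" if "b \<in> A" for b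
        unfolding \<tau>_def using that by (intro sum_R linear_formD(1)[OF cs] aus) auto
      show "\<tau> (\<lambda>x. b x + b' x) \<simeq>\<^sub>P \<tau> b + \<tau> b'" if "b \<in> A" "b' \<in> A" for b b'
        unfolding \<tau>_def sum.distrib[symmetric]
        using that by (intro cong_sum linear_formD(2)[OF cs] aus) auto
      show "\<tau> (\<lambda>x. sc c (b x)) \<simeq>\<^sub>P c * \<tau> b" if "c \<in> R" "b \<in> A" for c b
        unfolding \<tau>_def sum_distrib_left
        using that by (intro cong_sum linear_formD(3)[OF cs] aus) auto
      fix b m assume b: "b \<in> A" and nil: "\<forall>x\<in>V. (b ^^ m) x \<in> Z"
      show "\<tau> b \<in> P" unfolding \<tau>_def
      proof (rule nil_trace[rule_format, where m = m and B = "\<lambda>i j. cs i (b (us j))"])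
        show "cs i (b (us j)) \<in> R" if "i < r" "j < r" for i j
          using that b by (intro linear_formD(1)[OF cs] aus)
        fix x i assume x: "\<And>i. i < r \<Longrightarrow> x i \<in> R" and i: "i < r"
        have X: "(\<Sum>j<r. sc (x j) (us j)) \<in> V"
          using x us UV by (intro sub_sum[OF submod_V] subD(4)[OF submod_V]) auto
        have "cs i ((b ^^ m) (\<Sum>j<r. sc (x j) (us j))) \<in> P"
          using bspec[OF nil X] subD(1)[OF W(1)] csW[OF i] by blast
        moreover have "(mat_app r (\<lambda>i j. cs i (b (us j))) ^^ m) x i \<simeq>\<^sub>P cs i ((b ^^ m) (\<Sum>j<r. sc (x j) (us j)))"
          by (rule subquotient_matrix_power[where A = A and U = U and W = W],
              erule lin, rule U(1), rule W(2), erule us, erule cs, erule (1) csW, erule (1) dual,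
              erule dec, rule b, erule x, rule i)
        ultimately show "(mat_app r (\<lambda>i j. cs i (b (us j))) ^^ m) x i \<in> P"
          using cong_P by blast
      qed
    qed
    then have "\<tau> E \<in> P" using E by blast
    \<comment> \<open>\<open>g\<close> is the trace of \<open>E\<close> and also the factor by which
      \<open>E\<close> multiplies \<open>x1\<close> modulo \<open>W\<close>; so it would be both 0
      and 1 in the residue field.\<close>
    define g where "g = (\<Sum>i<r. cs i x1 * f (us i))"
    have fus: "f (us i) \<in> R" if "i < r" for i using f(1)[OF us[OF that]] .
    have x1V: "x1 \<in> V" using UV x1(1) by blast
    have c1: "cs i x1 \<in> R" if "i < r" for i using linear_formD(1)[OF cs[OF that] x1V] .
    have "\<tau> E \<simeq>\<^sub>P (\<Sum>i<r. cs i (sc (f (us i)) x1))"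
      unfolding \<tau>_def
    proof (intro cong_sum)
      fix i assume "i \<in> {..<r}"
      then have i: "i < r" by simp
      have "sc (f (us i)) x1 \<in> V" using subD(4)[OF submod_V fus[OF i] x1V] .
      then show "cs i (E (us i)) \<simeq>\<^sub>P cs i (sc (f (us i)) x1)"
        using linear_form_cong[OF cs[OF i] W(1) csW[OF i] _ aus[OF E i] Ef[OF us[OF i]]] cong_sym by blast
    qed
    also have "\<dots> \<simeq>\<^sub>P (\<Sum>i<r. f (us i) * cs i x1)"
      using fus x1V by (intro cong_sum linear_formD(3)[OF cs]) auto
    also have "\<dots> = g" by (simp add: g_def mult.commute)
    finally have gP: "g \<in> P" using \<open>\<tau> E \<in> P\<close> cong_sym cong_P by blast
    let ?X = "\<Sum>i<r. sc (cs i x1) (us i)"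
    have X: "?X \<in> U" using us c1 by (intro sub_sum[OF Us] subD(4)[OF Us]) auto
    have "x1 - E x1 \<in> W" using C(2) by (simp add: E_def u_def)
    moreover have "E (x1 - ?X) \<in> W" by (rule WA[OF E dec[OF x1(1)]])
    moreover have "(\<Sum>i<r. sc (cs i x1) (sc (f (us i)) x1 - E (us i))) \<in> W"
      using Ef us c1 by (intro sub_sum[OF W(1)] Ws) auto
    ultimately have "(x1 - E x1) + E (x1 - ?X) - (\<Sum>i<r. sc (cs i x1) (sc (f (us i)) x1 - E (us i))) \<in> W"
      using Wa sub_diff[OF W(1)] by blast
    moreover have "(\<Sum>i<r. sc (cs i x1) (sc (f (us i)) x1 - E (us i))) = sc g x1 - E ?X"
    proof -
      have "sc g x1 = (\<Sum>i<r. sc (cs i x1) (sc (f (us i)) x1))" unfolding g_def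
        by (induction r) (auto simp: sc_zero_left sc_add_left sc_mult)
      then show ?thesis by (simp add: sc_diff_right sum_subtractf lin_op_sum[OF lin[OF E]] El(4))
    qed
    ultimately have "sc (1 - g) x1 \<in> W"
      by (simp add: El(5) sc_diff_left sc_one algebra_simps)
    moreover have "x1 \<notin> W" using x1(2) WA[OF T(1)] by blast
    ultimately have "1 - g \<in> P"
      using sub_sc_cancel[OF W(1) diff_R[OF one_R P_R[OF gP]] _ x1V] by blast
    then have "1 \<in> P" using add_P[OF _ gP] by force
    then show False using one_P by blast
  qed
  then show ?thesis using W by blast
qed

text \<open>Every application of an operator moves a vector at least one step down a strictly
  decreasing chain of invariant submodules that ends in \<open>Z\<close>. \<open>foldr\<close>
  applies the last operator first, hence \<open>rev_cases\<close>.\<close>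

theorem nilpotent_if_spanned_by_nilpotents:
  shows "\<exists>m. \<forall>as x. length as = m \<longrightarrow> set as \<subseteq> A \<longrightarrow> x \<in> V \<longrightarrow> foldr (\<lambda>a x. a x) as x \<in> Z"
proof -
  have "\<exists>m. \<forall>as x. length as = m \<longrightarrow> set as \<subseteq> A \<longrightarrow> x \<in> U \<longrightarrow> foldr (\<lambda>a x. a x) as x \<in> Z"
    if "invariant A U" for U
    using that
  proof (induction "rk U" arbitrary: U rule: less_induct)
    case less
    show ?case
    proof (cases "U = Z")
      case True
      then show ?thesis by (intro exI[of _ 0]) auto
    next
      case False
      have "\<exists>W. invariant A W \<and> W \<subset> U \<and> (\<forall>a\<in>A. \<forall>x\<in>U. a x \<in> W)"
        by (rule shrinks_invariant[OF less.prems False])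
      then obtain W where W: "invariant A W" "W \<subset> U" "\<And>a x. a \<in> A \<Longrightarrow> x \<in> U \<Longrightarrow> a x \<in> W" by blast
      have "rk W < rk U" using W(1,2) less.prems rk_strict by (auto simp: invariant_def)
      from less.hyps[OF this W(1)] obtain m where
        m: "\<And>as x. length as = m \<Longrightarrow> set as \<subseteq> A \<Longrightarrow> x \<in> W \<Longrightarrow> foldr (\<lambda>a x. a x) as x \<in> Z" by blast
      have "foldr (\<lambda>a x. a x) as x \<in> Z" if "length as = Suc m" "set as \<subseteq> A" "x \<in> U" for as x
        using that m W(3) by (cases as rule: rev_cases) auto
      then show ?thesis by blast
    qed
  qed
  moreover have "invariant A V" unfolding invariant_def using submod_V lin_opD(1)[OF lin] by blast
  ultimately show ?thesis by blast
qed

end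

section \<open>Eigenvalues, coordinates and matrix words\<close>

lemma eigenvector_exists:
  fixes M :: "nat \<Rightarrow> nat \<Rightarrow> 'a::alg_closed_field"
  assumes I: "finite I" "I \<noteq> {}"
  shows "\<exists>c x. (\<exists>i\<in>I. x i \<noteq> 0) \<and> (\<forall>i\<in>I. (\<Sum>j\<in>I. M i j * x j) = c * x i)"
proof -
  define d where "d = card I"
  obtain h where h: "bij_betw h {0..<d} I"
    using ex_bij_betw_nat_finite[OF I(1)] d_def by blast
  define N where "N = mat d d (\<lambda>(i, j). M (h i) (h j))"
  have N: "N \<in> carrier_mat d d" by (simp add: N_def)
  have "d > 0" using I by (simp add: d_def card_gt_0_iff)
  then have "degree (char_poly N) > 0" using degree_monic_char_poly[OF N] by simp
  then obtain c where "poly (char_poly N) c = 0" using alg_closed_imp_poly_has_root by blast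
  then have "eigenvalue N c" using eigenvalue_root_char_poly[OF N] by simp
  then obtain y where y: "y \<in> carrier_vec d" "y \<noteq> 0\<^sub>v d" "N *\<^sub>v y = c \<cdot>\<^sub>v y"
    using N unfolding eigenvalue_def eigenvector_def by auto
  define g where "g = inv_into {0..<d} h"
  have g: "g i < d" "h (g i) = i" if "i \<in> I" for i
    using that h f_inv_into_f[of i h "{0..<d}"] inv_into_into[of i h "{0..<d}"]
    by (auto simp: g_def bij_betw_def)
  have gh: "g (h k) = k" if "k < d" for k
    using that h by (simp add: g_def bij_betw_def inv_into_f_f)
  have hI: "h k \<in> I" if "k < d" for k using h that by (auto simp: bij_betw_def)
  obtain k where k: "k < d" "y $ k \<noteq> 0" using y(1,2) by (metis eq_vecI carrier_vecD index_zero_vec)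
  have "(\<Sum>j\<in>I. M i j * y $ g j) = c * y $ g i" if i: "i \<in> I" for i
  proof -
    have "(N *\<^sub>v y) $ g i = (\<Sum>j = 0..<d. M i (h j) * y $ j)"
      using g[OF i] y(1) N by (auto simp: N_def scalar_prod_def)
    also have "\<dots> = (\<Sum>j\<in>{0..<d}. M i (h j) * y $ g (h j))"
      by (intro sum.cong) (auto simp: gh)
    also have "\<dots> = (\<Sum>j\<in>I. M i j * y $ g j)"
      using sum.reindex_bij_betw[OF h, of "\<lambda>j. M i j * y $ g j"] by simp
    finally show ?thesis using y(1,3) g[OF i] by simp
  qed
  then show ?thesis using k gh hI by (intro exI[of _ c] exI[of _ "\<lambda>i. y $ g i"]) force
qed

text \<open>Deflation: an eigenvector \<open>x\<close> with \<open>x l = 1\<close> lets the matrix act on the quotient by its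
  line, in the coordinates other than \<open>l\<close>.\<close>

lemma eigenvalue_list:
  fixes M :: "nat \<Rightarrow> nat \<Rightarrow> 'a::alg_closed_field"
  assumes "finite I"
  shows "\<exists>es. (\<Sum>i\<in>I. M i i) = sum_list es \<and> length es = card I \<and>
    (\<forall>e\<in>set es. \<exists>x. (\<exists>i\<in>I. x i \<noteq> 0) \<and> (\<forall>i\<in>I. (\<Sum>j\<in>I. M i j * x j) = e * x i)) \<and>
    (\<forall>x. \<forall>i\<in>I. fold (\<lambda>e z i. (\<Sum>j\<in>I. M i j * z j) - e * z i) es x i = 0)"
  using assms
proof (induction "card I" arbitrary: I M)
  case 0
  then show ?case by (intro exI[of _ "[]"]) auto
next
  case (Suc n)
  note fin = Suc.prems
  have "I \<noteq> {}" using Suc.hyps(2) by auto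
  from eigenvector_exists[OF fin this, of M] obtain c x0 l where
    x0: "l \<in> I" "x0 l \<noteq> 0" "\<And>i. i \<in> I \<Longrightarrow> (\<Sum>j\<in>I. M i j * x0 j) = c * x0 i" by blast
  define x where "x i = x0 i / x0 l" for i
  have xl: "x l = 1" using x0(2) by (simp add: x_def)
  have eig: "(\<Sum>j\<in>I. M i j * x j) = c * x i" if "i \<in> I" for i
    using x0(3)[OF that] by (simp add: x_def flip: sum_divide_distrib)
  define J where "J = I - {l}"
  have J: "finite J" "n = card J" "J \<subseteq> I" "l \<notin> J" using fin x0(1) Suc.hyps(2) by (auto simp: J_def)
  have sumI: "(\<Sum>j\<in>I. f j) = f l + (\<Sum>j\<in>J. f j)" for f :: "nat \<Rightarrow> 'a"
    unfolding J_def by (rule sum.remove[OF fin x0(1)])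
  \<comment> \<open>The matrix on the quotient by the line of \<open>x\<close>, where a vector
    \<open>z\<close> has coordinates z j - x j * z l; this is what \<open>bar\<close>
    expresses.\<close>
  define C where "C i j = M i j - x i * M l j" for i j
  obtain es where es: "(\<Sum>i\<in>J. C i i) = sum_list es" "length es = card J"
    "\<forall>e\<in>set es. \<exists>y. (\<exists>i\<in>J. y i \<noteq> 0) \<and> (\<forall>i\<in>J. (\<Sum>j\<in>J. C i j * y j) = e * y i)"
    "\<forall>y. \<forall>i\<in>J. fold (\<lambda>e z i. (\<Sum>j\<in>J. C i j * z j) - e * z i) es y i = 0"
    using Suc.hyps(1)[OF J(2,1), of C] by blast
  have eigJ: "(\<Sum>j\<in>J. M i j * x j) = c * x i - M i l" if "i \<in> I" for i
    using eig[OF that] by (simp add: sumI xl algebra_simps)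
  have bar: "(\<Sum>j\<in>J. C i j * (z j - x j * z l)) = (\<Sum>j\<in>I. M i j * z j) - x i * (\<Sum>j\<in>I. M l j * z j)"
    if i: "i \<in> J" for i z
  proof -
    have "(\<Sum>j\<in>J. C i j * (z j - x j * z l)) =
        (\<Sum>j\<in>J. M i j * z j) - x i * (\<Sum>j\<in>J. M l j * z j)
        - z l * ((\<Sum>j\<in>J. M i j * x j) - x i * (\<Sum>j\<in>J. M l j * x j))"
      by (simp add: C_def algebra_simps sum_subtractf sum.distrib sum_distrib_left)
    also have "\<dots> = (\<Sum>j\<in>J. M i j * z j) - x i * (\<Sum>j\<in>J. M l j * z j)
        - z l * (x i * M l l - M i l)"
      by (subst eigJ, use i J(3) in blast, subst eigJ[OF x0(1)]) (simp add: xl algebra_simps)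
    finally show ?thesis by (simp add: sumI algebra_simps)
  qed
  have trace: "(\<Sum>i\<in>I. M i i) = sum_list (es @ [c])"
  proof -
    have "(\<Sum>i\<in>J. C i i) = (\<Sum>i\<in>J. M i i) - (\<Sum>i\<in>J. M l i * x i)"
      by (simp add: C_def sum_subtractf mult.commute)
    then show ?thesis using eigJ[OF x0(1)] es(1) by (simp add: sumI xl)
  qed
  have eigs: "\<exists>y. (\<exists>i\<in>I. y i \<noteq> 0) \<and> (\<forall>i\<in>I. (\<Sum>j\<in>I. M i j * y j) = e * y i)" if e: "e \<in> set (es @ [c])" for e
  proof (cases "e = c")
    case True
    then show ?thesis using eig x0(1) xl by (intro exI[of _ x]) (auto intro: bexI[of _ l])
  next
    case False
    then have "e \<in> set es" using e by simp
    then obtain y where y: "\<exists>i\<in>J. y i \<noteq> 0" "\<And>i. i \<in> J \<Longrightarrow> (\<Sum>j\<in>J. C i j * y j) = e * y i"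
      using es(3) by blast
    \<comment> \<open>\<open>y\<close>, extended by 0, is an eigenvector only modulo the line of
      \<open>x\<close>: the error is \<open>t\<close> times \<open>x\<close>. As \<open>e\<close>
      and \<open>c\<close> differ, adding a multiple of \<open>x\<close> absorbs it.\<close>
    define t where "t = (\<Sum>j\<in>J. M l j * y j)"
    define s where "s = t / (e - c)"
    have s: "t + s * c = e * s" using False by (simp add: s_def field_simps)
    define w where "w i = (if i \<in> J then y i else 0) + s * x i" for i
    have "(\<Sum>j\<in>I. M i j * w j) = e * w i" if i: "i \<in> I" for i
    proof -
      have "(\<Sum>j\<in>I. M i j * w j) = (\<Sum>j\<in>I. M i j * (if j \<in> J then y j else 0)) + s * (\<Sum>j\<in>I. M i j * x j)"
        by (simp add: w_def algebra_simps sum.distrib sum_distrib_left)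
      also have "(\<Sum>j\<in>I. M i j * (if j \<in> J then y j else 0)) = (\<Sum>j\<in>J. M i j * y j)"
        using J(4) by (simp add: sumI)
      also have "(\<Sum>j\<in>J. M i j * y j) = (if i \<in> J then e * y i else 0) + x i * t"
      proof (cases "i \<in> J")
        case True
        have "(\<Sum>j\<in>J. C i j * y j) = (\<Sum>j\<in>J. M i j * y j) - x i * t"
          by (simp add: C_def t_def algebra_simps sum_subtractf sum_distrib_left)
        then show ?thesis using y(2)[OF True] True by simp
      next
        case False
        then have "i = l" using i by (auto simp: J_def)
        then show ?thesis using False xl by (simp add: t_def)
      qed
      finally have "(\<Sum>j\<in>I. M i j * w j) = (if i \<in> J then e * y i else 0) + x i * (t + s * c)"
        using eig[OF i] by (simp add: algebra_simps)
      then show ?thesis unfolding s by (simp add: w_def algebra_simps)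
    qed
    moreover have "\<exists>i\<in>I. w i \<noteq> 0"
    proof (cases "s = 0")
      case True
      then show ?thesis using y(1) J(3) by (auto simp: w_def)
    next
      case False
      then show ?thesis using x0(1) J(4) xl by (intro bexI[of _ l]) (auto simp: w_def)
    qed
    ultimately show ?thesis by blast
  qed
  let ?g = "\<lambda>e z i. (\<Sum>j\<in>I. M i j * z j) - e * z i"
  let ?gJ = "\<lambda>e z i. (\<Sum>j\<in>J. C i j * z j) - e * z i"
  \<comment> \<open>On the quotient coordinates the factors for \<open>M\<close> act as the factors
    for \<open>C\<close>. After all of \<open>es\<close> a vector therefore lies on the line of
    \<open>x\<close>, and the factor for \<open>c\<close>, put last, annihilates it.\<close>
  have red: "\<forall>i\<in>J. fold ?g ks z i - x i * fold ?g ks z l = fold ?gJ ks y i"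
    if "\<forall>i\<in>J. z i - x i * z l = y i" for ks z y
    using that
  proof (induction ks arbitrary: z y)
    case (Cons e ks)
    have "\<forall>i\<in>J. ?g e z i - x i * ?g e z l = ?gJ e y i"
    proof
      fix i assume i: "i \<in> J"
      have "(\<Sum>j\<in>J. C i j * y j) = (\<Sum>j\<in>J. C i j * (z j - x j * z l))"
        using Cons.prems by (intro sum.cong) auto
      then show "?g e z i - x i * ?g e z l = ?gJ e y i"
        using bar[OF i, of z] Cons.prems i by (auto simp: algebra_simps dest!: bspec)
    qed
    from Cons.IH[OF this] show ?case by simp
  qed simp
  have "fold ?g (es @ [c]) z i = 0" if i: "i \<in> I" for z i
  proof -
    define z' where "z' = fold ?g es z"
    have "\<forall>i\<in>J. z' i - x i * z' l = 0"
      using red[of z "\<lambda>i. z i - x i * z l" es] es(4) unfolding z'_def by auto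
    then have z': "z' j = z' l * x j" if "j \<in> I" for j
      using that xl by (cases "j = l") (auto simp: J_def)
    have "(\<Sum>j\<in>I. M i j * z' j) = z' l * (\<Sum>j\<in>I. M i j * x j)"
      unfolding sum_distrib_left by (intro sum.cong) (simp_all add: z' mult_ac)
    then have "?g c z' i = 0" using eig[OF i] z'[OF i] by simp
    then show ?thesis by (simp add: z'_def)
  qed
  then show ?case using trace eigs es(2) J(2) Suc.hyps(2)
    by (intro exI[of _ "es @ [c]"]) auto
qed

section \<open>Coordinate spaces over the residue field\<close>

context residue_field begin

definition int_vec :: "nat \<Rightarrow> (nat \<Rightarrow> 'r) set" where "int_vec d = {x. \<forall>i<d. x i \<in> R}"
definition small_vec :: "nat \<Rightarrow> (nat \<Rightarrow> 'r) set" where "small_vec d = {x. \<forall>i<d. x i \<in> P}"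
text \<open>The positions of leading entries in an echelon form modulo \<open>P\<close>; their
  number is the dimension over the residue field.\<close>

definition pivots :: "nat \<Rightarrow> (nat \<Rightarrow> 'r) set \<Rightarrow> nat set" where
  "pivots d U = {i. i < d \<and> (\<exists>x\<in>U. x i \<notin> P \<and> (\<forall>j<i. x j \<in> P))}"

text \<open>Gaussian elimination: if \<open>U\<close> had all the pivots of the larger
  \<open>W\<close>, vectors of \<open>U\<close> could clear the entries of any vector of
  \<open>W\<close> one after another, until an element of \<open>small_vec\<close> remained, which
  lies in \<open>U\<close>.\<close>

lemma finite_length_coordinates:
  "finite_length_module R P (\<lambda>c x i. c * x i) (small_vec d) (int_vec d) (\<lambda>U. card (pivots d U))"
proof
  let ?sub = "submod R (\<lambda>c x i. c * x i) (small_vec d) (int_vec d)"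
  show "0 \<in> small_vec d" by (simp add: small_vec_def zero_P)
  show "?sub (int_vec d)" "?sub (small_vec d)"
    by (auto simp: submod_def int_vec_def small_vec_def add_R mult_R add_P mult_P P_R)
  show "(\<lambda>i. a * x i) \<in> small_vec d" if "a \<in> P" "x \<in> int_vec d" for a x
    using that by (auto simp: int_vec_def small_vec_def mult_P')
  fix U W assume U: "?sub U" and W: "?sub W" and UW: "U \<subset> W"
  have mono: "pivots d U \<subseteq> pivots d W" using UW by (auto simp: pivots_def)
  have fin: "finite (pivots d W)" by (simp add: pivots_def)
  have "pivots d U \<noteq> pivots d W"
  proof
    assume eq: "pivots d U = pivots d W"
    \<comment> \<open>\<open>k\<close> counts the coordinates still to be cleared; \<open>k\<close>
      = \<open>d\<close> covers all of \<open>W\<close>.\<close>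
    have "x \<in> U" if "x \<in> W" "\<forall>j<d - k. x j \<in> P" "k \<le> d" for x k
      using that
    proof (induction k arbitrary: x)
      case 0
      then have "x \<in> small_vec d" by (simp add: small_vec_def)
      then show ?case using U by (auto simp: submod_def)
    next
      case (Suc k)
      define p where "p = d - Suc k"
      have p: "p < d" "d - k = Suc p" using Suc.prems(3) by (auto simp: p_def)
      show ?case
      proof (cases "x p \<in> P")
        case True
        then have "\<forall>j<d - k. x j \<in> P" using Suc.prems(2) unfolding p(2) by (auto simp: p_def less_Suc_eq)
        then show ?thesis using Suc by auto
      next
        case False
        then have "p \<in> pivots d U" unfolding eq using p Suc.prems by (auto simp: pivots_def p_def)
        then obtain y where y: "y \<in> U" "y p \<notin> P" "\<forall>j<p. y j \<in> P" by (auto simp: pivots_def)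
        have yR: "y i \<in> R" and xR: "x i \<in> R" if "i < d" for i
          using y(1) Suc.prems(1) U W that by (auto simp: submod_def int_vec_def)
        obtain b where b: "b \<in> R" "y p * b - 1 \<in> P" using inverse_mod[OF yR[OF p(1)] y(2)] by blast
        define t where "t = - (x p * b)"
        have tR: "t \<in> R" unfolding t_def using b xR[OF p(1)] by (intro uminus_R mult_R)
        have ty: "(\<lambda>i. t * y i) \<in> U" "(\<lambda>i. - t * y i) \<in> U"
          using U y(1) tR uminus_R[OF tR] by (auto simp: submod_def simp del: mult_minus_left)
        let ?x' = "x + (\<lambda>i. t * y i)"
        have "?x' \<in> W" using Suc.prems(1) ty(1) UW W by (auto simp: submod_def)
        moreover have "\<forall>j<d - k. ?x' j \<in> P"
        proof (intro allI impI)
          fix j assume j: "j < d - k"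
          show "?x' j \<in> P"
          proof (cases "j = p")
            case True
            have "?x' j = - x p * (y p * b - 1)" using True by (simp add: t_def algebra_simps)
            then show ?thesis using b uminus_R[OF xR[OF p(1)]] mult_P by metis
          next
            case False
            then have "j < p" using j p by linarith
            then show ?thesis using Suc.prems(2) y(3) tR by (auto simp: p_def intro!: add_P mult_P)
          qed
        qed
        ultimately have "?x' \<in> U" by (rule Suc.IH[OF _ _ Suc_leD[OF Suc.prems(3)]])
        then have "?x' + (\<lambda>i. - t * y i) \<in> U" using ty(2) U unfolding submod_def by blast
        moreover have "?x' + (\<lambda>i. - t * y i) = x" by (simp add: fun_eq_iff)
        ultimately show ?thesis by (simp only:)
      qed
    qed
    from this[of _ d] have "W \<subseteq> U" by auto
    then show False using UW by blast
  qed
  then show "card (pivots d U) < card (pivots d W)"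
    using mono fin by (intro psubset_card_mono) auto
qed (simp_all add: fun_eq_iff algebra_simps)

end

section \<open>Matrices as functions, and words in them\<close>

definition mat_mul :: "nat \<Rightarrow> (nat \<Rightarrow> nat \<Rightarrow> 'r) \<Rightarrow> (nat \<Rightarrow> nat \<Rightarrow> 'r) \<Rightarrow> nat \<Rightarrow> nat \<Rightarrow> 'r::comm_ring_1"
  where "mat_mul d A B = (\<lambda>i j. \<Sum>k<d. A i k * B k j)"

primrec words :: "nat \<Rightarrow> (nat \<Rightarrow> nat \<Rightarrow> 'r::comm_ring_1) set \<Rightarrow> nat \<Rightarrow> (nat \<Rightarrow> nat \<Rightarrow> 'r) set" where
  "words d S 0 = {\<lambda>i j. if i = j then 1 else 0}"
| "words d S (Suc n) = {mat_mul d s w | s w. s \<in> S \<and> w \<in> words d S n}"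

lemma mat_app_mul: "mat_app d (mat_mul d A B) x = mat_app d A (mat_app d B x)"
proof
  fix i
  have "mat_app d (mat_mul d A B) x i = (\<Sum>j<d. \<Sum>k<d. A i k * (B k j * x j))"
    by (simp add: mat_app_def mat_mul_def sum_distrib_right mult.assoc)
  also have "\<dots> = mat_app d A (mat_app d B x) i"
    by (subst sum.swap) (simp add: mat_app_def sum_distrib_left)
  finally show "mat_app d (mat_mul d A B) x i = mat_app d A (mat_app d B x) i" .
qed

lemma mat_mul_assoc: "mat_mul d (mat_mul d A B) C = mat_mul d A (mat_mul d B C)"
proof (intro ext)
  fix i j
  have "mat_mul d (mat_mul d A B) C i j = (\<Sum>l<d. \<Sum>k<d. A i k * (B k l * C l j))"
    by (simp add: mat_mul_def sum_distrib_right mult.assoc)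
  also have "\<dots> = mat_mul d A (mat_mul d B C) i j"
    by (subst sum.swap) (simp add: mat_mul_def sum_distrib_left)
  finally show "mat_mul d (mat_mul d A B) C i j = mat_mul d A (mat_mul d B C) i j" .
qed

text \<open>The identity matrix is neutral only at indices below \<open>d\<close>. The outer product
  with \<open>A\<close> sums over exactly those indices, which makes the equation hold
  everywhere.\<close>

lemma mat_mul_one: "mat_mul d A (mat_mul d (\<lambda>i j. if i = j then 1 else 0) B) = mat_mul d A B"
proof -
  have "(\<Sum>k<d. (if i = k then 1 else 0) * B k j) = B i j" if "i < d" for i j
    using that by (simp add: if_distrib[of "\<lambda>t. t * _"] cong: if_cong)
  then show ?thesis by (auto simp: mat_mul_def fun_eq_iff intro!: sum.cong)
qed

text \<open>The length of the first factor must be positive: the identity matrix times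
  \<open>w\<close> agrees with \<open>w\<close> only in the rows below \<open>d\<close>.\<close>

lemma words_mul:
  "v \<in> words d S m \<Longrightarrow> w \<in> words d S n \<Longrightarrow> m \<ge> 1 \<Longrightarrow> mat_mul d v w \<in> words d S (m + n)"
proof (induction m arbitrary: v)
  case (Suc m)
  obtain s v' where v: "v = mat_mul d s v'" "s \<in> S" "v' \<in> words d S m" using Suc.prems(1) by auto
  show ?case
  proof (cases "m = 0")
    case True
    then have "mat_mul d v w = mat_mul d s w" using v by (simp add: mat_mul_assoc mat_mul_one)
    then show ?thesis using v(2) Suc.prems(2) True by auto
  next
    case False
    then show ?thesis using Suc.IH[OF v(3) Suc.prems(2)] v by (auto simp: mat_mul_assoc)
  qed
qed simp

text \<open>The hypotheses say that the residue field is algebraically closed, in the form in which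
  this is used; they are satisfied because they hold before reduction.\<close>

locale closed_residue_field = residue_field R P for R P :: "'r::comm_ring_1 set" +
  assumes split: "(\<And>i j. i < d \<Longrightarrow> j < d \<Longrightarrow> M i j \<in> R) \<Longrightarrow> \<exists>ls. set ls \<subseteq> R \<and>
      (\<forall>x i. (\<forall>i<d. x i \<in> R) \<longrightarrow> i < d \<longrightarrow> fold (\<lambda>l z i. mat_app d M z i - l * z i) ls x i \<in> P)"
    and nil_trace: "\<forall>r B m. (\<forall>i<r. \<forall>j<r. B i j \<in> R) \<longrightarrow>
      (\<forall>x i. (\<forall>i<r. x i \<in> R) \<longrightarrow> i < r \<longrightarrow> (mat_app r B ^^ m) x i \<in> P) \<longrightarrow>
      (\<Sum>i<r. B i i) \<in> P"
begin

definition int_mat :: "nat \<Rightarrow> (nat \<Rightarrow> nat \<Rightarrow> 'r) set" where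
  "int_mat d = {M. \<forall>i<d. \<forall>j<d. M i j \<in> R}"

text \<open>The preimage of the span of \<open>X\<close> in the matrices over the residue field;
  matrices that reduce to 0 belong to every span.\<close>

inductive_set mspan :: "nat \<Rightarrow> (nat \<Rightarrow> nat \<Rightarrow> 'r) set \<Rightarrow> (nat \<Rightarrow> nat \<Rightarrow> 'r) set"
  for d :: nat and X :: "(nat \<Rightarrow> nat \<Rightarrow> 'r) set" where
  small: "(\<And>i j. i < d \<Longrightarrow> j < d \<Longrightarrow> M i j \<in> P) \<Longrightarrow> M \<in> mspan d X"
| base: "M \<in> X \<Longrightarrow> M \<in> mspan d X"
| add: "M \<in> mspan d X \<Longrightarrow> M' \<in> mspan d X \<Longrightarrow> (\<lambda>i j. M i j + M' i j) \<in> mspan d X"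
| scale: "c \<in> R \<Longrightarrow> M \<in> mspan d X \<Longrightarrow> (\<lambda>i j. c * M i j) \<in> mspan d X"

lemma mspan_int_mat: "M \<in> mspan d X \<Longrightarrow> X \<subseteq> int_mat d \<Longrightarrow> M \<in> int_mat d"
  by (induction rule: mspan.induct) (auto simp: int_mat_def P_R add_R mult_R)

lemma mspan_minimal: "M \<in> mspan d X \<Longrightarrow> X \<subseteq> mspan d Y \<Longrightarrow> M \<in> mspan d Y"
  by (induction rule: mspan.induct) (auto intro: mspan.intros)

lemma mat_mul_int: "A \<in> int_mat d \<Longrightarrow> B \<in> int_mat d \<Longrightarrow> mat_mul d A B \<in> int_mat d"
  by (auto simp: int_mat_def mat_mul_def intro!: sum_R mult_R)

lemma mspan_mul:
  assumes "M \<in> mspan d X" "M' \<in> mspan d X" "X \<subseteq> int_mat d"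
    and X: "\<And>A B. A \<in> X \<Longrightarrow> B \<in> X \<Longrightarrow> mat_mul d A B \<in> X"
  shows "mat_mul d M M' \<in> mspan d X"
  using assms(1)
proof induction
  case (small M)
  then show ?case using mspan_int_mat[OF assms(2,3)]
    by (intro mspan.small) (auto simp: mat_mul_def int_mat_def intro!: sum_P mult_P')
next
  case (base M)
  note M = this
  show ?case using assms(2)
  proof induction
    case (small M')
    then show ?case using M assms(3)
      by (intro mspan.small) (auto simp: mat_mul_def int_mat_def intro!: sum_P mult_P)
  next
    case (base M')
    then show ?case using X[OF M] by (intro mspan.base)
  next
    case (add M' M'')
    then show ?case using mspan.add by (fastforce simp: mat_mul_def algebra_simps sum.distrib)
  next
    case (scale c M')
    then show ?case using mspan.scale[OF scale(1) scale(3)]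
      by (simp add: mat_mul_def sum_distrib_left mult.left_commute)
  qed
next
  case (add M M'')
  then show ?case using mspan.add by (fastforce simp: mat_mul_def algebra_simps sum.distrib)
next
  case (scale c M)
  then show ?case using mspan.scale[OF scale(1) scale(3)]
    by (simp add: mat_mul_def sum_distrib_left mult.assoc)
qed

lemma words_int: "S \<subseteq> int_mat d \<Longrightarrow> words d S n \<subseteq> int_mat d"
proof (induction n)
  case 0
  then show ?case by (auto simp: int_mat_def one_R zero_R)
next
  case (Suc n)
  then show ?case by (auto intro!: mat_mul_int)
qed

text \<open>The span of all words acts as an algebra, and the hypothesis says that the short words,
  which are nilpotent, span it already. A long word is a product of equally many operators of this
  algebra, so the nilpotency theorem makes it reduce to 0.\<close>

theorem words_eventually_small:
  assumes S: "S \<subseteq> int_mat d"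
    and span: "\<And>n. n \<ge> 1 \<Longrightarrow> words d S n \<subseteq> mspan d (\<Union>i\<in>{1..k}. words d S i)"
    and nil: "\<And>i w. i \<in> {1..k} \<Longrightarrow> w \<in> words d S i \<Longrightarrow>
      \<exists>m. \<forall>x\<in>int_vec d. (mat_app d w ^^ m) x \<in> small_vec d"
  shows "\<exists>m. \<forall>w\<in>words d S m. \<forall>i<d. \<forall>j<d. w i j \<in> P"
proof -
  define X where "X = (\<Union>n\<in>{1..}. words d S n)"
  define Y where "Y = (\<Union>i\<in>{1..k}. words d S i)"
  have X_int: "X \<subseteq> int_mat d" unfolding X_def using words_int[OF S] by blast
  have YX: "Y \<subseteq> X" by (auto simp: X_def Y_def)
  have Y_X: "M \<in> mspan d Y" if "M \<in> mspan d X" for M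
    using that by (rule mspan_minimal) (use span in \<open>auto simp: X_def Y_def\<close>)
  have X_Y: "M \<in> mspan d X" if "M \<in> mspan d Y" for M
    using that by (rule mspan_minimal) (use YX in \<open>auto intro: mspan.base\<close>)
  have mulX: "mat_mul d A B \<in> X" if "A \<in> X" "B \<in> X" for A B
  proof -
    obtain m n where "A \<in> words d S m" "B \<in> words d S n" "m \<ge> 1" "n \<ge> 1"
      using \<open>A \<in> X\<close> \<open>B \<in> X\<close> by (auto simp: X_def)
    then show ?thesis using words_mul[of A d S m B n] by (auto simp: X_def intro!: bexI[of _ "m + n"])
  qed
  interpret finite_length_module R P "\<lambda>c x i. c * x i" "small_vec d" "int_vec d" "\<lambda>U. card (pivots d U)"
    by (rule finite_length_coordinates)
  let ?A = "mat_app d ` mspan d X"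
  have int: "M i j \<in> R" if "M \<in> mspan d X" "i < d" "j < d" for M i j
    using mspan_int_mat[OF that(1) X_int] that by (auto simp: int_mat_def)
  have app_add: "mat_app d (\<lambda>i j. M i j + M' i j) = (\<lambda>x. mat_app d M x + mat_app d M' x)" for M M'
    by (simp add: mat_app_def fun_eq_iff algebra_simps sum.distrib)
  have app_scale: "mat_app d (\<lambda>i j. c * M i j) = (\<lambda>x i. c * mat_app d M x i)" for c M
    by (simp add: mat_app_def fun_eq_iff sum_distrib_left mult.assoc)
  interpret nil_spanned_algebra R P "\<lambda>c x i. c * x i" "small_vec d" "int_vec d" "\<lambda>U. card (pivots d U)" ?A
  proof
    show "lin_op a" if a: "a \<in> ?A" for a
    proof -
      obtain M where M: "a = mat_app d M" "M \<in> mspan d X" using a by blast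
      have "mat_app d M x \<in> int_vec d" if "x \<in> int_vec d" for x
        using that int[OF M(2)] by (auto simp: int_vec_def mat_app_def intro!: sum_R mult_R)
      moreover have "mat_app d M x \<in> small_vec d" if "x \<in> small_vec d" for x
        using that int[OF M(2)] by (auto simp: small_vec_def mat_app_def intro!: sum_P mult_P)
      ultimately show ?thesis
        by (auto simp: lin_op_def M(1) mat_app_def fun_eq_iff algebra_simps sum.distrib sum_distrib_left)
    qed
    show "(\<lambda>x. 0) \<in> ?A"
      by (rule image_eqI[of _ _ "\<lambda>i j. 0"]) (auto simp: mat_app_def fun_eq_iff zero_P intro: mspan.small)
    show "(\<lambda>x. a (b x)) \<in> ?A" if ab: "a \<in> ?A" "b \<in> ?A" for a b
    proof -
      obtain M M' where "a = mat_app d M" "M \<in> mspan d X" "b = mat_app d M'" "M' \<in> mspan d X"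
        using ab by blast
      then show ?thesis using mspan_mul[OF _ _ X_int mulX, of M M']
        by (intro image_eqI[of _ _ "mat_mul d M M'"]) (auto simp: mat_app_mul)
    qed
    show "(\<lambda>x. a x + b x) \<in> ?A" if ab: "a \<in> ?A" "b \<in> ?A" for a b
    proof -
      obtain M M' where "a = mat_app d M" "M \<in> mspan d X" "b = mat_app d M'" "M' \<in> mspan d X"
        using ab by blast
      then show ?thesis
        by (intro image_eqI[OF _ mspan.add[of M d X M']]) (auto simp: app_add)
    qed
    show "(\<lambda>x i. c * a x i) \<in> ?A" if c: "c \<in> R" and a: "a \<in> ?A" for c a
    proof -
      obtain M where "a = mat_app d M" "M \<in> mspan d X" using a by blast
      then show ?thesis
        by (intro image_eqI[OF _ mspan.scale[OF c, of M]]) (auto simp: app_scale)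
    qed
    show "\<exists>ls. set ls \<subseteq> R \<and> (\<forall>x\<in>int_vec d. fold (\<lambda>l z. a z - (\<lambda>i. l * z i)) ls x \<in> small_vec d)"
      if a: "a \<in> ?A" for a
    proof -
      obtain M where M: "a = mat_app d M" "M \<in> mspan d X" using a by blast
      have "(\<lambda>l z. mat_app d M z - (\<lambda>i. l * z i)) = (\<lambda>l z i. mat_app d M z i - l * z i)"
        by (simp add: fun_eq_iff)
      then show ?thesis using split[of d M] int[OF M(2)] M(1) by (auto simp: int_vec_def small_vec_def)
    qed
    have *: "(\<forall>a\<in>?A. \<tau> a \<in> R) \<longrightarrow> (\<forall>a\<in>?A. \<forall>b\<in>?A. \<tau> (\<lambda>x. a x + b x) \<simeq>\<^sub>P \<tau> a + \<tau> b) \<longrightarrow>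
        (\<forall>c\<in>R. \<forall>a\<in>?A. \<tau> (\<lambda>x i. c * a x i) \<simeq>\<^sub>P c * \<tau> a) \<longrightarrow>
        (\<forall>a\<in>?A. \<forall>m. (\<forall>x\<in>int_vec d. (a ^^ m) x \<in> small_vec d) \<longrightarrow> \<tau> a \<in> P) \<longrightarrow> (\<forall>a\<in>?A. \<tau> a \<in> P)" for \<tau>
    proof (intro impI ballI)
      fix a
      assume add: "\<forall>a\<in>?A. \<forall>b\<in>?A. \<tau> (\<lambda>x. a x + b x) \<simeq>\<^sub>P \<tau> a + \<tau> b"
        and scale: "\<forall>c\<in>R. \<forall>a\<in>?A. \<tau> (\<lambda>x i. c * a x i) \<simeq>\<^sub>P c * \<tau> a"
        and nilp: "\<forall>a\<in>?A. \<forall>m. (\<forall>x\<in>int_vec d. (a ^^ m) x \<in> small_vec d) \<longrightarrow> \<tau> a \<in> P"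
        and a: "a \<in> ?A"
      obtain M where M: "a = mat_app d M" "M \<in> mspan d Y" using a Y_X by blast
      note add_cong = add[rule_format] and scale_cong = scale[rule_format]
      \<comment> \<open>Induction over the span of the short words, where \<open>nil\<close> covers
        the generators and linearity of \<tau> the rest.\<close>
      have "\<tau> (mat_app d M) \<in> P" using M(2)
      proof induction
        case (small M)
        have "mat_app d M x \<in> small_vec d" if "x \<in> int_vec d" for x
          using that small by (auto simp: int_vec_def small_vec_def mat_app_def intro!: sum_P mult_P')
        then show ?case using mspan.small[of d M X] small by (intro nilp[rule_format, of _ 1]) auto
      next
        case (base M)
        then obtain i where "i \<in> {1..k}" "M \<in> words d S i" unfolding Y_def by blast
        then obtain m where "\<forall>x\<in>int_vec d. (mat_app d M ^^ m) x \<in> small_vec d"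
          using nil by blast
        then show ?case using base YX by (intro nilp[rule_format, of _ m]) (auto intro: mspan.base)
      next
        case (add M M')
        then show ?case unfolding app_add
          by (intro cong_P[OF add_cong] add_P imageI X_Y)
      next
        case (scale c M)
        then show ?case unfolding app_scale
          by (intro cong_P[OF scale_cong] mult_P imageI X_Y)
      qed
      then show "\<tau> a \<in> P" using M(1) by simp
    qed
    show "\<forall>\<tau>. (\<forall>a\<in>?A. \<tau> a \<in> R) \<longrightarrow> (\<forall>a\<in>?A. \<forall>b\<in>?A. \<tau> (\<lambda>x. a x + b x) \<simeq>\<^sub>P \<tau> a + \<tau> b) \<longrightarrow>
        (\<forall>c\<in>R. \<forall>a\<in>?A. \<tau> (\<lambda>x i. c * a x i) \<simeq>\<^sub>P c * \<tau> a) \<longrightarrow>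
        (\<forall>a\<in>?A. \<forall>m. (\<forall>x\<in>int_vec d. (a ^^ m) x \<in> small_vec d) \<longrightarrow> \<tau> a \<in> P) \<longrightarrow> (\<forall>a\<in>?A. \<tau> a \<in> P)"
      by (rule allI) (rule *)
  qed (rule nil_trace)
  obtain m where m: "\<And>as x. length as = m \<Longrightarrow> set as \<subseteq> ?A \<Longrightarrow> x \<in> int_vec d \<Longrightarrow>
      foldr (\<lambda>a x. a x) as x \<in> small_vec d"
    using nilpotent_if_spanned_by_nilpotents by blast
  \<comment> \<open>A word of length 1 is a generator times the identity matrix. The two may differ
    in columns from \<open>d\<close> on but act in the same way.\<close>
  have SX: "mat_app d s \<in> ?A" if "s \<in> S" for s
  proof -
    let ?s = "mat_mul d s (\<lambda>i j. if i = j then 1 else 0)"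
    have "?s \<in> words d S 1" using that by auto
    then have "?s \<in> mspan d X" by (intro mspan.base) (auto simp: X_def simp del: words.simps)
    moreover have "mat_app d ?s = mat_app d s"
    proof -
      have "(\<Sum>k<d. s i k * (if k = j then 1 else 0)) = s i j" if "j < d" for i j
        using that by (simp add: if_distrib[of "(*) _"] cong: if_cong)
      then show ?thesis by (auto simp: mat_app_def mat_mul_def fun_eq_iff)
    qed
    ultimately show ?thesis by (metis imageI)
  qed
  have app_one: "(\<Sum>j<d. (if i = j then 1 else 0) * x j) = x i" if "i < d" for x :: "nat \<Rightarrow> 'r" and i
    using that by (simp add: if_distrib[of "\<lambda>t. t * _"] cong: if_cong)
  have word: "\<exists>as. length as = n \<and> set as \<subseteq> ?A \<and> (\<forall>x i. i < d \<longrightarrow> mat_app d w x i = foldr (\<lambda>a x. a x) as x i)"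
    if "w \<in> words d S n" for w n
    using that
  proof (induction n arbitrary: w)
    case 0
    then show ?case by (auto simp: mat_app_def app_one)
  next
    case (Suc n)
    obtain s v where w: "w = mat_mul d s v" "s \<in> S" "v \<in> words d S n" using Suc.prems by auto
    obtain as where as: "length as = n" "set as \<subseteq> ?A"
      "\<And>x i. i < d \<Longrightarrow> mat_app d v x i = foldr (\<lambda>a x. a x) as x i" using Suc.IH[OF w(3)] by blast
    have "mat_app d w x = foldr (\<lambda>a x. a x) (mat_app d s # as) x" for x
      unfolding w(1) mat_app_mul by (simp add: mat_app_def[of d s] as(3))
    then show ?case using as(1,2) SX[OF w(2)] by (intro exI[of _ "mat_app d s # as"]) auto
  qed
  have "w i j \<in> P" if w: "w \<in> words d S m" and ij: "i < d" "j < d" for w i j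
  proof -
    let ?e = "\<lambda>k. if k = j then 1 else 0"
    have e: "?e \<in> int_vec d" by (auto simp: int_vec_def one_R zero_R)
    obtain as where as: "length as = m" "set as \<subseteq> ?A"
      "\<And>x i. i < d \<Longrightarrow> mat_app d w x i = foldr (\<lambda>a x. a x) as x i" using word[OF w] by blast
    have "mat_app d w ?e i \<in> P" unfolding as(3)[OF ij(1)]
      using m[OF as(1,2) e] ij(1) by (auto simp: small_vec_def)
    moreover have "mat_app d w ?e i = w i j"
      using ij(2) by (simp add: mat_app_def if_distrib[of "(*) _"] cong: if_cong)
    ultimately show ?thesis by simp
  qed
  then show ?thesis by blast
qed

end

section \<open>Reduction to a residue field, and the number \<open>ell\<close>\<close>

text \<open>\<open>ell\<close> speaks of matrices over field records, so R/P is needed as a record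
  here: \<open>h\<close> is a surjective homomorphism with kernel \<open>P\<close>.\<close>

locale residue_field_map = closed_residue_field R P for R P :: "'r::comm_ring_1 set" +
  fixes F :: "'f ring" and h :: "'r \<Rightarrow> 'f"
  assumes field_F: "field F"
    and h_closed: "a \<in> R \<Longrightarrow> h a \<in> carrier F"
    and h_add: "a \<in> R \<Longrightarrow> b \<in> R \<Longrightarrow> h (a + b) = h a \<oplus>\<^bsub>F\<^esub> h b"
    and h_mult: "a \<in> R \<Longrightarrow> b \<in> R \<Longrightarrow> h (a * b) = h a \<otimes>\<^bsub>F\<^esub> h b"
    and h_one: "h 1 = \<one>\<^bsub>F\<^esub>"
    and h_surj: "carrier F \<subseteq> h ` R"
    and h_kernel: "a \<in> R \<Longrightarrow> h a = \<zero>\<^bsub>F\<^esub> \<longleftrightarrow> a \<in> P"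
begin

lemma h_zero: "h 0 = \<zero>\<^bsub>F\<^esub>" using h_kernel[OF zero_R] zero_P by simp

lemma h_sum: "finite I \<Longrightarrow> (\<And>i. i \<in> I \<Longrightarrow> f i \<in> R) \<Longrightarrow> h (sum f I) = (\<Oplus>\<^bsub>F\<^esub>i\<in>I. h (f i))"
proof (induction I rule: finite_induct)
  interpret F: field F by (rule field_F)
  case empty
  show ?case by (simp add: h_zero)
next
  interpret F: field F by (rule field_F)
  case (insert i I)
  then show ?case
    by (subst F.finsum_insert) (auto simp: h_add h_closed sum_R)
qed

lemma h_eq_cong: assumes "a \<in> R" "b \<in> R" "h a = h b" shows "a \<simeq>\<^sub>P b"
proof -
  interpret F: field F by (rule field_F)
  have "h (a - b) \<oplus>\<^bsub>F\<^esub> h b = \<zero>\<^bsub>F\<^esub> \<oplus>\<^bsub>F\<^esub> h b"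
    using h_add[of "a - b" b] assms diff_R h_closed by simp
  then have "h (a - b) = \<zero>\<^bsub>F\<^esub>"
    using F.add.right_cancel h_closed assms diff_R F.zero_closed by blast
  then show ?thesis using h_kernel diff_R assms by (simp add: cong_def)
qed

definition red :: "nat \<Rightarrow> (nat \<Rightarrow> nat \<Rightarrow> 'r) \<Rightarrow> 'f mat" where
  "red d M = Matrix.mat d d (\<lambda>(i, j). h (M i j))"

lemma red_simps: "red d M \<in> carrier_mat d d" "i < d \<Longrightarrow> j < d \<Longrightarrow> red d M $$ (i, j) = h (M i j)"
  by (simp_all add: red_def)

lemma red_carrier: "M \<in> int_mat d \<Longrightarrow> red d M \<in> carrier (mat_algebra F d)"
  by (auto simp: mat_algebra_carrier red_simps int_mat_def h_closed)

lemma red_mult: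
  assumes "A \<in> int_mat d" "B \<in> int_mat d"
  shows "red d (mat_mul d A B) = red d A \<otimes>\<^bsub>mat_algebra F d\<^esub> red d B"
proof (rule mat_algebra_eqI[of _ d])
  interpret F: field F by (rule field_F)
  show "red d A \<otimes>\<^bsub>mat_algebra F d\<^esub> red d B \<in> carrier_mat d d"
    by (simp add: mat_algebra_dim red_simps)
  fix i j assume ij: "i < d" "j < d"
  have "red d (mat_mul d A B) $$ (i, j) = (\<Oplus>\<^bsub>F\<^esub>k\<in>{..<d}. h (A i k * B k j))"
    using ij assms by (auto simp: red_simps mat_mul_def int_mat_def intro!: h_sum mult_R)
  also have "\<dots> = (\<Oplus>\<^bsub>F\<^esub>k\<in>{0..<d}. red d A $$ (i, k) \<otimes>\<^bsub>F\<^esub> red d B $$ (k, j))"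
    using ij assms by (intro F.finsum_cong') (auto simp: red_simps h_mult int_mat_def h_closed)
  also have "\<dots> = (red d A \<otimes>\<^bsub>mat_algebra F d\<^esub> red d B) $$ (i, j)"
    using ij assms F.ring_axioms
    by (intro mat_algebra_mult_index[symmetric]) (auto simp: red_simps h_closed int_mat_def)
  finally show "red d (mat_mul d A B) $$ (i, j) = (red d A \<otimes>\<^bsub>mat_algebra F d\<^esub> red d B) $$ (i, j)" .
qed (simp add: red_simps)

lemma red_words:
  assumes S: "S \<subseteq> int_mat d"
  shows "set_pow (mat_algebra F d) (red d ` S) n = red d ` words d S n"
proof (induction n)
  case 0
  show ?case
    by (auto simp: mat_algebra_index mat_algebra_dim red_simps h_one h_zero
        intro!: mat_algebra_eqI[of _ d])
       (auto simp: red_def mat_algebra_def h_one h_zero)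
next
  case (Suc n)
  have "red d (mat_mul d s w) = red d s \<otimes>\<^bsub>mat_algebra F d\<^esub> red d w" if "s \<in> S" "w \<in> words d S n" for s w
    using that S words_int[OF S, of n] by (intro red_mult) auto
  note mult = this
  have "set_pow (mat_algebra F d) (red d ` S) (Suc n) =
      (\<lambda>(s, w). red d s \<otimes>\<^bsub>mat_algebra F d\<^esub> red d w) ` (S \<times> words d S n)"
    unfolding set_pow.simps Suc.IH set_mult_def by auto
  also have "\<dots> = (\<lambda>(s, w). red d (mat_mul d s w)) ` (S \<times> words d S n)"
    by (intro image_cong) (auto simp: mult)
  also have "\<dots> = red d ` words d S (Suc n)" by (auto simp: image_def)
  finally show ?case .
qed

text \<open>The reductions of \<open>mspan\<close> form a subspace of matrices over \<open>F\<close>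
  that contains the short words, hence by choice of \<open>k\<close> all words. Lifting back leaves
  an error with entries in \<open>P\<close>, which \<open>mspan\<close> absorbs.\<close>

lemma words_in_mspan:
  assumes span: "powers_span TYPE('f) d k" and S: "S \<subseteq> int_mat d" and n: "n \<ge> 1"
  shows "words d S n \<subseteq> mspan d (\<Union>i\<in>{1..k}. words d S i)"
proof
  interpret F: field F by (rule field_F)
  let ?A = "mat_algebra F d" and ?X = "\<Union>i\<in>{1..k}. words d S i"
  interpret MA: Module.module F ?A by (rule mat_algebra_module[OF field_F])
  fix w assume w: "w \<in> words d S n"
  have X: "?X \<subseteq> int_mat d" using words_int[OF S] by blast
  let ?N = "red d ` mspan d ?X"
  have int: "M i j \<in> R" if "M \<in> mspan d ?X" "i < d" "j < d" for M i j
    using mspan_int_mat[OF that(1) X] that by (auto simp: int_mat_def)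
  have sub: "LinearCombinations.submodule F ?N ?A"
  proof (rule LinearCombinations.submodule.intro)
    show "Module.module F ?A" by (rule MA.module_axioms)
    show "?N \<subseteq> carrier ?A" using mspan_int_mat[OF _ X] red_carrier by blast
    show "\<zero>\<^bsub>?A\<^esub> \<in> ?N"
      by (rule image_eqI[OF _ mspan.small[of d "\<lambda>i j. 0"]])
        (auto simp: zero_P mat_algebra_def red_def h_zero)
    show "a \<oplus>\<^bsub>?A\<^esub> b \<in> ?N" if ab: "a \<in> ?N" "b \<in> ?N" for a b
    proof -
      obtain M M' where M: "a = red d M" "M \<in> mspan d ?X" "b = red d M'" "M' \<in> mspan d ?X"
        using ab by blast
      have "a \<oplus>\<^bsub>?A\<^esub> b = red d (\<lambda>i j. M i j + M' i j)"
        unfolding M(1,3) using int[OF M(2)] int[OF M(4)]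
        by (intro mat_algebra_eqI[of _ d])
          (auto simp: mat_algebra_dim mat_algebra_index red_simps h_add)
      then show ?thesis using mspan.add[OF M(2,4)] by blast
    qed
    show "c \<odot>\<^bsub>?A\<^esub> a \<in> ?N" if c: "c \<in> carrier F" and a: "a \<in> ?N" for c a
    proof -
      obtain M where M: "a = red d M" "M \<in> mspan d ?X" using a by blast
      obtain c' where c': "c = h c'" "c' \<in> R" using c h_surj by blast
      have "c \<odot>\<^bsub>?A\<^esub> a = red d (\<lambda>i j. c' * M i j)"
        unfolding M(1) c'(1) using int[OF M(2)] c'(2)
        by (intro mat_algebra_eqI[of _ d])
          (auto simp: mat_algebra_dim[OF red_simps(1) red_simps(1)]
              mat_algebra_index[OF red_simps(1) red_simps(1)] red_simps h_mult)
      then show ?thesis using mspan.scale[OF c'(2) M(2)] by blast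
    qed
  qed
  have S': "red d ` S \<subseteq> carrier ?A" using S red_carrier by blast
  have pow: "set_pow ?A (red d ` S) i = red d ` words d S i" for i by (rule red_words[OF S])
  have carr: "red d ` words d S i \<subseteq> carrier ?A" for i using words_int[OF S] red_carrier by blast
  have "red d w \<in> MA.span (\<Union>n\<in>{1..}. set_pow ?A (red d ` S) n)"
    using w n carr unfolding pow by (intro subsetD[OF MA.in_own_span]) auto
  then have "red d w \<in> MA.span (\<Union>i\<in>{1..k}. set_pow ?A (red d ` S) i)"
    using span field_F S' unfolding powers_span_def generated_algebra_def by blast
  moreover have "(\<Union>i\<in>{1..k}. set_pow ?A (red d ` S) i) \<subseteq> ?N"
    unfolding pow using mspan.base[of _ ?X d] by blast
  ultimately have "red d w \<in> ?N" using MA.span_is_subset[OF _ sub] by blast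
  then obtain M where M: "red d w = red d M" "M \<in> mspan d ?X" by blast
  have wR: "w i j \<in> R" if "i < d" "j < d" for i j
    using w words_int[OF S, of n] that by (auto simp: int_mat_def)
  have "w i j - M i j \<in> P" if ij: "i < d" "j < d" for i j
  proof -
    have "h (w i j) = h (M i j)" using M(1) red_simps(2)[OF ij] by metis
    then show ?thesis using h_eq_cong[OF wR[OF ij] int[OF M(2) ij]] by (simp add: cong_def)
  qed
  then have "(\<lambda>i j. w i j - M i j) \<in> mspan d ?X" by (rule mspan.small)
  from mspan.add[OF this M(2)] show "w \<in> mspan d ?X" by simp
qed

end

section \<open>Existence of the number \<open>ell\<close>\<close>

lemma mat_algebra_mult_distrib:
  assumes F: "field F" and s: "s \<in> carrier (mat_algebra F d)"
    and A: "A \<in> carrier (mat_algebra F d)" and B: "B \<in> carrier (mat_algebra F d)"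
  shows "s \<otimes>\<^bsub>mat_algebra F d\<^esub> (A \<oplus>\<^bsub>mat_algebra F d\<^esub> B) =
      s \<otimes>\<^bsub>mat_algebra F d\<^esub> A \<oplus>\<^bsub>mat_algebra F d\<^esub> s \<otimes>\<^bsub>mat_algebra F d\<^esub> B"
    and "c \<in> carrier F \<Longrightarrow> s \<otimes>\<^bsub>mat_algebra F d\<^esub> (c \<odot>\<^bsub>mat_algebra F d\<^esub> A) =
      c \<odot>\<^bsub>mat_algebra F d\<^esub> (s \<otimes>\<^bsub>mat_algebra F d\<^esub> A)"
    and "s \<otimes>\<^bsub>mat_algebra F d\<^esub> \<zero>\<^bsub>mat_algebra F d\<^esub> = \<zero>\<^bsub>mat_algebra F d\<^esub>"
proof -
  interpret F: field F by (rule F)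
  let ?A = "mat_algebra F d"
  note carr = s A B[unfolded mat_algebra_carrier]
  have dims: "s \<in> carrier_mat d d" "A \<in> carrier_mat d d" "B \<in> carrier_mat d d"
    using s A B by (auto simp: mat_algebra_carrier)
  have ent: "s $$ (i, j) \<in> carrier F" "A $$ (i, j) \<in> carrier F" "B $$ (i, j) \<in> carrier F"
    if "i < d" "j < d" for i j using s A B that by (auto simp: mat_algebra_carrier)
  note idx = mat_algebra_mult_index[OF dims(1) _ _ _ F.ring_axioms] mat_algebra_index mat_algebra_dim
  show "s \<otimes>\<^bsub>?A\<^esub> (A \<oplus>\<^bsub>?A\<^esub> B) = s \<otimes>\<^bsub>?A\<^esub> A \<oplus>\<^bsub>?A\<^esub> s \<otimes>\<^bsub>?A\<^esub> B"
  proof (rule mat_algebra_eqI[of _ d])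
    fix i j assume ij: "i < d" "j < d"
    have "(s \<otimes>\<^bsub>?A\<^esub> (A \<oplus>\<^bsub>?A\<^esub> B)) $$ (i, j) =
        (\<Oplus>\<^bsub>F\<^esub>k\<in>{0..<d}. s $$ (i, k) \<otimes>\<^bsub>F\<^esub> A $$ (k, j) \<oplus>\<^bsub>F\<^esub> s $$ (i, k) \<otimes>\<^bsub>F\<^esub> B $$ (k, j))"
    proof -
      have AB: "(A \<oplus>\<^bsub>?A\<^esub> B) $$ (k, j) = A $$ (k, j) \<oplus>\<^bsub>F\<^esub> B $$ (k, j)" if "k < d" for k
        using mat_algebra_index(1)[OF dims(2,3) that ij(2)] .
      have "(s \<otimes>\<^bsub>?A\<^esub> (A \<oplus>\<^bsub>?A\<^esub> B)) $$ (i, j) =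
          (\<Oplus>\<^bsub>F\<^esub>k\<in>{0..<d}. s $$ (i, k) \<otimes>\<^bsub>F\<^esub> (A \<oplus>\<^bsub>?A\<^esub> B) $$ (k, j))"
        using ij dims ent by (intro idx(1)) (auto simp: mat_algebra_dim mat_algebra_index(1)[OF dims(2,3)])
      also have "\<dots> = (\<Oplus>\<^bsub>F\<^esub>k\<in>{0..<d}. s $$ (i, k) \<otimes>\<^bsub>F\<^esub> A $$ (k, j) \<oplus>\<^bsub>F\<^esub> s $$ (i, k) \<otimes>\<^bsub>F\<^esub> B $$ (k, j))"
        by (intro F.finsum_cong' refl) (use ij ent in \<open>auto simp: AB F.r_distr simp del: F.finsum_addf\<close>)
      finally show ?thesis .
    qed
    also have "\<dots> = (\<Oplus>\<^bsub>F\<^esub>k\<in>{0..<d}. s $$ (i, k) \<otimes>\<^bsub>F\<^esub> A $$ (k, j)) \<oplus>\<^bsub>F\<^esub>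
        (\<Oplus>\<^bsub>F\<^esub>k\<in>{0..<d}. s $$ (i, k) \<otimes>\<^bsub>F\<^esub> B $$ (k, j))"
      using ij ent by (intro F.finsum_addf) auto
    also have "\<dots> = (s \<otimes>\<^bsub>?A\<^esub> A \<oplus>\<^bsub>?A\<^esub> s \<otimes>\<^bsub>?A\<^esub> B) $$ (i, j)"
    proof -
      have "(s \<otimes>\<^bsub>?A\<^esub> A) $$ (i, j) = (\<Oplus>\<^bsub>F\<^esub>k\<in>{0..<d}. s $$ (i, k) \<otimes>\<^bsub>F\<^esub> A $$ (k, j))"
        "(s \<otimes>\<^bsub>?A\<^esub> B) $$ (i, j) = (\<Oplus>\<^bsub>F\<^esub>k\<in>{0..<d}. s $$ (i, k) \<otimes>\<^bsub>F\<^esub> B $$ (k, j))"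
        by (rule idx(1)[OF dims(2) ij] idx(1)[OF dims(3) ij]; rule ent; assumption)+
      then show ?thesis
        using mat_algebra_index(1)[OF mat_algebra_dim(1)[OF dims(1,2), of F] mat_algebra_dim(1)[OF dims(1,3), of F] ij, of F]
        by (simp only:)
    qed
    finally show "(s \<otimes>\<^bsub>?A\<^esub> (A \<oplus>\<^bsub>?A\<^esub> B)) $$ (i, j) = (s \<otimes>\<^bsub>?A\<^esub> A \<oplus>\<^bsub>?A\<^esub> s \<otimes>\<^bsub>?A\<^esub> B) $$ (i, j)" .
  qed (use dims in \<open>auto simp: mat_algebra_dim\<close>)
  show "s \<otimes>\<^bsub>?A\<^esub> (c \<odot>\<^bsub>?A\<^esub> A) = c \<odot>\<^bsub>?A\<^esub> (s \<otimes>\<^bsub>?A\<^esub> A)" if c: "c \<in> carrier F"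
  proof (rule mat_algebra_eqI[of _ d])
    fix i j assume ij: "i < d" "j < d"
    have cA: "(c \<odot>\<^bsub>?A\<^esub> A) $$ (k, j) = c \<otimes>\<^bsub>F\<^esub> A $$ (k, j)" if "k < d" for k
      using mat_algebra_index(2)[OF dims(2,2) that ij(2)] .
    have "(s \<otimes>\<^bsub>?A\<^esub> (c \<odot>\<^bsub>?A\<^esub> A)) $$ (i, j) =
        (\<Oplus>\<^bsub>F\<^esub>k\<in>{0..<d}. s $$ (i, k) \<otimes>\<^bsub>F\<^esub> (c \<odot>\<^bsub>?A\<^esub> A) $$ (k, j))"
      using ij dims ent c
      by (intro idx(1)) (auto simp: mat_algebra_dim mat_algebra_index(2)[OF dims(2,2)])
    also have "\<dots> = (\<Oplus>\<^bsub>F\<^esub>k\<in>{0..<d}. c \<otimes>\<^bsub>F\<^esub> (s $$ (i, k) \<otimes>\<^bsub>F\<^esub> A $$ (k, j)))"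
      using ij dims ent c by (intro F.finsum_cong') (auto simp: cA F.m_lcomm)
    also have "\<dots> = c \<otimes>\<^bsub>F\<^esub> (\<Oplus>\<^bsub>F\<^esub>k\<in>{0..<d}. s $$ (i, k) \<otimes>\<^bsub>F\<^esub> A $$ (k, j))"
      using ij ent c by (intro F.finsum_rdistr[symmetric]) auto
    also have "\<dots> = (c \<odot>\<^bsub>?A\<^esub> (s \<otimes>\<^bsub>?A\<^esub> A)) $$ (i, j)"
    proof -
      have "(s \<otimes>\<^bsub>?A\<^esub> A) $$ (i, j) = (\<Oplus>\<^bsub>F\<^esub>k\<in>{0..<d}. s $$ (i, k) \<otimes>\<^bsub>F\<^esub> A $$ (k, j))"
        by (rule idx(1)[OF dims(2) ij]; rule ent; assumption)
      then show ?thesis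
        using mat_algebra_index(2)[OF dims(1) mat_algebra_dim(1)[OF dims(1,2), of F] ij, of F c] by (simp only:)
    qed
    finally show "(s \<otimes>\<^bsub>?A\<^esub> (c \<odot>\<^bsub>?A\<^esub> A)) $$ (i, j) = (c \<odot>\<^bsub>?A\<^esub> (s \<otimes>\<^bsub>?A\<^esub> A)) $$ (i, j)" .
  qed (use dims in \<open>auto simp: mat_algebra_dim\<close>)
  show "s \<otimes>\<^bsub>?A\<^esub> \<zero>\<^bsub>?A\<^esub> = \<zero>\<^bsub>?A\<^esub>"
  proof (rule mat_algebra_eqI[of _ d])
    fix i j assume ij: "i < d" "j < d"
    have z: "\<zero>\<^bsub>?A\<^esub> \<in> carrier_mat d d" using mat_algebra_dim(4)[OF dims(1,1)] .
    have "(s \<otimes>\<^bsub>?A\<^esub> \<zero>\<^bsub>?A\<^esub>) $$ (i, j) = (\<Oplus>\<^bsub>F\<^esub>k\<in>{0..<d}. s $$ (i, k) \<otimes>\<^bsub>F\<^esub> \<zero>\<^bsub>?A\<^esub> $$ (k, j))"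
      using ij dims ent z by (intro idx(1)) (auto simp: mat_algebra_index(3)[OF dims(1,1)])
    also have "\<dots> = (\<Oplus>\<^bsub>F\<^esub>k\<in>{0..<d}. \<zero>\<^bsub>F\<^esub>)"
      using ij ent by (intro F.finsum_cong') (auto simp: mat_algebra_index(3)[OF dims(1,1)])
    finally show "(s \<otimes>\<^bsub>?A\<^esub> \<zero>\<^bsub>?A\<^esub>) $$ (i, j) = \<zero>\<^bsub>?A\<^esub> $$ (i, j)"
      using ij by (simp add: mat_algebra_index(3)[OF dims(1,1)])
  qed (use dims mat_algebra_dim(4)[OF dims(1,1)] in \<open>auto simp: mat_algebra_dim\<close>)
qed

text \<open>Leading positions of matrices read row by row as vectors of length d * d, so there are
  at most d * d of them.\<close>

definition mat_pivots :: "('f, 'c) ring_scheme \<Rightarrow> nat \<Rightarrow> 'f mat set \<Rightarrow> nat set" where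
  "mat_pivots F d U = {p. p < d * d \<and> (\<exists>A\<in>U. A $$ (p div d, p mod d) \<noteq> \<zero>\<^bsub>F\<^esub> \<and>
     (\<forall>q<p. A $$ (q div d, q mod d) = \<zero>\<^bsub>F\<^esub>))}"

text \<open>The same elimination as in \<open>finite_length_coordinates\<close>, now over a field
  record. It limits the length of strict chains of spaces of matrices.\<close>

lemma card_mat_pivots_less:
  assumes F: "field F" and U: "LinearCombinations.submodule F U (mat_algebra F d)"
    and W: "LinearCombinations.submodule F W (mat_algebra F d)" and UW: "U \<subset> W"
  shows "card (mat_pivots F d U) < card (mat_pivots F d W)"
proof -
  interpret F: field F by (rule F)
  let ?A = "mat_algebra F d"
  interpret U: LinearCombinations.submodule F U ?A by (rule U)
  interpret W: LinearCombinations.submodule F W ?A by (rule W)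
  let ?e = "\<lambda>A p. A $$ (p div d, p mod d)"
  have pd: "p div d < d" "p mod d < d" if "p < d * d" for p
    using that less_mult_imp_div_less[OF that] by (cases "d = 0"; simp)+
  have ec: "?e A p \<in> carrier F" if "A \<in> W" "p < d * d" for A p
    using that W.subset pd by (auto simp: mat_algebra_carrier)
  have dim: "A \<in> carrier_mat d d" if "A \<in> W" for A using that W.subset by (auto simp: mat_algebra_carrier)
  have mono: "mat_pivots F d U \<subseteq> mat_pivots F d W" using UW unfolding mat_pivots_def by blast
  have fin: "finite (mat_pivots F d W)" by (simp add: mat_pivots_def)
  have "mat_pivots F d U \<noteq> mat_pivots F d W"
  proof
    assume eq: "mat_pivots F d U = mat_pivots F d W"
    have "A \<in> U" if "A \<in> W" "\<forall>q<d * d - k. ?e A q = \<zero>\<^bsub>F\<^esub>" "k \<le> d * d" for A k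
      using that
    proof (induction k arbitrary: A)
      case 0
      have "A = \<zero>\<^bsub>?A\<^esub>"
      proof (rule mat_algebra_eqI[OF dim[OF 0(1)]])
        show "\<zero>\<^bsub>?A\<^esub> \<in> carrier_mat d d" by (simp add: mat_algebra_def)
        fix i j assume ij: "i < d" "j < d"
        have "i * d + j < Suc i * d" using ij by simp
        also have "\<dots> \<le> d * d" using ij by (intro mult_right_mono) auto
        finally have "i * d + j < d * d" .
        moreover have "(i * d + j) div d = i" "(i * d + j) mod d = j" using ij by auto
        ultimately have "A $$ (i, j) = \<zero>\<^bsub>F\<^esub>" using 0(2) by fastforce
        then show "A $$ (i, j) = \<zero>\<^bsub>?A\<^esub> $$ (i, j)" using ij by (simp add: mat_algebra_def)
      qed
      then show ?case by simp
    next
      case (Suc k)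
      define p where "p = d * d - Suc k"
      have p: "p < d * d" "d * d - k = Suc p" using Suc.prems(3) by (auto simp: p_def)
      show ?case
      proof (cases "?e A p = \<zero>\<^bsub>F\<^esub>")
        case True
        then have "\<forall>q<d * d - k. ?e A q = \<zero>\<^bsub>F\<^esub>"
          using Suc.prems(2) unfolding p(2) by (auto simp: p_def less_Suc_eq)
        then show ?thesis using Suc by auto
      next
        case False
        then have "p \<in> mat_pivots F d U"
          unfolding eq using p Suc.prems by (auto simp: mat_pivots_def p_def)
        then obtain B where B: "B \<in> U" "?e B p \<noteq> \<zero>\<^bsub>F\<^esub>" "\<forall>q<p. ?e B q = \<zero>\<^bsub>F\<^esub>"
          by (auto simp: mat_pivots_def)
        have BW: "B \<in> W" using B(1) UW by blast
        define t where "t = ?e A p \<otimes>\<^bsub>F\<^esub> inv\<^bsub>F\<^esub> (?e B p)"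
        have inv: "inv\<^bsub>F\<^esub> (?e B p) \<in> carrier F" "inv\<^bsub>F\<^esub> (?e B p) \<otimes>\<^bsub>F\<^esub> ?e B p = \<one>\<^bsub>F\<^esub>"
          using B(2) ec[OF BW p(1)] F.field_Units by auto
        have t: "t \<in> carrier F" "t \<otimes>\<^bsub>F\<^esub> ?e B p = ?e A p"
          unfolding t_def using inv ec[OF BW p(1)] ec[OF Suc.prems(1) p(1)]
          by (auto simp: F.m_assoc)
        have tB: "t \<odot>\<^bsub>?A\<^esub> B \<in> U" using B(1) t(1) by simp
        have mtB: "(\<ominus>\<^bsub>F\<^esub> t) \<odot>\<^bsub>?A\<^esub> B \<in> U" using B(1) t(1) by simp
        define C where "C = A \<oplus>\<^bsub>?A\<^esub> (\<ominus>\<^bsub>F\<^esub> t) \<odot>\<^bsub>?A\<^esub> B"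
        have CW: "C \<in> W" unfolding C_def using Suc.prems(1) mtB UW by blast
        have eC: "?e C q = ?e A q \<oplus>\<^bsub>F\<^esub> (\<ominus>\<^bsub>F\<^esub> t) \<otimes>\<^bsub>F\<^esub> ?e B q" if "q < d * d" for q
          unfolding C_def using pd[OF that] dim[OF Suc.prems(1)] dim[OF BW]
          by (simp add: mat_algebra_index mat_algebra_dim)
        have "\<forall>q<d * d - k. ?e C q = \<zero>\<^bsub>F\<^esub>"
        proof (intro allI impI)
          fix q assume q: "q < d * d - k"
          then have qd: "q < d * d" by simp
          show "?e C q = \<zero>\<^bsub>F\<^esub>"
          proof (cases "q = p")
            case True
            then show ?thesis unfolding eC[OF qd] using t ec[OF BW p(1)] ec[OF Suc.prems(1) p(1)]
              by (simp add: F.l_minus F.r_neg)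
          next
            case False
            then have "q < p" using q p by linarith
            then show ?thesis unfolding eC[OF qd] using Suc.prems(2) B(3) t(1) by (simp add: p_def)
          qed
        qed
        then have CU: "C \<in> U" by (rule Suc.IH[OF CW _ Suc_leD[OF Suc.prems(3)]])
        have "A = C \<oplus>\<^bsub>?A\<^esub> t \<odot>\<^bsub>?A\<^esub> B"
        proof (rule mat_algebra_eqI[OF dim[OF Suc.prems(1)]])
          show "C \<oplus>\<^bsub>?A\<^esub> t \<odot>\<^bsub>?A\<^esub> B \<in> carrier_mat d d"
            using dim[OF CW] dim[OF BW] by (simp add: mat_algebra_dim)
          fix i j assume ij: "i < d" "j < d"
          have AB: "A $$ (i, j) \<in> carrier F" "B $$ (i, j) \<in> carrier F"
            using subsetD[OF W.subset Suc.prems(1)] subsetD[OF W.subset BW] ij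
            unfolding mat_algebra_carrier by blast+
          have tBc: "(c \<odot>\<^bsub>?A\<^esub> B) \<in> carrier_mat d d" for c
            using dim[OF BW] by (simp add: mat_algebra_dim(3)[OF _ dim[OF BW]])
          have "C $$ (i, j) = A $$ (i, j) \<oplus>\<^bsub>F\<^esub> (\<ominus>\<^bsub>F\<^esub> t) \<otimes>\<^bsub>F\<^esub> B $$ (i, j)"
            unfolding C_def mat_algebra_index(1)[OF dim[OF Suc.prems(1)] tBc ij]
              mat_algebra_index(2)[OF dim[OF BW] dim[OF BW] ij] ..
          moreover have "(C \<oplus>\<^bsub>?A\<^esub> t \<odot>\<^bsub>?A\<^esub> B) $$ (i, j) = C $$ (i, j) \<oplus>\<^bsub>F\<^esub> t \<otimes>\<^bsub>F\<^esub> B $$ (i, j)"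
            unfolding mat_algebra_index(1)[OF dim[OF CW] tBc ij]
              mat_algebra_index(2)[OF dim[OF BW] dim[OF BW] ij] ..
          moreover have "A $$ (i, j) \<oplus>\<^bsub>F\<^esub> (\<ominus>\<^bsub>F\<^esub> t) \<otimes>\<^bsub>F\<^esub> B $$ (i, j) \<oplus>\<^bsub>F\<^esub> t \<otimes>\<^bsub>F\<^esub> B $$ (i, j) = A $$ (i, j)"
            using AB t(1) by (simp add: F.l_minus F.a_assoc F.l_neg)
          ultimately show "A $$ (i, j) = (C \<oplus>\<^bsub>?A\<^esub> t \<odot>\<^bsub>?A\<^esub> B) $$ (i, j)" by (simp only:)
        qed
        then show ?thesis using CU tB by simp
      qed
    qed
    from this[of _ "d * d"] have "W \<subseteq> U" by auto
    then show False using UW by blast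
  qed
  then show ?thesis using mono fin by (intro psubset_card_mono) auto
qed

text \<open>The spans of the words up to length k increase with k and must repeat; from the first
  repetition on, multiplication by a generator leads no further. The bound is crude: it serves to
  make the least number in \<open>ell\<close> exist.\<close>

lemma powers_span_exists: "powers_span TYPE('f) d (d * d + 2)"
  unfolding powers_span_def
proof (intro allI impI)
  fix F :: "'f ring" and S
  assume F: "field F" and S: "S \<subseteq> carrier (mat_algebra F d)"
  let ?A = "mat_algebra F d"
  interpret F: field F by (rule F)
  interpret MA: Module.module F ?A by (rule mat_algebra_module[OF F])
  define V where "V k = MA.span (\<Union>i\<in>{1..k}. set_pow ?A S i)" for k
  have pow: "set_pow ?A S n \<subseteq> carrier ?A" for n by (rule set_pow_subset[OF F.ring_axioms S])
  have subV: "LinearCombinations.submodule F (V k) ?A" for k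
    unfolding V_def using pow by (intro MA.span_is_submodule) blast
  have mono: "V k \<subseteq> V l" if "k \<le> l" for k l
    unfolding V_def using that by (intro MA.span_is_monotone) force
  have inV: "set_pow ?A S i \<subseteq> V k" if "i \<in> {1..k}" for i k
    unfolding V_def using that pow by (intro order_trans[OF _ MA.in_own_span]) auto
  \<comment> \<open>d * d + 1 strict inclusions would force more than d * d pivots. Counting starts
    at 1 so that \<open>V k\<close> contains the generators.\<close>
  have "\<exists>k\<in>{1..d * d + 1}. V k = V (Suc k)"
  proof (rule ccontr)
    assume neg: "\<not> ?thesis"
    have "k \<le> card (mat_pivots F d (V (Suc k)))" if "k \<le> d * d + 1" for k
      using that
    proof (induction k)
      case (Suc k)
      have "V (Suc k) \<subset> V (Suc (Suc k))" using neg mono[of "Suc k" "Suc (Suc k)"] Suc.prems by auto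
      from card_mat_pivots_less[OF F subV subV this] show ?case using Suc by simp
    qed simp
    from this[of "d * d + 1"] have "d * d + 1 \<le> card (mat_pivots F d (V (Suc (d * d + 1))))" by simp
    moreover have "card (mat_pivots F d (V (Suc (d * d + 1)))) \<le> card {..<d * d}"
      by (intro card_mono) (auto simp: mat_pivots_def)
    ultimately show False by simp
  qed
  then obtain k where k: "1 \<le> k" "k \<le> d * d + 1" "V k = V (Suc k)" by auto
  have step: "s \<otimes>\<^bsub>?A\<^esub> w \<in> V (Suc k)" if s: "s \<in> S" and w: "w \<in> V k" for s w
  proof -
    interpret W: LinearCombinations.submodule F "V (Suc k)" ?A by (rule subV)
    have sc: "s \<in> carrier ?A" using s S by blast
    let ?N = "{w \<in> carrier ?A. s \<otimes>\<^bsub>?A\<^esub> w \<in> V (Suc k)}"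
    have "LinearCombinations.submodule F ?N ?A"
    proof (rule LinearCombinations.submodule.intro)
      show "Module.module F ?A" by (rule MA.module_axioms)
    qed (auto simp: mat_algebra_mult_distrib(1,2)[OF F sc] mat_algebra_mult_distrib(3)[OF F sc sc sc])
    moreover have "set_pow ?A S i \<subseteq> ?N" if "i \<in> {1..k}" for i
    proof
      fix w assume w: "w \<in> set_pow ?A S i"
      then have "s \<otimes>\<^bsub>?A\<^esub> w \<in> set_pow ?A S (Suc i)" using s by (auto simp: set_mult_def)
      then show "w \<in> ?N" using w pow[of i] inV[of "Suc i" "Suc k"] that by auto
    qed
    ultimately have "V k \<subseteq> ?N" unfolding V_def by (intro MA.span_is_subset) blast
    then show ?thesis using w by blast
  qed
  have "set_pow ?A S n \<subseteq> V k" if "n \<ge> 1" for n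
    using that
  proof (induction n)
    case (Suc n)
    show ?case
    proof (cases "n = 0")
      case True
      then show ?thesis using inV[of "Suc n" k] k(1) by (simp del: set_pow.simps)
    next
      case False
      then show ?thesis using Suc.IH step k(3) by (auto simp: set_mult_def)
    qed
  qed simp
  then have "generated_algebra F ?A S \<subseteq> V k"
    unfolding generated_algebra_def by (intro MA.span_is_subset[OF _ subV]) blast
  also have "V k \<subseteq> V (d * d + 2)" using k(2) by (intro mono) simp
  finally have 1: "generated_algebra F ?A S \<subseteq> V (d * d + 2)" .
  have "V (d * d + 2) \<subseteq> generated_algebra F ?A S"
    unfolding generated_algebra_def V_def by (intro MA.span_is_monotone) auto
  with 1 show "MA.span (\<Union>i\<in>{1..d * d + 2}. set_pow ?A S i) = generated_algebra F ?A S"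
    unfolding V_def by blast
qed

text \<open>\<open>ell\<close> is defined by fields on \<open>nat\<close>, whereas the residue
  fields below have sets of sequences as elements.\<close>

lemma powers_span_ell: "powers_span TYPE('f) d (ell d)"
proof (rule powers_span_transfer[where 'u = nat])
  show "powers_span TYPE(nat) d (ell d)" unfolding ell_def by (rule LeastI, rule powers_span_exists)
qed simp

section \<open>The residue field as a quotient record\<close>

context closed_residue_field begin

definition val_ring :: "'r ring" where
  "val_ring = \<lparr>carrier = R, mult = (*), one = 1, zero = 0, add = (+)\<rparr>"

lemma val_ring_simps:
  "carrier val_ring = R" "x \<otimes>\<^bsub>val_ring\<^esub> y = x * y" "\<one>\<^bsub>val_ring\<^esub> = 1" "\<zero>\<^bsub>val_ring\<^esub> = 0"
  "x \<oplus>\<^bsub>val_ring\<^esub> y = x + y"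
  by (simp_all add: val_ring_def)

lemma cring_val_ring: "cring val_ring"
proof (rule cringI)
  show "abelian_group val_ring"
  proof (rule abelian_groupI)
    fix x assume "x \<in> carrier val_ring"
    then show "\<exists>y\<in>carrier val_ring. y \<oplus>\<^bsub>val_ring\<^esub> x = \<zero>\<^bsub>val_ring\<^esub>"
      by (intro bexI[of _ "- x"]) (auto simp: val_ring_simps uminus_R)
  qed (auto simp: val_ring_simps add_R zero_R add.assoc add.commute)
  show "comm_monoid val_ring"
    by (rule comm_monoidI) (auto simp: val_ring_simps mult_R one_R mult.assoc mult.commute)
qed (auto simp: val_ring_simps distrib_right)

lemma ideal_P: "ideal P val_ring"
proof (rule idealI)
  interpret cring val_ring by (rule cring_val_ring)
  show "ring val_ring" by (rule ring_axioms)
  have inv: "inv\<^bsub>add_monoid val_ring\<^esub> a = - a" if "a \<in> R" for a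
    unfolding a_inv_def[symmetric] using that by (intro minus_equality) (auto simp: val_ring_simps uminus_R)
  show "subgroup P (add_monoid val_ring)"
  proof (rule subgroup.intro)
    show "inv\<^bsub>add_monoid val_ring\<^esub> x \<in> P" if "x \<in> P" for x
      using inv[OF P_R[OF that]] uminus_P[OF that] by (simp only:)
  qed (auto simp: val_ring_simps P_R zero_P add_P)
qed (auto simp: val_ring_simps mult_P mult_P')

text \<open>An element outside \<open>P\<close> is invertible up to \<open>P\<close>, so an ideal
  containing it together with \<open>P\<close> contains 1.\<close>

lemma maximalideal_P: "maximalideal P val_ring"
proof (rule maximalidealI[OF ideal_P])
  show "carrier val_ring \<noteq> P" using one_R one_P by (auto simp: val_ring_simps)
  fix J assume J: "ideal J val_ring" "P \<subseteq> J" "J \<subseteq> carrier val_ring"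
  interpret J: ideal J val_ring by (rule J(1))
  show "J = P \<or> J = carrier val_ring"
  proof (cases "J \<subseteq> P")
    case False
    then obtain a where a: "a \<in> J" "a \<notin> P" by blast
    then have "a \<in> R" using J(3) by (auto simp: val_ring_simps)
    then obtain b where b: "b \<in> R" "a * b - 1 \<in> P" using inverse_mod a(2) by blast
    have "a * b \<in> J" using J.I_r_closed[OF a(1), of b] b(1) by (simp add: val_ring_simps)
    moreover have "1 - a * b \<in> J" using uminus_P[OF b(2)] J(2) by auto
    ultimately have "a * b \<oplus>\<^bsub>val_ring\<^esub> (1 - a * b) \<in> J" by (rule additive_subgroup.a_closed[OF J.additive_subgroup_axioms])
    then have "\<one>\<^bsub>val_ring\<^esub> \<in> J" by (simp add: val_ring_simps)
    then show ?thesis using J.one_imp_carrier by blast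
  qed (use J in blast)
qed

lemma residue_field_map_quotient:
  "residue_field_map R P (val_ring Quot P) (\<lambda>a. P +>\<^bsub>val_ring\<^esub> a)"
proof (intro residue_field_map.intro residue_field_map_axioms.intro)
  show "closed_residue_field R P" by (rule closed_residue_field_axioms)
  interpret cring val_ring by (rule cring_val_ring)
  interpret P: ideal P val_ring by (rule ideal_P)
  interpret h: ring_hom_ring val_ring "val_ring Quot P" "(+>\<^bsub>val_ring\<^esub>) P"
    by (rule P.rcos_ring_hom_ring)
  show "field (val_ring Quot P)"
    by (rule maximalideal.quotient_is_field[OF maximalideal_P cring_val_ring])
  show "P +>\<^bsub>val_ring\<^esub> a \<in> carrier (val_ring Quot P)" if "a \<in> R" for a
    using h.hom_closed[of a] that by (simp add: val_ring_simps)
  show "P +>\<^bsub>val_ring\<^esub> (a + b) = (P +>\<^bsub>val_ring\<^esub> a) \<oplus>\<^bsub>val_ring Quot P\<^esub> (P +>\<^bsub>val_ring\<^esub> b)"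
    if "a \<in> R" "b \<in> R" for a b
    using h.hom_add[of a b] that by (simp add: val_ring_simps)
  show "P +>\<^bsub>val_ring\<^esub> (a * b) = (P +>\<^bsub>val_ring\<^esub> a) \<otimes>\<^bsub>val_ring Quot P\<^esub> (P +>\<^bsub>val_ring\<^esub> b)"
    if "a \<in> R" "b \<in> R" for a b
    using h.hom_mult[of a b] that by (simp add: val_ring_simps)
  show "P +>\<^bsub>val_ring\<^esub> 1 = \<one>\<^bsub>val_ring Quot P\<^esub>"
    using h.hom_one by (simp add: val_ring_simps)
  show "carrier (val_ring Quot P) \<subseteq> (\<lambda>a. P +>\<^bsub>val_ring\<^esub> a) ` R"
    by (auto simp: FactRing_def A_RCOSETS_def' val_ring_simps)
  show "P +>\<^bsub>val_ring\<^esub> a = \<zero>\<^bsub>val_ring Quot P\<^esub> \<longleftrightarrow> a \<in> P" if "a \<in> R" for a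
    using that P.rcos_const_imp_mem[of a] a_rcos_zero[OF ideal_P, of a]
    by (auto simp: FactRing_def val_ring_simps)
qed

text \<open>Over the quotient field, \<open>ell\<close> discharges the spanning hypothesis, so only
  the eigenvalues of short words remain to be controlled.\<close>

theorem words_eventually_small_ell:
  assumes S: "S \<subseteq> int_mat d"
    and nil: "\<And>i w. i \<in> {1..ell d} \<Longrightarrow> w \<in> words d S i \<Longrightarrow>
      \<exists>m. \<forall>x\<in>int_vec d. (mat_app d w ^^ m) x \<in> small_vec d"
  shows "\<exists>m. \<forall>w\<in>words d S m. \<forall>i<d. \<forall>j<d. w i j \<in> P"
proof (rule words_eventually_small[OF S _ nil])
  fix n :: nat assume "n \<ge> 1"
  interpret residue_field_map R P "val_ring Quot P" "\<lambda>a. P +>\<^bsub>val_ring\<^esub> a"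
    by (rule residue_field_map_quotient)
  show "words d S n \<subseteq> mspan d (\<Union>i\<in>{1..ell d}. words d S i)"
    by (rule words_in_mspan[OF powers_span_ell S \<open>n \<ge> 1\<close>])
qed

end

section \<open>Nilpotency from eigenvalues that reduce to 0\<close>

context residue_field begin

text \<open>A factor M - l with \<open>l\<close> in \<open>P\<close> agrees with \<open>M\<close>
  modulo \<open>P\<close>. The two starting vectors are allowed to differ by \<open>P\<close>
  because they do so after the first factor.\<close>

lemma fold_small_eigenvalues:
  assumes M: "\<And>i j. i < d \<Longrightarrow> j < d \<Longrightarrow> M i j \<in> R" and ls: "set ls \<subseteq> P"
    and x: "x \<in> int_vec d" and y: "\<And>i. i < d \<Longrightarrow> x i - y i \<in> P" and i: "i < d"
  shows "fold (\<lambda>l z i. mat_app d M z i - l * z i) ls x i - (mat_app d M ^^ length ls) y i \<in> P"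
  using ls x y
proof (induction ls arbitrary: x y)
  case Nil
  then show ?case using i by simp
next
  case (Cons l ls)
  have l: "l \<in> P" and ls: "set ls \<subseteq> P" using Cons.prems by auto
  let ?x = "\<lambda>i. mat_app d M x i - l * x i"
  have x: "x i \<in> R" if "i < d" for i using Cons.prems that by (auto simp: int_vec_def)
  have "?x \<in> int_vec d"
    using x M l P_R by (auto simp: int_vec_def mat_app_def intro!: diff_R sum_R mult_R)
  moreover have "?x i - mat_app d M y i \<in> P" if "i < d" for i
  proof -
    have "?x i - mat_app d M y i = (\<Sum>j<d. M i j * (x j - y j)) - l * x i"
      by (simp add: mat_app_def sum_subtractf algebra_simps)
    also have "\<dots> \<in> P"
      by (rule diff_P, rule sum_P, rule mult_P) (use that x M l Cons.prems(3) in \<open>auto intro: mult_P'\<close>)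
    finally show ?thesis .
  qed
  ultimately have "fold (\<lambda>l z i. mat_app d M z i - l * z i) ls ?x i
      - (mat_app d M ^^ length ls) (mat_app d M y) i \<in> P"
    by (rule Cons.IH[OF ls])
  then show ?case by (simp add: funpow_swap1)
qed

lemma nilpotent_if_small_eigenvalues:
  assumes M: "\<And>i j. i < d \<Longrightarrow> j < d \<Longrightarrow> M i j \<in> R" and ls: "set ls \<subseteq> P"
    and fold: "\<And>x i. x \<in> int_vec d \<Longrightarrow> i < d \<Longrightarrow> fold (\<lambda>l z i. mat_app d M z i - l * z i) ls x i \<in> P"
  shows "\<exists>m. \<forall>x\<in>int_vec d. (mat_app d M ^^ m) x \<in> small_vec d"
proof (intro exI ballI)
  fix x assume x: "x \<in> int_vec d"
  have "(mat_app d M ^^ length ls) x i \<in> P" if i: "i < d" for i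
  proof -
    have "fold (\<lambda>l z i. mat_app d M z i - l * z i) ls x i - (mat_app d M ^^ length ls) x i \<in> P"
      by (rule fold_small_eigenvalues[OF _ ls x _ i]) (auto simp: M zero_P)
    from diff_P[OF fold[OF x i] this] show ?thesis by simp
  qed
  then show "(mat_app d M ^^ length ls) x \<in> small_vec d" by (simp add: small_vec_def)
qed

end

lemma eigenvector_power:
  assumes "\<And>i. i < d \<Longrightarrow> mat_app d M x i = l * x i" "i < d"
  shows "(mat_app d M ^^ m) x i = l ^ m * x i"
  using assms(2)
proof (induction m arbitrary: i)
  case (Suc m)
  have "(mat_app d M ^^ Suc m) x i = (\<Sum>j<d. M i j * (l ^ m * x j))"
    using Suc.IH by (simp add: mat_app_def[of d M "(mat_app d M ^^ m) x"])
  also have "\<dots> = l ^ m * mat_app d M x i"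
    by (simp add: mat_app_def sum_distrib_left mult.left_commute)
  finally show ?case using assms(1)[OF Suc.prems] by (simp add: algebra_simps)
qed simp

lemma eigenvalue_list_mat_app:
  fixes M :: "nat \<Rightarrow> nat \<Rightarrow> 'a::alg_closed_field"
  shows "\<exists>es. (\<Sum>i<d. M i i) = sum_list es \<and> length es = d \<and>
    (\<forall>e\<in>set es. \<exists>x. (\<exists>i<d. x i \<noteq> 0) \<and> (\<forall>i<d. mat_app d M x i = e * x i)) \<and>
    (\<forall>x. \<forall>i<d. fold (\<lambda>e z i. mat_app d M z i - e * z i) es x i = 0)"
proof -
  obtain es where es: "(\<Sum>i<d. M i i) = sum_list es" "length es = card {..<d}"
    "\<forall>e\<in>set es. \<exists>x. (\<exists>i\<in>{..<d}. x i \<noteq> 0) \<and> (\<forall>i\<in>{..<d}. (\<Sum>j<d. M i j * x j) = e * x i)"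
    "\<forall>x. \<forall>i\<in>{..<d}. fold (\<lambda>e z i. (\<Sum>j<d. M i j * z j) - e * z i) es x i = 0"
    using eigenvalue_list[of "{..<d}" M] by blast
  show ?thesis
    by (rule exI[of _ es]) (use es in \<open>simp add: mat_app_def Bex_def Ball_def\<close>)
qed

text \<open>The field as its own residue field. A nilpotent matrix has only the eigenvalue 0, so its
  trace, a sum of eigenvalues, is 0.\<close>

lemma closed_residue_field_trivial:
  "closed_residue_field (UNIV :: 'a::alg_closed_field set) {0}"
proof
  show "\<exists>b\<in>UNIV. a * b - 1 \<in> {0}" if "a \<notin> {0}" for a :: 'a
    using that by (intro bexI[of _ "inverse a"]) auto
  show "\<exists>ls. set ls \<subseteq> UNIV \<and> (\<forall>x i. (\<forall>i<d. x i \<in> UNIV) \<longrightarrow> i < d \<longrightarrow>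
      fold (\<lambda>l z i. mat_app d M z i - l * z i) ls x i \<in> {0})"
    for d and M :: "nat \<Rightarrow> nat \<Rightarrow> 'a"
    using eigenvalue_list_mat_app[of M d] by auto
  show "\<forall>r B m. (\<forall>i<r. \<forall>j<r. B i j \<in> UNIV) \<longrightarrow>
      (\<forall>x i. (\<forall>i<r. x i \<in> UNIV) \<longrightarrow> i < r \<longrightarrow> (mat_app r B ^^ m) x i \<in> {0 :: 'a}) \<longrightarrow>
      (\<Sum>i<r. B i i) \<in> {0}"
  proof (intro allI impI)
    fix r m and B :: "nat \<Rightarrow> nat \<Rightarrow> 'a"
    assume "\<forall>x i. (\<forall>i<r. x i \<in> UNIV) \<longrightarrow> i < r \<longrightarrow> (mat_app r B ^^ m) x i \<in> {0}"
    then have nil: "(mat_app r B ^^ m) x i = 0" if "i < r" for x i using that by simp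
    obtain es where es: "(\<Sum>i<r. B i i) = sum_list es"
      "\<forall>e\<in>set es. \<exists>x. (\<exists>i<r. x i \<noteq> 0) \<and> (\<forall>i<r. mat_app r B x i = e * x i)"
      using eigenvalue_list_mat_app[of B r] by blast
    have "e = 0" if "e \<in> set es" for e
    proof -
      obtain x i where x: "i < r" "x i \<noteq> 0" "\<And>i. i < r \<Longrightarrow> mat_app r B x i = e * x i" using es(2) \<open>e \<in> set es\<close> by blast
      have "e ^ m * x i = 0" using eigenvector_power[of r B x e i m] x nil by simp
      then show ?thesis using x(2) by simp
    qed
    then have "sum_list es = 0" by (induction es) auto
    then show "(\<Sum>i<r. B i i) \<in> {0}" unfolding es(1) by simp
  qed
qed auto

section \<open>Ultraproducts of a non-archimedean field\<close>

lemma sum_fun_apply: "sum f I x = (\<Sum>i\<in>I. f i x)"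
  by (induction I rule: infinite_finite_induct) auto

text \<open>Zorn's lemma gives a minimal proper filter below \<open>F\<close>, since the infimum of
  a chain of proper filters is proper. Minimality decides every predicate: restricting the filter to
  it either makes it improper or changes nothing.\<close>

lemma ultrafilter_exists:
  fixes F :: "'i filter"
  assumes "F \<noteq> bot"
  obtains U where "U \<noteq> bot" "U \<le> F" "\<And>P. eventually P U \<or> eventually (\<lambda>x. \<not> P x) U"
proof -
  let ?A = "{G. G \<noteq> bot \<and> G \<le> F}" and ?le = "\<lambda>G H :: 'i filter. H \<le> G"
  have "\<exists>m\<in>?A. \<forall>a\<in>?A. ?le m a \<longrightarrow> a = m"
  proof (rule predicate_Zorn)
    show "partial_order_on ?A (relation_of ?le ?A)"
      by (auto simp: partial_order_on_def preorder_on_def refl_on_def trans_def antisym_def relation_of_def)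
    fix C assume "C \<in> Chains (relation_of ?le ?A)"
    then have C: "\<And>G. G \<in> C \<Longrightarrow> G \<noteq> bot \<and> G \<le> F" "\<And>G H. G \<in> C \<Longrightarrow> H \<in> C \<Longrightarrow> G \<le> H \<or> H \<le> G"
      by (auto simp: Chains_def relation_of_def)
    show "\<exists>u\<in>?A. \<forall>a\<in>C. ?le a u"
    proof (cases "C = {}")
      case True
      then show ?thesis using assms by auto
    next
      case False
      have "\<exists>x\<in>C. x \<le> inf G H" if "G \<in> C" "H \<in> C" for G H
        using C(2)[OF that] that by auto
      then have "eventually P (Inf C) \<longleftrightarrow> (\<exists>b\<in>C. eventually P b)" for P
        by (rule eventually_Inf_base[OF False])
      then have "Inf C \<noteq> bot" using C(1) by (auto simp: trivial_limit_def)
      moreover have "Inf C \<le> F" using False C(1) by (meson Inf_lower2 ex_in_conv)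
      ultimately show ?thesis by (intro bexI[of _ "Inf C"]) (auto intro: Inf_lower)
    qed
  qed
  then obtain U where U: "U \<noteq> bot" "U \<le> F" "\<And>G. G \<noteq> bot \<Longrightarrow> G \<le> F \<Longrightarrow> G \<le> U \<Longrightarrow> G = U" by auto
  have "eventually P U \<or> eventually (\<lambda>x. \<not> P x) U" for P
  proof (cases "inf U (principal {x. P x}) = bot")
    case True
    then show ?thesis
      by (simp add: trivial_limit_def eventually_inf_principal)
  next
    case False
    then have "inf U (principal {x. P x}) = U" using U(2) by (intro U(3)) (auto intro: le_infI1)
    moreover have "eventually P (inf U (principal {x. P x}))" by (simp add: eventually_inf_principal)
    ultimately show ?thesis by simp
  qed
  then show thesis using that U by blast
qed

section \<open>Rules for the absolute value\<close>

locale nonarch_field =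
  fixes v :: "'a::field \<Rightarrow> real"
  assumes nonarch: "nonarch_absolute_value v"
begin

lemma v_nonneg [simp]: "0 \<le> v x"
  and v_zero_iff [simp]: "v x = 0 \<longleftrightarrow> x = 0"
  and v_mult: "v (x * y) = v x * v y"
  and v_add: "v (x + y) \<le> max (v x) (v y)"
  using nonarch by (auto simp: nonarch_absolute_value_def)

lemma v_zero [simp]: "v 0 = 0" by simp
lemma v_pos_iff [simp]: "0 < v x \<longleftrightarrow> x \<noteq> 0" using v_nonneg[of x] by (auto simp: less_le)
lemma v_one [simp]: "v 1 = 1" using v_mult[of 1 1] by simp
lemma v_power: "v (x ^ n) = v x ^ n" by (induction n) (auto simp: v_mult)
lemma v_minus_one: "v (- 1) = 1"
proof -
  have "v (- 1) ^ 2 = 1" using v_mult[of "- 1" "- 1"] by (simp add: power2_eq_square)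
  then show ?thesis using v_nonneg[of "- 1"] by (auto simp: power2_eq_1_iff)
qed
lemma v_uminus [simp]: "v (- x) = v x" using v_mult[of "- 1" x] v_minus_one by simp
lemma v_inverse: "v (inverse x) = inverse (v x)"
proof (cases "x = 0")
  case False
  then have "v (inverse x) * v x = 1" by (simp flip: v_mult)
  then show ?thesis by (metis inverse_unique mult.commute)
qed simp
lemma v_divide: "v (x / y) = v x / v y" by (simp add: divide_inverse v_mult v_inverse)

lemma v_sum_le: "0 \<le> D \<Longrightarrow> (\<And>i. i \<in> I \<Longrightarrow> v (f i) \<le> D) \<Longrightarrow> v (sum f I) \<le> D"
proof (induction I rule: infinite_finite_induct)
  case (insert i I)
  then show ?case using v_add[of "f i" "sum f I"] by (auto intro: order_trans)
qed auto

end

locale ultra_nonarch_field = nonarch_field v for v :: "'a::alg_closed_field \<Rightarrow> real" +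
  fixes U :: "nat filter"
  assumes U_not_bot: "U \<noteq> bot" and ultra: "eventually P U \<or> eventually (\<lambda>x. \<not> P x) U"
begin

text \<open>Integral and small mean that the absolute values have a limit at most 1, or below 1,
  along the ultrafilter. Factors whose absolute values tend to 1 are thus invisible, as they would
  not be with an inequality at each index.\<close>

definition int_seq :: "(nat \<Rightarrow> 'a) set" where
  "int_seq = {x. \<forall>D>1. eventually (\<lambda>n. v (x n) \<le> D) U}"
definition small_seq :: "(nat \<Rightarrow> 'a) set" where
  "small_seq = {x. \<exists>D<1. eventually (\<lambda>n. v (x n) \<le> D) U}"

lemma R_I: "(\<And>D. D > 1 \<Longrightarrow> eventually (\<lambda>n. v (x n) \<le> D) U) \<Longrightarrow> x \<in> int_seq" by (simp add: int_seq_def)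
lemma R_D: "x \<in> int_seq \<Longrightarrow> D > 1 \<Longrightarrow> eventually (\<lambda>n. v (x n) \<le> D) U" by (simp add: int_seq_def)
lemma P_I: "D < 1 \<Longrightarrow> eventually (\<lambda>n. v (x n) \<le> D) U \<Longrightarrow> x \<in> small_seq" by (auto simp: small_seq_def)

lemma P_D: assumes "x \<in> small_seq" obtains D where "0 < D" "D < 1" "eventually (\<lambda>n. v (x n) \<le> D) U"
proof -
  obtain D where D: "D < 1" "eventually (\<lambda>n. v (x n) \<le> D) U" using assms by (auto simp: small_seq_def)
  have "eventually (\<lambda>n. v (x n) \<le> max D (1/2)) U" using D(2) by (rule eventually_mono) auto
  then show ?thesis using D(1) by (intro that[of "max D (1/2)"]) auto
qed

lemma bounded_R: "(\<And>n. v (x n) \<le> 1) \<Longrightarrow> x \<in> int_seq"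
  by (intro R_I always_eventually) (meson less_imp_le order_trans)

text \<open>Inverses rest on the ultrafilter: a sequence that is not small exceeds every bound below
  1 along it, so its pointwise inverse is integral.\<close>

sublocale residue_field int_seq small_seq
proof
  show "1 \<in> int_seq" "- 1 \<in> int_seq" by (auto intro: bounded_R simp: v_minus_one one_fun_def)
  show "a + b \<in> int_seq" if "a \<in> int_seq" "b \<in> int_seq" for a b
  proof (rule R_I)
    fix D :: real assume D: "D > 1"
    show "eventually (\<lambda>n. v ((a + b) n) \<le> D) U"
      using R_D[OF that(1) D] R_D[OF that(2) D]
    proof eventually_elim
      case (elim n)
      then show ?case using v_add[of "a n" "b n"] by auto
    qed
  qed
  show "a * b \<in> int_seq" if "a \<in> int_seq" "b \<in> int_seq" for a b
  proof (rule R_I)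
    fix D :: real assume D: "D > 1"
    then have s: "sqrt D > 1" by simp
    show "eventually (\<lambda>n. v ((a * b) n) \<le> D) U"
      using R_D[OF that(1) s] R_D[OF that(2) s]
    proof eventually_elim
      case (elim n)
      have "v (a n) * v (b n) \<le> sqrt D * sqrt D" using elim s by (intro mult_mono) auto
      then show ?case using D by (simp add: v_mult)
    qed
  qed
  show "small_seq \<subseteq> int_seq"
  proof
    fix x assume "x \<in> small_seq"
    then obtain D where D: "D < 1" "eventually (\<lambda>n. v (x n) \<le> D) U" by (rule P_D)
    show "x \<in> int_seq" by (rule R_I, rule eventually_mono[OF D(2)]) (use D(1) in auto)
  qed
  show "0 \<in> small_seq" by (rule P_I[of 0]) auto
  show "1 \<notin> small_seq"
  proof
    assume "1 \<in> small_seq"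
    then obtain D :: real where "D < 1" "eventually (\<lambda>n. v ((1 :: nat \<Rightarrow> 'a) n) \<le> D) U" by (rule P_D)
    then show False using U_not_bot by auto
  qed
  show "a + b \<in> small_seq" if "a \<in> small_seq" "b \<in> small_seq" for a b
  proof -
    from that(1) obtain D where D: "D < 1" "eventually (\<lambda>n. v (a n) \<le> D) U" by (rule P_D)
    from that(2) obtain E where E: "E < 1" "eventually (\<lambda>n. v (b n) \<le> E) U" by (rule P_D)
    show ?thesis
    proof (rule P_I)
      show "eventually (\<lambda>n. v ((a + b) n) \<le> max D E) U"
        using D(2) E(2)
      proof eventually_elim
        case (elim n)
        then show ?case using v_add[of "a n" "b n"] by auto
      qed
    qed (use D E in auto)
  qed
  show "a * b \<in> small_seq" if "a \<in> int_seq" "b \<in> small_seq" for a b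
  proof -
    from that(2) obtain D where D: "0 < D" "D < 1" "eventually (\<lambda>n. v (b n) \<le> D) U" by (rule P_D)
    \<comment> \<open>The integral factor may exceed 1 slightly. It is granted 1 / sqrt D, which
      leaves the bound sqrt D, still below 1, for the product.\<close>
    have s: "1 / sqrt D > 1" using D by (simp add: real_sqrt_lt_1_iff)
    show ?thesis
    proof (rule P_I)
      show "sqrt D < 1" using D by (simp add: real_sqrt_lt_1_iff)
      show "eventually (\<lambda>n. v ((a * b) n) \<le> sqrt D) U"
        using R_D[OF that(1) s] D(3)
      proof eventually_elim
        case (elim n)
        have "v (a n) * v (b n) \<le> (1 / sqrt D) * D" using elim D by (intro mult_mono) auto
        also have "\<dots> = sqrt D" using D by (simp add: real_div_sqrt)
        finally show ?case by (simp add: v_mult)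
      qed
    qed
  qed
  show "\<exists>b\<in>int_seq. a * b - 1 \<in> small_seq" if a: "a \<in> int_seq" "a \<notin> small_seq" for a
  proof (intro bexI)
    let ?b = "\<lambda>n. inverse (a n)"
    have big: "eventually (\<lambda>n. v (a n) > D) U" if "D < 1" for D
      using ultra[of "\<lambda>n. v (a n) \<le> D"] a(2) P_I[OF that, of a] by (auto simp: not_le)
    show "a * ?b - 1 \<in> small_seq"
    proof (rule P_I[of 0])
      show "eventually (\<lambda>n. v ((a * ?b - 1) n) \<le> 0) U"
        using big[of 0, simplified] by (rule eventually_mono) auto
    qed simp
    show "?b \<in> int_seq"
    proof (rule R_I)
      fix D :: real assume D: "D > 1"
      then have "1 / D < 1" by simp
      from big[OF this] show "eventually (\<lambda>n. v (?b n) \<le> D) U"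
      proof (rule eventually_mono)
        fix n assume "1 / D < v (a n)"
        then show "v (inverse (a n)) \<le> D" using le_imp_inverse_le[of "1 / D" "v (a n)"] D by (simp add: v_inverse)
      qed
    qed
  qed
qed

lemma mat_app_eval: "mat_app d M x i n = mat_app d (\<lambda>i j. M i j n) (\<lambda>i. x i n) i"
  by (simp add: mat_app_def sum_fun_apply)

lemma fold_eval:
  "fold (\<lambda>l z i. mat_app d M z i - l * z i) ls x i n =
    fold (\<lambda>e z i. mat_app d (\<lambda>i j. M i j n) z i - e * z i) (map (\<lambda>l. l n) ls) (\<lambda>i. x i n) i"
proof (induction ls arbitrary: x)
  case (Cons l ls)
  then show ?case by (simp add: mat_app_eval)
qed simp

text \<open>Division by a coordinate of greatest absolute value makes the vector integral, and the
  coordinate 1 prevents it from reducing to 0.\<close>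

lemma normalized_eigenvector:
  assumes "\<exists>i<d. x i \<noteq> 0" "\<forall>i<d. mat_app d M x i = e * x i"
  shows "\<exists>y. (\<forall>i<d. v (y i) \<le> 1) \<and> (\<exists>i<d. y i = 1) \<and> (\<forall>i<d. mat_app d M y i = e * y i)"
proof -
  let ?V = "(\<lambda>i. v (x i)) ` {..<d}"
  have ne: "{..<d} \<noteq> {}" using assms(1) by auto
  then have "Max ?V \<in> ?V" by (intro Max_in) auto
  then obtain i0 where "i0 \<in> {..<d}" "Max ?V = v (x i0)" by (rule imageE)
  then have i0: "i0 < d" "v (x i0) = Max ?V" by simp_all
  have le: "v (x i) \<le> v (x i0)" if "i < d" for i unfolding i0(2) using that by (intro Max_ge) auto
  have nz: "x i0 \<noteq> 0" using assms(1) le by (metis v_nonneg v_zero_iff order_antisym)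
  have "mat_app d M (\<lambda>i. x i / x i0) i = e * (x i / x i0)" if "i < d" for i
    using assms(2) that by (simp add: mat_app_def flip: sum_divide_distrib)
  then show ?thesis using le nz i0(1)
    by (intro exI[of _ "\<lambda>i. x i / x i0"]) (auto simp: v_divide divide_le_eq_1)
qed

text \<open>Eigenvalues are taken for every n separately. All the lists have length
  \<open>d\<close>, so their k-th members form \<open>d\<close> sequences. Which coordinate of an
  eigenvector equals 1 may change with n.\<close>

lemma eigenvalue_sequences:
  fixes M :: "nat \<Rightarrow> nat \<Rightarrow> nat \<Rightarrow> 'a"
  shows "\<exists>ls. (\<Sum>i<d. M i i) = sum_list ls \<and>
    (\<forall>l\<in>set ls. \<exists>x. (\<forall>i<d. x i \<in> int_seq) \<and> (\<forall>n. \<exists>i<d. x i n = 1) \<and> (\<forall>i<d. mat_app d M x i = l * x i)) \<and>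
    (\<forall>x. \<forall>i<d. fold (\<lambda>l z i. mat_app d M z i - l * z i) ls x i = 0)"
proof -
  let ?M = "\<lambda>n i j. M i j n"
  have "\<forall>n. \<exists>es. (\<Sum>i<d. ?M n i i) = sum_list es \<and> length es = d \<and>
      (\<forall>e\<in>set es. \<exists>x. (\<exists>i<d. x i \<noteq> 0) \<and> (\<forall>i<d. mat_app d (?M n) x i = e * x i)) \<and>
      (\<forall>x. \<forall>i<d. fold (\<lambda>e z i. mat_app d (?M n) z i - e * z i) es x i = 0)"
    by (intro allI eigenvalue_list_mat_app)
  from choice[OF this] obtain es where
    "\<forall>n. (\<Sum>i<d. ?M n i i) = sum_list (es n) \<and> length (es n) = d \<and>
      (\<forall>e\<in>set (es n). \<exists>x. (\<exists>i<d. x i \<noteq> 0) \<and> (\<forall>i<d. mat_app d (?M n) x i = e * x i)) \<and>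
      (\<forall>x. \<forall>i<d. fold (\<lambda>e z i. mat_app d (?M n) z i - e * z i) (es n) x i = 0)"
    by (rule exE)
  then have es: "(\<Sum>i<d. ?M n i i) = sum_list (es n)" "length (es n) = d"
    "\<forall>e\<in>set (es n). \<exists>x. (\<exists>i<d. x i \<noteq> 0) \<and> (\<forall>i<d. mat_app d (?M n) x i = e * x i)"
    "\<forall>x. \<forall>i<d. fold (\<lambda>e z i. mat_app d (?M n) z i - e * z i) (es n) x i = 0" for n
    by simp_all
  define ls where "ls = map (\<lambda>k n. es n ! k) [0..<d]"
  have ls: "map (\<lambda>l. l n) ls = es n" for n
    by (rule nth_equalityI) (auto simp: ls_def es(2))
  have "(\<Sum>i<d. M i i) n = sum_list ls n" for n
  proof -
    have "sum_list ks n = sum_list (map (\<lambda>l. l n) ks)" for ks :: "(nat \<Rightarrow> 'a) list"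
      by (induction ks) auto
    then show ?thesis using es(1)[of n] ls[of n] by (simp add: sum_fun_apply)
  qed
  moreover have "\<exists>x. (\<forall>i<d. x i \<in> int_seq) \<and> (\<forall>n. \<exists>i<d. x i n = 1) \<and> (\<forall>i<d. mat_app d M x i = l * x i)"
    if l: "l \<in> set ls" for l
  proof -
    have "l n \<in> set (es n)" for n using l ls[of n] by (metis image_eqI list.set_map)
    then have "\<exists>y. (\<forall>i<d. v (y i) \<le> 1) \<and> (\<exists>i<d. y i = 1) \<and> (\<forall>i<d. mat_app d (?M n) y i = l n * y i)" for n
      using es(3)[of n] normalized_eigenvector[of d _ "?M n" "l n"] by blast
    then obtain y where y: "\<And>n. \<forall>i<d. v (y n i) \<le> 1" "\<And>n. \<exists>i<d. y n i = 1"
      "\<And>n. \<forall>i<d. mat_app d (?M n) (y n) i = l n * y n i" by metis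
    show ?thesis
      by (rule exI[of _ "\<lambda>i n. y n i"]) (use y in \<open>auto intro!: bounded_R simp: fun_eq_iff mat_app_eval\<close>)
  qed
  moreover have "fold (\<lambda>l z i. mat_app d M z i - l * z i) ls x i = 0" if "i < d" for x i
    using es(4) that by (simp add: fun_eq_iff fold_eval ls)
  ultimately show ?thesis by (intro exI[of _ ls]) (auto simp: fun_eq_iff)
qed

text \<open>If M is integral, so is M x = l x, and the coordinate 1 of \<open>x\<close> passes this
  on to \<open>l\<close>. In the same way a small l ^ m x makes \<open>l\<close> small, and the
  trace is the sum of these \<open>l\<close>.\<close>

sublocale closed_residue_field int_seq small_seq
proof
  fix d and M :: "nat \<Rightarrow> nat \<Rightarrow> nat \<Rightarrow> 'a"
  assume M: "\<And>i j. i < d \<Longrightarrow> j < d \<Longrightarrow> M i j \<in> int_seq"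
  obtain ls where
    ls: "\<And>l. l \<in> set ls \<Longrightarrow> \<exists>x. (\<forall>i<d. x i \<in> int_seq) \<and> (\<forall>n. \<exists>i<d. x i n = 1) \<and> (\<forall>i<d. mat_app d M x i = l * x i)"
    "\<forall>x. \<forall>i<d. fold (\<lambda>l z i. mat_app d M z i - l * z i) ls x i = 0"
    using eigenvalue_sequences[where d = d and M = M] by blast
  have "l \<in> int_seq" if l: "l \<in> set ls" for l
  proof -
    obtain x where x: "\<And>i. i < d \<Longrightarrow> x i \<in> int_seq" "\<And>n. \<exists>i<d. x i n = 1" "\<And>i. i < d \<Longrightarrow> mat_app d M x i = l * x i"
      using ls(1)[OF l] by blast
    have "l * x i \<in> int_seq" if "i < d" for i
      unfolding x(3)[OF that, symmetric] mat_app_def using M x(1) that by (intro sum_R mult_R) auto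
    then have "\<forall>i\<in>{..<d}. eventually (\<lambda>n. v ((l * x i) n) \<le> D) U" if "D > 1" for D
      using that R_D by blast
    then have ev: "eventually (\<lambda>n. \<forall>i\<in>{..<d}. v ((l * x i) n) \<le> D) U" if "D > 1" for D
      using that by (simp add: eventually_ball_finite)
    have "eventually (\<lambda>n. v (l n) \<le> D) U" if "D > 1" for D
      using ev[OF that]
    proof (rule eventually_mono)
      fix n assume *: "\<forall>i\<in>{..<d}. v ((l * x i) n) \<le> D"
      obtain i where "i < d" "x i n = 1" using x(2) by blast
      then show "v (l n) \<le> D" using bspec[OF *, of i] by simp
    qed
    then show ?thesis by (rule R_I)
  qed
  then show "\<exists>ls. set ls \<subseteq> int_seq \<and> (\<forall>x i. (\<forall>i<d. x i \<in> int_seq) \<longrightarrow> i < d \<longrightarrow>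
      fold (\<lambda>l z i. mat_app d M z i - l * z i) ls x i \<in> small_seq)"
    using ls(2) zero_P by (intro exI[of _ ls]) auto
next
  show "\<forall>r B m. (\<forall>i<r. \<forall>j<r. B i j \<in> int_seq) \<longrightarrow>
      (\<forall>x i. (\<forall>i<r. x i \<in> int_seq) \<longrightarrow> i < r \<longrightarrow> (mat_app r B ^^ m) x i \<in> small_seq) \<longrightarrow>
      (\<Sum>i<r. B i i) \<in> small_seq"
  proof (intro allI impI)
    fix r m and B :: "nat \<Rightarrow> nat \<Rightarrow> nat \<Rightarrow> 'a"
    assume nil: "\<forall>x i. (\<forall>i<r. x i \<in> int_seq) \<longrightarrow> i < r \<longrightarrow> (mat_app r B ^^ m) x i \<in> small_seq"
    obtain ls where ls: "(\<Sum>i<r. B i i) = sum_list ls"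
      "\<And>l. l \<in> set ls \<Longrightarrow> \<exists>x. (\<forall>i<r. x i \<in> int_seq) \<and> (\<forall>n. \<exists>i<r. x i n = 1) \<and> (\<forall>i<r. mat_app r B x i = l * x i)"
      using eigenvalue_sequences[where d = r and M = B] by blast
    have "l \<in> small_seq" if l: "l \<in> set ls" for l
    proof -
      obtain x where x: "\<And>i. i < r \<Longrightarrow> x i \<in> int_seq" "\<And>n. \<exists>i<r. x i n = 1" "\<And>i. i < r \<Longrightarrow> mat_app r B x i = l * x i"
        using ls(2)[OF l] by blast
      have "l ^ m * x i \<in> small_seq" if i: "i < r" for i
      proof -
        have "(mat_app r B ^^ m) x i \<in> small_seq" using nil x(1) i by blast
        moreover have "(mat_app r B ^^ m) x i = l ^ m * x i"
          using x(3) i by (rule eigenvector_power)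
        ultimately show ?thesis by (simp only:)
      qed
      then have "\<exists>D. 0 < D \<and> D < 1 \<and> eventually (\<lambda>n. v ((l ^ m * x i) n) \<le> D) U" if "i < r" for i
        using that P_D by metis
      then obtain D where D: "\<And>i. i < r \<Longrightarrow> 0 < D i \<and> D i < 1"
        "\<And>i. i < r \<Longrightarrow> eventually (\<lambda>n. v ((l ^ m * x i) n) \<le> D i) U" by metis
      \<comment> \<open>The coordinate equal to 1 varies with n, so a bound common to all
        coordinates is taken.\<close>
      define E where "E = Max (D ` {..<r})"
      have r: "{..<r} \<noteq> {}" using x(2)[of 0] by auto
      have DE: "D i \<le> E" if "i < r" for i unfolding E_def using that by (intro Max_ge) auto
      have E: "0 < E" "E < 1" using r D(1) by (auto simp: E_def Max_gr_iff)
      have "eventually (\<lambda>n. \<forall>i\<in>{..<r}. v ((l ^ m * x i) n) \<le> D i) U"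
        using D(2) by (simp add: eventually_ball_finite)
      then have ev: "eventually (\<lambda>n. v (l n) ^ m \<le> E) U"
      proof (rule eventually_mono)
        fix n assume *: "\<forall>i\<in>{..<r}. v ((l ^ m * x i) n) \<le> D i"
        obtain i where i: "i < r" "x i n = 1" using x(2) by blast
        have "(l ^ m) n = l n ^ m" by (induction m) auto
        then have "v (l n) ^ m \<le> D i" using bspec[OF *, of i] i by (simp add: v_power)
        then show "v (l n) ^ m \<le> E" using DE[OF i(1)] by simp
      qed
      have m: "m > 0"
      proof (rule ccontr)
        assume "\<not> m > 0"
        then have "eventually (\<lambda>n. False) U" using ev E(2) by simp
        then show False using U_not_bot by simp
      qed
      show ?thesis
      proof (rule P_I)
        show "root m E < 1" using E m by (simp add: real_root_lt_1_iff)
        show "eventually (\<lambda>n. v (l n) \<le> root m E) U" using ev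
        proof (rule eventually_mono)
          fix n assume "v (l n) ^ m \<le> E"
          then have "root m (v (l n) ^ m) \<le> root m E" using m by simp
          then show "v (l n) \<le> root m E" using m by (simp add: real_root_power_cancel)
        qed
      qed
    qed
    then have "sum_list ls \<in> small_seq" by (induction ls) (auto simp: zero_P add_P)
    then show "(\<Sum>i<r. B i i) \<in> small_seq" unfolding ls(1) .
  qed
qed

end

section \<open>Ultrametric norms and almost orthogonal bases\<close>

context nonarch_field begin

definition ultra_seminorm :: "nat \<Rightarrow> ('a Matrix.vec \<Rightarrow> real) \<Rightarrow> bool" where
  "ultra_seminorm d q \<longleftrightarrow>
     (\<forall>x \<in> carrier_vec d. 0 \<le> q x) \<and>
     (\<forall>c. \<forall>x \<in> carrier_vec d. q (c \<cdot>\<^sub>v x) = v c * q x) \<and>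
     (\<forall>x \<in> carrier_vec d. \<forall>y \<in> carrier_vec d. q (x + y) \<le> max (q x) (q y))"

lemma ultra_seminormD:
  assumes "ultra_seminorm d q"
  shows "x \<in> carrier_vec d \<Longrightarrow> 0 \<le> q x"
    "x \<in> carrier_vec d \<Longrightarrow> q (c \<cdot>\<^sub>v x) = v c * q x"
    "x \<in> carrier_vec d \<Longrightarrow> y \<in> carrier_vec d \<Longrightarrow> q (x + y) \<le> max (q x) (q y)"
    "q (0\<^sub>v d) = 0"
    "x \<in> carrier_vec d \<Longrightarrow> y \<in> carrier_vec d \<Longrightarrow> q (x - y) \<le> max (q x) (q y)"
proof -
  show a: "x \<in> carrier_vec d \<Longrightarrow> 0 \<le> q x" "x \<in> carrier_vec d \<Longrightarrow> q (c \<cdot>\<^sub>v x) = v c * q x"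
    "x \<in> carrier_vec d \<Longrightarrow> y \<in> carrier_vec d \<Longrightarrow> q (x + y) \<le> max (q x) (q y)" for x y c
    using assms by (auto simp: ultra_seminorm_def)
  have "0 \<cdot>\<^sub>v 0\<^sub>v d = (0\<^sub>v d :: 'a Matrix.vec)" by (intro eq_vecI) auto
  then show "q (0\<^sub>v d) = 0" using a(2)[of "0\<^sub>v d" 0] by simp
  show "q (x - y) \<le> max (q x) (q y)" if "x \<in> carrier_vec d" "y \<in> carrier_vec d"
  proof -
    have "x - y = x + (- 1) \<cdot>\<^sub>v y" using that by (intro eq_vecI) auto
    then show ?thesis using a(3)[of x "(- 1) \<cdot>\<^sub>v y"] a(2)[of y "- 1"] that v_minus_one by simp
  qed
qed

text \<open>Homogeneity follows from one inequality, applied to a scalar and to its inverse. This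
  suits suprema and upper limits.\<close>

lemma ultra_seminormI:
  assumes nn: "\<And>x. x \<in> carrier_vec d \<Longrightarrow> 0 \<le> q x"
    and le: "\<And>c x. x \<in> carrier_vec d \<Longrightarrow> q (c \<cdot>\<^sub>v x) \<le> v c * q x"
    and add: "\<And>x y. x \<in> carrier_vec d \<Longrightarrow> y \<in> carrier_vec d \<Longrightarrow> q (x + y) \<le> max (q x) (q y)"
  shows "ultra_seminorm d q"
proof -
  have "q (c \<cdot>\<^sub>v x) = v c * q x" if x: "x \<in> carrier_vec d" for c x
  proof (cases "c = 0")
    case True
    then show ?thesis using le[OF x, of c] nn[of "c \<cdot>\<^sub>v x"] x by simp
  next
    case False
    have "inverse c \<cdot>\<^sub>v (c \<cdot>\<^sub>v x) = x" using False x by (simp add: smult_smult_assoc)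
    then have "q x \<le> v (inverse c) * q (c \<cdot>\<^sub>v x)" using le[of "c \<cdot>\<^sub>v x" "inverse c"] x by simp
    then have "v c * q x \<le> q (c \<cdot>\<^sub>v x)" using False unfolding v_inverse by (simp add: field_simps)
    then show ?thesis using le[OF x] by (simp add: order_antisym)
  qed
  then show ?thesis using nn add by (auto simp: ultra_seminorm_def)
qed

lemma ultrametric_norm_iff:
  "ultrametric_norm v d N \<longleftrightarrow>
    ultra_seminorm d N \<and> (\<forall>x\<in>carrier_vec d. N x = 0 \<longrightarrow> x = 0\<^sub>v d)"
  unfolding ultrametric_norm_def
proof (intro iffI conjI)
  assume *: "ultra_seminorm d N \<and> (\<forall>x\<in>carrier_vec d. N x = 0 \<longrightarrow> x = 0\<^sub>v d)"
  then show "\<forall>x\<in>carrier_vec d. N x = 0 \<longleftrightarrow> x = 0\<^sub>v d" using ultra_seminormD(4) by blast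
qed (auto simp: ultra_seminorm_def)

lemma ultrametric_normD:
  assumes "ultrametric_norm v d N"
  shows "ultra_seminorm d N" "x \<in> carrier_vec d \<Longrightarrow> N x = 0 \<Longrightarrow> x = 0\<^sub>v d"
    "x \<in> carrier_vec d \<Longrightarrow> x \<noteq> 0\<^sub>v d \<Longrightarrow> 0 < N x"
proof -
  show a: "ultra_seminorm d N" "x \<in> carrier_vec d \<Longrightarrow> N x = 0 \<Longrightarrow> x = 0\<^sub>v d" for x
    using assms by (auto simp: ultrametric_norm_iff)
  show "x \<in> carrier_vec d \<Longrightarrow> x \<noteq> 0\<^sub>v d \<Longrightarrow> 0 < N x"
    using a(2)[of x] ultra_seminormD(1)[OF a(1), of x] by (auto simp: less_le)
qed

text \<open>The inserted 0 gives the space of dimension 0 its norm.\<close>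

definition sup_norm :: "nat \<Rightarrow> 'a Matrix.vec \<Rightarrow> real" where
  "sup_norm d x = Max (insert 0 ((\<lambda>i. v (x $ i)) ` {..<d}))"

lemma sup_norm_le: "sup_norm d x \<le> D \<longleftrightarrow> 0 \<le> D \<and> (\<forall>i<d. v (x $ i) \<le> D)"
  unfolding sup_norm_def by (subst Max_le_iff) auto
lemma sup_norm_nonneg: "0 \<le> sup_norm d x" and sup_norm_ge: "i < d \<Longrightarrow> v (x $ i) \<le> sup_norm d x"
  using sup_norm_le[of d x "sup_norm d x"] by auto
lemma sup_norm_leI: "0 \<le> D \<Longrightarrow> (\<And>i. i < d \<Longrightarrow> v (x $ i) \<le> D) \<Longrightarrow> sup_norm d x \<le> D"
  by (auto simp: sup_norm_le)

lemma sup_norm_ultrametric: "ultrametric_norm v d (sup_norm d)"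
  unfolding ultrametric_norm_iff
proof (intro conjI ballI impI)
  show "ultra_seminorm d (sup_norm d)"
  proof (rule ultra_seminormI)
    fix x y :: "'a Matrix.vec" and c assume x: "x \<in> carrier_vec d" and y: "y \<in> carrier_vec d"
    show "sup_norm d (x + y) \<le> max (sup_norm d x) (sup_norm d y)"
    proof (rule sup_norm_leI)
      fix i assume i: "i < d"
      have "v ((x + y) $ i) \<le> max (v (x $ i)) (v (y $ i))" using x y i v_add by simp
      then show "v ((x + y) $ i) \<le> max (sup_norm d x) (sup_norm d y)"
        using sup_norm_ge[OF i, of x] sup_norm_ge[OF i, of y] by linarith
    qed (simp add: sup_norm_nonneg le_max_iff_disj)
  next
    fix x :: "'a Matrix.vec" and c assume "x \<in> carrier_vec d"
    then show "sup_norm d (c \<cdot>\<^sub>v x) \<le> v c * sup_norm d x"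
      by (intro sup_norm_leI mult_nonneg_nonneg sup_norm_nonneg)
        (auto simp: v_mult intro: mult_left_mono sup_norm_ge)
  qed (rule sup_norm_nonneg)
  fix x :: "'a Matrix.vec" assume x: "x \<in> carrier_vec d" and zero: "sup_norm d x = 0"
  show "x = 0\<^sub>v d"
  proof (rule eq_vecI)
    fix i assume "i < dim_vec (0\<^sub>v d :: 'a Matrix.vec)"
    then have i: "i < d" by simp
    have "v (x $ i) = 0" using sup_norm_ge[OF i, of x] zero v_nonneg by (metis order_antisym)
    then show "x $ i = 0\<^sub>v d $ i" using i by simp
  qed (use x in auto)
qed

lemma ultra_seminorm_comp:
  assumes q: "ultra_seminorm d q" and A: "A \<in> carrier_mat d d"
  shows "ultra_seminorm d (\<lambda>x. q (A *\<^sub>v x))"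
  unfolding ultra_seminorm_def using A ultra_seminormD[OF q]
  by (auto simp: mult_mat_vec mult_add_distrib_mat_vec)

lemma ultra_seminorm_max:
  assumes "ultra_seminorm d p" "ultra_seminorm d q"
  shows "ultra_seminorm d (\<lambda>x. max (p x) (q x))"
  unfolding ultra_seminorm_def
proof (intro conjI ballI allI)
  fix x y :: "'a Matrix.vec" and c assume x: "x \<in> carrier_vec d" and y: "y \<in> carrier_vec d"
  note p = ultra_seminormD[OF assms(1)] and q = ultra_seminormD[OF assms(2)]
  show "0 \<le> max (p x) (q x)" using p(1)[OF x] by (simp add: le_max_iff_disj)
  show "max (p (c \<cdot>\<^sub>v x)) (q (c \<cdot>\<^sub>v x)) = v c * max (p x) (q x)"
    using p(2)[OF x] q(2)[OF x] by (simp add: max_mult_distrib_left)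
  show "max (p (x + y)) (q (x + y)) \<le> max (max (p x) (q x)) (max (p y) (q y))"
    using p(3)[OF x y] q(3)[OF x y] by linarith
qed

lemma ultra_seminorm_scale:
  assumes q: "ultra_seminorm d q" and r: "0 \<le> r"
  shows "ultra_seminorm d (\<lambda>x. r * q x)"
  unfolding ultra_seminorm_def
proof (intro conjI ballI allI)
  fix x y :: "'a Matrix.vec" and c assume x: "x \<in> carrier_vec d" and y: "y \<in> carrier_vec d"
  note q = ultra_seminormD[OF q]
  show "0 \<le> r * q x" using q(1)[OF x] r by simp
  show "r * q (c \<cdot>\<^sub>v x) = v c * (r * q x)" using q(2)[OF x] by simp
  have "r * q (x + y) \<le> r * max (q x) (q y)" using q(3)[OF x y] r by (rule mult_left_mono)
  then show "r * q (x + y) \<le> max (r * q x) (r * q y)" using r by (simp add: max_mult_distrib_left)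
qed

lemma ultra_seminorm_sup:
  fixes Q :: "('a Matrix.vec \<Rightarrow> real) set"
  assumes Q: "Q \<noteq> {}" "\<And>q. q \<in> Q \<Longrightarrow> ultra_seminorm d q"
    and bdd: "\<And>x. x \<in> carrier_vec d \<Longrightarrow> bdd_above ((\<lambda>q. q x) ` Q)"
  shows "ultra_seminorm d (\<lambda>x. SUP q\<in>Q. q x)"
proof (rule ultra_seminormI)
  have up: "q x \<le> (SUP q\<in>Q. q x)" if "q \<in> Q" "x \<in> carrier_vec d" for q x
    using that bdd by (intro cSUP_upper)
  fix x :: "'a Matrix.vec" and c assume x: "x \<in> carrier_vec d"
  obtain q0 where q0: "q0 \<in> Q" using Q(1) by blast
  show "0 \<le> (SUP q\<in>Q. q x)" using up[OF q0 x] ultra_seminormD(1)[OF Q(2)[OF q0] x] by linarith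
  show "(SUP q\<in>Q. q (c \<cdot>\<^sub>v x)) \<le> v c * (SUP q\<in>Q. q x)"
  proof (rule cSUP_least[OF Q(1)])
    fix q assume q: "q \<in> Q"
    show "q (c \<cdot>\<^sub>v x) \<le> v c * (SUP q\<in>Q. q x)"
      unfolding ultra_seminormD(2)[OF Q(2)[OF q] x] using up[OF q x] by (intro mult_left_mono) auto
  qed
  fix y :: "'a Matrix.vec" assume y: "y \<in> carrier_vec d"
  show "(SUP q\<in>Q. q (x + y)) \<le> max (SUP q\<in>Q. q x) (SUP q\<in>Q. q y)"
  proof (rule cSUP_least[OF Q(1)])
    fix q assume q: "q \<in> Q"
    show "q (x + y) \<le> max (SUP q\<in>Q. q x) (SUP q\<in>Q. q y)"
      using ultra_seminormD(3)[OF Q(2)[OF q] x y] up[OF q x] up[OF q y] by linarith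
  qed
qed

end

section \<open>Density of the value group, and almost orthogonal bases\<close>

locale complete_nonarch_field = nonarch_field v for v :: "'a::alg_closed_field \<Rightarrow> real" +
  assumes nontrivial: "nontrivial_absolute_value v" and complete: "complete_absolute_value v"
begin

text \<open>The k-th roots of an \<open>x\<close> with absolute value above 1 have absolute values
  that tend to 1 from above. The powers of one close enough to 1 cannot jump over the
  interval.\<close>

lemma value_group_dense:
  assumes "0 < a" "a < b" obtains c where "c \<noteq> 0" "a < v c" "v c < b"
proof -
  obtain x0 where x0: "x0 \<noteq> 0" "v x0 \<noteq> 1" using nontrivial by (auto simp: nontrivial_absolute_value_def)
  define x where "x = (if v x0 > 1 then x0 else inverse x0)"
  have x: "v x > 1" using x0 by (auto simp: x_def v_inverse one_less_inverse_iff)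
  have "(\<lambda>n. root n (v x)) \<longlonglongrightarrow> 1" using x by (intro LIMSEQ_root_const) auto
  moreover have "1 < b / a" using assms by simp
  ultimately have "eventually (\<lambda>n. root n (v x) < b / a) sequentially" by (rule order_tendstoD(2))
  then have "eventually (\<lambda>n. root n (v x) < b / a \<and> n > 0) sequentially"
    using eventually_gt_at_top by (rule eventually_conj)
  then obtain k where k: "root k (v x) < b / a" "k > 0"
    using eventually_happens'[OF trivial_limit_sequentially] by blast
  obtain y where y: "y ^ k = x" using nth_root_exists[OF k(2)] by blast
  define q where "q = v y"
  have "q ^ k = v x" unfolding q_def y[symmetric] by (simp add: v_power)
  then have q: "q = root k (v x)" using k(2) by (simp add: q_def real_root_power_cancel flip: \<open>q ^ k = v x\<close>)
  have q1: "q > 1" unfolding q using k(2) x by simp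
  have y0: "y \<noteq> 0" using q1 by (auto simp: q_def)
  have qa: "q * a < b" using k(1) assms unfolding q by (simp add: field_simps)
  \<comment> \<open>Multiplication by q ^ M moves the lower end of the interval above 1, so that
    natural exponents suffice.\<close>
  obtain M where M: "1 / a < q ^ M" using real_arch_pow[OF q1] by blast
  have Ma: "1 < a * q ^ M" using M assms(1) by (simp add: field_simps)
  define n where "n = (LEAST n. a * q ^ M < q ^ n)"
  have "\<exists>n. a * q ^ M < q ^ n" using real_arch_pow[OF q1] by blast
  then have n: "a * q ^ M < q ^ n" unfolding n_def by (rule LeastI_ex)
  then have "n \<noteq> 0" using Ma by (intro notI) simp
  then obtain n' where n': "n = Suc n'" by (cases n) auto
  have "\<not> a * q ^ M < q ^ n'" using not_less_Least[of n' "\<lambda>n. a * q ^ M < q ^ n"] n' n_def by auto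
  then have "q ^ n \<le> q * (a * q ^ M)" using q1 n' by simp
  also have "\<dots> < b * q ^ M" using qa q1 by (simp add: mult.assoc[symmetric])
  finally have up: "q ^ n < b * q ^ M" .
  show thesis
  proof (rule that)
    show "y ^ n / y ^ M \<noteq> 0" using y0 by simp
    have "v (y ^ n / y ^ M) = q ^ n / q ^ M" by (simp add: v_divide v_power q_def)
    moreover have "a < q ^ n / q ^ M" "q ^ n / q ^ M < b"
      using n up q1 by (simp_all add: field_simps)
    ultimately show "a < v (y ^ n / y ^ M)" "v (y ^ n / y ^ M) < b" by (simp_all only:)
  qed
qed

lemma v_Cauchy_converges:
  fixes x :: "nat \<Rightarrow> 'a"
  assumes "\<And>\<epsilon>. 0 < \<epsilon> \<Longrightarrow> \<exists>M. \<forall>n\<ge>M. \<forall>m\<ge>M. v (x n - x m) < \<epsilon>"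
  shows "\<exists>l. \<forall>\<epsilon>>0. \<exists>M. \<forall>n\<ge>M. v (x n - l) < \<epsilon>"
proof -
  interpret Metric_space UNIV "\<lambda>x y. v (x - y)"
  proof
    show "v (x - y) = v (y - x)" for x y using v_uminus[of "x - y"] by simp
    show "v (x - z) \<le> v (x - y) + v (y - z)" for x y z
      using v_add[of "x - y" "y - z"] by (simp add: max_def) (smt (verit) v_nonneg)
  qed auto
  have "MCauchy x" unfolding MCauchy_def using assms by blast
  then obtain l where "limitin mtopology x l sequentially"
    using complete unfolding complete_absolute_value_def mcomplete_def by blast
  then show ?thesis unfolding limit_metric_sequentially by (intro exI[of _ l]) auto
qed

definition coord_space :: "nat \<Rightarrow> nat \<Rightarrow> 'a Matrix.vec set" where
  "coord_space d k = {x \<in> carrier_vec d. \<forall>i<d. k \<le> i \<longrightarrow> x $ i = 0}"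

text \<open>Completeness enters here: a hyperplane has positive distance to every vector outside
  of it, so a basis can be extended to an almost orthogonal one.\<close>

lemma almost_orthogonal_basis_aux:
  assumes N: "ultrametric_norm v d N" and "k \<le> d" "0 < \<alpha>" "\<alpha> < 1"
  shows "\<exists>B\<in>carrier_mat d d. (\<forall>x\<in>coord_space d k. B *\<^sub>v x \<in> coord_space d k \<and>
      \<alpha> * sup_norm d x \<le> N (B *\<^sub>v x) \<and> N (B *\<^sub>v x) \<le> sup_norm d x) \<and>
    (\<forall>y\<in>coord_space d k. \<exists>x\<in>coord_space d k. B *\<^sub>v x = y)"
  using assms(2-4)
proof (induction k arbitrary: \<alpha>)
  case 0
  have eq: "coord_space d 0 = {0\<^sub>v d}"
    by (auto simp: coord_space_def intro!: eq_vecI)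
  have "0\<^sub>m d d *\<^sub>v 0\<^sub>v d = (0\<^sub>v d :: 'a Matrix.vec)" by (intro eq_vecI) auto
  moreover have "N (0\<^sub>v d) = 0" "sup_norm d (0\<^sub>v d) = 0"
    using ultra_seminormD(4) ultrametric_normD(1)[OF N] ultrametric_normD(1)[OF sup_norm_ultrametric]
    by blast+
  ultimately show ?case unfolding eq by (intro bexI[of _ "0\<^sub>m d d"]) simp_all
next
  case (Suc k)
  note Nn = ultra_seminormD[OF ultrametric_normD(1)[OF N]]
  note sn = ultra_seminormD[OF ultrametric_normD(1)[OF sup_norm_ultrametric[of d]]]
  have k: "k < d" using Suc.prems(1) by simp
  \<comment> \<open>Each coordinate loses the factor \<beta> twice: once because the distance to
    \<open>?W\<close> is only almost attained, and once through the norm of the new vector or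
    through the induction hypothesis.\<close>
  define \<beta> where "\<beta> = sqrt \<alpha>"
  have \<beta>: "0 < \<beta>" "\<beta> < 1" "\<beta> * \<beta> = \<alpha>" "\<alpha> \<le> \<beta>"
  proof -
    show b: "0 < \<beta>" "\<beta> < 1" "\<beta> * \<beta> = \<alpha>" using Suc.prems by (auto simp: \<beta>_def real_sqrt_lt_1_iff)
    show "\<alpha> \<le> \<beta>" using mult_left_mono[of \<beta> 1 \<beta>] b by simp
  qed
  let ?W = "coord_space d k"
  have Wc: "x \<in> carrier_vec d" if "x \<in> coord_space d j" for x j using that by (simp add: coord_space_def)
  from Suc.IH[of \<beta>] k \<beta> obtain B where B: "B \<in> carrier_mat d d"
    and BW: "\<And>x. x \<in> ?W \<Longrightarrow> B *\<^sub>v x \<in> ?W"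
    and Blow: "\<And>x. x \<in> ?W \<Longrightarrow> \<beta> * sup_norm d x \<le> N (B *\<^sub>v x)"
    and Bup: "\<And>x. x \<in> ?W \<Longrightarrow> N (B *\<^sub>v x) \<le> sup_norm d x"
    and Bsurj: "\<And>y. y \<in> ?W \<Longrightarrow> \<exists>x\<in>?W. B *\<^sub>v x = y"
    by (auto dest: order.strict_implies_order)
  define e where "e = (unit_vec d k :: 'a Matrix.vec)"
  have e: "e \<in> carrier_vec d" by (simp add: e_def)
  define D where "D = (INF w\<in>?W. N (e + w))"
  have W0: "0\<^sub>v d \<in> ?W" by (simp add: coord_space_def)
  have Wdiff: "x - y \<in> ?W" if "x \<in> ?W" "y \<in> ?W" for x y using that by (auto simp: coord_space_def)
  have bdd: "bdd_below ((\<lambda>w. N (e + w)) ` ?W)"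
    using Nn(1) e Wc by (intro bdd_belowI2[of _ 0]) auto
  have D_le: "D \<le> N (e + w)" if "w \<in> ?W" for w unfolding D_def by (rule cINF_lower[OF bdd that])
  \<comment> \<open>At distance 0 the approximating vectors would have Cauchy coordinates, because
    \<open>B\<close> is bounded below on \<open>?W\<close>. Their limit would put \<open>e\<close>
    into \<open>?W\<close>.\<close>
  have "D > 0"
  proof (rule ccontr)
    assume "\<not> D > 0"
    then have "\<exists>w\<in>?W. N (e + w) < \<epsilon>" if "\<epsilon> > 0" for \<epsilon>
      using that cINF_less_iff[OF _ bdd, of \<epsilon>] W0 unfolding D_def by fastforce
    then have "\<exists>y\<in>?W. N (e + B *\<^sub>v y) < 1 / real (Suc n)" for n
      using Bsurj by (metis of_nat_0_less_iff zero_less_Suc zero_less_divide_1_iff)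
    then obtain y where y: "\<And>n. y n \<in> ?W" "\<And>n. N (e + B *\<^sub>v y n) < 1 / real (Suc n)" by metis
    have Byc: "B *\<^sub>v y n \<in> carrier_vec d" for n using Wc[OF BW[OF y(1)]] .
    have small: "\<exists>M. \<forall>n\<ge>M. 1 / real (Suc n) < \<epsilon>" if pos: "\<epsilon> > 0" for \<epsilon>
    proof -
      obtain M where M: "1 / real (Suc M) < \<epsilon>" using nat_approx_posE[OF pos] by blast
      have "1 / real (Suc n) \<le> 1 / real (Suc M)" if "n \<ge> M" for n using that by (simp add: frac_le)
      then show ?thesis using M by (meson le_less_trans)
    qed
    have cauchy: "\<exists>M. \<forall>n\<ge>M. \<forall>m\<ge>M. v (y n $ i - y m $ i) < \<epsilon>" if i: "i < d" and \<epsilon>: "\<epsilon> > 0" for i \<epsilon>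
    proof -
      have "\<beta> * \<epsilon> > 0" using \<beta> \<epsilon> by simp
      then obtain M where M: "\<And>n. n \<ge> M \<Longrightarrow> 1 / real (Suc n) < \<beta> * \<epsilon>" using small by blast
      have "v (y n $ i - y m $ i) < \<epsilon>" if nm: "n \<ge> M" "m \<ge> M" for n m
      proof -
        have yc: "y n \<in> carrier_vec d" "y m \<in> carrier_vec d" using Wc y(1) by auto
        have "\<beta> * v (y n $ i - y m $ i) \<le> \<beta> * sup_norm d (y n - y m)"
          using sup_norm_ge[OF i, of "y n - y m"] yc i \<beta>(1) by (simp add: mult_left_mono)
        also have "\<dots> \<le> N (B *\<^sub>v (y n - y m))" by (rule Blow[OF Wdiff[OF y(1) y(1)]])
        also have "B *\<^sub>v (y n - y m) = (e + B *\<^sub>v y n) - (e + B *\<^sub>v y m)"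
          using mult_minus_distrib_mat_vec[OF B yc] e Byc[of n] Byc[of m] by (intro eq_vecI) auto
        also have "N \<dots> \<le> max (N (e + B *\<^sub>v y n)) (N (e + B *\<^sub>v y m))"
          using e Byc by (intro Nn(5)) auto
        also have "\<dots> < \<beta> * \<epsilon>" using y(2)[of n] y(2)[of m] M[OF nm(1)] M[OF nm(2)] by simp
        finally show ?thesis using \<beta>(1) by simp
      qed
      then show ?thesis by blast
    qed
    have "\<exists>l. \<forall>\<epsilon>>0. \<exists>M. \<forall>n\<ge>M. v (y n $ i - l) < \<epsilon>" if "i < d" for i
      using cauchy[OF that] by (rule v_Cauchy_converges)
    then obtain l where l: "\<And>i \<epsilon>. i < d \<Longrightarrow> \<epsilon> > 0 \<Longrightarrow> \<exists>M. \<forall>n\<ge>M. v (y n $ i - l i) < \<epsilon>" by metis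
    \<comment> \<open>From \<open>k\<close> on the coordinates of all \<open>y n\<close> are 0;
      choosing 0 there keeps the limit in \<open>?W\<close>.\<close>
    define z where "z = Matrix.vec d (\<lambda>i. if i < k then l i else 0)"
    have z: "z \<in> ?W" by (auto simp: z_def coord_space_def)
    have Bzc: "B *\<^sub>v z \<in> carrier_vec d" using Wc[OF BW[OF z]] .
    have "N (e + B *\<^sub>v z) \<le> \<epsilon>" if \<epsilon>: "\<epsilon> > 0" for \<epsilon>
    proof -
      have "\<exists>M. \<forall>n\<ge>M. v (y n $ i - z $ i) < \<epsilon>" if i: "i < d" for i
      proof (cases "i < k")
        case True
        then show ?thesis using l[OF i \<epsilon>] i by (simp add: z_def)
      next
        case False
        then show ?thesis using y(1) i \<epsilon> by (auto simp: z_def coord_space_def)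
      qed
      then have "\<forall>i\<in>{..<d}. eventually (\<lambda>n. v (y n $ i - z $ i) < \<epsilon>) sequentially"
        by (auto simp: eventually_sequentially)
      then have "eventually (\<lambda>n. \<forall>i\<in>{..<d}. v (y n $ i - z $ i) < \<epsilon>) sequentially"
        by (simp add: eventually_ball_finite)
      moreover have "eventually (\<lambda>n. 1 / real (Suc n) < \<epsilon>) sequentially"
        using small[OF \<epsilon>] by (simp add: eventually_sequentially)
      ultimately have "eventually (\<lambda>n. (\<forall>i\<in>{..<d}. v (y n $ i - z $ i) < \<epsilon>) \<and> 1 / real (Suc n) < \<epsilon>) sequentially"
        by (rule eventually_conj)
      then obtain n where n: "\<forall>i\<in>{..<d}. v (y n $ i - z $ i) < \<epsilon>" "1 / real (Suc n) < \<epsilon>"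
        using eventually_happens'[OF trivial_limit_sequentially] by blast
      have yc: "y n \<in> carrier_vec d" "z \<in> carrier_vec d" using Wc y(1) z by auto
      have "sup_norm d (y n - z) \<le> \<epsilon>"
        using n(1) yc \<epsilon> by (intro sup_norm_leI) (auto intro: less_imp_le)
      then have 1: "N (B *\<^sub>v (y n - z)) \<le> \<epsilon>" using Bup[OF Wdiff[OF y(1) z], of n] by linarith
      have "e + B *\<^sub>v z = (e + B *\<^sub>v y n) - B *\<^sub>v (y n - z)"
        using mult_minus_distrib_mat_vec[OF B yc] e Byc[of n] Bzc by (intro eq_vecI) auto
      also have "N \<dots> \<le> max (N (e + B *\<^sub>v y n)) (N (B *\<^sub>v (y n - z)))"
        using e Byc B yc by (intro Nn(5)) auto
      also have "\<dots> \<le> \<epsilon>" using 1 y(2)[of n] n(2) by simp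
      finally show ?thesis .
    qed
    then have "N (e + B *\<^sub>v z) \<le> 0" by (meson dense_ge)
    moreover have c: "e + B *\<^sub>v z \<in> carrier_vec d" using e Bzc by simp
    ultimately have "e + B *\<^sub>v z = 0\<^sub>v d" using Nn(1)[OF c] ultrametric_normD(2)[OF N c] by simp
    then have "(e + B *\<^sub>v z) $ k = 0" using k by simp
    moreover have "(B *\<^sub>v z) $ k = 0" using BW[OF z] k by (simp add: coord_space_def)
    ultimately show False using k B by (simp add: e_def)
  qed
  then have "D < D / \<beta>" using \<beta> by (simp add: field_simps)
  then obtain w0 where w0: "w0 \<in> ?W" "N (e + w0) < D / \<beta>"
    using cINF_less_iff[OF _ bdd, of "D / \<beta>"] W0 unfolding D_def by blast
  define u where "u = e + w0"
  have u: "u \<in> carrier_vec d" using e Wc[OF w0(1)] by (simp add: u_def)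
  have Nu: "N u > 0" "\<beta> * N u < D"
    using w0(2) D_le[OF w0(1)] \<open>D > 0\<close> \<beta> by (auto simp: u_def field_simps)
  have "0 < \<beta> / N u" "\<beta> / N u < 1 / N u" using Nu(1) \<beta> by (auto simp: divide_strict_right_mono)
  \<comment> \<open>Norm 1 may be out of reach by scaling, but density of the value group brings the
    norm of the new basis vector between \<beta> and 1.\<close>
  then obtain c where c: "c \<noteq> 0" "\<beta> / N u < v c" "v c < 1 / N u" by (rule value_group_dense)
  define b where "b = c \<cdot>\<^sub>v u"
  have b: "b \<in> carrier_vec d" using u by (simp add: b_def)
  have Nb: "\<beta> < N b" "N b < 1" using c Nu(1) by (auto simp: b_def Nn(2)[OF u] field_simps)
  \<comment> \<open>For non-zero \<open>t\<close>, the vector is t * c times a member of the coset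
    of \<open>e\<close> modulo \<open>?W\<close>, whose norm is at least \<open>D\<close>.\<close>
  have key: "\<beta> * (v t * N b) \<le> N (t \<cdot>\<^sub>v b + w)" if w: "w \<in> ?W" for t w
  proof (cases "t = 0")
    case True
    then show ?thesis using Nn(1) b Wc[OF w] by simp
  next
    case False
    have wc: "w \<in> carrier_vec d" by (rule Wc[OF w])
    define w' where "w' = w0 + inverse (t * c) \<cdot>\<^sub>v w"
    have w'W: "w' \<in> ?W" using w w0(1) by (auto simp: w'_def coord_space_def)
    have eq: "t \<cdot>\<^sub>v b + w = (t * c) \<cdot>\<^sub>v (e + w')"
    proof (rule eq_vecI)
      fix i assume "i < dim_vec ((t * c) \<cdot>\<^sub>v (e + w'))"
      then have i: "i < d" using wc by (simp add: w'_def)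
      define r where "r = inverse (t * c)"
      have r: "t * c * r = 1" unfolding r_def using False c(1) by (intro right_inverse) simp
      have "t * (c * (r * w $ i)) = (t * c * r) * w $ i" by (simp only: mult.assoc)
      then have "t * (c * (r * w $ i)) = w $ i" unfolding r by simp
      then have "t * (c * (e $ i + w0 $ i)) + w $ i = t * c * (e $ i + (w0 $ i + r * w $ i))"
        by (simp add: distrib_left mult.assoc)
      then show "(t \<cdot>\<^sub>v b + w) $ i = ((t * c) \<cdot>\<^sub>v (e + w')) $ i"
        using i wc e Wc[OF w0(1)] by (simp add: b_def u_def w'_def r_def del: inverse_mult_distrib)
    qed (use wc e Wc[OF w0(1)] in \<open>simp add: w'_def b_def u_def\<close>)
    have "\<beta> * (v t * N b) = v (t * c) * (\<beta> * N u)" by (simp add: b_def Nn(2)[OF u] v_mult)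
    also have "\<dots> \<le> v (t * c) * D" using Nu(2) by (intro mult_left_mono) auto
    also have "\<dots> \<le> v (t * c) * N (e + w')" using D_le[OF w'W] by (intro mult_left_mono) auto
    also have "\<dots> = N (t \<cdot>\<^sub>v b + w)" unfolding eq using e Wc[OF w'W] by (intro Nn(2)[symmetric]) simp
    finally show ?thesis .
  qed
  \<comment> \<open>Vectors of \<open>coord_space d (Suc k)\<close> do not see the columns beyond
    \<open>k\<close>, so only column \<open>k\<close> has to change.\<close>
  define B' where "B' = Matrix.mat d d (\<lambda>(i, j). if j = k then b $ i else B $$ (i, j))"
  define trunc where "trunc x = Matrix.vec d (\<lambda>i. if i = k then 0 else x $ i)" for x :: "'a Matrix.vec"
  have B'c: "B' \<in> carrier_mat d d" by (simp add: B'_def)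
  have truncW: "trunc x \<in> ?W" if "x \<in> coord_space d (Suc k)" for x
    using that by (auto simp: trunc_def coord_space_def)
  have B'x: "B' *\<^sub>v x = x $ k \<cdot>\<^sub>v b + B *\<^sub>v trunc x" if x: "x \<in> carrier_vec d" for x
  proof (rule eq_vecI)
    fix i assume "i < dim_vec (x $ k \<cdot>\<^sub>v b + B *\<^sub>v trunc x)"
    then have i: "i < d" using B by simp
    have "(B' *\<^sub>v x) $ i = (\<Sum>j\<in>{0..<d}. (if j = k then b $ i else B $$ (i, j)) * x $ j)"
      using i x by (simp add: B'_def scalar_prod_def)
    also have "\<dots> = b $ i * x $ k + (\<Sum>j\<in>{0..<d} - {k}. B $$ (i, j) * x $ j)"
      using k by (subst sum.remove[of _ k]) auto
    also have "(\<Sum>j\<in>{0..<d} - {k}. B $$ (i, j) * x $ j) = (\<Sum>j\<in>{0..<d}. B $$ (i, j) * trunc x $ j)"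
      using k by (subst sum.remove[of "{0..<d}" k]) (auto simp: trunc_def intro!: sum.cong)
    also have "\<dots> = (B *\<^sub>v trunc x) $ i" using i B by (simp add: scalar_prod_def trunc_def)
    finally show "(B' *\<^sub>v x) $ i = (x $ k \<cdot>\<^sub>v b + B *\<^sub>v trunc x) $ i"
      using i b B by (simp add: mult.commute)
  qed (use B in \<open>simp add: B'_def\<close>)
  have bS: "b \<in> coord_space d (Suc k)"
    using w0(1) by (auto simp: b_def u_def e_def coord_space_def)
  have WS: "x \<in> coord_space d (Suc k)" if "x \<in> ?W" for x using that by (auto simp: coord_space_def)
  have lin: "t \<cdot>\<^sub>v x + y \<in> coord_space d j" if "x \<in> coord_space d j" "y \<in> coord_space d j" for t x y j
    using that by (auto simp: coord_space_def)
  have sup_split: "sup_norm d x = max (v (x $ k)) (sup_norm d (trunc x))" if x: "x \<in> carrier_vec d" for x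
  proof (rule order_antisym)
    show "sup_norm d x \<le> max (v (x $ k)) (sup_norm d (trunc x))"
    proof (rule sup_norm_leI)
      fix i assume i: "i < d"
      show "v (x $ i) \<le> max (v (x $ k)) (sup_norm d (trunc x))"
        using sup_norm_ge[OF i, of "trunc x"] i by (cases "i = k") (auto simp: trunc_def)
    qed (simp add: le_max_iff_disj)
    have "sup_norm d (trunc x) \<le> sup_norm d x"
      by (rule sup_norm_leI[OF sup_norm_nonneg]) (auto simp: trunc_def sup_norm_nonneg sup_norm_ge)
    then show "max (v (x $ k)) (sup_norm d (trunc x)) \<le> sup_norm d x" using sup_norm_ge[OF k] by simp
  qed
  show ?case
  proof (intro bexI[OF _ B'c] conjI ballI)
    fix x assume x: "x \<in> coord_space d (Suc k)"
    have xc: "x \<in> carrier_vec d" by (rule Wc[OF x])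
    define w where "w = B *\<^sub>v trunc x"
    have w: "w \<in> ?W" "w \<in> carrier_vec d" using BW[OF truncW[OF x]] Wc by (auto simp: w_def)
    have eq: "B' *\<^sub>v x = x $ k \<cdot>\<^sub>v b + w" using B'x[OF xc] by (simp add: w_def)
    show "B' *\<^sub>v x \<in> coord_space d (Suc k)" unfolding eq by (rule lin[OF bS WS[OF w(1)]])
    have tb: "N (x $ k \<cdot>\<^sub>v b) = v (x $ k) * N b" by (rule Nn(2)[OF b])
    have "v (x $ k) * N b \<le> v (x $ k)" using mult_left_mono[of "N b" 1 "v (x $ k)"] Nb by simp
    then show "N (B' *\<^sub>v x) \<le> sup_norm d x"
      unfolding eq using Nn(3)[of "x $ k \<cdot>\<^sub>v b" w] b w tb Bup[OF truncW[OF x]] sup_split[OF xc]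
      by (simp add: w_def)
    let ?n = "N (x $ k \<cdot>\<^sub>v b + w)"
    have k1: "\<beta> * (v (x $ k) * N b) \<le> ?n" by (rule key[OF w(1)])
    have "\<alpha> * v (x $ k) \<le> \<beta> * (v (x $ k) * N b)"
      using mult_left_mono[of \<beta> "N b" "\<beta> * v (x $ k)"] Nb \<beta> by (simp flip: \<beta>(3) add: mult_ac)
    then have 1: "\<alpha> * v (x $ k) \<le> ?n" using k1 by linarith
    have low: "\<beta> * sup_norm d (trunc x) \<le> N w" using Blow[OF truncW[OF x]] by (simp add: w_def)
    \<comment> \<open>If \<open>w\<close> dominates the other summand, the ultrametric inequality
      bounds it by the norm of the sum; otherwise \<open>key\<close> bounds the dominating
      summand.\<close>
    have "\<beta> * N w \<le> ?n"
    proof (cases "N w \<le> v (x $ k) * N b")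
      case True
      then show ?thesis using k1 \<beta>(1) mult_left_mono[of "N w" "v (x $ k) * N b" \<beta>] by linarith
    next
      case False
      have "w = (x $ k \<cdot>\<^sub>v b + w) - x $ k \<cdot>\<^sub>v b" using b w by (intro eq_vecI) auto
      then have "N w \<le> max ?n (N (x $ k \<cdot>\<^sub>v b))" using Nn(5)[of "x $ k \<cdot>\<^sub>v b + w" "x $ k \<cdot>\<^sub>v b"] b w by simp
      then have "N w \<le> ?n" using False tb by simp
      moreover have "\<beta> * N w \<le> N w" using mult_right_mono[of \<beta> 1 "N w"] \<beta> Nn(1)[OF w(2)] by simp
      ultimately show ?thesis by linarith
    qed
    moreover have "\<alpha> * sup_norm d (trunc x) \<le> \<beta> * N w"
      using mult_left_mono[OF low, of \<beta>] \<beta> by (simp flip: \<beta>(3) add: mult.assoc)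
    ultimately have 2: "\<alpha> * sup_norm d (trunc x) \<le> ?n" by linarith
    show "\<alpha> * sup_norm d x \<le> N (B' *\<^sub>v x)"
      unfolding eq sup_split[OF xc] using 1 2 by (auto simp: max_def)
  next
    fix y assume y: "y \<in> coord_space d (Suc k)"
    have bk: "b $ k = c" using w0(1) k by (auto simp: b_def u_def e_def coord_space_def)
    define t where "t = y $ k / c"
    have "(- t) \<cdot>\<^sub>v b + y \<in> ?W"
      using lin[OF bS y, of "- t"] b Wc[OF y] bk c(1) k
      by (auto simp: coord_space_def t_def le_Suc_eq not_less_eq_eq)
    then obtain x where x: "x \<in> ?W" "B *\<^sub>v x = (- t) \<cdot>\<^sub>v b + y" using Bsurj by blast
    define x' where "x' = Matrix.vec d (\<lambda>i. if i = k then t else x $ i)"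
    have "x' \<in> coord_space d (Suc k)" using x(1) by (auto simp: x'_def coord_space_def)
    moreover have "trunc x' = x"
      using x(1) by (intro eq_vecI) (auto simp: trunc_def x'_def coord_space_def)
    moreover have "t \<cdot>\<^sub>v b + ((- t) \<cdot>\<^sub>v b + y) = y" using b Wc[OF y] by (intro eq_vecI) auto
    ultimately show "\<exists>x\<in>coord_space d (Suc k). B' *\<^sub>v x = y"
      using B'x[OF Wc, of x' "Suc k"] x(2) k by (intro bexI[of _ x']) (auto simp: x'_def)
  qed
qed

text \<open>The case k = d. The lower bound leaves no kernel, which makes \<open>B\<close>
  invertible.\<close>

lemma almost_orthogonal_basis:
  assumes N: "ultrametric_norm v d N" and \<alpha>: "0 < \<alpha>" "\<alpha> < 1"
  obtains B B' where "B \<in> carrier_mat d d" "B' \<in> carrier_mat d d" "B * B' = 1\<^sub>m d" "B' * B = 1\<^sub>m d"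
    "\<And>x. x \<in> carrier_vec d \<Longrightarrow> \<alpha> * sup_norm d x \<le> N (B *\<^sub>v x)"
    "\<And>x. x \<in> carrier_vec d \<Longrightarrow> N (B *\<^sub>v x) \<le> sup_norm d x"
proof -
  have "coord_space d d = carrier_vec d" by (auto simp: coord_space_def)
  then obtain B where B: "B \<in> carrier_mat d d"
    "\<And>x. x \<in> carrier_vec d \<Longrightarrow> \<alpha> * sup_norm d x \<le> N (B *\<^sub>v x)"
    "\<And>x. x \<in> carrier_vec d \<Longrightarrow> N (B *\<^sub>v x) \<le> sup_norm d x"
    using almost_orthogonal_basis_aux[OF N order.refl \<alpha>] by auto
  have "x = 0\<^sub>v d" if x: "x \<in> carrier_vec d" "B *\<^sub>v x = 0\<^sub>v d" for x
  proof -
    have "\<alpha> * sup_norm d x \<le> 0"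
      using B(2)[OF x(1)] x(2) ultra_seminormD(4)[OF ultrametric_normD(1)[OF N]] by simp
    then have "sup_norm d x = 0" using \<alpha>(1) sup_norm_nonneg[of d x] by (simp add: mult_le_0_iff)
    then show ?thesis using ultrametric_normD(2)[OF sup_norm_ultrametric x(1)] by simp
  qed
  then have "det B \<noteq> 0" using det_0_iff_vec_prod_zero_field[OF B(1)] by blast
  then obtain B' where "B' \<in> carrier_mat d d" "B * B' = 1\<^sub>m d" "B' * B = 1\<^sub>m d"
    using det_non_zero_imp_unit[OF B(1), of "()"] unfolding Units_def ring_mat_simps by auto
  then show thesis using that B by blast
qed

end

section \<open>Norm bounds and the Rota--Strang radius\<close>

abbreviation mat_pow :: "nat \<Rightarrow> 'a::field mat set \<Rightarrow> nat \<Rightarrow> 'a mat set" where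
  "mat_pow d S n \<equiv> set_pow (module_mat TYPE('a) d d) S n"

lemma mat_pow_Suc_iff: "w \<in> mat_pow d S (Suc n) \<longleftrightarrow> (\<exists>s\<in>S. \<exists>u\<in>mat_pow d S n. w = s * u)"
  by (auto simp: set_mult_def module_mat_simps)

lemma mat_pow_0: "mat_pow d S 0 = {1\<^sub>m d}"
  by (simp add: module_mat_simps)

declare set_pow.simps [simp del]

lemma mat_pow_carrier: "S \<subseteq> carrier_mat d d \<Longrightarrow> mat_pow d S n \<subseteq> carrier_mat d d"
proof (induction n)
  case (Suc n)
  then show ?case
    by (auto simp: mat_pow_Suc_iff intro!: mult_carrier_mat[of _ d d _ d])
qed (simp add: mat_pow_0)

lemma mat_pow_mult:
  assumes S: "S \<subseteq> carrier_mat d d" and w: "w \<in> mat_pow d S n"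
  shows "u \<in> mat_pow d S m \<Longrightarrow> u * w \<in> mat_pow d S (m + n)"
proof (induction m arbitrary: u)
  case 0
  then show ?case using w mat_pow_carrier[OF S, of n] by (auto simp: mat_pow_0)
next
  case (Suc m)
  obtain s u' where u: "u = s * u'" "s \<in> S" "u' \<in> mat_pow d S m" using Suc.prems mat_pow_Suc_iff by blast
  have "u * w = s * (u' * w)"
    using u S w mat_pow_carrier[OF S] unfolding u(1) by (intro assoc_mult_mat[of _ d d _ d _ d]) auto
  then show ?case using u(2) Suc.IH[OF u(3)] mat_pow_Suc_iff[of _ d S "m + n"] by auto
qed

lemma mat_pow_split:
  assumes S: "S \<subseteq> carrier_mat d d"
  shows "w \<in> mat_pow d S (m + n) \<Longrightarrow> \<exists>u\<in>mat_pow d S m. \<exists>w'\<in>mat_pow d S n. w = u * w'"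
proof (induction m arbitrary: w)
  case 0
  then show ?case using mat_pow_carrier[OF S, of n] by (auto simp: mat_pow_0 intro!: bexI[of _ w])
next
  case (Suc m)
  then obtain s w1 where w: "w = s * w1" "s \<in> S" "w1 \<in> mat_pow d S (m + n)"
    using mat_pow_Suc_iff[of w d S "m + n"] by auto
  obtain u w' where uw: "u \<in> mat_pow d S m" "w' \<in> mat_pow d S n" "w1 = u * w'" using Suc.IH[OF w(3)] by blast
  have "w = (s * u) * w'"
    unfolding w(1) uw(3)
    using uw w S mat_pow_carrier[OF S] by (intro assoc_mult_mat[symmetric, of _ d d _ d _ d]) auto
  then show ?case using w(2) uw mat_pow_Suc_iff[of "s * u" d S m] by blast
qed

section \<open>Norm bounds and comparison of norms\<close>

context complete_nonarch_field begin

text \<open>As an inequality instead of a supremum of quotients, this makes sense for seminorms with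
  a kernel as well.\<close>

definition norm_bound :: "nat \<Rightarrow> ('a Matrix.vec \<Rightarrow> real) \<Rightarrow> 'a mat set \<Rightarrow> real \<Rightarrow> bool" where
  "norm_bound d q S t \<longleftrightarrow> 0 \<le> t \<and> (\<forall>s\<in>S. \<forall>x\<in>carrier_vec d. q (s *\<^sub>v x) \<le> t * q x)"

lemma norm_boundD: "norm_bound d q S t \<Longrightarrow> s \<in> S \<Longrightarrow> x \<in> carrier_vec d \<Longrightarrow> q (s *\<^sub>v x) \<le> t * q x"
  by (auto simp: norm_bound_def)

lemma seminorm_le_sup_norm:
  assumes q: "ultra_seminorm d q" shows "\<exists>C>0. \<forall>x\<in>carrier_vec d. q x \<le> C * sup_norm d x"
proof -
  note qn = ultra_seminormD[OF q]
  \<comment> \<open>The sum dominates the value at each unit vector; the 1 keeps \<open>C\<close>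
    positive.\<close>
  define C where "C = 1 + (\<Sum>j<d. q (unit_vec d j))"
  have nn: "0 \<le> q (unit_vec d j)" for j using qn(1)[of "unit_vec d j"] by simp
  have C: "q (unit_vec d j) \<le> C" if "j < d" for j
    unfolding C_def using member_le_sum[of j "{..<d}" "\<lambda>j. q (unit_vec d j)"] that nn by auto
  have C1: "C \<ge> 1" unfolding C_def using nn by (simp add: sum_nonneg)
  have "q x \<le> C * sup_norm d x" if "x \<in> coord_space d k" "k \<le> d" for x k
    using that
  proof (induction k arbitrary: x)
    case 0
    then have "x = 0\<^sub>v d" by (intro eq_vecI) (auto simp: coord_space_def)
    then show ?case using qn(4) C1 sup_norm_nonneg[of d x] by simp
  next
    case (Suc k)
    have k: "k < d" and xc: "x \<in> carrier_vec d" using Suc.prems by (auto simp: coord_space_def)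
    define y where "y = Matrix.vec d (\<lambda>i. if i = k then 0 else x $ i)"
    have y: "y \<in> coord_space d k" "y \<in> carrier_vec d" using Suc.prems by (auto simp: y_def coord_space_def)
    have "sup_norm d y \<le> sup_norm d x"
      by (rule sup_norm_leI[OF sup_norm_nonneg]) (auto simp: y_def sup_norm_nonneg sup_norm_ge)
    then have "C * sup_norm d y \<le> C * sup_norm d x" using C1 by (intro mult_left_mono) auto
    then have 1: "q y \<le> C * sup_norm d x" using Suc.IH[OF y(1)] k by simp
    have "v (x $ k) * q (unit_vec d k) \<le> sup_norm d x * C"
      using C[OF k] sup_norm_ge[OF k] nn sup_norm_nonneg by (intro mult_mono) auto
    then have 2: "q (x $ k \<cdot>\<^sub>v unit_vec d k) \<le> C * sup_norm d x"
      using qn(2)[of "unit_vec d k" "x $ k"] by (simp add: mult.commute)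
    have "x = x $ k \<cdot>\<^sub>v unit_vec d k + y" using xc k by (intro eq_vecI) (auto simp: y_def)
    then have "q x \<le> max (q (x $ k \<cdot>\<^sub>v unit_vec d k)) (q y)"
      using qn(3)[of "x $ k \<cdot>\<^sub>v unit_vec d k" y] y(2) by simp
    then show ?case using 1 2 by linarith
  qed
  from this[of _ d] show ?thesis using C1 by (intro exI[of _ C]) (auto simp: coord_space_def)
qed

text \<open>An almost orthogonal basis compares \<open>N\<close> with \<open>sup_norm\<close>, which
  dominates every seminorm up to a constant. The value 1/2 is an arbitrary choice below 1.\<close>

lemma seminorm_le_norm:
  assumes N: "ultrametric_norm v d N" and q: "ultra_seminorm d q"
  obtains C where "C > 0" "\<And>x. x \<in> carrier_vec d \<Longrightarrow> q x \<le> C * N x"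
proof -
  obtain B B' where B: "B \<in> carrier_mat d d" "B' \<in> carrier_mat d d" "B * B' = 1\<^sub>m d"
    and low: "\<And>x. x \<in> carrier_vec d \<Longrightarrow> 1/2 * sup_norm d x \<le> N (B *\<^sub>v x)"
    by (rule almost_orthogonal_basis[OF N, of "1/2"]) auto
  obtain C where C: "C > 0" "\<And>x. x \<in> carrier_vec d \<Longrightarrow> q (B *\<^sub>v x) \<le> C * sup_norm d x"
    using seminorm_le_sup_norm[OF ultra_seminorm_comp[OF q B(1)]] by blast
  have "q x \<le> (2 * C) * N x" if x: "x \<in> carrier_vec d" for x
  proof -
    have B'x: "B' *\<^sub>v x \<in> carrier_vec d" using B(2) x by simp
    have eq: "B *\<^sub>v (B' *\<^sub>v x) = x" using B x by (simp flip: assoc_mult_mat_vec)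
    have "C * sup_norm d (B' *\<^sub>v x) \<le> C * (2 * N x)"
      using low[OF B'x] C(1) unfolding eq by (intro mult_left_mono) auto
    then show ?thesis using C(2)[OF B'x] unfolding eq by simp
  qed
  then show thesis using C(1) by (intro that[of "2 * C"]) auto
qed

text \<open>\<open>d \<ge> 1\<close> ensures that the supremum is over a non-empty set; comparison
  of seminorms with \<open>N\<close> makes it finite.\<close>

lemma op_norm:
  assumes N: "ultrametric_norm v d N" and d: "d \<ge> 1" and A: "A \<in> carrier_mat d d"
  shows "x \<in> carrier_vec d \<Longrightarrow> N (A *\<^sub>v x) \<le> op_norm d N A * N x"
    and "0 \<le> op_norm d N A"
    and "(\<And>x. x \<in> carrier_vec d \<Longrightarrow> N (A *\<^sub>v x) \<le> C * N x) \<Longrightarrow> op_norm d N A \<le> C"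
proof -
  note Nn = ultra_seminormD[OF ultrametric_normD(1)[OF N]]
  let ?D = "carrier_vec d - {0\<^sub>v d} :: 'a Matrix.vec set"
  obtain K where K: "\<And>x. x \<in> carrier_vec d \<Longrightarrow> N (A *\<^sub>v x) \<le> K * N x"
    using seminorm_le_norm[OF N ultra_seminorm_comp[OF ultrametric_normD(1)[OF N] A]] by blast
  have pos: "0 < N x" if "x \<in> ?D" for x using that ultrametric_normD(3)[OF N] by blast
  have bdd: "bdd_above ((\<lambda>x. N (A *\<^sub>v x) / N x) ` ?D)"
    using K pos by (intro bdd_aboveI2[of _ _ K]) (auto simp: divide_le_eq)
  have up: "N (A *\<^sub>v x) / N x \<le> op_norm d N A" if "x \<in> ?D" for x
    unfolding op_norm_def using that bdd by (intro cSUP_upper)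
  have "unit_vec d 0 $ 0 = (1 :: 'a)" using d by simp
  then have e: "unit_vec d 0 \<in> ?D" using d by (auto dest: arg_cong[of _ _ "\<lambda>x. x $ 0"])
  show "0 \<le> op_norm d N A"
    using up[OF e] pos[OF e] Nn(1)[of "A *\<^sub>v unit_vec d 0"] A
    by (meson divide_nonneg_pos mult_mat_vec_carrier order_trans unit_vec_carrier)
  show "N (A *\<^sub>v x) \<le> op_norm d N A * N x" if x: "x \<in> carrier_vec d"
  proof (cases "x = 0\<^sub>v d")
    case True
    have "A *\<^sub>v 0\<^sub>v d = 0\<^sub>v d" using A by (intro eq_vecI) auto
    then show ?thesis using True Nn(4) by simp
  next
    case False
    then have "x \<in> ?D" using x by simp
    from up[OF this] pos[OF this] show ?thesis by (simp add: divide_le_eq)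
  qed
  show "op_norm d N A \<le> C" if C: "\<And>x. x \<in> carrier_vec d \<Longrightarrow> N (A *\<^sub>v x) \<le> C * N x"
    unfolding op_norm_def
  proof (rule cSUP_least)
    show "?D \<noteq> {}" using e by blast
    show "N (A *\<^sub>v x) / N x \<le> C" if "x \<in> ?D" for x
      using C[of x] pos[OF that] that by (simp add: divide_le_eq)
  qed
qed

lemma op_norm_le:
  assumes "ultrametric_norm v d N" "d \<ge> 1" "S \<subseteq> carrier_mat d d" "norm_bound d N S t" "s \<in> S"
  shows "op_norm d N s \<le> t"
  using assms by (intro op_norm(3)) (auto simp: norm_bound_def)

lemma set_norm_le:
  assumes "ultrametric_norm v d N" "d \<ge> 1" "S \<subseteq> carrier_mat d d" "norm_bound d N S t"
  shows "set_norm d N S \<le> t"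
  unfolding set_norm_def using op_norm_le[OF assms] assms(4)
  by (intro cSup_least) (auto simp: norm_bound_def)

lemma norm_bound_set_norm:
  assumes N: "ultrametric_norm v d N" and d: "d \<ge> 1" and S: "S \<subseteq> carrier_mat d d"
    and bdd: "bdd_above (op_norm d N ` S)"
  shows "norm_bound d N S (set_norm d N S)"
  unfolding norm_bound_def
proof (intro conjI ballI)
  have bdd': "bdd_above (insert 0 (op_norm d N ` S))" using bdd by simp
  show "0 \<le> set_norm d N S" unfolding set_norm_def by (rule cSup_upper[OF _ bdd']) simp
  fix s and x :: "'a Matrix.vec" assume s: "s \<in> S" and x: "x \<in> carrier_vec d"
  have "op_norm d N s \<le> set_norm d N S" unfolding set_norm_def using s by (intro cSup_upper[OF _ bdd']) simp
  then have "op_norm d N s * N x \<le> set_norm d N S * N x"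
    using ultra_seminormD(1)[OF ultrametric_normD(1)[OF N] x] by (rule mult_right_mono)
  then show "N (s *\<^sub>v x) \<le> set_norm d N S * N x" using op_norm(1)[OF N d _ x, of s] s S by force
qed

lemma norm_bound_set_norm':
  assumes "ultrametric_norm v d N" "d \<ge> 1" "S \<subseteq> carrier_mat d d" "norm_bound d N S t"
  shows "norm_bound d N S (set_norm d N S)"
  using op_norm_le[OF assms] by (intro norm_bound_set_norm[OF assms(1-3)] bdd_aboveI2[of _ _ t])

text \<open>The constant depends only on the two norms. One constant thus serves all powers of a set
  and disappears under n-th roots.\<close>

lemma norm_bound_change:
  assumes N: "ultrametric_norm v d N" "ultrametric_norm v d N'"
  obtains C where "C > 0"
    "\<And>S t. S \<subseteq> carrier_mat d d \<Longrightarrow> norm_bound d N S t \<Longrightarrow> norm_bound d N' S (C * t)"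
proof -
  obtain C1 where C1: "C1 > 0" "\<And>x. x \<in> carrier_vec d \<Longrightarrow> N' x \<le> C1 * N x"
    using seminorm_le_norm[OF N(1) ultrametric_normD(1)[OF N(2)]] by blast
  obtain C2 where C2: "C2 > 0" "\<And>x. x \<in> carrier_vec d \<Longrightarrow> N x \<le> C2 * N' x"
    using seminorm_le_norm[OF N(2) ultrametric_normD(1)[OF N(1)]] by blast
  have "norm_bound d N' S (C1 * C2 * t)" if S: "S \<subseteq> carrier_mat d d" and b: "norm_bound d N S t" for S t
    unfolding norm_bound_def
  proof (intro conjI ballI)
    have t: "0 \<le> t" using b by (simp add: norm_bound_def)
    then show "0 \<le> C1 * C2 * t" using C1 C2 by simp
    fix s and x :: "'a Matrix.vec" assume s: "s \<in> S" and x: "x \<in> carrier_vec d"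
    have "N' (s *\<^sub>v x) \<le> C1 * N (s *\<^sub>v x)" using s S x by (intro C1(2)) auto
    also have "\<dots> \<le> C1 * (t * N x)" using norm_boundD[OF b s x] C1(1) by simp
    also have "\<dots> \<le> C1 * (t * (C2 * N' x))"
      using C1(1) C2(2)[OF x] t by (intro mult_left_mono) auto
    finally show "N' (s *\<^sub>v x) \<le> C1 * C2 * t * N' x" by (simp add: mult_ac)
  qed
  then show thesis using C1(1) C2(1) by (intro that[of "C1 * C2"]) auto
qed

lemma norm_bound_pow:
  assumes q: "ultra_seminorm d q" and S: "S \<subseteq> carrier_mat d d" and b: "norm_bound d q S t"
  shows "norm_bound d q (mat_pow d S n) (t ^ n)"
proof (induction n)
  case 0
  show ?case by (auto simp: norm_bound_def mat_pow_0)
next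
  case (Suc n)
  have t: "0 \<le> t" using b by (simp add: norm_bound_def)
  show ?case unfolding norm_bound_def
  proof (intro conjI ballI)
    show "0 \<le> t ^ Suc n" using t by simp
    fix w and x :: "'a Matrix.vec" assume "w \<in> mat_pow d S (Suc n)" and x: "x \<in> carrier_vec d"
    then obtain s u where w: "w = s * u" "s \<in> S" "u \<in> mat_pow d S n" using mat_pow_Suc_iff by blast
    have uc: "u \<in> carrier_mat d d" "s \<in> carrier_mat d d" using w S mat_pow_carrier[OF S] by auto
    have "q (w *\<^sub>v x) = q (s *\<^sub>v (u *\<^sub>v x))" using w(1) uc x by (simp add: assoc_mult_mat_vec)
    also have "\<dots> \<le> t * q (u *\<^sub>v x)" using uc x by (intro norm_boundD[OF b w(2)]) simp
    also have "\<dots> \<le> t * (t ^ n * q x)" using t by (intro mult_left_mono norm_boundD[OF Suc w(3) x])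
    finally show "q (w *\<^sub>v x) \<le> t ^ Suc n * q x" by simp
  qed
qed

text \<open>The new norm of x is the supremum of t ^ (-j) N (w x) over words \<open>w\<close> of
  length j < m. Applying a member of \<open>S\<close> to x lengthens the word by one letter, which
  costs a factor \<open>t\<close>; at length m the hypothesis leads back to the empty word.\<close>

lemma rota_strang:
  assumes N: "ultrametric_norm v d N" and S: "S \<subseteq> carrier_mat d d" and bS: "norm_bound d N S C"
    and m: "m \<ge> 1" and t: "t > 0" and b: "norm_bound d N (mat_pow d S m) (t ^ m)"
  obtains N' where "ultrametric_norm v d N'" "norm_bound d N' S t"
proof -
  note Ns = ultrametric_normD(1)[OF N] and Nn = ultra_seminormD[OF ultrametric_normD(1)[OF N]]
  define Q where "Q = {\<lambda>x. (1 / t ^ j) * N (w *\<^sub>v x) | j w. j < m \<and> w \<in> mat_pow d S j}"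
  have powc: "mat_pow d S j \<subseteq> carrier_mat d d" for j by (rule mat_pow_carrier[OF S])
  have Q0: "(\<lambda>x. (1 / t ^ 0) * N (1\<^sub>m d *\<^sub>v x)) \<in> Q"
    unfolding Q_def using m mat_pow_0 by (intro CollectI exI[of _ 0] exI[of _ "1\<^sub>m d"]) auto
  have Qs: "ultra_seminorm d q" if q: "q \<in> Q" for q
  proof -
    obtain j w where jw: "q = (\<lambda>x. (1 / t ^ j) * N (w *\<^sub>v x))" "w \<in> mat_pow d S j"
      using q unfolding Q_def by blast
    show ?thesis unfolding jw(1)
      using t powc jw(2) by (intro ultra_seminorm_scale ultra_seminorm_comp[OF Ns]) auto
  qed
  \<comment> \<open>Words of length j are bounded by the j-th power of \<open>C\<close>, so the
    supremum over \<open>Q\<close> is finite.\<close>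
  define K where "K = (\<Sum>j<m. (1 / t ^ j) * C ^ j)"
  have C: "0 \<le> C" using bS by (simp add: norm_bound_def)
  have QK: "q x \<le> K * N x" if q: "q \<in> Q" and x: "x \<in> carrier_vec d" for q and x :: "'a Matrix.vec"
  proof -
    obtain j w where jw: "q = (\<lambda>x. (1 / t ^ j) * N (w *\<^sub>v x))" "j < m" "w \<in> mat_pow d S j"
      using q unfolding Q_def by blast
    have "N (w *\<^sub>v x) \<le> C ^ j * N x"
      by (rule norm_boundD[OF norm_bound_pow[OF Ns S bS] jw(3) x])
    then have "q x \<le> (1 / t ^ j) * (C ^ j * N x)" unfolding jw(1) using t by (intro mult_left_mono) auto
    also have "\<dots> = ((1 / t ^ j) * C ^ j) * N x" by simp
    also have "\<dots> \<le> K * N x"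
      unfolding K_def using jw(2) t C Nn(1)[OF x]
      by (intro mult_right_mono member_le_sum[of j "{..<m}" "\<lambda>j. (1 / t ^ j) * C ^ j"]) auto
    finally show ?thesis .
  qed
  have bdd: "bdd_above ((\<lambda>q. q x) ` Q)" if "x \<in> carrier_vec d" for x
    using QK[OF _ that] by (intro bdd_aboveI2[of _ _ "K * N x"])
  define N' where "N' x = (SUP q\<in>Q. q x)" for x
  have up: "q x \<le> N' x" if "q \<in> Q" "x \<in> carrier_vec d" for q x
    unfolding N'_def using that bdd by (intro cSUP_upper)
  have N's: "ultra_seminorm d N'" unfolding N'_def using Q0 Qs bdd by (intro ultra_seminorm_sup) auto
  have NN': "N x \<le> N' x" if "x \<in> carrier_vec d" for x using up[OF Q0 that] that by simp
  have "ultrametric_norm v d N'"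
    unfolding ultrametric_norm_iff
  proof (intro conjI N's ballI impI)
    fix x assume x: "x \<in> carrier_vec d" "N' x = 0"
    then show "x = 0\<^sub>v d" using NN'[OF x(1)] Nn(1)[OF x(1)] by (intro ultrametric_normD(2)[OF N]) auto
  qed
  moreover have "norm_bound d N' S t" unfolding norm_bound_def
  proof (intro conjI ballI)
    show "0 \<le> t" using t by simp
    fix s and x :: "'a Matrix.vec" assume s: "s \<in> S" and x: "x \<in> carrier_vec d"
    have sc: "s \<in> carrier_mat d d" using s S by blast
    have "q (s *\<^sub>v x) \<le> t * N' x" if q: "q \<in> Q" for q
    proof -
      obtain j w where jw: "q = (\<lambda>x. (1 / t ^ j) * N (w *\<^sub>v x))" "j < m" "w \<in> mat_pow d S j"
        using q unfolding Q_def by blast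
      have wc: "w \<in> carrier_mat d d" using jw(3) powc by blast
      have "s * 1\<^sub>m d \<in> mat_pow d S (Suc 0)" unfolding mat_pow_Suc_iff mat_pow_0 using s by blast
      then have "s \<in> mat_pow d S 1" using sc by simp
      then have ws: "w * s \<in> mat_pow d S (Suc j)" using mat_pow_mult[OF S _ jw(3)] by fastforce
      have eq: "q (s *\<^sub>v x) = (1 / t ^ j) * N ((w * s) *\<^sub>v x)"
        using jw(1) wc sc x by (simp add: assoc_mult_mat_vec)
      show ?thesis
      proof (cases "Suc j < m")
        case True
        then have "(\<lambda>x. (1 / t ^ Suc j) * N ((w * s) *\<^sub>v x)) \<in> Q" unfolding Q_def using ws by blast
        from up[OF this x] have "t * ((1 / t ^ Suc j) * N ((w * s) *\<^sub>v x)) \<le> t * N' x"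
          using t by (intro mult_left_mono) auto
        then show ?thesis unfolding eq using t by (simp add: field_simps)
      next
        case False
        then have m: "m = Suc j" using jw(2) by simp
        have "N ((w * s) *\<^sub>v x) \<le> t ^ Suc j * N x" using norm_boundD[OF b _ x] ws m by blast
        then have "(1 / t ^ j) * N ((w * s) *\<^sub>v x) \<le> (1 / t ^ j) * (t ^ Suc j * N x)"
          using t by (intro mult_left_mono) auto
        also have "\<dots> = t * N x" using t by simp
        also have "\<dots> \<le> t * N' x" using NN'[OF x] t by simp
        finally show ?thesis unfolding eq .
      qed
    qed
    then show "N' (s *\<^sub>v x) \<le> t * N' x" unfolding N'_def[of "s *\<^sub>v x"] using Q0 by (intro cSUP_least) auto
  qed
  ultimately show thesis by (rule that)
qed

definition radius :: "nat \<Rightarrow> 'a mat set \<Rightarrow> real" where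
  "radius d S = Inf {t. \<exists>N. ultrametric_norm v d N \<and> norm_bound d N S t}"

lemma radius_le: "ultrametric_norm v d N \<Longrightarrow> norm_bound d N S t \<Longrightarrow> radius d S \<le> t"
  unfolding radius_def by (intro cInf_lower bdd_belowI[of _ 0]) (auto simp: norm_bound_def)

lemma radius_nonneg: "ultrametric_norm v d N \<Longrightarrow> norm_bound d N S t \<Longrightarrow> 0 \<le> radius d S"
  unfolding radius_def by (intro cInf_greatest) (auto simp: norm_bound_def)

lemma radius_less:
  assumes "ultrametric_norm v d N" "norm_bound d N S t" "radius d S < t'"
  obtains N' where "ultrametric_norm v d N'" "norm_bound d N' S t'"
proof -
  have "{t. \<exists>N. ultrametric_norm v d N \<and> norm_bound d N S t} \<noteq> {}" using assms by blast
  from cInf_lessD[OF this] assms(3) obtain t1 N' where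
    N': "ultrametric_norm v d N'" "norm_bound d N' S t1" "t1 < t'" unfolding radius_def by blast
  have "t1 * N' x \<le> t' * N' x" if "x \<in> carrier_vec d" for x
    using N'(3) ultra_seminormD(1)[OF ultrametric_normD(1)[OF N'(1)] that] by (intro mult_right_mono) auto
  then have "norm_bound d N' S t'" using N'(2,3) unfolding norm_bound_def by (meson less_imp_le order_trans)
  then show thesis using that N'(1) by blast
qed

text \<open>If a power had a smaller norm, the Rota--Strang construction would produce a norm in
  which \<open>S\<close> is bounded by some t below the infimum.\<close>

lemma radius_pow_le:
  assumes N: "ultrametric_norm v d N" and S: "S \<subseteq> carrier_mat d d" and bS: "norm_bound d N S C"
    and N': "ultrametric_norm v d N'" and m: "m \<ge> 1" and b: "norm_bound d N' (mat_pow d S m) a"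
  shows "radius d S ^ m \<le> a"
proof (rule ccontr)
  let ?R = "radius d S"
  assume "\<not> ?thesis"
  then have aR: "a < ?R ^ m" by simp
  have a: "0 \<le> a" using b by (simp add: norm_bound_def)
  have R: "0 < ?R" using radius_nonneg[OF N bS] aR a m by (cases "?R = 0") (auto simp: power_0_left)
  obtain D where "norm_bound d N' S D" using norm_bound_change[OF N N'] S bS by metis
  note bS' = this
  \<comment> \<open>The maximum with half the radius keeps \<open>t\<close> positive when
    \<open>a\<close> is 0.\<close>
  define t where "t = max (root m a) (?R / 2)"
  have "root m a < root m (?R ^ m)" using aR m by (intro real_root_less_mono) auto
  then have "root m a < ?R" using m R by (simp add: real_root_power_cancel)
  then have t: "0 < t" "t < ?R" using R by (auto simp: t_def)
  have "a = root m a ^ m" using a m by simp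
  also have "\<dots> \<le> t ^ m" using a m by (intro power_mono) (auto simp: t_def intro: real_root_ge_zero)
  finally have "a \<le> t ^ m" .
  then have "norm_bound d N' (mat_pow d S m) (t ^ m)"
    using b t ultra_seminormD(1)[OF ultrametric_normD(1)[OF N']] unfolding norm_bound_def
    by (meson less_imp_le mult_right_mono order_trans zero_le_power)
  from rota_strang[OF N' S bS' m t(1) this] obtain N'' where "ultrametric_norm v d N''" "norm_bound d N'' S t" .
  then have "?R \<le> t" by (rule radius_le)
  then show False using t(2) by simp
qed

end

section \<open>The limit formula, and conjugates of the set\<close>

lemma inv_module_mat:
  assumes "g \<in> carrier_mat d d" "h \<in> carrier_mat d d" "g * h = 1\<^sub>m d" "h * g = (1\<^sub>m d :: 'a::field mat)"
  shows "inv\<^bsub>module_mat TYPE('a) d d\<^esub> g = h"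
  unfolding m_inv_def module_mat_simps
proof (rule the_equality)
  fix k :: "'a mat" assume k: "k \<in> carrier_mat d d \<and> g * k = 1\<^sub>m d \<and> k * g = 1\<^sub>m d"
  have "k = (h * g) * k" using k assms by auto
  also have "\<dots> = h * (g * k)" using k assms by (intro assoc_mult_mat[of _ d d _ d _ d]) auto
  finally show "k = h" using k assms by auto
qed (use assms in auto)

lemma Units_module_mat:
  "g \<in> Units (module_mat TYPE('a::field) d d) \<longleftrightarrow>
    g \<in> carrier_mat d d \<and> (\<exists>h\<in>carrier_mat d d. h * g = 1\<^sub>m d \<and> g * h = 1\<^sub>m d)"
  by (auto simp: Units_def module_mat_simps)

text \<open>The upper limit of a bounded non-negative sequence.\<close>

definition ev_bound :: "(nat \<Rightarrow> real) \<Rightarrow> real" where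
  "ev_bound f = Inf {D. 0 \<le> D \<and> eventually (\<lambda>n. f n \<le> D) sequentially}"

lemma ev_bound_le: "0 \<le> D \<Longrightarrow> eventually (\<lambda>n. f n \<le> D) sequentially \<Longrightarrow> ev_bound f \<le> D"
  unfolding ev_bound_def by (intro cInf_lower bdd_belowI[of _ 0]) auto

lemma ev_bound_nonneg: "0 \<le> D \<Longrightarrow> eventually (\<lambda>n. f n \<le> D) sequentially \<Longrightarrow> 0 \<le> ev_bound f"
  unfolding ev_bound_def by (intro cInf_greatest) auto

lemma ev_bound_less:
  assumes "0 \<le> D" "eventually (\<lambda>n. f n \<le> D) sequentially" "ev_bound f < E"
  shows "eventually (\<lambda>n. f n \<le> E) sequentially"
proof -
  have "{D. 0 \<le> D \<and> eventually (\<lambda>n. f n \<le> D) sequentially} \<noteq> {}" using assms by blast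
  from cInf_lessD[OF this] assms(3) obtain D' where
    "eventually (\<lambda>n. f n \<le> D') sequentially" "D' < E" unfolding ev_bound_def by blast
  then show ?thesis by (auto elim: eventually_mono)
qed

context complete_nonarch_field begin

text \<open>From below this is \<open>radius_pow_le\<close>. From above, a norm that bounds
  \<open>S\<close> by t slightly over the radius bounds the n-th power by K t ^ n in the given norm,
  and the n-th root of K tends to 1.\<close>

lemma joint_spectral_radius_eq:
  assumes N: "ultrametric_norm v d N" and d: "d \<ge> 1" and S: "S \<subseteq> carrier_mat d d" and b: "norm_bound d N S C"
  shows "joint_spectral_radius d N S = radius d S"
proof -
  let ?R = "radius d S"
  define a where "a n = set_norm d N (mat_pow d S n)" for n
  note Ns = ultrametric_normD(1)[OF N]
  have R0: "0 \<le> ?R" by (rule radius_nonneg[OF N b])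
  have powc: "mat_pow d S n \<subseteq> carrier_mat d d" for n by (rule mat_pow_carrier[OF S])
  have low: "?R ^ n \<le> a n" if "n \<ge> 1" for n
    unfolding a_def
    by (rule radius_pow_le[OF N S b N that norm_bound_set_norm'[OF N d powc norm_bound_pow[OF Ns S b]]])
  have "(\<lambda>n. root n (a n)) \<longlonglongrightarrow> ?R"
  proof (rule order_tendstoI)
    fix y assume y: "y < ?R"
    show "eventually (\<lambda>n. y < root n (a n)) sequentially"
      using eventually_ge_at_top[of 1]
    proof eventually_elim
      case (elim n)
      have "?R = root n (?R ^ n)" using elim R0 by (simp add: real_root_power_cancel)
      also have "\<dots> \<le> root n (a n)" using elim low[OF elim] by simp
      finally show ?case using y by simp
    qed
  next
    fix y assume y: "?R < y"
    then obtain t where t: "?R < t" "t < y" using dense by blast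
    obtain N' where N': "ultrametric_norm v d N'" "norm_bound d N' S t" by (rule radius_less[OF N b t(1)])
    obtain K where K: "K > 0" "\<And>S t. S \<subseteq> carrier_mat d d \<Longrightarrow> norm_bound d N' S t \<Longrightarrow> norm_bound d N S (K * t)"
      using norm_bound_change[OF N'(1) N] by blast
    have up: "a n \<le> K * t ^ n" for n unfolding a_def
      by (rule set_norm_le[OF N d powc K(2)[OF powc norm_bound_pow[OF ultrametric_normD(1)[OF N'(1)] S N'(2)]]])
    have "(\<lambda>n. root n K * t) \<longlonglongrightarrow> 1 * t" using K(1) by (intro tendsto_mult LIMSEQ_root_const tendsto_const)
    then have "eventually (\<lambda>n. root n K * t < y) sequentially" using t(2) by (intro order_tendstoD(2)) auto
    then show "eventually (\<lambda>n. root n (a n) < y) sequentially"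
      using eventually_ge_at_top[of 1]
    proof eventually_elim
      case (elim n)
      have "root n (a n) \<le> root n (K * t ^ n)" using elim up[of n] by simp
      also have "\<dots> = root n K * t" using elim t R0 by (simp add: real_root_mult real_root_power_cancel)
      finally show ?case using elim by simp
    qed
  qed
  then show ?thesis unfolding joint_spectral_radius_def a_def by (rule limI)
qed

text \<open>Conjugating the matrices amounts to pulling the norm back, so conjugates are covered by
  the infimum over all norms.\<close>

lemma conjugate_norm_bound:
  assumes N: "ultrametric_norm v d N" and S: "S \<subseteq> carrier_mat d d"
    and g: "g \<in> carrier_mat d d" "h \<in> carrier_mat d d" "h * g = 1\<^sub>m d"
  shows "ultrametric_norm v d (\<lambda>x. N (g *\<^sub>v x))"
    and "norm_bound d (\<lambda>x. N (g *\<^sub>v x)) S t \<longleftrightarrow> norm_bound d N ((\<lambda>s. g * s * h) ` S) t"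
proof -
  have hgx: "h *\<^sub>v (g *\<^sub>v x) = x" if "x \<in> carrier_vec d" for x
    using g that by (simp flip: assoc_mult_mat_vec)
  have "g * h = 1\<^sub>m d" using mat_mult_left_right_inverse[OF g(2,1,3)] .
  then have ghx: "g *\<^sub>v (h *\<^sub>v x) = x" if "x \<in> carrier_vec d" for x
    using g that by (simp flip: assoc_mult_mat_vec)
  show "ultrametric_norm v d (\<lambda>x. N (g *\<^sub>v x))"
    unfolding ultrametric_norm_iff
  proof (intro conjI ballI impI)
    show "ultra_seminorm d (\<lambda>x. N (g *\<^sub>v x))" by (rule ultra_seminorm_comp[OF ultrametric_normD(1)[OF N] g(1)])
    fix x assume x: "x \<in> carrier_vec d" "N (g *\<^sub>v x) = 0"
    then have "g *\<^sub>v x = 0\<^sub>v d" using g by (intro ultrametric_normD(2)[OF N]) auto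
    moreover have "h *\<^sub>v 0\<^sub>v d = 0\<^sub>v d" using g by (intro eq_vecI) auto
    ultimately show "x = 0\<^sub>v d" using hgx[OF x(1)] by simp
  qed
  have conj: "(g * s * h) *\<^sub>v x = g *\<^sub>v (s *\<^sub>v (h *\<^sub>v x))" if "s \<in> S" "x \<in> carrier_vec d" for s x
  proof -
    have s: "s \<in> carrier_mat d d" using that S by blast
    show ?thesis using s g that(2) by (simp add: assoc_mult_mat_vec[of _ d d _ d])
  qed
  show "norm_bound d (\<lambda>x. N (g *\<^sub>v x)) S t \<longleftrightarrow> norm_bound d N ((\<lambda>s. g * s * h) ` S) t"
    unfolding norm_bound_def
  proof (intro conj_cong refl iffI ballI)
    fix s' and x :: "'a Matrix.vec"
    assume b: "\<forall>s\<in>S. \<forall>x\<in>carrier_vec d. N (g *\<^sub>v (s *\<^sub>v x)) \<le> t * N (g *\<^sub>v x)"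
      and "s' \<in> (\<lambda>s. g * s * h) ` S" and x: "x \<in> carrier_vec d"
    then obtain s where s: "s \<in> S" "s' = g * s * h" by blast
    have "h *\<^sub>v x \<in> carrier_vec d" using g x by simp
    from b[rule_format, OF s(1) this] show "N (s' *\<^sub>v x) \<le> t * N x"
      unfolding s(2) conj[OF s(1) x] ghx[OF x] .
  next
    fix s and x :: "'a Matrix.vec"
    assume b: "\<forall>s\<in>(\<lambda>s. g * s * h) ` S. \<forall>x\<in>carrier_vec d. N (s *\<^sub>v x) \<le> t * N x"
      and s: "s \<in> S" and x: "x \<in> carrier_vec d"
    have gx: "g *\<^sub>v x \<in> carrier_vec d" using g x by simp
    have "N ((g * s * h) *\<^sub>v (g *\<^sub>v x)) \<le> t * N (g *\<^sub>v x)" using b s gx by blast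
    then show "N (g *\<^sub>v (s *\<^sub>v x)) \<le> t * N (g *\<^sub>v x)" unfolding conj[OF s gx] hgx[OF x] .
  qed
qed

text \<open>\<open>g\<close> carries an almost orthogonal basis of a nearly optimal norm to one of
  \<open>N\<^sub>0\<close>, so that pulling back \<open>N\<^sub>0\<close> gives the nearly optimal
  norm up to the factor \<alpha> in both directions.\<close>

lemma almost_optimal_conjugate:
  assumes N: "ultrametric_norm v d N" and S: "S \<subseteq> carrier_mat d d" and b: "norm_bound d N S C"
    and N0: "ultrametric_norm v d N\<^sub>0" and t: "radius d S < t"
  obtains g h where "g \<in> carrier_mat d d" "h \<in> carrier_mat d d" "h * g = 1\<^sub>m d" "g * h = 1\<^sub>m d"
    "norm_bound d N\<^sub>0 ((\<lambda>s. g * s * h) ` S) t"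
proof -
  have R0: "0 \<le> radius d S" by (rule radius_nonneg[OF N b])
  obtain t1 where t1: "radius d S < t1" "t1 < t" using dense[OF t] by blast
  obtain N' where N': "ultrametric_norm v d N'" "norm_bound d N' S t1" by (rule radius_less[OF N b t1(1)])
  \<comment> \<open>Passing to the other norm and back loses \<alpha> twice, which uses up exactly
    the room between \<open>t1\<close> and \<open>t\<close>.\<close>
  define \<alpha> where "\<alpha> = sqrt (t1 / t)"
  have \<alpha>: "0 < \<alpha>" "\<alpha> < 1" using t1 R0 by (auto simp: \<alpha>_def real_sqrt_lt_1_iff)
  have \<alpha>t: "\<alpha> * \<alpha> * t = t1" using t1 R0 by (simp add: \<alpha>_def)
  obtain B B' where B: "B \<in> carrier_mat d d" "B' \<in> carrier_mat d d" "B * B' = 1\<^sub>m d" "B' * B = 1\<^sub>m d"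
    and Blow: "\<And>x. x \<in> carrier_vec d \<Longrightarrow> \<alpha> * sup_norm d x \<le> N' (B *\<^sub>v x)"
    and Bup: "\<And>x. x \<in> carrier_vec d \<Longrightarrow> N' (B *\<^sub>v x) \<le> sup_norm d x"
    by (rule almost_orthogonal_basis[OF N'(1) \<alpha>]) blast
  obtain D D' where D: "D \<in> carrier_mat d d" "D' \<in> carrier_mat d d" "D * D' = 1\<^sub>m d" "D' * D = 1\<^sub>m d"
    and Dlow: "\<And>x. x \<in> carrier_vec d \<Longrightarrow> \<alpha> * sup_norm d x \<le> N\<^sub>0 (D *\<^sub>v x)"
    and Dup: "\<And>x. x \<in> carrier_vec d \<Longrightarrow> N\<^sub>0 (D *\<^sub>v x) \<le> sup_norm d x"
    by (rule almost_orthogonal_basis[OF N0 \<alpha>]) blast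
  define g where "g = D * B'"
  define h where "h = B * D'"
  have gh: "g \<in> carrier_mat d d" "h \<in> carrier_mat d d" using B D by (auto simp: g_def h_def)
  have "h * g = B * (D' * (D * B'))" unfolding g_def h_def
    using B D by (intro assoc_mult_mat[of _ d d _ d _ d]) auto
  also have "D' * (D * B') = (D' * D) * B'" using B D by (intro assoc_mult_mat[symmetric, of _ d d _ d _ d]) auto
  finally have hg: "h * g = 1\<^sub>m d" using B D by simp
  have gh1: "g * h = 1\<^sub>m d" using mat_mult_left_right_inverse[OF gh(2,1) hg] .
  have cmp: "\<alpha> * N' x \<le> N\<^sub>0 (g *\<^sub>v x)" "\<alpha> * N\<^sub>0 (g *\<^sub>v x) \<le> N' x" if x: "x \<in> carrier_vec d" for x
  proof -
    define y where "y = B' *\<^sub>v x"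
    have y: "y \<in> carrier_vec d" using B x by (simp add: y_def)
    have By: "B *\<^sub>v y = x" using B x by (simp add: y_def flip: assoc_mult_mat_vec)
    have gx: "g *\<^sub>v x = D *\<^sub>v y" using B D x by (simp add: g_def y_def assoc_mult_mat_vec[of _ d d _ d])
    show "\<alpha> * N' x \<le> N\<^sub>0 (g *\<^sub>v x)"
      using mult_left_mono[OF Bup[OF y], of \<alpha>] \<alpha> Dlow[OF y] unfolding By gx by linarith
    show "\<alpha> * N\<^sub>0 (g *\<^sub>v x) \<le> N' x"
      using mult_left_mono[OF Dup[OF y], of \<alpha>] \<alpha> Blow[OF y] unfolding By gx by linarith
  qed
  have "norm_bound d (\<lambda>x. N\<^sub>0 (g *\<^sub>v x)) S t" unfolding norm_bound_def
  proof (intro conjI ballI)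
    show t0: "0 \<le> t" using R0 t by simp
    fix s and x :: "'a Matrix.vec" assume s: "s \<in> S" and x: "x \<in> carrier_vec d"
    have sx: "s *\<^sub>v x \<in> carrier_vec d" using s S x by auto
    have "\<alpha> * N\<^sub>0 (g *\<^sub>v (s *\<^sub>v x)) \<le> N' (s *\<^sub>v x)" by (rule cmp(2)[OF sx])
    also have "\<dots> \<le> t1 * N' x" by (rule norm_boundD[OF N'(2) s x])
    also have "\<dots> = \<alpha> * (t * (\<alpha> * N' x))" by (simp flip: \<alpha>t)
    also have "\<dots> \<le> \<alpha> * (t * N\<^sub>0 (g *\<^sub>v x))" using cmp(1)[OF x] \<alpha> t0 by (intro mult_left_mono) auto
    finally show "N\<^sub>0 (g *\<^sub>v (s *\<^sub>v x)) \<le> t * N\<^sub>0 (g *\<^sub>v x)" using \<alpha> by simp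
  qed
  then have "norm_bound d N\<^sub>0 ((\<lambda>s. g * s * h) ` S) t"
    using conjugate_norm_bound(2)[OF N0 S gh hg] by blast
  then show thesis using that gh hg gh1 by blast
qed

lemma radius_eq_INF:
  assumes N: "ultrametric_norm v d N" and d: "d \<ge> 1" and S: "S \<subseteq> carrier_mat d d" and b: "norm_bound d N S C"
  shows "radius d S = (INF g\<in>Units (module_mat TYPE('a) d d).
    set_norm d N ((\<lambda>s. g * s * inv\<^bsub>module_mat TYPE('a) d d\<^esub> g) ` S))" (is "_ = (INF g\<in>?U. ?f g)")
proof (rule order_antisym)
  have img: "(\<lambda>s. g * s * h) ` S \<subseteq> carrier_mat d d" if "g \<in> carrier_mat d d" "h \<in> carrier_mat d d" for g h
    using that S by (auto intro!: mult_carrier_mat[of _ d d _ d])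
  have one: "1\<^sub>m d \<in> ?U" by (auto simp: Units_module_mat intro!: bexI[of _ "1\<^sub>m d"])
  have low: "radius d S \<le> ?f g" if "g \<in> ?U" for g
  proof -
    obtain h where g: "g \<in> carrier_mat d d" and h: "h \<in> carrier_mat d d" "h * g = 1\<^sub>m d" "g * h = 1\<^sub>m d"
      using \<open>g \<in> ?U\<close> unfolding Units_module_mat by blast
    have inv: "inv\<^bsub>module_mat TYPE('a) d d\<^esub> g = h" by (rule inv_module_mat[OF g h(1,3,2)])
    note c = conjugate_norm_bound[OF N S g h(1,2)]
    obtain C' where "norm_bound d (\<lambda>x. N (g *\<^sub>v x)) S C'"
      using norm_bound_change[OF N c(1)] S b by metis
    then have "norm_bound d N ((\<lambda>s. g * s * h) ` S) C'" using c(2) by blast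
    from norm_bound_set_norm'[OF N d img[OF g h(1)] this]
    have "norm_bound d (\<lambda>x. N (g *\<^sub>v x)) S (set_norm d N ((\<lambda>s. g * s * h) ` S))" using c(2) by blast
    from radius_le[OF c(1) this] show ?thesis unfolding inv .
  qed
  show "radius d S \<le> (INF g\<in>?U. ?f g)" using low one by (intro cINF_greatest) auto
  show "(INF g\<in>?U. ?f g) \<le> radius d S"
  proof (rule dense_ge)
    fix t assume "radius d S < t"
    then obtain g h where gh: "g \<in> carrier_mat d d" "h \<in> carrier_mat d d" "h * g = 1\<^sub>m d" "g * h = 1\<^sub>m d"
      "norm_bound d N ((\<lambda>s. g * s * h) ` S) t"
      by (rule almost_optimal_conjugate[OF N S b N])
    have g: "g \<in> ?U" using gh by (auto simp: Units_module_mat)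
    have "bdd_below (?f ` ?U)" using low by (intro bdd_belowI2)
    then have "(INF g\<in>?U. ?f g) \<le> ?f g" using g by (intro cINF_lower)
    also have "\<dots> \<le> t" unfolding inv_module_mat[OF gh(1,2,4,3)] by (rule set_norm_le[OF N d img[OF gh(1,2)] gh(5)])
    finally show "(INF g\<in>?U. ?f g) \<le> t" .
  qed
qed

end

section \<open>Extremal norms\<close>

context complete_nonarch_field begin

interpretation triv: closed_residue_field "UNIV :: 'a set" "{0}"
  by (rule closed_residue_field_trivial)

text \<open>Formulated with functions so that submodules and pivots over the trivial residue field
  apply; the number of pivots is the dimension of the kernel.\<close>

abbreviation kernel_fun :: "nat \<Rightarrow> ('a Matrix.vec \<Rightarrow> real) \<Rightarrow> (nat \<Rightarrow> 'a) set" where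
  "kernel_fun d q \<equiv> {f. q (Matrix.vec d f) = 0}"

lemma kernel_fun_submod:
  assumes q: "ultra_seminorm d q"
  shows "submod UNIV (\<lambda>c x i. c * x i) (triv.small_vec d) (triv.int_vec d) (kernel_fun d q)"
  unfolding submod_def
proof (intro conjI ballI subsetI)
  note qn = ultra_seminormD[OF q]
  fix f assume "f \<in> triv.small_vec d"
  then have "Matrix.vec d f = 0\<^sub>v d" by (intro eq_vecI) (auto simp: triv.small_vec_def)
  then show "f \<in> kernel_fun d q" using qn(4) by simp
next
  fix f show "f \<in> triv.int_vec d" by (simp add: triv.int_vec_def)
next
  note qn = ultra_seminormD[OF q]
  fix f g assume "f \<in> kernel_fun d q" "g \<in> kernel_fun d q"
  moreover have "Matrix.vec d (f + g) = Matrix.vec d f + Matrix.vec d g" by (intro eq_vecI) auto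
  ultimately have "q (Matrix.vec d (f + g)) \<le> 0" using qn(3)[of "Matrix.vec d f" "Matrix.vec d g"] by simp
  then show "f + g \<in> kernel_fun d q" using qn(1)[of "Matrix.vec d (f + g)"] by simp
next
  note qn = ultra_seminormD[OF q]
  fix c f assume "f \<in> kernel_fun d q"
  moreover have "Matrix.vec d (\<lambda>i. c * f i) = c \<cdot>\<^sub>v Matrix.vec d f" by (intro eq_vecI) auto
  ultimately show "(\<lambda>i. c * f i) \<in> kernel_fun d q" using qn(2)[of "Matrix.vec d f" c] by simp
qed

text \<open>The coordinates \<open>c i\<close> are linear on the whole space, so they define a
  projection onto the kernel and not merely a basis of it.\<close>

lemma kernel_coordinates:
  assumes q: "ultra_seminorm d q"
  obtains r :: nat and b :: "nat \<Rightarrow> 'a Matrix.vec" and c where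
    "\<And>i. i < r \<Longrightarrow> b i \<in> carrier_vec d" "\<And>i. i < r \<Longrightarrow> q (b i) = 0"
    "\<And>i x y. i < r \<Longrightarrow> x \<in> carrier_vec d \<Longrightarrow> y \<in> carrier_vec d \<Longrightarrow> c i (x + y) = c i x + c i y"
    "\<And>i k x. i < r \<Longrightarrow> x \<in> carrier_vec d \<Longrightarrow> c i (k \<cdot>\<^sub>v x) = k * c i x"
    "\<And>i j. i < r \<Longrightarrow> j < r \<Longrightarrow> c i (b j) = (if i = j then 1 else (0 :: 'a))"
    "\<And>x. x \<in> carrier_vec d \<Longrightarrow> q x = 0 \<Longrightarrow> x = Matrix.vec d (\<lambda>j. \<Sum>i<r. c i x * b i $ j)"
proof -
  interpret finite_length_module "UNIV :: 'a set" "{0}" "\<lambda>c x i. c * x i"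
    "triv.small_vec d" "triv.int_vec d" "\<lambda>U. card (triv.pivots d U)"
    by (rule triv.finite_length_coordinates)
  have smallI: "f \<in> triv.small_vec d \<longleftrightarrow> (\<forall>i<d. f i = 0)" for f by (simp add: triv.small_vec_def)
  have intI: "f \<in> triv.int_vec d" for f by (simp add: triv.int_vec_def)
  have K: "sub (kernel_fun d q)" by (rule kernel_fun_submod[OF q])
  from dual_basis[OF submod_Z K subD(1)[OF K]] obtain r :: nat and us cs where
    db: "\<forall>i<r. us i \<in> kernel_fun d q \<and> linear_form (cs i) \<and> (\<forall>w\<in>triv.small_vec d. cs i w \<in> {0})"
      "\<forall>i<r. \<forall>j<r. triv.cong (cs i (us j)) (if i = j then 1 else 0)"
      "\<forall>x\<in>kernel_fun d q. x - (\<Sum>i<r. (\<lambda>k. cs i x * us i k)) \<in> triv.small_vec d"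
    by blast
  have cong: "triv.cong a a' \<longleftrightarrow> a = a'" for a a' by (simp add: triv.cong_def)
  have add: "cs i (f + g) = cs i f + cs i g" and scale: "cs i (\<lambda>k. t * f k) = t * cs i f"
    if "i < r" for i f g t
    using db(1) that linear_formD(2,3)[of "cs i"] intI by (auto simp: cong)
  have ext: "cs i f = cs i g" if i: "i < r" and fg: "\<And>j. j < d \<Longrightarrow> f j = g j" for i f g
  proof -
    have "f - g \<in> triv.small_vec d" using fg by (simp add: smallI)
    then have "cs i (f - g) = 0" using db(1) i by blast
    then show ?thesis using add[OF i, of "f - g" g] by simp
  qed
  define b where "b i = Matrix.vec d (us i)" for i
  define c where "c i x = cs i (\<lambda>j. x $ j)" for i and x :: "'a Matrix.vec"
  show thesis
  proof (rule that[of r b c])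
    show "b i \<in> carrier_vec d" "q (b i) = 0" if "i < r" for i using db(1) that by (auto simp: b_def)
    show "c i (x + y) = c i x + c i y" if "i < r" "x \<in> carrier_vec d" "y \<in> carrier_vec d" for i x y
    proof -
      have "c i (x + y) = cs i ((\<lambda>j. x $ j) + (\<lambda>j. y $ j))"
        unfolding c_def using that by (intro ext) auto
      then show ?thesis using add[OF that(1)] by (simp add: c_def)
    qed
    show "c i (k \<cdot>\<^sub>v x) = k * c i x" if "i < r" "x \<in> carrier_vec d" for i k x
    proof -
      have "c i (k \<cdot>\<^sub>v x) = cs i (\<lambda>j. k * x $ j)" unfolding c_def using that by (intro ext) auto
      then show ?thesis using scale[OF that(1)] by (simp add: c_def)
    qed
    show "c i (b j) = (if i = j then 1 else 0)" if "i < r" "j < r" for i j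
    proof -
      have "c i (b j) = cs i (us j)" unfolding c_def using that by (intro ext) (auto simp: b_def)
      then show ?thesis using db(2) that by (auto simp: cong)
    qed
    show "x = Matrix.vec d (\<lambda>j. \<Sum>i<r. c i x * b i $ j)" if x: "x \<in> carrier_vec d" "q x = 0" for x
    proof (rule eq_vecI)
      have "Matrix.vec d (\<lambda>j. x $ j) = x" using x(1) by (intro eq_vecI) auto
      then have "(\<lambda>j. x $ j) \<in> kernel_fun d q" using x(2) by simp
      then have "(\<lambda>j. x $ j) - (\<Sum>i<r. (\<lambda>k. c i x * us i k)) \<in> triv.small_vec d"
        using db(3) by (auto simp: c_def)
      then have "x $ j = (\<Sum>i<r. c i x * us i j)" if "j < d" for j
        using that by (auto simp: smallI sum_fun_apply)
      then show "x $ j = Matrix.vec d (\<lambda>j. \<Sum>i<r. c i x * b i $ j) $ j"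
        if "j < dim_vec (Matrix.vec d (\<lambda>j. \<Sum>i<r. c i x * b i $ j))" for j
        using that by (simp add: b_def)
    qed (use x in auto)
  qed
qed

text \<open>Norms with \<open>N\<^sub>n S \<le> (1 + 1/n) radius S\<close>, normalised on the kernel of a seminorm \<open>q\<close>
  that \<open>S\<close> expands by at most \<open>radius S\<close>, have there a non-zero upper limit with the same property.\<close>

lemma enlarge_seminorm:
  assumes N: "ultrametric_norm v d N" and S: "S \<subseteq> carrier_mat d d" and bS: "norm_bound d N S C"
    and R: "radius d S > 0"
    and q: "ultra_seminorm d q" and bq: "norm_bound d q S (radius d S)"
    and x0: "x0 \<in> carrier_vec d" "q x0 = 0" "x0 \<noteq> 0\<^sub>v d"
  shows "\<exists>q'. ultra_seminorm d q' \<and> norm_bound d q' S (radius d S) \<and>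
    (\<forall>x\<in>carrier_vec d. q' x = 0 \<longrightarrow> q x = 0) \<and> (\<exists>x\<in>carrier_vec d. q x = 0 \<and> q' x \<noteq> 0)"
proof -
  let ?R = "radius d S"
  note qn = ultra_seminormD[OF q]
  obtain r :: nat and b :: "nat \<Rightarrow> 'a Matrix.vec" and c where
    b: "\<And>i. i < r \<Longrightarrow> b i \<in> carrier_vec d" "\<And>i. i < r \<Longrightarrow> q (b i) = 0"
    and c_add: "\<And>i x y. i < r \<Longrightarrow> x \<in> carrier_vec d \<Longrightarrow> y \<in> carrier_vec d \<Longrightarrow> c i (x + y) = c i x + c i y"
    and c_scale: "\<And>i k x. i < r \<Longrightarrow> x \<in> carrier_vec d \<Longrightarrow> c i (k \<cdot>\<^sub>v x) = k * c i x"
    and cb: "\<And>i j. i < r \<Longrightarrow> j < r \<Longrightarrow> c i (b j) = (if i = j then 1 else (0 :: 'a))"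
    and dec: "\<And>x. x \<in> carrier_vec d \<Longrightarrow> q x = 0 \<Longrightarrow> x = Matrix.vec d (\<lambda>j. \<Sum>i<r. c i x * b i $ j)"
    by (rule kernel_coordinates[OF q]) blast
  define part where "part k x = Matrix.vec d (\<lambda>j. \<Sum>i<k. c i x * b i $ j)" for k x
  \<comment> \<open>The projection onto the kernel of \<open>q\<close>; below, \<beta> is the
    maximum norm of its coordinates.\<close>
  define \<pi> where "\<pi> = part r"
  define \<beta> where "\<beta> x = sup_norm r (Matrix.vec r (\<lambda>i. c i x))" for x
  have partc: "part k x \<in> carrier_vec d" for k x by (simp add: part_def)
  have \<pi>c: "\<pi> x \<in> carrier_vec d" for x by (simp add: \<pi>_def partc)
  have part_Suc: "part (Suc k) x = part k x + c k x \<cdot>\<^sub>v b k" if "k < r" for k x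
    using b(1)[OF that] by (intro eq_vecI) (auto simp: part_def)
  have part_0: "part 0 x = 0\<^sub>v d" for x by (intro eq_vecI) (auto simp: part_def)
  have \<beta>_ge: "v (c i x) \<le> \<beta> x" if "i < r" for i x
    using sup_norm_ge[OF that, of "Matrix.vec r (\<lambda>i. c i x)"] that by (simp add: \<beta>_def)
  have part_le: "p (part k x) \<le> \<beta> x * K"
    if p: "ultra_seminorm d p" "\<And>i. i < r \<Longrightarrow> p (b i) \<le> K" "0 \<le> K" and k: "k \<le> r" for p k x K
    using k
  proof (induction k)
    case 0
    then show ?case using ultra_seminormD(4)[OF p(1)] p(3) by (simp add: part_0 \<beta>_def sup_norm_nonneg)
  next
    case (Suc k)
    then have k: "k < r" by simp
    have "p (part (Suc k) x) \<le> max (p (part k x)) (p (c k x \<cdot>\<^sub>v b k))"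
      unfolding part_Suc[OF k] using b(1)[OF k] by (intro ultra_seminormD(3)[OF p(1) partc]) simp
    moreover have "p (c k x \<cdot>\<^sub>v b k) \<le> \<beta> x * K"
      unfolding ultra_seminormD(2)[OF p(1) b(1)[OF k]]
      using \<beta>_ge[OF k] p(2)[OF k] ultra_seminormD(1)[OF p(1) b(1)[OF k]]
      by (intro mult_mono) (auto simp: \<beta>_def sup_norm_nonneg)
    ultimately show ?case using Suc by simp
  qed
  have q\<pi>: "q (\<pi> x) = 0" for x
    using part_le[OF q, of 0 r x] b(2) qn(1)[OF \<pi>c, of x] by (simp add: \<pi>_def)
  have \<pi>_id: "\<pi> x = x" if "x \<in> carrier_vec d" "q x = 0" for x
    using dec[OF that] by (simp add: \<pi>_def part_def)
  have c_sum: "c i (part k x) = (if i < k then c i x else 0)" if "i < r" "k \<le> r" for i k x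
    using that(2)
  proof (induction k)
    case 0
    have "0 \<cdot>\<^sub>v 0\<^sub>v d = (0\<^sub>v d :: 'a Matrix.vec)" by (intro eq_vecI) auto
    then show ?case using c_scale[OF that(1), of "0\<^sub>v d" 0] by (simp add: part_0)
  next
    case (Suc k)
    then have k: "k < r" by simp
    have "c i (part (Suc k) x) = c i (part k x) + c k x * c i (b k)"
      unfolding part_Suc[OF k] using b(1)[OF k] partc
      by (simp add: c_add[OF that(1)] c_scale[OF that(1)])
    then show ?case using Suc cb[OF that(1) k] by (auto simp: less_Suc_eq)
  qed
  have c\<pi>: "c i (\<pi> x) = c i x" if "i < r" for i x using c_sum[OF that, of r x] that by (simp add: \<pi>_def)
  have \<pi>_add: "\<pi> (x + y) = \<pi> x + \<pi> y" if "x \<in> carrier_vec d" "y \<in> carrier_vec d" for x y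
    using that by (intro eq_vecI) (auto simp: \<pi>_def part_def c_add sum.distrib algebra_simps)
  have \<pi>_scale: "\<pi> (k \<cdot>\<^sub>v x) = k \<cdot>\<^sub>v \<pi> x" if "x \<in> carrier_vec d" for k x
    using that by (intro eq_vecI) (auto simp: \<pi>_def part_def c_scale sum_distrib_left mult.assoc)
  have \<beta>s: "ultra_seminorm d \<beta>"
  proof -
    note sn = ultra_seminormD[OF ultrametric_normD(1)[OF sup_norm_ultrametric[of r]]]
    have "\<beta> (k \<cdot>\<^sub>v x) = v k * \<beta> x" if "x \<in> carrier_vec d" for k x
    proof -
      have "Matrix.vec r (\<lambda>i. c i (k \<cdot>\<^sub>v x)) = k \<cdot>\<^sub>v Matrix.vec r (\<lambda>i. c i x)"
        using that by (intro eq_vecI) (auto simp: c_scale)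
      then show ?thesis by (simp add: \<beta>_def sn(2))
    qed
    moreover have "\<beta> (x + y) \<le> max (\<beta> x) (\<beta> y)" if "x \<in> carrier_vec d" "y \<in> carrier_vec d" for x y
    proof -
      have "Matrix.vec r (\<lambda>i. c i (x + y)) = Matrix.vec r (\<lambda>i. c i x) + Matrix.vec r (\<lambda>i. c i y)"
        using that by (intro eq_vecI) (auto simp: c_add)
      then show ?thesis using sn(3)[of "Matrix.vec r (\<lambda>i. c i x)" "Matrix.vec r (\<lambda>i. c i y)"] by (simp add: \<beta>_def)
    qed
    ultimately show ?thesis by (auto simp: ultra_seminorm_def \<beta>_def sup_norm_nonneg)
  qed
  have r: "r > 0"
  proof (rule ccontr)
    assume "\<not> r > 0"
    then have "\<pi> x0 = 0\<^sub>v d" using part_0 by (simp add: \<pi>_def)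
    then show False using \<pi>_id[OF x0(1,2)] x0(3) by simp
  qed
  have b_nz: "b i \<noteq> 0\<^sub>v d" if "i < r" for i
  proof
    assume "b i = 0\<^sub>v d"
    moreover have "0 \<cdot>\<^sub>v 0\<^sub>v d = (0\<^sub>v d :: 'a Matrix.vec)" by (intro eq_vecI) auto
    ultimately show False using c_scale[OF that, of "0\<^sub>v d" 0] cb[OF that that] by simp
  qed
  define t where "t n = ?R * (1 + 1 / real (Suc n))" for n
  have tR: "?R < t n" for n using R by (simp add: t_def)
  have t_lim: "t \<longlonglongrightarrow> ?R"
  proof -
    have "(\<lambda>n. ?R * (1 + 1 / real (Suc n))) \<longlonglongrightarrow> ?R * (1 + 0)"
      by (intro tendsto_intros lim_1_over_n LIMSEQ_Suc)
    then show ?thesis by (simp add: t_def [abs_def])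
  qed
  have "\<exists>N'. ultrametric_norm v d N' \<and> norm_bound d N' S (t n)" for n
    using radius_less[OF N bS tR[of n]] by blast
  then obtain Ns where Ns: "\<And>n. ultrametric_norm v d (Ns n)" "\<And>n. norm_bound d (Ns n) S (t n)" by metis
  \<comment> \<open>Division by the largest value on the basis bounds all \<open>M n\<close> on the
    kernel by \<beta>, so that upper limits are finite. It also leaves, for every n, some basis
    vector with value 1, so that the limit is not 0 on the kernel.\<close>
  define K where "K n = Max ((\<lambda>i. Ns n (b i)) ` {..<r})" for n
  have ne: "{..<r} \<noteq> {}" using r by auto
  have K_ge: "Ns n (b i) \<le> K n" if "i < r" for i n unfolding K_def using that by (intro Max_ge) auto
  have K_pos: "K n > 0" for n
    using K_ge[OF r, of n] ultrametric_normD(3)[OF Ns(1) b(1)[OF r] b_nz[OF r], of n] by simp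
  have K_att: "\<exists>i<r. Ns n (b i) = K n" for n
  proof -
    have "K n \<in> (\<lambda>i. Ns n (b i)) ` {..<r}" unfolding K_def using ne by (intro Max_in) auto
    then show ?thesis by auto
  qed
  define M where "M n x = (1 / K n) * Ns n x" for n x
  have Ms: "ultra_seminorm d (M n)" for n
    unfolding M_def [abs_def] using K_pos[of n]
    by (intro ultra_seminorm_scale ultrametric_normD(1)[OF Ns(1)]) auto
  have Mb: "M n (b i) \<le> 1" if "i < r" for n i using K_ge[OF that, of n] K_pos[of n] by (simp add: M_def)
  have M\<beta>: "M n (\<pi> x) \<le> \<beta> x" for n x
    using part_le[OF Ms Mb, of r n x] by (simp add: \<pi>_def)
  have \<beta>nn: "0 \<le> \<beta> x" for x by (simp add: \<beta>_def sup_norm_nonneg)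
  \<comment> \<open>Composition with the projection extends the limit from the kernel to the whole
    space.\<close>
  define m where "m x = ev_bound (\<lambda>n. M n (\<pi> x))" for x
  have ev\<beta>: "eventually (\<lambda>n. M n (\<pi> x) \<le> \<beta> x) sequentially" for x using M\<beta> by simp
  have m\<beta>: "m x \<le> \<beta> x" and mnn: "0 \<le> m x" for x
    unfolding m_def using ev_bound_le[OF \<beta>nn ev\<beta>] ev_bound_nonneg[OF \<beta>nn ev\<beta>] by auto
  have mE: "eventually (\<lambda>n. M n (\<pi> x) \<le> E) sequentially" if "m x < E" for x E
    using ev_bound_less[OF \<beta>nn ev\<beta>] that unfolding m_def .
  have mI: "m x \<le> E" if "0 \<le> E" "eventually (\<lambda>n. M n (\<pi> x) \<le> E) sequentially" for x E
    unfolding m_def using that by (rule ev_bound_le)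
  have m_add: "m (x + y) \<le> max (m x) (m y)" if x: "x \<in> carrier_vec d" and y: "y \<in> carrier_vec d" for x y
  proof (rule dense_ge)
    fix E assume E: "max (m x) (m y) < E"
    have "eventually (\<lambda>n. M n (\<pi> x) \<le> E) sequentially" "eventually (\<lambda>n. M n (\<pi> y) \<le> E) sequentially"
      using mE E by auto
    then have "eventually (\<lambda>n. M n (\<pi> (x + y)) \<le> E) sequentially"
    proof eventually_elim
      case (elim n)
      then show ?case
        using ultra_seminormD(3)[OF Ms \<pi>c \<pi>c, of n x y] by (simp add: \<pi>_add[OF x y])
    qed
    moreover have "0 \<le> E" using mnn[of x] E by simp
    ultimately show "m (x + y) \<le> E" by (intro mI)
  qed
  have m_scale: "m (k \<cdot>\<^sub>v x) \<le> v k * m x" if x: "x \<in> carrier_vec d" for k x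
  proof (cases "k = 0")
    case True
    have "M n (\<pi> (k \<cdot>\<^sub>v x)) = 0" for n
      using ultra_seminormD(2)[OF Ms \<pi>c] True by (simp add: \<pi>_scale[OF x])
    then show ?thesis using True mI[of 0 "k \<cdot>\<^sub>v x"] by simp
  next
    case False
    show ?thesis
    proof (rule dense_ge)
      fix E assume E: "v k * m x < E"
      then have "m x < E / v k" using False by (simp add: field_simps)
      from mE[OF this] have "eventually (\<lambda>n. M n (\<pi> (k \<cdot>\<^sub>v x)) \<le> E) sequentially"
      proof (rule eventually_mono)
        fix n assume "M n (\<pi> x) \<le> E / v k"
        then show "M n (\<pi> (k \<cdot>\<^sub>v x)) \<le> E"
          using False by (simp add: \<pi>_scale[OF x] ultra_seminormD(2)[OF Ms \<pi>c] field_simps)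
      qed
      moreover have "0 \<le> v k * m x" by (simp add: mnn)
      then have "0 \<le> E" using E by linarith
      ultimately show "m (k \<cdot>\<^sub>v x) \<le> E" by (intro mI)
    qed
  qed
  have ms: "ultra_seminorm d m" by (rule ultra_seminormI[OF mnn m_scale m_add])
  \<comment> \<open>By \<open>bq\<close>, \<open>S\<close> preserves the kernel of \<open>q\<close>,
    so the bounds \<open>t n\<close> of the individual norms apply there, and they tend to the
    radius.\<close>
  have m_ker: "m (s *\<^sub>v w) \<le> ?R * m w" if s: "s \<in> S" and w: "w \<in> carrier_vec d" "q w = 0" for s w
  proof (rule dense_ge)
    fix F assume F: "?R * m w < F"
    have sc: "s *\<^sub>v w \<in> carrier_vec d" using s S w by auto
    have "q (s *\<^sub>v w) \<le> ?R * q w" by (rule norm_boundD[OF bq s w(1)])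
    then have "q (s *\<^sub>v w) = 0" using w(2) qn(1)[OF sc] by simp
    then have \<pi>s: "\<pi> (s *\<^sub>v w) = s *\<^sub>v w" by (rule \<pi>_id[OF sc])
    have "m w < F / ?R" using F R by (simp add: field_simps)
    then obtain E where E: "m w < E" "E < F / ?R" using dense by blast
    have E0: "0 < E" using mnn[of w] E by simp
    have "?R * E < F" using E(2) R by (simp add: field_simps)
    moreover have "(\<lambda>n. t n * E) \<longlonglongrightarrow> ?R * E" by (intro tendsto_mult t_lim tendsto_const)
    ultimately have "eventually (\<lambda>n. t n * E < F) sequentially" by (intro order_tendstoD(2))
    with mE[OF E(1)] have "eventually (\<lambda>n. M n (\<pi> (s *\<^sub>v w)) \<le> F) sequentially"
    proof eventually_elim
      case (elim n)
      have "M n (s *\<^sub>v w) \<le> (1 / K n) * (t n * Ns n w)"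
        unfolding M_def using norm_boundD[OF Ns(2) s w(1)] K_pos[of n] by (intro mult_left_mono) auto
      also have "\<dots> = t n * M n w" by (simp add: M_def)
      also have "\<dots> \<le> t n * E" using elim(1) tR[of n] R by (intro mult_left_mono) (auto simp: \<pi>_id[OF w])
      finally show ?case using elim(2) \<pi>s by simp
    qed
    moreover have "0 \<le> ?R * m w" using R by (simp add: mnn)
    then have "0 \<le> F" using F by linarith
    ultimately show "m (s *\<^sub>v w) \<le> F" by (intro mI)
  qed
  \<comment> \<open>Off the kernel nothing relates \<open>m\<close> to the radius. The norm
    \<open>p\<close>, which dominates \<open>m\<close>, supplies at least some bound
    \<open>D\<close> there.\<close>
  define p where "p x = max (q x) (\<beta> x)" for x
  have p: "ultrametric_norm v d p"
    unfolding ultrametric_norm_iff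
  proof (intro conjI ballI impI)
    show "ultra_seminorm d p" unfolding p_def [abs_def] by (rule ultra_seminorm_max[OF q \<beta>s])
    fix x assume x: "x \<in> carrier_vec d" "p x = 0"
    then have z: "q x = 0" "\<beta> x = 0" using qn(1)[OF x(1)] \<beta>nn[of x] by (auto simp: p_def max_def split: if_splits)
    have "v (c i x) = 0" if "i < r" for i using \<beta>_ge[OF that, of x] z(2) v_nonneg by (metis order_antisym)
    then have "part r x = 0\<^sub>v d" by (intro eq_vecI) (auto simp: part_def)
    then show "x = 0\<^sub>v d" using \<pi>_id[OF x(1) z(1)] by (simp add: \<pi>_def)
  qed
  obtain D where D: "norm_bound d p S D" using norm_bound_change[OF N p] S bS by metis
  have D0: "0 \<le> D" using D by (simp add: norm_bound_def)
  \<comment> \<open>Small enough that the component outside the kernel, which \<open>S\<close> may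
    expand by \<open>D\<close>, contributes at most the radius times \<open>q x\<close>.\<close>
  define \<epsilon> where "\<epsilon> = ?R / (D + 1)"
  have \<epsilon>: "0 < \<epsilon>" "\<epsilon> * D \<le> ?R" using R D0 by (auto simp: \<epsilon>_def field_simps)
  define q' where "q' x = max (q x) (\<epsilon> * m x)" for x
  have q's: "ultra_seminorm d q'"
    unfolding q'_def [abs_def] using \<epsilon> by (intro ultra_seminorm_max[OF q] ultra_seminorm_scale[OF ms]) auto
  have "norm_bound d q' S ?R" unfolding norm_bound_def
  proof (intro conjI ballI)
    show "0 \<le> ?R" using R by simp
    fix s and x :: "'a Matrix.vec" assume s: "s \<in> S" and x: "x \<in> carrier_vec d"
    have sc: "s \<in> carrier_mat d d" using s S by blast
    define y where "y = x - \<pi> x"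
    have y: "y \<in> carrier_vec d" using x \<pi>c by (simp add: y_def)
    have xy: "x = \<pi> x + y" using x \<pi>c[of x] by (intro eq_vecI) (auto simp: y_def)
    have "c i y = 0" if "i < r" for i
      using c_add[OF that \<pi>c y, of x] c\<pi>[OF that, of x] by (simp flip: xy)
    then have "\<beta> y \<le> 0" unfolding \<beta>_def by (intro sup_norm_leI) auto
    moreover have "q y \<le> q x" unfolding y_def using qn(5)[OF x \<pi>c, of x] q\<pi>[of x] qn(1)[OF x] by simp
    ultimately have py: "p y \<le> q x" using qn(1)[OF x] by (simp add: p_def)
    have sy: "s *\<^sub>v y \<in> carrier_vec d" and s\<pi>: "s *\<^sub>v \<pi> x \<in> carrier_vec d" using sc y \<pi>c by auto
    have "m (s *\<^sub>v y) \<le> p (s *\<^sub>v y)" using m\<beta>[of "s *\<^sub>v y"] by (simp add: p_def)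
    also have "\<dots> \<le> D * p y" by (rule norm_boundD[OF D s y])
    also have "\<dots> \<le> D * q x" using py D0 by (intro mult_left_mono)
    finally have "\<epsilon> * m (s *\<^sub>v y) \<le> \<epsilon> * (D * q x)" using \<epsilon>(1) by simp
    also have "\<dots> \<le> ?R * q x" using mult_right_mono[OF \<epsilon>(2) qn(1)[OF x]] by (simp add: mult.assoc)
    finally have 1: "\<epsilon> * m (s *\<^sub>v y) \<le> ?R * q x" .
    have "m (\<pi> x) = m x" unfolding m_def by (simp add: \<pi>_id[OF \<pi>c q\<pi>])
    then have "\<epsilon> * m (s *\<^sub>v \<pi> x) \<le> \<epsilon> * (?R * m x)" using m_ker[OF s \<pi>c q\<pi>, of x] \<epsilon>(1) by simp
    then have 2: "\<epsilon> * m (s *\<^sub>v \<pi> x) \<le> ?R * (\<epsilon> * m x)" by (simp add: mult.left_commute)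
    have "s *\<^sub>v x = s *\<^sub>v \<pi> x + s *\<^sub>v y" using mult_add_distrib_mat_vec[OF sc \<pi>c y, of x] by (simp flip: xy)
    then have "m (s *\<^sub>v x) \<le> max (m (s *\<^sub>v \<pi> x)) (m (s *\<^sub>v y))" using m_add[OF s\<pi> sy] by simp
    then have "\<epsilon> * m (s *\<^sub>v x) \<le> \<epsilon> * max (m (s *\<^sub>v \<pi> x)) (m (s *\<^sub>v y))"
      using \<epsilon>(1) by (intro mult_left_mono) auto
    then have "\<epsilon> * m (s *\<^sub>v x) \<le> max (\<epsilon> * m (s *\<^sub>v \<pi> x)) (\<epsilon> * m (s *\<^sub>v y))"
      using \<epsilon>(1) by (simp add: max_mult_distrib_left)
    then have "\<epsilon> * m (s *\<^sub>v x) \<le> max (?R * (\<epsilon> * m x)) (?R * q x)" using 1 2 by linarith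
    moreover have "q (s *\<^sub>v x) \<le> ?R * q x" by (rule norm_boundD[OF bq s x])
    moreover have "?R * q' x = max (?R * q x) (?R * (\<epsilon> * m x))" using R by (simp add: q'_def max_mult_distrib_left)
    ultimately show "q' (s *\<^sub>v x) \<le> ?R * q' x" unfolding q'_def[of "s *\<^sub>v x"] by linarith
  qed
  moreover have "q x = 0" if "x \<in> carrier_vec d" "q' x = 0" for x
    using that qn(1)[OF that(1)] by (auto simp: q'_def max_def split: if_splits)
  \<comment> \<open>If all these limits were 0, some \<open>M n\<close> would be at most 1/2 on the
    whole basis, against its normalisation to the value 1.\<close>
  moreover have "\<exists>i<r. m (b i) > 0"
  proof (rule ccontr)
    assume neg: "\<not> ?thesis"
    have "eventually (\<lambda>n. M n (b i) \<le> 1 / 2) sequentially" if i: "i < r" for i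
    proof -
      have "m (b i) \<le> 0" using neg i by force
      then show ?thesis using mE[of "b i" "1 / 2"] \<pi>_id[OF b(1)[OF i] b(2)[OF i]] by simp
    qed
    then have "eventually (\<lambda>n. \<forall>i\<in>{..<r}. M n (b i) \<le> 1 / 2) sequentially"
      by (simp add: eventually_ball_finite)
    then obtain n where n: "\<forall>i\<in>{..<r}. M n (b i) \<le> 1 / 2"
      using eventually_happens'[OF trivial_limit_sequentially] by blast
    obtain i where i: "i < r" "Ns n (b i) = K n" using K_att by blast
    have "M n (b i) = 1" using i(2) K_pos[of n] by (simp add: M_def)
    then show False using n i(1) by force
  qed
  then obtain i where "i < r" "m (b i) > 0" by blast
  then have "q' (b i) \<noteq> 0" "q (b i) = 0" "b i \<in> carrier_vec d" using b \<epsilon>(1) by (auto simp: q'_def max_def)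
  ultimately show ?thesis using q's by (intro exI[of _ q']) blast
qed

text \<open>The zero seminorm is an admissible start. Dimensions of kernels are natural numbers, so
  the smallest kernel exists, and \<open>enlarge_seminorm\<close> shows that it is 0.\<close>

theorem extremal_norm_exists:
  assumes N: "ultrametric_norm v d N" and S: "S \<subseteq> carrier_mat d d" and bS: "norm_bound d N S C"
    and R: "radius d S > 0"
  obtains N' where "ultrametric_norm v d N'" "norm_bound d N' S (radius d S)"
proof -
  interpret finite_length_module "UNIV :: 'a set" "{0}" "\<lambda>c x i. c * x i"
    "triv.small_vec d" "triv.int_vec d" "\<lambda>U. card (triv.pivots d U)"
    by (rule triv.finite_length_coordinates)
  define Q where "Q q \<longleftrightarrow> ultra_seminorm d q \<and> norm_bound d q S (radius d S)" for q
  have "Q (\<lambda>x. 0)" using R by (auto simp: Q_def ultra_seminorm_def norm_bound_def)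
  from ex_has_least_nat[of Q, OF this, of "\<lambda>q. card (triv.pivots d (kernel_fun d q))"]
  obtain q where q: "Q q"
    and min: "\<And>q'. Q q' \<Longrightarrow> card (triv.pivots d (kernel_fun d q)) \<le> card (triv.pivots d (kernel_fun d q'))"
    by blast
  have qs: "ultra_seminorm d q" and bq: "norm_bound d q S (radius d S)" using q by (auto simp: Q_def)
  have "x = 0\<^sub>v d" if x: "x \<in> carrier_vec d" "q x = 0" for x
  proof (rule ccontr)
    assume "x \<noteq> 0\<^sub>v d"
    from enlarge_seminorm[OF N S bS R qs bq x this] obtain q' y where
      q': "ultra_seminorm d q'" "norm_bound d q' S (radius d S)"
        "\<And>x. x \<in> carrier_vec d \<Longrightarrow> q' x = 0 \<Longrightarrow> q x = 0"
      and y: "y \<in> carrier_vec d" "q y = 0" "q' y \<noteq> 0" by blast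
    have "Matrix.vec d (\<lambda>i. y $ i) = y" using y(1) by (intro eq_vecI) auto
    then have "(\<lambda>i. y $ i) \<in> kernel_fun d q - kernel_fun d q'" using y by simp
    moreover have "kernel_fun d q' \<subseteq> kernel_fun d q" using q'(3) by auto
    ultimately have "kernel_fun d q' \<subset> kernel_fun d q" by blast
    from rk_strict[OF kernel_fun_submod[OF q'(1)] kernel_fun_submod[OF qs] this]
    show False using min[of q'] q' by (simp add: Q_def)
  qed
  then have "ultrametric_norm v d q" using qs by (simp add: ultrametric_norm_iff)
  then show thesis using bq that by blast
qed

end

section \<open>Short words determine the radius\<close>

lemma field_class_ring: "field (class_ring :: 'a::field ring)"
  by (rule class_field.field_axioms)

lemma vectorspace_module_mat: "vectorspace class_ring (module_mat TYPE('a::field) d d)"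
proof -
  have "Module.module class_ring (module_mat TYPE('a) d d)"
    using mat_algebra_module[OF field_class_ring, of d] unfolding mat_algebra_class_ring .
  then show ?thesis using field_class_ring by (intro vectorspace.intro)
qed

text \<open>No words at all span only 0, whereas the identity matrix generates a non-zero algebra.
  Hence the maximum over short words has a non-empty range.\<close>

lemma ell_positive: assumes "d \<ge> 1" shows "ell d \<ge> 1"
proof (rule ccontr)
  let ?A = "module_mat TYPE(rat) d d"
  interpret MA: vectorspace class_ring ?A by (rule vectorspace_module_mat)
  assume "\<not> ell d \<ge> 1"
  then have "ell d = 0" by simp
  then have "powers_span TYPE(rat) d 0" using powers_span_ell[where 'f = rat, of d] by simp
  moreover have "{1\<^sub>m d} \<subseteq> carrier (mat_algebra (class_ring :: rat ring) d)"
    by (simp add: mat_algebra_class_ring module_mat_simps)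
  ultimately have "MA.span (\<Union>i\<in>{1..0::nat}. mat_pow d {1\<^sub>m d} i) = generated_algebra class_ring ?A {1\<^sub>m d}"
    using field_class_ring unfolding powers_span_def mat_algebra_class_ring[symmetric] by blast
  then have gen: "generated_algebra class_ring ?A {1\<^sub>m d} = {0\<^sub>m d d}"
    using MA.span_empty by (simp add: module_mat_simps)
  have "mat_pow d {1\<^sub>m d} n \<subseteq> carrier ?A" for n
    using mat_pow_carrier[of "{1\<^sub>m d :: rat mat}" d n] by (simp add: module_mat_simps)
  moreover have "1\<^sub>m d * 1\<^sub>m d \<in> mat_pow d {1\<^sub>m d :: rat mat} (Suc 0)"
    unfolding mat_pow_Suc_iff mat_pow_0 by blast
  ultimately have "1\<^sub>m d * 1\<^sub>m d \<in> generated_algebra class_ring ?A {1\<^sub>m d}"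
    unfolding generated_algebra_def by (intro subsetD[OF MA.in_own_span]) auto
  then have "(1\<^sub>m d :: rat mat) = 0\<^sub>m d d" unfolding gen by simp
  then have "(1\<^sub>m d :: rat mat) $$ (0, 0) = 0\<^sub>m d d $$ (0, 0)" by simp
  then show False using assms by simp
qed

text \<open>Makes the \<open>Max\<close> in \<open>max_eigenvalue\<close> meaningful.\<close>

lemma eigenvalues_finite_nonempty:
  fixes A :: "'a::alg_closed_field mat"
  assumes A: "A \<in> carrier_mat d d" and d: "d \<ge> 1"
  shows "finite {c. eigenvalue A c}" "{c. eigenvalue A c} \<noteq> {}"
proof -
  have eq: "{c. eigenvalue A c} = {c. poly (char_poly A) c = 0}" using eigenvalue_root_char_poly[OF A] by simp
  have deg: "degree (char_poly A) = d" using degree_monic_char_poly[OF A] by simp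
  then have "char_poly A \<noteq> 0" using d by auto
  then show "finite {c. eigenvalue A c}" unfolding eq by (rule poly_roots_finite)
  show "{c. eigenvalue A c} \<noteq> {}"
    unfolding eq using alg_closed_imp_poly_has_root[of "char_poly A"] deg d by auto
qed

section \<open>Eigenvalues of words against the radius\<close>

context complete_nonarch_field begin

lemma max_eigenvalue_ge:
  "A \<in> carrier_mat d d \<Longrightarrow> d \<ge> 1 \<Longrightarrow> eigenvalue A c \<Longrightarrow> v c \<le> max_eigenvalue v A"
  unfolding max_eigenvalue_def using eigenvalues_finite_nonempty[of A d] by (intro Max_ge) auto

lemma max_eigenvalue_le:
  "A \<in> carrier_mat d d \<Longrightarrow> d \<ge> 1 \<Longrightarrow> (\<And>c. eigenvalue A c \<Longrightarrow> v c \<le> D) \<Longrightarrow> max_eigenvalue v A \<le> D"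
  unfolding max_eigenvalue_def using eigenvalues_finite_nonempty[of A d] by (intro Max.boundedI) auto

text \<open>In a norm that bounds \<open>S\<close> by t, an eigenvector of a word of length k is
  stretched by at most t ^ k. Then t tends to the radius.\<close>

lemma eigenvalue_le_radius:
  assumes N: "ultrametric_norm v d N" and S: "S \<subseteq> carrier_mat d d" and b: "norm_bound d N S C"
    and w: "w \<in> mat_pow d S k" and c: "eigenvalue w c"
  shows "v c \<le> radius d S ^ k"
proof -
  have wc: "w \<in> carrier_mat d d" using w mat_pow_carrier[OF S] by blast
  obtain y where y: "y \<in> carrier_vec d" "y \<noteq> 0\<^sub>v d" "w *\<^sub>v y = c \<cdot>\<^sub>v y"
    using c wc unfolding eigenvalue_def eigenvector_def by auto
  have le: "v c \<le> t ^ k" if t: "radius d S < t" for t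
  proof -
    obtain N' where N': "ultrametric_norm v d N'" "norm_bound d N' S t" by (rule radius_less[OF N b t])
    have "N' (w *\<^sub>v y) \<le> t ^ k * N' y"
      by (rule norm_boundD[OF norm_bound_pow[OF ultrametric_normD(1)[OF N'(1)] S N'(2)] w y(1)])
    then have "v c * N' y \<le> t ^ k * N' y"
      unfolding y(3) ultra_seminormD(2)[OF ultrametric_normD(1)[OF N'(1)] y(1)] .
    then show ?thesis using ultrametric_normD(3)[OF N'(1) y(1,2)] by simp
  qed
  have "(\<lambda>n. (radius d S + 1 / real (Suc n)) ^ k) \<longlonglongrightarrow> (radius d S + 0) ^ k"
    by (intro tendsto_intros lim_1_over_n LIMSEQ_Suc)
  then show ?thesis using le by (intro LIMSEQ_le_const[where a = "v c"]) auto
qed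

text \<open>The radius bounds the set of values, so that its \<open>Sup\<close> is meaningful; the
  inserted 0 covers an empty set of words.\<close>

lemma max_eigenvalue_set_bounds:
  assumes N: "ultrametric_norm v d N" and d: "d \<ge> 1" and S: "S \<subseteq> carrier_mat d d" and b: "norm_bound d N S C"
  shows "0 \<le> max_eigenvalue_set v (mat_pow d S k)"
    and "max_eigenvalue_set v (mat_pow d S k) \<le> radius d S ^ k"
    and "w \<in> mat_pow d S k \<Longrightarrow> eigenvalue w c \<Longrightarrow> v c \<le> max_eigenvalue_set v (mat_pow d S k)"
proof -
  let ?L = "insert 0 (max_eigenvalue v ` mat_pow d S k)"
  have carr: "w \<in> carrier_mat d d" if "w \<in> mat_pow d S k" for w using that mat_pow_carrier[OF S] by blast
  have le: "x \<le> radius d S ^ k" if "x \<in> ?L" for x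
    using that radius_nonneg[OF N b] eigenvalue_le_radius[OF N S b] max_eigenvalue_le[OF carr d] by auto
  then have bdd: "bdd_above ?L" by (rule bdd_aboveI)
  show "0 \<le> max_eigenvalue_set v (mat_pow d S k)"
    unfolding max_eigenvalue_set_def by (rule cSup_upper[OF _ bdd]) simp
  show "max_eigenvalue_set v (mat_pow d S k) \<le> radius d S ^ k"
    unfolding max_eigenvalue_set_def using le by (intro cSup_least) auto
  assume w: "w \<in> mat_pow d S k" and c: "eigenvalue w c"
  have "v c \<le> max_eigenvalue v w" by (rule max_eigenvalue_ge[OF carr[OF w] d c])
  also have "\<dots> \<le> max_eigenvalue_set v (mat_pow d S k)"
    unfolding max_eigenvalue_set_def using w by (intro cSup_upper[OF _ bdd]) auto
  finally show "v c \<le> max_eigenvalue_set v (mat_pow d S k)" .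
qed

lemma conjugate_mult:
  assumes "g \<in> carrier_mat d d" "h \<in> carrier_mat d d" "h * g = 1\<^sub>m d"
    and "s \<in> carrier_mat d d" "u \<in> carrier_mat d d"
  shows "(g * s * h) * (g * u * h) = g * (s * u) * (h :: 'a mat)"
proof -
  note as = assoc_mult_mat[of _ d d _ d _ d]
  have "(g * s * h) * (g * u * h) = g * s * (h * (g * (u * h)))" using assms by (simp add: as)
  also have "h * (g * (u * h)) = (h * g) * (u * h)" using assms(1,2,4,5) by (intro as[symmetric]) auto
  also have "\<dots> = u * h" unfolding assms(3) using assms by auto
  also have "g * s * (u * h) = g * (s * u) * h" using assms by (simp add: as)
  finally show ?thesis .
qed

text \<open>Together with \<open>norm_bound_entries\<close>: in the maximum norm, the norm of a
  matrix is the greatest absolute value of its entries.\<close>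

lemma entries_le_norm_bound:
  assumes A: "A \<in> T" "T \<subseteq> carrier_mat d d" and b: "norm_bound d (sup_norm d) T t" and ij: "i < d" "j < d"
  shows "v (A $$ (i, j)) \<le> t"
proof -
  have Ac: "A \<in> carrier_mat d d" using A by blast
  have t: "0 \<le> t" using b by (simp add: norm_bound_def)
  have "(A *\<^sub>v unit_vec d j) $ i = (\<Sum>k\<in>{0..<d}. A $$ (i, k) * (if k = j then 1 else 0))"
    using Ac ij by (auto simp: scalar_prod_def intro!: sum.cong)
  then have "(A *\<^sub>v unit_vec d j) $ i = A $$ (i, j)" using ij by (simp add: if_distrib[of "(*) _"] cong: if_cong)
  then have "v (A $$ (i, j)) \<le> sup_norm d (A *\<^sub>v unit_vec d j)"
    using sup_norm_ge[OF ij(1), of "A *\<^sub>v unit_vec d j"] by simp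
  also have "\<dots> \<le> t * sup_norm d (unit_vec d j)" by (rule norm_boundD[OF b A(1)]) simp
  also have "\<dots> \<le> t * 1" using t ij by (intro mult_left_mono sup_norm_leI) auto
  finally show ?thesis by simp
qed

lemma norm_bound_entries:
  assumes T: "T \<subseteq> carrier_mat d d" and t: "0 \<le> t"
    and le: "\<And>A i j. A \<in> T \<Longrightarrow> i < d \<Longrightarrow> j < d \<Longrightarrow> v (A $$ (i, j)) \<le> t"
  shows "norm_bound d (sup_norm d) T t"
  unfolding norm_bound_def
proof (intro conjI ballI t)
  fix A and x :: "'a Matrix.vec" assume A: "A \<in> T" and x: "x \<in> carrier_vec d"
  have Ac: "A \<in> carrier_mat d d" using A T by blast
  show "sup_norm d (A *\<^sub>v x) \<le> t * sup_norm d x"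
  proof (rule sup_norm_leI)
    show "0 \<le> t * sup_norm d x" using t sup_norm_nonneg by simp
    fix i assume i: "i < d"
    have "(A *\<^sub>v x) $ i = (\<Sum>k\<in>{0..<d}. A $$ (i, k) * x $ k)" using Ac i x by (simp add: scalar_prod_def)
    also have "v \<dots> \<le> t * sup_norm d x"
      using t le[OF A i] sup_norm_ge sup_norm_nonneg by (intro v_sum_le) (auto simp: v_mult intro!: mult_mono)
    finally show "v ((A *\<^sub>v x) $ i) \<le> t * sup_norm d x" .
  qed
qed

text \<open>If \<open>r < radius d S\<close>, rescale and conjugate \<open>S\<close> so that its norm tends to 1, and pass to
  an ultraproduct. The residue field of the ultraproduct receives all long words as combinations
  of words of length at most \<open>ell d\<close>, which are nilpotent there since their eigenvalues stay away
  from absolute value 1. Hence long words reduce to 0, contradicting the choice of the radius.\<close>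

lemma radius_le_short_eigenvalues:
  assumes N: "ultrametric_norm v d N" and d: "d \<ge> 1" and S: "S \<subseteq> carrier_mat d d" and bS: "norm_bound d N S C"
    and r0: "0 \<le> r"
    and short: "\<And>k w c. k \<in> {1..ell d} \<Longrightarrow> w \<in> mat_pow d S k \<Longrightarrow> eigenvalue w c \<Longrightarrow> v c \<le> r ^ k"
  shows "radius d S \<le> r"
proof (rule ccontr)
  let ?R = "radius d S"
  assume "\<not> ?R \<le> r"
  then have rR: "r < ?R" by simp
  have R: "0 < ?R" using rR r0 by simp
  define T where "T n = ?R * (1 + 1 / real (Suc n))" for n
  \<comment> \<open>The radius need not be an absolute value, so \<open>c\<close> is squeezed into a
    short interval above \<open>T n\<close>. Lying above \<open>T n\<close> makes the rescaled
    matrices integral; the upper end keeps the loss negligible in the limit.\<close>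
  define \<Phi> where "\<Phi> n g h c \<longleftrightarrow> g \<in> carrier_mat d d \<and> h \<in> carrier_mat d d \<and> h * g = 1\<^sub>m d \<and> g * h = 1\<^sub>m d \<and>
      norm_bound d (sup_norm d) ((\<lambda>s. g * s * h) ` S) (T n) \<and>
      T n < v c \<and> v c < ?R * (1 + 2 / real (Suc n))" for n g h c
  have "\<exists>g h c. \<Phi> n g h c" for n
  proof -
    have RT: "?R < T n" using R by (simp add: T_def)
    obtain g h where gh: "g \<in> carrier_mat d d" "h \<in> carrier_mat d d" "h * g = 1\<^sub>m d" "g * h = 1\<^sub>m d"
      "norm_bound d (sup_norm d) ((\<lambda>s. g * s * h) ` S) (T n)"
      by (rule almost_optimal_conjugate[OF N S bS sup_norm_ultrametric RT])
    have "0 < T n" using RT R by simp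
    moreover have "T n < ?R * (1 + 2 / real (Suc n))"
      unfolding T_def using R by (intro mult_strict_left_mono) (auto simp: divide_strict_right_mono)
    ultimately obtain c where "c \<noteq> 0" "T n < v c" "v c < ?R * (1 + 2 / real (Suc n))" by (rule value_group_dense)
    then show ?thesis unfolding \<Phi>_def using gh by blast
  qed
  then obtain g h c where "\<And>n. \<Phi> n (g n) (h n) (c n)" by metis
  then have g: "g n \<in> carrier_mat d d" and h: "h n \<in> carrier_mat d d"
    and hg: "h n * g n = 1\<^sub>m d" and gh: "g n * h n = 1\<^sub>m d"
    and gSh: "norm_bound d (sup_norm d) ((\<lambda>s. g n * s * h n) ` S) (T n)"
    and cT: "T n < v (c n)" and c_up: "v (c n) < ?R * (1 + 2 / real (Suc n))" for n
    by (auto simp: \<Phi>_def)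
  have Rc: "?R < v (c n)" for n
  proof -
    have "?R \<le> T n" using R by (simp add: T_def)
    then show ?thesis using cT[of n] by simp
  qed
  have c0: "c n \<noteq> 0" for n using Rc[of n] R by auto
  have powc: "u \<in> carrier_mat d d" if "u \<in> mat_pow d S k" for u k using that mat_pow_carrier[OF S] by blast
  have Sc: "s \<in> carrier_mat d d" if "s \<in> S" for s using that S by blast
  have conjc: "g n * u * h n \<in> carrier_mat d d" if "u \<in> carrier_mat d d" for n u
    using that g h by (intro mult_carrier_mat[of _ d d _ d])
  \<comment> \<open>The word \<open>u\<close> in the n-th coordinates after rescaling. Its length
    \<open>k\<close> is passed along because \<open>u\<close> as a matrix does not determine
    it.\<close>
  define E where "E n k u = (\<lambda>i j. inverse (c n) ^ k * (g n * u * h n) $$ (i, j))" for n k u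
  have E_mult: "(\<Sum>l<d. E n 1 s i l * E n k u l j) = E n (Suc k) (s * u) i j"
    if "s \<in> carrier_mat d d" "u \<in> carrier_mat d d" "i < d" "j < d" for n k s u i j
  proof -
    have "g n * (s * u) * h n = (g n * s * h n) * (g n * u * h n)"
      using conjugate_mult[OF g h hg that(1,2)] by simp
    moreover have "((g n * s * h n) * (g n * u * h n)) $$ (i, j) =
        (\<Sum>l<d. (g n * s * h n) $$ (i, l) * (g n * u * h n) $$ (l, j))"
    proof -
      have "A * B = Matrix.mat d d (\<lambda>(i, j). \<Sum>l<d. A $$ (i, l) * B $$ (l, j))"
        if "A \<in> carrier_mat d d" "B \<in> carrier_mat d d" for A B :: "'a mat"
        using that by (intro eq_matI) (auto simp: scalar_prod_def atLeast0LessThan)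
      from this[OF conjc[OF that(1)] conjc[OF that(2)]] show ?thesis using that(3,4) by simp
    qed
    ultimately show ?thesis by (simp add: E_def sum_distrib_left algebra_simps)
  qed
  have app: "(A *\<^sub>v Matrix.vec d f) $ i = (\<Sum>j<d. A $$ (i, j) * f j)"
    if "A \<in> carrier_mat d d" "i < d" for A :: "'a mat" and f i
    using that by (simp add: scalar_prod_def atLeast0LessThan)
  \<comment> \<open>A different member of \<open>S\<close> may be chosen for each n. Only so do the
    almost optimal words, which vary with n, come from words in \<Sigma>.\<close>
  define \<Sigma> where "\<Sigma> = {M. \<forall>n. \<exists>s\<in>S. \<forall>i<d. \<forall>j<d. M i j n = E n 1 s i j}"
  have words_E: "\<forall>n. \<exists>u\<in>mat_pow d S k. \<forall>i<d. \<forall>j<d. w i j n = E n k u i j"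
    if "w \<in> words d \<Sigma> k" for w k
    using that
  proof (induction k arbitrary: w)
    case 0
    show ?case
    proof
      fix n
      have "g n * 1\<^sub>m d * h n = 1\<^sub>m d" using g[of n] gh[of n] by simp
      then show "\<exists>u\<in>mat_pow d S 0. \<forall>i<d. \<forall>j<d. w i j n = E n 0 u i j"
        unfolding mat_pow_0 using 0 by (auto simp: E_def)
    qed
  next
    case (Suc k)
    then obtain M w' where w: "w = mat_mul d M w'" "M \<in> \<Sigma>" "w' \<in> words d \<Sigma> k" by auto
    show ?case
    proof
      fix n
      obtain s where s: "s \<in> S" "\<And>i j. i < d \<Longrightarrow> j < d \<Longrightarrow> M i j n = E n 1 s i j"
        using w(2) unfolding \<Sigma>_def by blast
      obtain u where u: "u \<in> mat_pow d S k" "\<And>i j. i < d \<Longrightarrow> j < d \<Longrightarrow> w' i j n = E n k u i j"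
        using Suc.IH[OF w(3)] by blast
      have "w i j n = E n (Suc k) (s * u) i j" if ij: "i < d" "j < d" for i j
      proof -
        have "w i j n = (\<Sum>l<d. E n 1 s i l * E n k u l j)"
          unfolding w(1) mat_mul_def sum_fun_apply using s(2) u(2) ij by (auto intro!: sum.cong)
        then show ?thesis using E_mult[OF Sc[OF s(1)] powc[OF u(1)] ij] by simp
      qed
      moreover have "s * u \<in> mat_pow d S (Suc k)" using s(1) u(1) mat_pow_Suc_iff by blast
      ultimately show "\<exists>u\<in>mat_pow d S (Suc k). \<forall>i<d. \<forall>j<d. w i j n = E n (Suc k) u i j" by blast
    qed
  qed
  have E_words: "\<exists>w\<in>words d \<Sigma> k. \<forall>n. \<forall>i<d. \<forall>j<d. w i j n = E n k (u n) i j"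
    if "\<forall>n. u n \<in> mat_pow d S k" for u k
    using that
  proof (induction k arbitrary: u)
    case 0
    have "g n * 1\<^sub>m d * h n = 1\<^sub>m d" for n using g[of n] gh[of n] by simp
    then show ?case using 0 by (auto simp: mat_pow_0 E_def)
  next
    case (Suc k)
    then have "\<exists>s\<in>S. \<exists>u'\<in>mat_pow d S k. u n = s * u'" for n using mat_pow_Suc_iff by blast
    then obtain s u' where su: "\<And>n. s n \<in> S" "\<forall>n. u' n \<in> mat_pow d S k" "\<And>n. u n = s n * u' n" by metis
    obtain w' where w': "w' \<in> words d \<Sigma> k" "\<And>n i j. i < d \<Longrightarrow> j < d \<Longrightarrow> w' i j n = E n k (u' n) i j"
      using Suc.IH[OF su(2)] by blast
    define M where "M i j n = E n 1 (s n) i j" for i j n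
    have "M \<in> \<Sigma>" unfolding \<Sigma>_def M_def using su(1) by blast
    then have "mat_mul d M w' \<in> words d \<Sigma> (Suc k)" using w'(1) by auto
    moreover have "mat_mul d M w' i j n = E n (Suc k) (u n) i j" if "i < d" "j < d" for i j n
    proof -
      have "mat_mul d M w' i j n = (\<Sum>l<d. E n 1 (s n) i l * E n k (u' n) l j)"
        unfolding mat_mul_def sum_fun_apply using w'(2) that by (auto simp: M_def intro!: sum.cong)
      then show ?thesis using E_mult[OF Sc[OF su(1)] powc[of "u' n" k] that] su(2,3) by simp
    qed
    ultimately show ?case by blast
  qed
  obtain U :: "nat filter" where U: "U \<noteq> bot" "U \<le> sequentially"
    "\<And>P. eventually P U \<or> eventually (\<lambda>x. \<not> P x) U"
    using ultrafilter_exists[OF trivial_limit_sequentially] by blast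
  interpret U: ultra_nonarch_field v U by unfold_locales (use U in auto)
  have S_int: "\<Sigma> \<subseteq> U.int_mat d"
  proof
    fix M assume M: "M \<in> \<Sigma>"
    have "M i j \<in> U.int_seq" if ij: "i < d" "j < d" for i j
    proof (rule U.bounded_R)
      fix n
      obtain s where s: "s \<in> S" "M i j n = E n 1 s i j" using M ij unfolding \<Sigma>_def by blast
      have "v ((g n * s * h n) $$ (i, j)) \<le> T n"
        by (rule entries_le_norm_bound[OF _ _ gSh ij]) (use s(1) conjc Sc in auto)
      then have "v ((g n * s * h n) $$ (i, j)) \<le> v (c n)" using cT[of n] by simp
      then show "v (M i j n) \<le> 1"
        unfolding s(2) E_def using c0[of n] by (simp add: v_mult v_inverse v_divide field_simps)
    qed
    then show "M \<in> U.int_mat d" by (simp add: U.int_mat_def)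
  qed
  have nil: "\<exists>m. \<forall>x\<in>U.int_vec d. (mat_app d w ^^ m) x \<in> U.small_vec d"
    if k: "k \<in> {1..ell d}" and w: "w \<in> words d \<Sigma> k" for k w
  proof -
    obtain ls where
      ls: "\<And>l. l \<in> set ls \<Longrightarrow> \<exists>x. (\<forall>i<d. x i \<in> U.int_seq) \<and> (\<forall>n. \<exists>i<d. x i n = 1) \<and> (\<forall>i<d. mat_app d w x i = l * x i)"
      and fold: "\<forall>x. \<forall>i<d. fold (\<lambda>l z i. mat_app d w z i - l * z i) ls x i = 0"
      using U.eigenvalue_sequences[where d = d and M = w] by blast
    have "l \<in> U.small_seq" if l: "l \<in> set ls" for l
    proof -
      obtain x where x: "\<forall>n. \<exists>i<d. x i n = 1" "\<forall>i<d. mat_app d w x i = l * x i" using ls[OF l] by blast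
      \<comment> \<open>Undoing rescaling and conjugation turns \<open>l n\<close> into the
        eigenvalue c n ^ k * l n of a word of length \<open>k\<close>, bounded by r ^ k, while
        \<open>c n\<close> exceeds the radius. Since k is at least 1, r / R bounds all
        cases.\<close>
      have "v (l n) \<le> r / ?R" for n
      proof -
        obtain u where u: "u \<in> mat_pow d S k" "\<And>i j. i < d \<Longrightarrow> j < d \<Longrightarrow> w i j n = E n k u i j"
          using words_E[OF w] by blast
        have uc: "u \<in> carrier_mat d d" by (rule powc[OF u(1)])
        define y where "y = Matrix.vec d (\<lambda>i. x i n)"
        have y: "y \<in> carrier_vec d" by (simp add: y_def)
        obtain i0 where "i0 < d" "x i0 n = 1" using x(1) by blast
        then have y0: "y \<noteq> 0\<^sub>v d" by (auto simp: y_def dest!: arg_cong[of _ _ "\<lambda>y. y $ i0"])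
        define e where "e = c n ^ k * l n"
        have gy: "(g n * u * h n) *\<^sub>v y = e \<cdot>\<^sub>v y"
        proof (rule eq_vecI)
          fix i assume "i < dim_vec (e \<cdot>\<^sub>v y)"
          then have i: "i < d" by (simp add: y_def)
          have "inverse (c n) ^ k * ((g n * u * h n) *\<^sub>v y) $ i =
              (\<Sum>j<d. inverse (c n) ^ k * ((g n * u * h n) $$ (i, j) * x j n))"
            using app[OF conjc[OF uc] i] by (simp add: y_def sum_distrib_left)
          also have "\<dots> = (\<Sum>j<d. w i j n * x j n)"
            using u(2)[OF i] by (intro sum.cong) (auto simp: E_def)
          also have "\<dots> = mat_app d w x i n" by (simp add: mat_app_def sum_fun_apply)
          also have "\<dots> = l n * x i n" using x(2) i by simp
          finally show "((g n * u * h n) *\<^sub>v y) $ i = (e \<cdot>\<^sub>v y) $ i"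
            using i c0[of n] by (simp add: e_def y_def field_simps)
        qed (use g[of n] in \<open>simp add: y_def\<close>)
        define z where "z = h n *\<^sub>v y"
        have z: "z \<in> carrier_vec d" using h[of n] y by (simp add: z_def)
        have gz: "g n *\<^sub>v z = y" using g[of n] h[of n] gh[of n] y by (simp add: z_def flip: assoc_mult_mat_vec)
        have uz: "u *\<^sub>v z \<in> carrier_vec d" using uc z by simp
        have "g n *\<^sub>v (u *\<^sub>v z) = e \<cdot>\<^sub>v y"
          using gy g[of n] h[of n] uc y by (simp add: z_def assoc_mult_mat_vec[of _ d d _ d])
        then have "h n *\<^sub>v (g n *\<^sub>v (u *\<^sub>v z)) = h n *\<^sub>v (e \<cdot>\<^sub>v y)" by simp
        moreover have "h n *\<^sub>v (g n *\<^sub>v (u *\<^sub>v z)) = u *\<^sub>v z"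
          using g[of n] h[of n] hg[of n] uz by (simp flip: assoc_mult_mat_vec)
        moreover have "h n *\<^sub>v (e \<cdot>\<^sub>v y) = e \<cdot>\<^sub>v z" unfolding z_def using h[of n] y by (simp add: mult_mat_vec)
        ultimately have "u *\<^sub>v z = e \<cdot>\<^sub>v z" by simp
        moreover have "z \<noteq> 0\<^sub>v d"
        proof
          assume "z = 0\<^sub>v d"
          moreover have "g n *\<^sub>v 0\<^sub>v d = 0\<^sub>v d" using g[of n] by (intro eq_vecI) auto
          ultimately show False using gz y0 by simp
        qed
        ultimately have "eigenvalue u e" using z uc unfolding eigenvalue_def eigenvector_def by auto
        then have ve: "v e \<le> r ^ k" by (rule short[OF k u(1)])
        have "?R ^ k * v (l n) \<le> v (c n) ^ k * v (l n)"
          using Rc[of n] R by (intro mult_right_mono power_mono) auto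
        also have "\<dots> \<le> r ^ k" using ve by (simp add: e_def v_mult v_power)
        finally have "v (l n) \<le> (r / ?R) ^ k" using R by (simp add: field_simps power_divide)
        also have "\<dots> \<le> (r / ?R) ^ 1" using k r0 R rR by (intro power_decreasing) auto
        finally show ?thesis by simp
      qed
      then show ?thesis using rR R by (intro U.P_I[of "r / ?R"]) auto
    qed
    then have "set ls \<subseteq> U.small_seq" by blast
    moreover have "w i j \<in> U.int_seq" if "i < d" "j < d" for i j
      using U.words_int[OF S_int, of k] w that by (auto simp: U.int_mat_def)
    ultimately show ?thesis
      using fold U.zero_P by (intro U.nilpotent_if_small_eigenvalues[of d w ls]) auto
  qed
  have "\<exists>m. \<forall>w\<in>words d \<Sigma> m. \<forall>i<d. \<forall>j<d. w i j \<in> U.small_seq"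
    by (rule U.words_eventually_small_ell[OF S_int]) (rule nil)
  then obtain m where m: "\<And>w i j. w \<in> words d \<Sigma> m \<Longrightarrow> i < d \<Longrightarrow> j < d \<Longrightarrow> w i j \<in> U.small_seq"
    by blast
  have m1: "m \<ge> 1"
  proof (rule ccontr)
    assume "\<not> m \<ge> 1"
    then have "m = 0" by simp
    then have "(\<lambda>i j. if i = j then 1 else 0) \<in> words d \<Sigma> m" by simp
    from m[OF this, of 0 0] show False using d U.one_P by simp
  qed
  \<comment> \<open>A positive sequence that tends to 1 from below. As the radius is minimal, some
    word of length \<open>m\<close> has an entry above \<gamma> n times the m-th power of the radius
    in the n-th coordinates.\<close>
  define \<gamma> where "\<gamma> n = 1 - 1 / real (Suc (Suc n))" for n
  have \<gamma>: "0 < \<gamma> n" "\<gamma> n < 1" for n by (auto simp: \<gamma>_def field_simps)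
  have "\<exists>u\<in>mat_pow d S m. \<exists>i<d. \<exists>j<d. \<gamma> n * ?R ^ m < v ((g n * u * h n) $$ (i, j))" for n
  proof (rule ccontr)
    assume neg: "\<not> ?thesis"
    have "norm_bound d (sup_norm d) ((\<lambda>u. g n * u * h n) ` mat_pow d S m) (\<gamma> n * ?R ^ m)"
    proof (rule norm_bound_entries)
      show "(\<lambda>u. g n * u * h n) ` mat_pow d S m \<subseteq> carrier_mat d d" using conjc powc by blast
      show "0 \<le> \<gamma> n * ?R ^ m" using \<gamma>[of n] R by simp
      fix A i j assume "A \<in> (\<lambda>u. g n * u * h n) ` mat_pow d S m" and ij: "i < d" "j < d"
      then obtain u where u: "u \<in> mat_pow d S m" "A = g n * u * h n" by blast
      show "v (A $$ (i, j)) \<le> \<gamma> n * ?R ^ m"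
        unfolding u(2) using neg u(1) ij by (meson not_less)
    qed
    then have "norm_bound d (\<lambda>x. sup_norm d (g n *\<^sub>v x)) (mat_pow d S m) (\<gamma> n * ?R ^ m)"
      using conjugate_norm_bound(2)[OF sup_norm_ultrametric mat_pow_carrier[OF S] g h hg] by blast
    from radius_pow_le[OF N S bS conjugate_norm_bound(1)[OF sup_norm_ultrametric S g h hg] m1 this]
    have "?R ^ m \<le> \<gamma> n * ?R ^ m" .
    moreover have "\<gamma> n * ?R ^ m < 1 * ?R ^ m" using \<gamma>[of n] R by (intro mult_strict_right_mono) auto
    ultimately show False by simp
  qed
  then obtain u where u: "\<forall>n. u n \<in> mat_pow d S m"
    "\<And>n. \<exists>i<d. \<exists>j<d. \<gamma> n * ?R ^ m < v ((g n * u n * h n) $$ (i, j))" by metis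
  obtain w where w: "w \<in> words d \<Sigma> m" "\<And>n i j. i < d \<Longrightarrow> j < d \<Longrightarrow> w i j n = E n m (u n) i j"
    using E_words[OF u(1)] by blast
  \<comment> \<open>What remains of \<gamma> after division by c n ^ m. It tends to 1, whereas
    smallness keeps all entries of \<open>w\<close> below a constant less than 1 along the
    ultrafilter.\<close>
  define \<delta> where "\<delta> n = \<gamma> n / (1 + 2 / real (Suc n)) ^ m" for n
  have big: "\<exists>i<d. \<exists>j<d. \<delta> n < v (w i j n)" for n
  proof -
    obtain i j where ij: "i < d" "j < d" "\<gamma> n * ?R ^ m < v ((g n * u n * h n) $$ (i, j))" using u(2) by blast
    have cm: "v (c n) ^ m \<le> (?R * (1 + 2 / real (Suc n))) ^ m" using c_up[of n] by (intro power_mono) auto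
    have "\<delta> n = \<gamma> n * ?R ^ m / (?R * (1 + 2 / real (Suc n))) ^ m"
      using R by (simp add: \<delta>_def power_mult_distrib)
    also have "\<dots> \<le> \<gamma> n * ?R ^ m / v (c n) ^ m"
    proof (rule divide_left_mono[OF cm])
      show "0 \<le> \<gamma> n * ?R ^ m" using \<gamma>[of n] R by simp
      have "0 < v (c n) ^ m" using c0[of n] by simp
      then show "0 < (?R * (1 + 2 / real (Suc n))) ^ m * v (c n) ^ m" using cm by (intro mult_pos_pos) linarith+
    qed
    also have "\<dots> < v ((g n * u n * h n) $$ (i, j)) / v (c n) ^ m"
      using ij(3) c0[of n] by (intro divide_strict_right_mono) auto
    also have "\<dots> = v (w i j n)"
      using w(2)[OF ij(1,2)] by (simp add: E_def v_mult v_power v_inverse v_divide field_simps)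
    finally show ?thesis using ij(1,2) by blast
  qed
  have "\<delta> \<longlonglongrightarrow> (1 - 0) / (1 + 2 * 0) ^ m"
  proof -
    have 1: "(\<lambda>n. 1 / real (Suc n)) \<longlonglongrightarrow> 0" by (intro LIMSEQ_Suc lim_1_over_n)
    have "(\<lambda>n. (1 - 1 / real (Suc (Suc n))) / (1 + 2 * (1 / real (Suc n))) ^ m) \<longlonglongrightarrow> (1 - 0) / (1 + 2 * 0) ^ m"
      using LIMSEQ_Suc[OF 1] 1 by (intro tendsto_intros) auto
    then show ?thesis by (simp add: \<delta>_def [abs_def] \<gamma>_def)
  qed
  then have \<delta>_lim: "\<delta> \<longlonglongrightarrow> 1" by simp
  have "eventually (\<lambda>n. v (w i j n) \<le> \<delta> n) U" if ij: "i < d" "j < d" for i j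
  proof -
    obtain D where D: "D < 1" "eventually (\<lambda>n. v (w i j n) \<le> D) U" using m[OF w(1) ij] by (rule U.P_D)
    have "eventually (\<lambda>n. D < \<delta> n) sequentially" using \<delta>_lim D(1) by (intro order_tendstoD(1))
    then have "eventually (\<lambda>n. D < \<delta> n) U" using U(2) by (rule filter_leD[rotated])
    with D(2) show ?thesis by eventually_elim simp
  qed
  then have "\<forall>p\<in>{..<d} \<times> {..<d}. eventually (\<lambda>n. v (w (fst p) (snd p) n) \<le> \<delta> n) U" by auto
  then have "eventually (\<lambda>n. \<forall>p\<in>{..<d} \<times> {..<d}. v (w (fst p) (snd p) n) \<le> \<delta> n) U"
    by (simp add: eventually_ball_finite)
  then obtain n where n: "\<forall>p\<in>{..<d} \<times> {..<d}. v (w (fst p) (snd p) n) \<le> \<delta> n"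
    using eventually_happens'[OF U(1)] by blast
  obtain i j where "i < d" "j < d" "\<delta> n < v (w i j n)" using big by blast
  then show False using bspec[OF n, of "(i, j)"] by simp
qed

end

text \<open>Products of linear combinations need not be expanded: the vectors killed by all words of
  length j form a filtration, and every element of the generated algebra moves it down by one
  step.\<close>

lemma mat_pow_zero_nilpotent:
  fixes S :: "'a::field mat set"
  assumes S: "S \<subseteq> carrier_mat d d" and m: "mat_pow d S m \<subseteq> {0\<^sub>m d d}"
  shows "nilpotent_algebra (module_mat TYPE('a) d d) (generated_algebra class_ring (module_mat TYPE('a) d d) S)"
proof -
  let ?A = "module_mat TYPE('a) d d"
  interpret MA: vectorspace class_ring ?A by (rule vectorspace_module_mat)
  define G where "G = generated_algebra class_ring ?A S"
  have powc: "mat_pow d S n \<subseteq> carrier_mat d d" for n by (rule mat_pow_carrier[OF S])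
  have sub: "(\<Union>n\<in>{1..}. mat_pow d S n) \<subseteq> carrier ?A" using powc by (auto simp: module_mat_simps)
  have Gsub: "LinearCombinations.submodule class_ring G ?A"
    unfolding G_def generated_algebra_def using sub by (rule MA.span_is_submodule)
  have Gc: "G \<subseteq> carrier_mat d d" using LinearCombinations.submodule.subset[OF Gsub] by (simp add: module_mat_simps)
  have G0: "0\<^sub>m d d \<in> G" using submodule.zero_closed[OF Gsub] by (simp add: module_mat_simps)
  define L where "L j = {x \<in> carrier_vec d. \<forall>w\<in>mat_pow d S j. w *\<^sub>v x = 0\<^sub>v d}" for j
  have step: "a *\<^sub>v x \<in> L j" if a: "a \<in> G" and x: "x \<in> L (Suc j)" for a x j
  proof -
    have xc: "x \<in> carrier_vec d" using x by (simp add: L_def)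
    let ?K = "{a \<in> carrier_mat d d. a *\<^sub>v x \<in> L j}"
    have "LinearCombinations.submodule class_ring ?K ?A"
    proof (rule LinearCombinations.submodule.intro)
      show "Module.module class_ring ?A" by (rule MA.module_axioms)
      show "?K \<subseteq> carrier ?A" by (auto simp: module_mat_simps)
      have L0: "0\<^sub>v d \<in> L j"
      proof -
        have "w *\<^sub>v 0\<^sub>v d = 0\<^sub>v d" if "w \<in> carrier_mat d d" for w :: "'a mat"
          using that by (intro eq_vecI) auto
        then show ?thesis using powc by (auto simp: L_def)
      qed
      have "0\<^sub>m d d *\<^sub>v x = 0\<^sub>v d" using xc by (intro eq_vecI) auto
      then show "\<zero>\<^bsub>?A\<^esub> \<in> ?K" using L0 by (simp add: module_mat_simps)
      show "a \<oplus>\<^bsub>?A\<^esub> b \<in> ?K" if a: "a \<in> ?K" and b: "b \<in> ?K" for a b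
      proof -
        have "w *\<^sub>v ((a + b) *\<^sub>v x) = 0\<^sub>v d" if w: "w \<in> mat_pow d S j" for w
        proof -
          have wc: "w \<in> carrier_mat d d" using w powc by blast
          have z: "w *\<^sub>v (a *\<^sub>v x) = 0\<^sub>v d" "w *\<^sub>v (b *\<^sub>v x) = 0\<^sub>v d" using a b w by (auto simp: L_def)
          have "(a + b) *\<^sub>v x = a *\<^sub>v x + b *\<^sub>v x" using a b xc by (intro add_mult_distrib_mat_vec[of _ d d]) auto
          then have "w *\<^sub>v ((a + b) *\<^sub>v x) = w *\<^sub>v (a *\<^sub>v x) + w *\<^sub>v (b *\<^sub>v x)"
            using wc a b xc by (auto intro!: mult_add_distrib_mat_vec[of _ d d])
          then show ?thesis unfolding z by simp
        qed
        then show ?thesis using a b xc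
          by (auto simp: module_mat_simps L_def intro!: mult_mat_vec_carrier[of _ d d])
      qed
      show "c \<odot>\<^bsub>?A\<^esub> a \<in> ?K" if c: "c \<in> carrier class_ring" and a: "a \<in> ?K" for c a
      proof -
        have eq: "(c \<cdot>\<^sub>m a) *\<^sub>v x = c \<cdot>\<^sub>v (a *\<^sub>v x)" using a xc by (intro eq_vecI) auto
        have "w *\<^sub>v ((c \<cdot>\<^sub>m a) *\<^sub>v x) = 0\<^sub>v d" if w: "w \<in> mat_pow d S j" for w
        proof -
          have wc: "w \<in> carrier_mat d d" using w powc by blast
          have "w *\<^sub>v (c \<cdot>\<^sub>v (a *\<^sub>v x)) = c \<cdot>\<^sub>v (w *\<^sub>v (a *\<^sub>v x))"
            using wc a xc by (intro mult_mat_vec[of _ d d]) auto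
          also have "w *\<^sub>v (a *\<^sub>v x) = 0\<^sub>v d" using a w by (auto simp: L_def)
          also have "c \<cdot>\<^sub>v 0\<^sub>v d = 0\<^sub>v d" by (intro eq_vecI) auto
          finally show ?thesis unfolding eq .
        qed
        then show ?thesis using a xc
          by (auto simp: module_mat_simps L_def intro!: mult_mat_vec_carrier[of _ d d])
      qed
    qed
    moreover have "(\<Union>n\<in>{1..}. mat_pow d S n) \<subseteq> ?K"
    proof
      fix u assume "u \<in> (\<Union>n\<in>{1..}. mat_pow d S n)"
      then obtain n where n: "n \<ge> 1" "u \<in> mat_pow d S n" by auto
      have uc: "u \<in> carrier_mat d d" using n powc by blast
      have "w *\<^sub>v (u *\<^sub>v x) = 0\<^sub>v d" if w: "w \<in> mat_pow d S j" for w
      proof -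
        have wc: "w \<in> carrier_mat d d" using w powc by blast
        have "w * u \<in> mat_pow d S (j + n)" by (rule mat_pow_mult[OF S n(2) w])
        \<comment> \<open>\<open>u\<close> has at least one letter, so w * u ends in a word of
          length j + 1, which already kills \<open>x\<close>.\<close>
        then have "w * u \<in> mat_pow d S ((n - 1) + Suc j)" using n(1) by (simp add: add.commute)
        then obtain p q where pq: "p \<in> mat_pow d S (n - 1)" "q \<in> mat_pow d S (Suc j)" "w * u = p * q"
          using mat_pow_split[OF S] by blast
        have c: "p \<in> carrier_mat d d" "q \<in> carrier_mat d d" using pq powc by blast+
        have "w *\<^sub>v (u *\<^sub>v x) = (w * u) *\<^sub>v x" using wc uc xc by (simp add: assoc_mult_mat_vec)
        also have "\<dots> = p *\<^sub>v (q *\<^sub>v x)" unfolding pq(3) using c xc by (simp add: assoc_mult_mat_vec)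
        also have "q *\<^sub>v x = 0\<^sub>v d" using x pq(2) by (simp add: L_def)
        also have "p *\<^sub>v 0\<^sub>v d = 0\<^sub>v d" using c by (intro eq_vecI) auto
        finally show ?thesis .
      qed
      then show "u \<in> ?K" using uc xc by (auto simp: L_def)
    qed
    ultimately have "G \<subseteq> ?K" unfolding G_def generated_algebra_def by (intro MA.span_is_subset)
    then show ?thesis using a by blast
  qed
  have "a *\<^sub>v x \<in> L j" if "a \<in> mat_pow d G n" "x \<in> L (j + n)" for a x j n
    using that
  proof (induction n arbitrary: a j)
    case 0
    then show ?case by (auto simp: mat_pow_0 L_def)
  next
    case (Suc n)
    obtain b a' where ba: "a = b * a'" "b \<in> G" "a' \<in> mat_pow d G n" using Suc.prems(1) mat_pow_Suc_iff by blast
    have c: "b \<in> carrier_mat d d" "a' \<in> carrier_mat d d" "x \<in> carrier_vec d"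
      using ba Gc mat_pow_carrier[OF Gc] Suc.prems(2) by (auto simp: L_def)
    have "a' *\<^sub>v x \<in> L (Suc j)" using Suc.IH[OF ba(3), of "Suc j"] Suc.prems(2) by simp
    then have "b *\<^sub>v (a' *\<^sub>v x) \<in> L j" by (rule step[OF ba(2)])
    then show ?case unfolding ba(1) using c by (simp add: assoc_mult_mat_vec)
  qed
  note chain = this
  \<comment> \<open>The exponent is raised by one because \<open>nilpotent_algebra\<close> asks for
    a positive one.\<close>
  have Sm: "mat_pow d S (Suc m) \<subseteq> {0\<^sub>m d d}"
  proof
    fix w assume "w \<in> mat_pow d S (Suc m)"
    then obtain s u where su: "w = s * u" "s \<in> S" "u \<in> mat_pow d S m" using mat_pow_Suc_iff by blast
    have "s \<in> carrier_mat d d" "u = 0\<^sub>m d d" using su S m by blast+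
    then show "w \<in> {0\<^sub>m d d}" unfolding su(1) by simp
  qed
  have "mat_pow d G (Suc m) \<subseteq> {0\<^sub>m d d}"
  proof
    fix a assume a: "a \<in> mat_pow d G (Suc m)"
    have ac: "a \<in> carrier_mat d d" using a mat_pow_carrier[OF Gc] by blast
    have "a *\<^sub>v x = 0\<^sub>v d" if x: "x \<in> carrier_vec d" for x
    proof -
      have "0\<^sub>m d d *\<^sub>v x = 0\<^sub>v d" using x by (intro eq_vecI) auto
      then have "x \<in> L (0 + Suc m)" using x Sm by (auto simp: L_def)
      from chain[OF a this] have "1\<^sub>m d *\<^sub>v (a *\<^sub>v x) = 0\<^sub>v d" by (simp add: L_def mat_pow_0)
      then show ?thesis using ac x by simp
    qed
    note ax = this
    have "a $$ (i, j) = 0" if ij: "i < d" "j < d" for i j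
    proof -
      have "(a *\<^sub>v unit_vec d j) $ i = (\<Sum>k\<in>{0..<d}. a $$ (i, k) * (if k = j then 1 else 0))"
        using ac ij by (auto simp: scalar_prod_def intro!: sum.cong)
      also have "\<dots> = a $$ (i, j)" using ij by (simp add: if_distrib[of "(*) _"] cong: if_cong)
      finally show ?thesis using ax[of "unit_vec d j"] ij by simp
    qed
    then show "a \<in> {0\<^sub>m d d}" using ac by (auto intro!: eq_matI)
  qed
  \<comment> \<open>\<open>nilpotent_algebra\<close> demands equality with the set of the zero
    matrix, so 0 must also be attained.\<close>
  moreover have "0\<^sub>m d d \<in> mat_pow d G (Suc n)" for n
  proof (induction n)
    case 0
    have "0\<^sub>m d d * 1\<^sub>m d \<in> mat_pow d G (Suc 0)" unfolding mat_pow_Suc_iff mat_pow_0 using G0 by blast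
    then show ?case by simp
  next
    case (Suc n)
    have "0\<^sub>m d d * 0\<^sub>m d d \<in> mat_pow d G (Suc (Suc n))" unfolding mat_pow_Suc_iff[of _ _ _ "Suc n"] using G0 Suc by blast
    then show ?case by simp
  qed
  ultimately have "mat_pow d G (Suc m) = {\<zero>\<^bsub>?A\<^esub>}" by (auto simp: module_mat_simps)
  then show ?thesis unfolding nilpotent_algebra_def G_def by (intro exI[of _ "Suc m"]) simp
qed

section \<open>Radius 0, and the maximum over short words\<close>

context complete_nonarch_field begin

text \<open>The nilpotency theorem over the trivial residue field, where reduction is the identity
  and small means 0. What remains is a translation between matrices and functions.\<close>

lemma mat_pow_zero_of_short_nilpotent:
  fixes S :: "'a mat set"
  assumes S: "S \<subseteq> carrier_mat d d"
    and short: "\<And>k w c. k \<in> {1..ell d} \<Longrightarrow> w \<in> mat_pow d S k \<Longrightarrow> eigenvalue w c \<Longrightarrow> c = 0"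
  shows "\<exists>m. mat_pow d S m \<subseteq> {0\<^sub>m d d}"
proof -
  interpret triv: closed_residue_field "UNIV :: 'a set" "{0}" by (rule closed_residue_field_trivial)
  define F where "F u = (\<lambda>i j. u $$ (i, j))" for u :: "'a mat"
  have powc: "u \<in> carrier_mat d d" if "u \<in> mat_pow d S k" for u k using that mat_pow_carrier[OF S] by blast
  have mul: "(\<Sum>l<d. s $$ (i, l) * u $$ (l, j)) = (s * u) $$ (i, j)"
    if "s \<in> carrier_mat d d" "u \<in> carrier_mat d d" "i < d" "j < d" for s u :: "'a mat" and i j
    using that by (simp add: scalar_prod_def atLeast0LessThan)
  have wF: "\<exists>u\<in>mat_pow d S k. \<forall>i<d. \<forall>j<d. w i j = u $$ (i, j)" if "w \<in> words d (F ` S) k" for w k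
    using that
  proof (induction k arbitrary: w)
    case 0
    then show ?case by (simp add: mat_pow_0)
  next
    case (Suc k)
    obtain s w' where w: "w = mat_mul d (F s) w'" "s \<in> S" "w' \<in> words d (F ` S) k" using Suc.prems by auto
    obtain u where u: "u \<in> mat_pow d S k" "\<And>i j. i < d \<Longrightarrow> j < d \<Longrightarrow> w' i j = u $$ (i, j)" using Suc.IH[OF w(3)] by blast
    have "w i j = (s * u) $$ (i, j)" if "i < d" "j < d" for i j
      unfolding w(1) mat_mul_def F_def mul[OF subsetD[OF S w(2)] powc[OF u(1)] that, symmetric]
      using u(2) that by (intro sum.cong) auto
    moreover have "s * u \<in> mat_pow d S (Suc k)" using w(2) u(1) mat_pow_Suc_iff by blast
    ultimately show ?case by blast
  qed
  have Fw: "\<exists>w\<in>words d (F ` S) k. \<forall>i<d. \<forall>j<d. w i j = u $$ (i, j)" if "u \<in> mat_pow d S k" for u k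
    using that
  proof (induction k arbitrary: u)
    case 0
    then show ?case by (simp add: mat_pow_0)
  next
    case (Suc k)
    obtain s u' where u: "u = s * u'" "s \<in> S" "u' \<in> mat_pow d S k" using Suc.prems mat_pow_Suc_iff by blast
    obtain w where w: "w \<in> words d (F ` S) k" "\<And>i j. i < d \<Longrightarrow> j < d \<Longrightarrow> w i j = u' $$ (i, j)" using Suc.IH[OF u(3)] by blast
    have "mat_mul d (F s) w i j = u $$ (i, j)" if "i < d" "j < d" for i j
      unfolding u(1) mat_mul_def F_def mul[OF subsetD[OF S u(2)] powc[OF u(3)] that, symmetric]
      using w(2) that by (intro sum.cong) auto
    moreover have "mat_mul d (F s) w \<in> words d (F ` S) (Suc k)" using u(2) w(1) by auto
    ultimately show ?case by blast
  qed
  have "\<exists>m. \<forall>w\<in>words d (F ` S) m. \<forall>i<d. \<forall>j<d. w i j \<in> {0 :: 'a}"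
  proof (rule triv.words_eventually_small_ell)
    show "F ` S \<subseteq> triv.int_mat d" by (simp add: triv.int_mat_def)
    fix k w assume k: "k \<in> {1..ell d}" and w: "w \<in> words d (F ` S) k"
    obtain u where u: "u \<in> mat_pow d S k" "\<And>i j. i < d \<Longrightarrow> j < d \<Longrightarrow> w i j = u $$ (i, j)" using wF[OF w] by blast
    have uc: "u \<in> carrier_mat d d" by (rule powc[OF u(1)])
    obtain es where es: "\<forall>e\<in>set es. \<exists>x. (\<exists>i<d. x i \<noteq> 0) \<and> (\<forall>i<d. mat_app d w x i = e * x i)"
      "\<forall>x. \<forall>i<d. fold (\<lambda>e z i. mat_app d w z i - e * z i) es x i = 0"
      using eigenvalue_list_mat_app[of w d] by blast
    have "e = 0" if e: "e \<in> set es" for e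
    proof -
      obtain x i0 where x: "i0 < d" "x i0 \<noteq> 0" "\<And>i. i < d \<Longrightarrow> mat_app d w x i = e * x i" using es(1) e by blast
      define y where "y = Matrix.vec d x"
      have "u *\<^sub>v y = e \<cdot>\<^sub>v y"
      proof (rule eq_vecI)
        fix i assume "i < dim_vec (e \<cdot>\<^sub>v y)"
        then have i: "i < d" by (simp add: y_def)
        have "(u *\<^sub>v y) $ i = (\<Sum>j<d. u $$ (i, j) * x j)"
          using i uc by (simp add: y_def scalar_prod_def atLeast0LessThan)
        also have "\<dots> = mat_app d w x i" unfolding mat_app_def using u(2)[OF i] by (intro sum.cong) auto
        finally show "(u *\<^sub>v y) $ i = (e \<cdot>\<^sub>v y) $ i" using x(3)[OF i] i by (simp add: y_def)
      qed (use uc in \<open>simp add: y_def\<close>)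
      moreover have "y \<noteq> 0\<^sub>v d" using x(1,2) by (auto simp: y_def dest!: arg_cong[of _ _ "\<lambda>y. y $ i0"])
      ultimately have "eigenvalue u e" using uc by (auto simp: eigenvalue_def eigenvector_def y_def intro!: exI[of _ y])
      then show ?thesis by (rule short[OF k u(1)])
    qed
    then show "\<exists>m. \<forall>x\<in>triv.int_vec d. (mat_app d w ^^ m) x \<in> triv.small_vec d"
      using es(2) by (intro triv.nilpotent_if_small_eigenvalues[of d w es]) auto
  qed
  then obtain m where m: "\<forall>w\<in>words d (F ` S) m. \<forall>i<d. \<forall>j<d. w i j = 0" by auto
  have "u = 0\<^sub>m d d" if u: "u \<in> mat_pow d S m" for u
  proof -
    obtain w where "w \<in> words d (F ` S) m" "\<forall>i<d. \<forall>j<d. w i j = u $$ (i, j)" using Fw[OF u] by blast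
    then show ?thesis using m powc[OF u] by (intro eq_matI) auto
  qed
  then show ?thesis by blast
qed

text \<open>Rescaling by the radius is impossible when it is 0; instead all eigenvalues of words
  then vanish, and the nilpotency theorem applies directly. Conversely, a vanishing power of
  \<open>S\<close> has norm 0, which bounds a power of the radius.\<close>

lemma radius_zero_iff_nilpotent:
  assumes N: "ultrametric_norm v d N" and d: "d \<ge> 1" and S: "S \<subseteq> carrier_mat d d" and b: "norm_bound d N S C"
  shows "radius d S = 0 \<longleftrightarrow>
    nilpotent_algebra (module_mat TYPE('a) d d) (generated_algebra class_ring (module_mat TYPE('a) d d) S)"
proof
  assume R: "radius d S = 0"
  have "c = 0" if "k \<in> {1..ell d}" "w \<in> mat_pow d S k" "eigenvalue w c" for k w c
  proof -
    have "v c \<le> 0" using eigenvalue_le_radius[OF N S b that(2,3)] R that(1) by (simp add: power_0_left)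
    then have "v c = 0" using v_nonneg[of c] by linarith
    then show ?thesis by simp
  qed
  then obtain m where "mat_pow d S m \<subseteq> {0\<^sub>m d d}" using mat_pow_zero_of_short_nilpotent[OF S] by metis
  then show "nilpotent_algebra (module_mat TYPE('a) d d) (generated_algebra class_ring (module_mat TYPE('a) d d) S)"
    by (rule mat_pow_zero_nilpotent[OF S])
next
  let ?A = "module_mat TYPE('a) d d"
  interpret MA: vectorspace class_ring ?A by (rule vectorspace_module_mat)
  assume "nilpotent_algebra ?A (generated_algebra class_ring ?A S)"
  then obtain n where n: "n \<ge> 1" "mat_pow d (generated_algebra class_ring ?A S) n = {0\<^sub>m d d}"
    unfolding nilpotent_algebra_def by (auto simp: module_mat_simps)
  have "(\<Union>n\<in>{1..}. mat_pow d S n) \<subseteq> carrier ?A" using mat_pow_carrier[OF S] by (auto simp: module_mat_simps)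
  then have in_gen: "(\<Union>n\<in>{1..}. mat_pow d S n) \<subseteq> generated_algebra class_ring ?A S"
    unfolding generated_algebra_def by (rule MA.in_own_span)
  have "S \<subseteq> generated_algebra class_ring ?A S"
  proof
    fix s assume s: "s \<in> S"
    have "s * 1\<^sub>m d \<in> mat_pow d S (Suc 0)" unfolding mat_pow_Suc_iff mat_pow_0 using s by blast
    then have "s \<in> mat_pow d S 1" using subsetD[OF S s] by simp
    then show "s \<in> generated_algebra class_ring ?A S" using in_gen by auto
  qed
  then have Sn: "mat_pow d S n \<subseteq> {0\<^sub>m d d}" using set_pow_mono n(2) by metis
  have "norm_bound d N (mat_pow d S n) 0"
    unfolding norm_bound_def
  proof (intro conjI ballI)
    fix w and x :: "'a Matrix.vec" assume "w \<in> mat_pow d S n" and x: "x \<in> carrier_vec d"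
    then have "w = 0\<^sub>m d d" using Sn by blast
    moreover have "0\<^sub>m d d *\<^sub>v x = 0\<^sub>v d" using x by (intro eq_vecI) auto
    ultimately show "N (w *\<^sub>v x) \<le> 0 * N x" using ultra_seminormD(4)[OF ultrametric_normD(1)[OF N]] by simp
  qed simp
  from radius_pow_le[OF N S b N n(1) this] have "radius d S ^ n \<le> 0" .
  then show "radius d S = 0" using radius_nonneg[OF N b] by (metis order_antisym power_eq_0_iff zero_le_power)
qed

text \<open>One inequality is the bound of eigenvalues by powers of the radius. The other is
  \<open>radius_le_short_eigenvalues\<close> with the maximum itself as \<open>r\<close>.\<close>

lemma max_short_eigenvalues_eq_radius:
  assumes N: "ultrametric_norm v d N" and d: "d \<ge> 1" and S: "S \<subseteq> carrier_mat d d" and b: "norm_bound d N S C"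
  shows "(MAX k\<in>{1..ell d}. root k (max_eigenvalue_set v (mat_pow d S k))) = radius d S"
proof -
  let ?\<Lambda> = "\<lambda>k. max_eigenvalue_set v (mat_pow d S k)"
  define r where "r = (MAX k\<in>{1..ell d}. root k (?\<Lambda> k))"
  note \<Lambda> = max_eigenvalue_set_bounds[OF N d S b]
  have R0: "0 \<le> radius d S" by (rule radius_nonneg[OF N b])
  have ge: "root k (?\<Lambda> k) \<le> r" if "k \<in> {1..ell d}" for k
    unfolding r_def using that by (intro Max_ge) auto
  have "r \<le> radius d S" unfolding r_def
  proof (intro Max.boundedI)
    show "(\<lambda>k. root k (?\<Lambda> k)) ` {1..ell d} \<noteq> {}" using ell_positive[OF d] by auto
    fix x assume "x \<in> (\<lambda>k. root k (?\<Lambda> k)) ` {1..ell d}"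
    then obtain k where k: "k \<ge> 1" "x = root k (?\<Lambda> k)" by auto
    have "x \<le> root k (radius d S ^ k)" unfolding k(2) using \<Lambda>(2)[of k] k(1) by simp
    then show "x \<le> radius d S" using k(1) R0 by (simp add: real_root_power_cancel)
  qed simp
  moreover have "radius d S \<le> r"
  proof (rule radius_le_short_eigenvalues[OF N d S b])
    have one: "1 \<in> {1..ell d}" using ell_positive[OF d] by simp
    show "0 \<le> r" using ge[OF one] \<Lambda>(1)[of 1] by simp
    fix k w c assume k: "k \<in> {1..ell d}" and w: "w \<in> mat_pow d S k" and c: "eigenvalue w c"
    have "v c \<le> ?\<Lambda> k" by (rule \<Lambda>(3)[OF w c])
    also have "?\<Lambda> k = root k (?\<Lambda> k) ^ k" using k \<Lambda>(1)[of k] by simp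
    also have "\<dots> \<le> r ^ k" using ge[OF k] k \<Lambda>(1)[of k] by (intro power_mono real_root_ge_zero) auto
    finally show "v c \<le> r ^ k" .
  qed
  ultimately show ?thesis unfolding r_def by (rule order_antisym)
qed

end

theorem theorem7:
  fixes v :: "'a::alg_closed_field \<Rightarrow> real"
    and d :: nat
    and N\<^sub>0 :: "'a Matrix.vec \<Rightarrow> real"
    and S :: "'a mat set"
  assumes "nonarch_absolute_value v"
    and "nontrivial_absolute_value v"
    and "complete_absolute_value v"
    and "d \<ge> 1"
    and "ultrametric_norm v d N\<^sub>0"
    and "S \<subseteq> carrier_mat d d"
    and "bdd_above (op_norm d N\<^sub>0 ` S)"
  shows
    "(MAX k\<in>{1..ell d}. root k (max_eigenvalue_set v (set_pow (module_mat TYPE('a) d d) S k)))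
        = joint_spectral_radius d N\<^sub>0 S
     \<and> joint_spectral_radius d N\<^sub>0 S
        = (INF g\<in>Units (module_mat TYPE('a) d d).
             set_norm d N\<^sub>0 ((\<lambda>s. g * s * inv\<^bsub>module_mat TYPE('a) d d\<^esub> g) ` S))
     \<and> (joint_spectral_radius d N\<^sub>0 S > 0 \<longleftrightarrow>
          \<not> nilpotent_algebra (module_mat TYPE('a) d d)
              (generated_algebra class_ring (module_mat TYPE('a) d d) S))
     \<and> (joint_spectral_radius d N\<^sub>0 S > 0 \<longrightarrow>
          (\<exists>N. ultrametric_norm v d N \<and> set_norm d N S = joint_spectral_radius d N\<^sub>0 S))"
proof -
  interpret complete_nonarch_field v by unfold_locales (use assms in auto)
  note N = assms(5) and d = assms(4) and S = assms(6)
  have b: "norm_bound d N\<^sub>0 S (set_norm d N\<^sub>0 S)" by (rule norm_bound_set_norm[OF N d S assms(7)])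
  note jsr = joint_spectral_radius_eq[OF N d S b]
  have "\<exists>N. ultrametric_norm v d N \<and> set_norm d N S = radius d S" if R: "radius d S > 0"
  proof -
    obtain N where N': "ultrametric_norm v d N" "norm_bound d N S (radius d S)"
      by (rule extremal_norm_exists[OF N S b R])
    have "set_norm d N S \<le> radius d S" by (rule set_norm_le[OF N'(1) d S N'(2)])
    moreover have "radius d S \<le> set_norm d N S"
      by (rule radius_le[OF N'(1) norm_bound_set_norm'[OF N'(1) d S N'(2)]])
    ultimately show ?thesis using N'(1) by (intro exI[of _ N]) auto
  qed
  moreover have "radius d S > 0 \<longleftrightarrow> \<not> nilpotent_algebra (module_mat TYPE('a) d d)
      (generated_algebra class_ring (module_mat TYPE('a) d d) S)"
    using radius_zero_iff_nilpotent[OF N d S b] radius_nonneg[OF N b] by auto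
  ultimately show ?thesis
    unfolding jsr using max_short_eigenvalues_eq_radius[OF N d S b] radius_eq_INF[OF N d S b] by blast
qed

end
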